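(* Let $A\in L^\infty_{\mathrm{loc}}(\mathbb{R}^3,\mathbb{R}^3)$ and let $V$ satisfy the potential hypothesis below. Let $\phi_\lambda$ be a normalized eigenvector of the Dirac operator $D_{A,V}$ corresponding to an eigenvalue $\lambda\in(-1,1)$. Then for all $a\in(0,\sqrt{1-\lambda^2})$ there is a constant $C(\lambda,a)\in(0,\infty)$, independent of $A$, such that $\|e^{a|\cdot|}\phi_\lambda\|\le C(\lambda,a)$. If in addition $A$ and $V$ satisfy the smoothness hypothesis below, then $\phi_\lambda\in C^\infty(\mathbb{R}^3\setminus\{0\},\mathbb{C}^4)$. Moreover, for all $a\in(0,\sqrt{1-\lambda^2})$ and $\beta\in\mathbb{N}_0^3$ there is $C(\lambda,a,\beta)\in(0,\infty)$ with $|\partial^\beta_x\phi_\lambda(x)|\le C(\lambda,a,\beta)e^{-a|x|}$ for all $|x|\ge1$.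
   Context: $\mathcal H=L^2(\mathbb{R}^3,\mathbb{C}^4)$, and $D_0=-i\alpha\cdot\nabla+\beta$ is the free Dirac operator with standard $4\times4$ Dirac matrices. Potential hypothesis: $V\in L^\infty_{\mathrm{loc}}(\mathbb{R}^3\setminus\{0\},\mathcal L(\mathbb{C}^4))$ is Hermitian-valued, $V(x)\to0$ as $|x|\to\infty$, and there exist $\gamma\in(0,1)$ and $\rho>0$ with $\|V(x)\|\le\gamma/|x|$ for $0<|x|<\rho$. $D_{A,V}$ is the distinguished self-adjoint extension of $D_0+\alpha\cdot A+V$ defined on $C_0^\infty(\mathbb{R}^3,\mathbb{C}^4)$. It is uniquely determined by the following two conditions: 1. $\mathrm{dom}(D_{A,V})\subset H^{1/2}_{\mathrm{loc}}$. 2. For every compactly supported $\psi\in H^{1/2}(\mathbb{R}^3,\mathbb{C}^4)$ and every $\phi\in\mathrm{dom}(D_{A,V})$, $$\langle\psi,D_{A,V}\phi\rangle=\langle|D_0|^{1/2}\psi,\mathrm{sgn}(D_0)|D_0|^{1/2}\phi\rangle+\langle|X|^{1/2}\psi,U|X|^{1/2}\phi\rangle,$$ where $U|X|$ is the polar decomposition of $X=\alpha\cdot A+V$. Smoothness hypothesis: - $A\in C^\infty(\mathbb{R}^3,\mathbb{R}^3)$, and for all $\varepsilon>0$ and $\beta$, $|\partial^\beta A(x)|\le K(\varepsilon,\beta)e^{\varepsilon|x|}$. - $V\in C^\infty(\mathbb{R}^3\setminus\{0\},\mathcal L(\mathbb{C}^4))$ satisfies the Hermiticity, decay and $\gamma/|x|$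 conditions above. - For all $r>0$ and $\beta$, $\sup_{|x|\ge r}\|\partial^\beta V(x)\|<\infty$. *)

theory Defs
  imports "HOL-Analysis.Analysis"
begin

text \<open>Conventions. Points of R^3 are real^3, spinors are complex^4, 4x4 complex
matrices are complex^4^4. Functions are representatives; L^2-type notions are
stated up to a.e. equality w.r.t. Lebesgue measure.\<close>

type_synonym point = "real^3"
type_synonym spinor = "complex^4"
type_synonym mat4 = "complex^4^4"

text \<open>Pauli matrices sigma_1, sigma_2, sigma_3 indexed by the spatial index k :: 3
(the element 3 of type 3 is the third spatial direction).\<close>
definition pauli :: "3 \<Rightarrow> complex^2^2" where
  "pauli k =
     (if k = 1 then (\<chi> a b. if a = b then 0 else 1)
      else if k = 2 then (\<chi> a b. if a = b then 0 else if a = 0 then - \<i> else \<i>)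
      else (\<chi> a b. if a \<noteq> b then 0 else if a = 0 then 1 else -1))"

definition upper_idx :: "4 \<Rightarrow> bool" where
  "upper_idx i \<longleftrightarrow> i = 0 \<or> i = 1"

definition sub_idx :: "4 \<Rightarrow> 2" where
  "sub_idx i = (if i = 0 \<or> i = 2 then 0 else 1)"

text \<open>alpha_k = [[0, sigma_k],[sigma_k, 0]], beta = diag(1,1,-1,-1).\<close>
definition dirac_alpha :: "3 \<Rightarrow> mat4" where
  "dirac_alpha k = (\<chi> i j. if upper_idx i = upper_idx j then 0
                            else pauli k $ sub_idx i $ sub_idx j)"

definition dirac_beta :: mat4 where
  "dirac_beta = (\<chi> i j. if i = j then (if upper_idx i then 1 else -1) else 0)"

definition alpha_dot :: "point \<Rightarrow> mat4" where
  "alpha_dot v = (\<Sum>k\<in>UNIV. (v $ k) *\<^sub>R dirac_alpha k)"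

definition sp_inner :: "spinor \<Rightarrow> spinor \<Rightarrow> complex" where
  "sp_inner u v = (\<Sum>j\<in>UNIV. cnj (u $ j) * v $ j)"

definition hermitian4 :: "mat4 \<Rightarrow> bool" where
  "hermitian4 M \<longleftrightarrow> (\<forall>i j. M $ i $ j = cnj (M $ j $ i))"

definition mat_norm :: "mat4 \<Rightarrow> real" where
  "mat_norm M = onorm (\<lambda>v::spinor. M *v v)"

definition pdiff :: "3 \<Rightarrow> (point \<Rightarrow> 'b::real_normed_vector) \<Rightarrow> point \<Rightarrow> 'b" where
  "pdiff k f x = vector_derivative (\<lambda>t. f (x + t *\<^sub>R axis k 1)) (at 0)"

definition dpart :: "nat^3 \<Rightarrow> (point \<Rightarrow> 'b::real_normed_vector) \<Rightarrow> point \<Rightarrow> 'b" where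
  "dpart \<beta> f = ((pdiff 1 ^^ (\<beta> $ 1)) ((pdiff 2 ^^ (\<beta> $ 2)) ((pdiff 3 ^^ (\<beta> $ 3)) f)))"

definition smooth_on :: "point set \<Rightarrow> (point \<Rightarrow> 'b::real_normed_vector) \<Rightarrow> bool" where
  "smooth_on U f \<longleftrightarrow>
     (\<forall>\<beta>. continuous_on U (dpart \<beta> f) \<and>
          (\<forall>k. \<forall>x\<in>U. (\<lambda>t. dpart \<beta> f (x + t *\<^sub>R axis k 1)) differentiable (at 0)))"

definition csupp :: "(point \<Rightarrow> 'b::zero) \<Rightarrow> point set" where
  "csupp f = closure {x. f x \<noteq> 0}"

definition test_fun :: "(point \<Rightarrow> 'b::real_normed_vector) \<Rightarrow> bool" where
  "test_fun f \<longleftrightarrow> smooth_on UNIV f \<and> compact (csupp f)"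

definition L2 :: "(point \<Rightarrow> spinor) \<Rightarrow> bool" where
  "L2 f \<longleftrightarrow> f \<in> borel_measurable lebesgue \<and> integrable lebesgue (\<lambda>x. (norm (f x))\<^sup>2)"

definition l2_inner :: "(point \<Rightarrow> spinor) \<Rightarrow> (point \<Rightarrow> spinor) \<Rightarrow> complex" where
  "l2_inner f g = (\<integral>x. sp_inner (f x) (g x) \<partial>lebesgue)"

text \<open>H^{1/2}(R^3,C^4) via the Sobolev-Slobodeckij (Gagliardo) seminorm; for s = 1/2,
d = 3 the kernel is |x-y|^{-(d+2s)} = |x-y|^{-4}.\<close>
definition H12 :: "(point \<Rightarrow> spinor) \<Rightarrow> bool" where
  "H12 f \<longleftrightarrow> L2 f \<and>
     (\<integral>\<^sup>+x. \<integral>\<^sup>+y. ennreal ((norm (f x - f y))\<^sup>2 / (norm (x - y)) ^ 4) \<partial>lebesgue \<partial>lebesgue) < \<infinity>"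

definition H12_loc :: "(point \<Rightarrow> spinor) \<Rightarrow> bool" where
  "H12_loc f \<longleftrightarrow> f \<in> borel_measurable lebesgue \<and>
     (\<forall>K. compact K \<longrightarrow>
        (\<integral>\<^sup>+x. indicator K x * ennreal ((norm (f x))\<^sup>2) \<partial>lebesgue) < \<infinity> \<and>
        (\<integral>\<^sup>+x. \<integral>\<^sup>+y. indicator K x * indicator K y *
            ennreal ((norm (f x - f y))\<^sup>2 / (norm (x - y)) ^ 4) \<partial>lebesgue \<partial>lebesgue) < \<infinity>)"

text \<open>Unitary Fourier transform (integral form; used on compactly supported L^2,
hence L^1, functions).\<close>
definition fourier :: "(point \<Rightarrow> spinor) \<Rightarrow> point \<Rightarrow> spinor" where
  "fourier f \<xi> = complex_of_real ((2 * pi) powr (-3/2)) *s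
      (\<integral>x. exp (- \<i> * complex_of_real (x \<bullet> \<xi>)) *s f x \<partial>lebesgue)"

definition dirac_expr :: "(point \<Rightarrow> point) \<Rightarrow> (point \<Rightarrow> mat4) \<Rightarrow> (point \<Rightarrow> spinor) \<Rightarrow> point \<Rightarrow> spinor" where
  "dirac_expr A V \<psi> x =
     (\<Sum>k\<in>UNIV. (- \<i>) *s (dirac_alpha k *v pdiff k \<psi> x))
     + dirac_beta *v \<psi> x + (alpha_dot (A x) + V x) *v \<psi> x"

text \<open>The free form <|D_0|^{1/2} psi, sgn(D_0)|D_0|^{1/2} phi> for compactly supported
psi in H^{1/2} and phi in H^{1/2}_loc, computed in Fourier space with phi localised by a
cut-off chi equal to 1 near the support of psi (D_0 has symbol alpha.xi + beta).\<close>
definition d0_form :: "(point \<Rightarrow> spinor) \<Rightarrow> (point \<Rightarrow> spinor) \<Rightarrow> (point \<Rightarrow> real) \<Rightarrow> complex" where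
  "d0_form \<psi> \<phi> \<chi>' = (\<integral>\<xi>. sp_inner (fourier \<psi> \<xi>)
        ((alpha_dot \<xi> + dirac_beta) *v fourier (\<lambda>x. \<chi>' x *\<^sub>R \<phi> x) \<xi>) \<partial>lebesgue)"

text \<open><|X|^{1/2} psi, U |X|^{1/2} phi> with X = alpha.A + V, written pointwise
(|X(x)|^{1/2} U(x) |X(x)|^{1/2} = X(x)).\<close>
definition x_form :: "(point \<Rightarrow> point) \<Rightarrow> (point \<Rightarrow> mat4) \<Rightarrow> (point \<Rightarrow> spinor) \<Rightarrow> (point \<Rightarrow> spinor) \<Rightarrow> complex" where
  "x_form A V \<psi> \<phi> = (\<integral>x. sp_inner (\<psi> x) ((alpha_dot (A x) + V x) *v \<phi> x) \<partial>lebesgue)"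

definition self_adjoint_op :: "(point \<Rightarrow> spinor) set \<Rightarrow> ((point \<Rightarrow> spinor) \<Rightarrow> (point \<Rightarrow> spinor)) \<Rightarrow> bool" where
  "self_adjoint_op Ddom Dop \<longleftrightarrow>
     (\<forall>f\<in>Ddom. L2 f \<and> L2 (Dop f)) \<and>
     (\<forall>f. L2 f \<longrightarrow> (\<forall>\<epsilon>>0. \<exists>g\<in>Ddom.
         (\<integral>\<^sup>+x. ennreal ((norm (f x - g x))\<^sup>2) \<partial>lebesgue) < ennreal \<epsilon>)) \<and>
     (\<forall>f\<in>Ddom. \<forall>g\<in>Ddom. l2_inner (Dop f) g = l2_inner f (Dop g)) \<and>
     (\<forall>g. L2 g \<longrightarrow> (\<exists>h. L2 h \<and> (\<forall>f\<in>Ddom. l2_inner (Dop f) g = l2_inner f h)) \<longrightarrow> g \<in> Ddom)"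

definition distinguished_ext ::
  "(point \<Rightarrow> point) \<Rightarrow> (point \<Rightarrow> mat4) \<Rightarrow> (point \<Rightarrow> spinor) set \<Rightarrow> ((point \<Rightarrow> spinor) \<Rightarrow> (point \<Rightarrow> spinor)) \<Rightarrow> bool" where
  "distinguished_ext A V Ddom Dop \<longleftrightarrow>
     self_adjoint_op Ddom Dop \<and>
     (\<forall>\<psi>::point \<Rightarrow> spinor. test_fun \<psi> \<longrightarrow>
         \<psi> \<in> Ddom \<and> (AE x in lebesgue. Dop \<psi> x = dirac_expr A V \<psi> x)) \<and>
     (\<forall>\<phi>\<in>Ddom. H12_loc \<phi>) \<and>
     (\<forall>\<psi> \<phi> (\<chi>'::point \<Rightarrow> real) K U.
         H12 \<psi> \<and> compact K \<and> (AE x in lebesgue. x \<notin> K \<longrightarrow> \<psi> x = 0) \<and>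
         \<phi> \<in> Ddom \<and> test_fun \<chi>' \<and> open U \<and> K \<subseteq> U \<and> (\<forall>x\<in>U. \<chi>' x = 1) \<longrightarrow>
         l2_inner \<psi> (Dop \<phi>) = d0_form \<psi> \<phi> \<chi>' + x_form A V \<psi> \<phi>)"

definition normalized_eigvec ::
  "(point \<Rightarrow> spinor) set \<Rightarrow> ((point \<Rightarrow> spinor) \<Rightarrow> (point \<Rightarrow> spinor)) \<Rightarrow> real \<Rightarrow> (point \<Rightarrow> spinor) \<Rightarrow> bool" where
  "normalized_eigvec Ddom Dop lam \<phi> \<longleftrightarrow>
     \<phi> \<in> Ddom \<and> (AE x in lebesgue. Dop \<phi> x = lam *\<^sub>R \<phi> x) \<and>
     (\<integral>\<^sup>+x. ennreal ((norm (\<phi> x))\<^sup>2) \<partial>lebesgue) = 1"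

definition Linf_loc :: "(point \<Rightarrow> point) \<Rightarrow> bool" where
  "Linf_loc A \<longleftrightarrow> A \<in> borel_measurable lebesgue \<and>
     (\<forall>K. compact K \<longrightarrow> (\<exists>M. AE x in lebesgue. x \<in> K \<longrightarrow> norm (A x) \<le> M))"

definition potential_hyp :: "(point \<Rightarrow> mat4) \<Rightarrow> bool" where
  "potential_hyp V \<longleftrightarrow>
     V \<in> borel_measurable lebesgue \<and>
     (\<forall>K. compact K \<and> 0 \<notin> K \<longrightarrow> (\<exists>M. AE x in lebesgue. x \<in> K \<longrightarrow> mat_norm (V x) \<le> M)) \<and>
     (\<forall>x. x \<noteq> 0 \<longrightarrow> hermitian4 (V x)) \<and>
     ((\<lambda>x. mat_norm (V x)) \<longlongrightarrow> 0) at_infinity \<and>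
     (\<exists>\<gamma> \<rho>. 0 < \<gamma> \<and> \<gamma> < 1 \<and> 0 < \<rho> \<and>
        (\<forall>x. 0 < norm x \<and> norm x < \<rho> \<longrightarrow> mat_norm (V x) \<le> \<gamma> / norm x))"

definition smooth_hyp :: "(point \<Rightarrow> point) \<Rightarrow> (point \<Rightarrow> mat4) \<Rightarrow> bool" where
  "smooth_hyp A V \<longleftrightarrow>
     smooth_on UNIV A \<and>
     (\<forall>\<epsilon>>0. \<forall>\<beta>. \<exists>K. \<forall>x. norm (dpart \<beta> A x) \<le> K * exp (\<epsilon> * norm x)) \<and>
     smooth_on (- {0}) V \<and> potential_hyp V \<and>
     (\<forall>r>0. \<forall>\<beta>. \<exists>M. \<forall>x. norm x \<ge> r \<longrightarrow> mat_norm (dpart \<beta> V x) \<le> M)"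

end

theory Submission
  imports Defs
begin

text \<open>
  Testing the symmetry of the operator against smooth compactly supported functions shows that the
  eigenvector \<open>\<phi>\<close> solves the Dirac equation in the sense of distributions. Spinors are treated as a real
  inner product space, in which the operators \<open>J k = - \<i> \<alpha>\<^sub>k\<close> are skew and generate a Clifford
  algebra, so that cross terms in squared norms are divergences and integrate to zero.

  For the \<open>L\<^sup>2\<close> bound, let \<open>u = \<zeta> \<phi>\<close> with a smooth cut-off weight \<open>\<zeta>\<close> supported where
  \<open>\<parallel>V\<parallel> \<le> \<epsilon>\<close>. Then \<open>D u = \<lambda> \<zeta> \<phi> + J(\<nabla>\<zeta>) \<phi> - V u\<close> for the Dirac operator \<open>D\<close> with magnetic field
  and without \<open>V\<close>. Since \<open>\<beta>\<close> anticommutes with the rest of \<open>D\<close>, we have \<open>\<parallel>u\<parallel> \<le> \<parallel>D u\<parallel>\<close> whatever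
  \<open>A\<close> is, while skewness gives the pointwise identity
  \<open>\<bar>\<lambda> \<zeta> \<phi> + J(\<nabla>\<zeta>) \<phi>\<bar>\<^sup>2 = (\<lambda>\<^sup>2 \<zeta>\<^sup>2 + \<bar>\<nabla>\<zeta>\<bar>\<^sup>2) \<bar>\<phi>\<bar>\<^sup>2\<close>. Weights with \<open>\<bar>\<nabla>\<zeta>\<bar> \<le> a \<zeta> + const\<close> and
  \<open>\<lambda>\<^sup>2 + a\<^sup>2 < 1\<close> then absorb the main term into the left-hand side.

  For the regularity, the mollifications of \<open>\<phi>\<close> are bounded, derivative by derivative, in \<open>L\<^sup>2\<close> of small balls
  around \<open>x\<close> by \<open>exp (- a \<bar>x\<bar>)\<close>. The induction step is the ellipticity estimate
  \<open>\<parallel>\<partial>\<^sub>j f\<parallel> \<le> \<parallel>\<Sum>\<^sub>k J\<^sub>k \<partial>\<^sub>k f\<parallel>\<close> for compactly supported \<open>f\<close>. An elementary Sobolev inequality turns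
  these bounds into pointwise ones, and the mollifications converge with all derivatives.
\<close>

section \<open>Partial derivatives and smooth functions\<close>

text \<open>An eigenvector is a priori only square integrable, so no energy identity applies to it
  directly: each inequality is proved for smooth compactly supported spinors and carried over by
  mollification. Absorbing the main term also needs a finite left-hand side. The weights are
  therefore bounded and compactly supported, with a damped exponent whose damping is removed by
  Fatou's lemma; the outer cut-off radius is chosen after the damping so that it costs only a
  constant. The resulting constant involves \<open>a\<close>, \<open>lam\<close>, the transition
  function \<open>step\<close> and a radius beyond which V is small, whence the independence of A.
  In the bootstrap, A and its derivatives may grow like \<open>exp (\<epsilon> * norm x)\<close>.
  Bounds are therefore stated for all rates below \<open>sqrt (1 - lam\<^sup>2)\<close> at once, and
  a product spends a little of the rate. Multiplication by A or V does not commute with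
  mollification; no commutator is estimated, since products are first formed with mollifications of
  the eigenvector. The singularity of V is kept out by cutting off near the origin.\<close>

definition has_pd :: "3 \<Rightarrow> (point \<Rightarrow> 'b::real_normed_vector) \<Rightarrow> 'b \<Rightarrow> point \<Rightarrow> bool" where
  "has_pd k f d x \<longleftrightarrow> ((\<lambda>t. f (x + t *\<^sub>R axis k 1)) has_vector_derivative d) (at 0)"

text \<open>\<open>pdiff\<close> is a choice of derivative and has an unspecified value where none
  exists. The calculus is therefore developed for the relation \<open>has_pd\<close> and read back
  here.\<close>

lemma has_pd_imp_pdiff: "has_pd k f d x \<Longrightarrow> pdiff k f x = d"
  unfolding has_pd_def pdiff_def by (rule vector_derivative_at)

lemma has_pd_line:
  assumes "has_pd k f d (x + t *\<^sub>R axis k 1)"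
  shows "((\<lambda>t. f (x + t *\<^sub>R axis k 1)) has_vector_derivative d) (at t)"
proof -
  have *: "((\<lambda>s. f (x + (t + s) *\<^sub>R axis k 1)) has_vector_derivative d) (at (t - t))"
    using assms unfolding has_pd_def by (simp add: scaleR_add_left add.assoc)
  have "(((\<lambda>s. f (x + (t + s) *\<^sub>R axis k 1)) \<circ> (\<lambda>s. s - t)) has_vector_derivative 1 *\<^sub>R d) (at t)"
    by (rule vector_diff_chain_at[where f="\<lambda>s. s - t"]) (use * in \<open>auto intro!: derivative_eq_intros\<close>)
  then show ?thesis by (simp add: o_def)
qed

lemma has_pd_const: "has_pd k (\<lambda>x. c) 0 x"
  unfolding has_pd_def by simp

lemma has_pd_add: "has_pd k f a x \<Longrightarrow> has_pd k g b x \<Longrightarrow> has_pd k (\<lambda>x. f x + g x) (a + b) x"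
  unfolding has_pd_def by (rule has_vector_derivative_add)

lemma has_pd_linear: "bounded_linear h \<Longrightarrow> has_pd k f a x \<Longrightarrow> has_pd k (\<lambda>x. h (f x)) (h a) x"
  unfolding has_pd_def by (rule bounded_linear.has_vector_derivative)

lemma has_pd_bilinear:
  assumes "bounded_bilinear h" "has_pd k f a x" "has_pd k g b x"
  shows "has_pd k (\<lambda>x. h (f x) (g x)) (h (f x) b + h a (g x)) x"
  using bounded_bilinear.has_vector_derivative[OF assms(1) assms(2,3)[unfolded has_pd_def]]
  unfolding has_pd_def by simp

lemma has_pd_chain:
  fixes g :: "real \<Rightarrow> real"
  assumes "(g has_real_derivative d) (at (f x))" "has_pd k f a x"
  shows "has_pd k (\<lambda>x. g (f x)) (d * a) x"
proof -
  have "((\<lambda>t. f (x + t *\<^sub>R axis k 1)) has_real_derivative a) (at 0)"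
    using assms(2) by (simp add: has_pd_def has_real_derivative_iff_has_vector_derivative)
  then have "((\<lambda>t. g (f (x + t *\<^sub>R axis k 1))) has_real_derivative d * a) (at 0)"
    using DERIV_chain2[of g d "\<lambda>t. f (x + t *\<^sub>R axis k 1)" 0 a UNIV] assms(1) by simp
  then show ?thesis
    by (simp add: has_pd_def has_real_derivative_iff_has_vector_derivative)
qed

lemma has_pd_eq_on:
  assumes "open U" "x \<in> U" "\<And>y. y \<in> U \<Longrightarrow> f y = g y" "has_pd k f d x"
  shows "has_pd k g d x"
proof -
  have "\<forall>\<^sub>F t in at 0. x + t *\<^sub>R axis k 1 \<in> U"
  proof (rule topological_tendstoD)
    show "((\<lambda>t. x + t *\<^sub>R axis k 1) \<longlongrightarrow> x) (at (0::real))"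
      by (auto intro!: tendsto_eq_intros)
  qed (use assms in auto)
  then have "\<forall>\<^sub>F t in at 0. f (x + t *\<^sub>R axis k 1) = g (x + t *\<^sub>R axis k 1)"
    by (rule eventually_mono) (use assms in auto)
  then show ?thesis
    using assms(4) assms(3)[OF assms(2)] unfolding has_pd_def has_vector_derivative_def
    by (auto elim!: has_derivative_transform_eventually)
qed

lemma has_pd_shift:
  assumes "has_pd k f d (x + c)" shows "has_pd k (\<lambda>x. f (x + c)) d x"
  using assms unfolding has_pd_def by (simp add: algebra_simps)

lemma has_pd_reflect:
  assumes "has_pd k f d (c - x)" shows "has_pd k (\<lambda>x. f (c - x)) (- d) x"
proof -
  have *: "((\<lambda>t. f ((c - x) + t *\<^sub>R axis k 1)) has_vector_derivative d) (at (- 0))"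
    using assms unfolding has_pd_def by simp
  have "(((\<lambda>t. f ((c - x) + t *\<^sub>R axis k 1)) \<circ> uminus) has_vector_derivative (-1) *\<^sub>R d) (at 0)"
    by (rule vector_diff_chain_at) (use * in \<open>auto intro!: derivative_eq_intros\<close>)
  then show ?thesis unfolding has_pd_def by (simp add: o_def algebra_simps)
qed

lemma has_pd_nth: "has_pd k (\<lambda>x. x $ j) (if j = k then 1 else 0) x"
proof -
  have "((\<lambda>t. x $ j + t *\<^sub>R (axis k 1 :: point) $ j) has_vector_derivative (axis k 1 :: point) $ j) (at 0)"
    by (auto intro!: derivative_eq_intros)
  then show ?thesis by (simp add: has_pd_def axis_def)
qed

text \<open>Derivatives in every order of the directions, so that inductions can pass from a
  function to its partial derivatives. \<open>smooth_on\<close> only speaks of the fixed order of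
  \<open>dpart\<close>; the two notions are compared in \<open>smooth_on_imp_smth\<close> and
  \<open>smth_imp_smooth_on\<close>.\<close>

primrec Ck :: "nat \<Rightarrow> point set \<Rightarrow> (point \<Rightarrow> 'b::real_normed_vector) \<Rightarrow> bool" where
  "Ck 0 U f \<longleftrightarrow> continuous_on U f"
| "Ck (Suc n) U f \<longleftrightarrow> continuous_on U f \<and> (\<forall>k. \<forall>x\<in>U. has_pd k f (pdiff k f x) x) \<and> (\<forall>k. Ck n U (pdiff k f))"

definition smth :: "point set \<Rightarrow> (point \<Rightarrow> 'b::real_normed_vector) \<Rightarrow> bool" where
  "smth U f \<longleftrightarrow> (\<forall>n. Ck n U f)"

lemma Ck_lower: "Ck (Suc n) U f \<Longrightarrow> Ck n U f"
proof (induction n arbitrary: f)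
  case (Suc n)
  then have "Ck n U (pdiff k f)" for k by (metis Ck.simps(2))
  then show ?case using Suc.prems by simp
qed simp

lemma Ck_cong: 
  assumes "open U" "\<And>x. x \<in> U \<Longrightarrow> f x = g x" "Ck n U f" shows "Ck n U g"
  using assms(2,3)
proof (induction n arbitrary: f g)
  case 0
  then show ?case by (simp cong: continuous_on_cong)
next
  case (Suc n)
  have pd: "has_pd k g (pdiff k f x) x" if "x \<in> U" for x k
    by (rule has_pd_eq_on[OF assms(1) that, of f]) (use Suc.prems that in auto)
  then have eq: "pdiff k f x = pdiff k g x" if "x \<in> U" for x k
    using has_pd_imp_pdiff that by metis
  have "continuous_on U g" using Suc.prems by (simp cong: continuous_on_cong)
  moreover have "Ck n U (pdiff k g)" for k
    by (rule Suc.IH[of "pdiff k f"]) (use eq Suc.prems in auto)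
  ultimately show ?case using pd eq by simp
qed

lemma Ck_SucI:
  assumes "open U" "continuous_on U f" "\<And>k x. x \<in> U \<Longrightarrow> has_pd k f (g k x) x" "\<And>k. Ck n U (g k)"
  shows "Ck (Suc n) U f"
proof -
  have "pdiff k f x = g k x" if "x \<in> U" for x k using assms(3) has_pd_imp_pdiff that by blast
  moreover have "Ck n U (pdiff k f)" for k
    by (rule Ck_cong[OF assms(1) _ assms(4)[of k]]) (simp add: calculation)
  ultimately show ?thesis using assms by auto
qed

lemma Ck_SucD: "Ck (Suc n) U f \<Longrightarrow> x \<in> U \<Longrightarrow> has_pd k f (pdiff k f x) x" by simp

lemma Ck_const: "Ck n U (\<lambda>x. c)"
proof (induction n arbitrary: c)
  case (Suc n)
  have "pdiff k (\<lambda>x. c) = (\<lambda>x. 0)" for k :: 3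
    using has_pd_imp_pdiff[OF has_pd_const] by auto
  then show ?case using Suc by (auto intro: has_pd_const)
qed auto

lemma Ck_add: "open U \<Longrightarrow> Ck n U f \<Longrightarrow> Ck n U g \<Longrightarrow> Ck n U (\<lambda>x. f x + g x)"
proof (induction n arbitrary: f g)
  case (Suc n)
  show ?case
    by (rule Ck_SucI[where g="\<lambda>k x. pdiff k f x + pdiff k g x"])
      (use Suc in \<open>auto intro!: continuous_intros has_pd_add\<close>)
qed (auto intro: continuous_intros)

lemma Ck_linear: "open U \<Longrightarrow> bounded_linear h \<Longrightarrow> Ck n U f \<Longrightarrow> Ck n U (\<lambda>x. h (f x))"
proof (induction n arbitrary: f)
  case 0 then show ?case by (simp add: bounded_linear.continuous_on)
next
  case (Suc n)
  have "continuous_on U (\<lambda>x. h (f x))"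
    by (rule bounded_linear.continuous_on[OF Suc.prems(2)]) (use Suc.prems in simp)
  moreover have "has_pd k (\<lambda>x. h (f x)) (h (pdiff k f x)) x" if "x \<in> U" for x k
    by (rule has_pd_linear) (use Suc.prems that in simp_all)
  moreover have "Ck n U (\<lambda>x. h (pdiff k f x))" for k by (rule Suc.IH) (use Suc.prems in simp_all)
  ultimately show ?case by (rule Ck_SucI[OF Suc.prems(1)])
qed

lemma Ck_bilinear:
  assumes "open U" "bounded_bilinear h"
  shows "Ck n U f \<Longrightarrow> Ck n U g \<Longrightarrow> Ck n U (\<lambda>x. h (f x) (g x))"
proof (induction n arbitrary: f g)
  case 0 then show ?case using bounded_bilinear.continuous_on[OF assms(2)] by auto
next
  case (Suc n)
  show ?case
  proof (rule Ck_SucI[where g="\<lambda>k x. h (f x) (pdiff k g x) + h (pdiff k f x) (g x)"])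
    show "continuous_on U (\<lambda>x. h (f x) (g x))"
      using bounded_bilinear.continuous_on[OF assms(2)] Suc.prems by auto
    show "has_pd k (\<lambda>x. h (f x) (g x)) (h (f x) (pdiff k g x) + h (pdiff k f x) (g x)) x"
      if "x \<in> U" for k x using Suc.prems that by (auto intro!: has_pd_bilinear assms)
    show "Ck n U (\<lambda>x. h (f x) (pdiff k g x) + h (pdiff k f x) (g x))" for k
      by (rule Ck_add[OF assms(1)]; rule Suc.IH) (use Suc.prems Ck_lower in auto)
  qed (rule assms)
qed

lemma Ck_nth: "open U \<Longrightarrow> Ck n U (\<lambda>x. x $ j)"
proof (cases n)
  case (Suc m)
  assume "open U"
  then show ?thesis unfolding Suc
    by (intro Ck_SucI[where g="\<lambda>k x. if j = k then 1 else 0"])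
      (use has_pd_nth[of _ j] in \<open>auto intro!: Ck_const continuous_intros\<close>)
qed (auto intro: continuous_intros)

lemma Ck_shift: "Ck n UNIV f \<Longrightarrow> Ck n UNIV (\<lambda>x. f (x + c))"
proof (induction n arbitrary: f)
  case 0 then show ?case by (auto intro!: continuous_on_compose2[of UNIV f] continuous_intros)
next
  case (Suc n)
  show ?case
  proof (rule Ck_SucI[where g="\<lambda>k x. pdiff k f (x + c)"])
    show "Ck n UNIV (\<lambda>x. pdiff k f (x + c))" for k by (rule Suc.IH) (use Suc.prems in simp)
    show "continuous_on UNIV (\<lambda>x. f (x + c))"
      by (rule continuous_on_compose2[of UNIV f]) (use Suc.prems in \<open>auto intro!: continuous_intros\<close>)
    show "has_pd k (\<lambda>x. f (x + c)) (pdiff k f (x + c)) x" for k x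
      by (rule has_pd_shift) (use Suc.prems in simp)
  qed simp
qed

lemma Ck_reflect: "Ck n UNIV f \<Longrightarrow> Ck n UNIV (\<lambda>x. f (c - x))"
proof (induction n arbitrary: f)
  case 0 then show ?case by (auto intro!: continuous_on_compose2[of UNIV f] continuous_intros)
next
  case (Suc n)
  show ?case
  proof (rule Ck_SucI[where g="\<lambda>k x. - pdiff k f (c - x)"])
    have "Ck n UNIV (\<lambda>x. pdiff k f (c - x))" for k by (rule Suc.IH) (use Suc.prems in simp)
    then show "Ck n UNIV (\<lambda>x. - pdiff k f (c - x))" for k
      by (rule Ck_linear[OF open_UNIV bounded_linear_minus[OF bounded_linear_ident]])
    show "continuous_on UNIV (\<lambda>x. f (c - x))"
      by (rule continuous_on_compose2[of UNIV f]) (use Suc.prems in \<open>auto intro!: continuous_intros\<close>)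
    show "has_pd k (\<lambda>x. f (c - x)) (- pdiff k f (c - x)) x" for k x
      by (rule has_pd_reflect) (use Suc.prems in simp)
  qed simp
qed

lemma smth_has_pd: "smth U f \<Longrightarrow> x \<in> U \<Longrightarrow> has_pd k f (pdiff k f x) x"
  unfolding smth_def using Ck_SucD by blast

lemma smth_pdiff: "smth U f \<Longrightarrow> smth U (pdiff k f)"
  unfolding smth_def by (metis Ck.simps(2))

lemma smth_continuous: "smth U f \<Longrightarrow> continuous_on U f"
  unfolding smth_def by (metis Ck.simps(1))

lemma smth_cong: "open U \<Longrightarrow> (\<And>x. x \<in> U \<Longrightarrow> f x = g x) \<Longrightarrow> smth U f \<Longrightarrow> smth U g"
  unfolding smth_def using Ck_cong by blast

lemma Ck_subset: "V \<subseteq> U \<Longrightarrow> Ck n U f \<Longrightarrow> Ck n V f"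
  by (induction n arbitrary: f) (auto intro: continuous_on_subset)

lemma smth_subset: "V \<subseteq> U \<Longrightarrow> smth U f \<Longrightarrow> smth V f"
  unfolding smth_def using Ck_subset by blast

lemma smth_const: "smth U (\<lambda>x. c)" by (simp add: smth_def Ck_const)
lemma smth_add: "open U \<Longrightarrow> smth U f \<Longrightarrow> smth U g \<Longrightarrow> smth U (\<lambda>x. f x + g x)"
  by (simp add: smth_def Ck_add)
lemma smth_linear: "open U \<Longrightarrow> bounded_linear h \<Longrightarrow> smth U f \<Longrightarrow> smth U (\<lambda>x. h (f x))"
  by (simp add: smth_def Ck_linear)
lemma smth_bilinear: "open U \<Longrightarrow> bounded_bilinear h \<Longrightarrow> smth U f \<Longrightarrow> smth U g \<Longrightarrow> smth U (\<lambda>x. h (f x) (g x))"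
  by (simp add: smth_def Ck_bilinear)
lemma smth_nth: "open U \<Longrightarrow> smth U (\<lambda>x. x $ j)" by (simp add: smth_def Ck_nth)
lemma smth_shift: "smth UNIV f \<Longrightarrow> smth UNIV (\<lambda>x. f (x + c))" by (simp add: smth_def Ck_shift)
lemma smth_reflect: "smth UNIV f \<Longrightarrow> smth UNIV (\<lambda>x. f (c - x))" by (simp add: smth_def Ck_reflect)
lemmas smth_mult = smth_bilinear[OF _ bounded_bilinear_mult]
lemmas smth_scaleR = smth_bilinear[OF _ bounded_bilinear_scaleR]
lemmas smth_inner = smth_bilinear[OF _ bounded_bilinear_inner]
lemma smth_diff: "open U \<Longrightarrow> smth U f \<Longrightarrow> smth U g \<Longrightarrow> smth U (\<lambda>x. f x - g x)"
  using smth_add[of U f "\<lambda>x. - g x"] smth_linear[of U uminus g] 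
  by (simp add: bounded_linear_minus)
lemma smth_sum: "open U \<Longrightarrow> (\<And>i. i \<in> I \<Longrightarrow> smth U (f i)) \<Longrightarrow> smth U (\<lambda>x. \<Sum>i\<in>I. f i x)"
  by (induction I rule: infinite_finite_induct) (auto intro: smth_const smth_add)

text \<open>Coinduction for smoothness. It suits families whose derivatives stay in the family, such
  as the convolutions of one function with all kernels, or the limits
  \<open>\<Psi> ks\<close>.\<close>

lemma smth_I:
  assumes "open U" "P f" 
    and "\<And>f. P f \<Longrightarrow> continuous_on U f"
    and "\<And>f k. P f \<Longrightarrow> \<exists>g. P g \<and> (\<forall>x\<in>U. has_pd k f (g x) x)"
  shows "smth U f"
proof -
  have "Ck n U f" if "P f" for n f
    using that
  proof (induction n arbitrary: f)
    case 0 then show ?case using assms(3) by simp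
  next
    case (Suc n)
    obtain g where "\<And>k. P (g k)" "\<And>k x. x \<in> U \<Longrightarrow> has_pd k f (g k x) x"
      using assms(4)[OF Suc.prems] by metis
    then show ?case using Suc assms by (intro Ck_SucI[where g=g]) auto
  qed
  then show ?thesis using assms(2) by (simp add: smth_def)
qed

lemma vector_mvt_bound:
  fixes f :: "real \<Rightarrow> 'b::real_normed_vector"
  assumes "\<And>s. s \<in> closed_segment a b \<Longrightarrow> (f has_vector_derivative f' s) (at s)"
    and "\<And>s. s \<in> closed_segment a b \<Longrightarrow> norm (f' s) \<le> B"
  shows "norm (f b - f a) \<le> B * \<bar>b - a\<bar>"
proof -
  have "norm (f b - f a) \<le> B * norm (b - a)"
  proof (rule differentiable_bound[where S="closed_segment a b" and f'="\<lambda>s x. x *\<^sub>R f' s"])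
    show "(f has_derivative (\<lambda>x. x *\<^sub>R f' s)) (at s within closed_segment a b)" if "s \<in> closed_segment a b" for s
      using assms(1)[OF that] by (simp add: has_vector_derivative_def has_derivative_at_withinI)
    show "onorm (\<lambda>x. x *\<^sub>R f' s) \<le> B" if "s \<in> closed_segment a b" for s
      using assms(2)[OF that]
      by (intro onorm_bound) (auto simp: mult.commute[of B] intro: order_trans[OF norm_ge_zero] mult_left_mono)
  qed auto
  then show ?thesis by simp
qed

section \<open>Mixed partial derivatives and the order of differentiation\<close>

lemma has_pd_alt:
  "has_pd k f d x \<longleftrightarrow> (\<forall>e>0. \<exists>\<delta>>0. \<forall>t. \<bar>t\<bar> < \<delta> \<longrightarrow> norm (f (x + t *\<^sub>R axis k 1) - f x - t *\<^sub>R d) \<le> e * \<bar>t\<bar>)"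
  unfolding has_pd_def has_vector_derivative_def has_derivative_at_alt
  by (simp add: bounded_linear_scaleR_left)

text \<open>A one-sided Schwarz theorem: the derivative of \<open>p\<close> in direction
  \<open>k\<close> is not assumed but produced from the continuous mixed derivative \<open>m\<close>
  taken in the other order. The second difference of \<open>f\<close> over a rectangle with sides
  \<open>h\<close> and \<open>t\<close> is compared with \<open>t * h\<close> times
  \<open>m x\<close>; dividing by \<open>h\<close> and letting \<open>h\<close> tend to 0 turns it
  into a difference of values of \<open>p\<close>.\<close>

lemma has_pd_mixed:
  assumes "open U" "x \<in> U" and p: "\<And>y. y \<in> U \<Longrightarrow> has_pd j f (p y) y"
    and q: "\<And>y. y \<in> U \<Longrightarrow> has_pd k f (q y) y" and m: "\<And>y. y \<in> U \<Longrightarrow> has_pd j q (m y) y"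
    and "continuous_on U m"
  shows "has_pd k p (m x) x"
  unfolding has_pd_alt
proof (intro allI impI)
  fix e :: real assume "e > 0"
  obtain d1 where d1: "d1 > 0" "ball x d1 \<subseteq> U" using assms(1,2) openE by blast
  have "isCont m x" using assms(1,2,6) continuous_on_eq_continuous_at by blast
  then obtain d2 where d2: "d2 > 0" "\<And>y. dist y x < d2 \<Longrightarrow> dist (m y) (m x) < e"
    using \<open>e > 0\<close> unfolding continuous_at_eps_delta by blast
  define d where "d = min d1 d2 / 2"
  have "d > 0" using d1 d2 by (simp add: d_def)
  let ?ej = "axis j 1 :: point" and ?ek = "axis k 1 :: point"
  have near: "x + h *\<^sub>R ?ej + t *\<^sub>R ?ek \<in> U \<and> norm (m (x + h *\<^sub>R ?ej + t *\<^sub>R ?ek) - m x) \<le> e" if "\<bar>h\<bar> < d" "\<bar>t\<bar> < d" for h t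
  proof -
    have "norm (h *\<^sub>R ?ej + t *\<^sub>R ?ek) \<le> \<bar>h\<bar> + \<bar>t\<bar>"
      using norm_triangle_ineq[of "h *\<^sub>R ?ej" "t *\<^sub>R ?ek"] by simp
    then have "dist (x + h *\<^sub>R ?ej + t *\<^sub>R ?ek) x < min d1 d2"
      using that unfolding d_def dist_norm by (simp add: add.assoc)
    then have "x + h *\<^sub>R ?ej + t *\<^sub>R ?ek \<in> ball x d1" "dist (m (x + h *\<^sub>R ?ej + t *\<^sub>R ?ek)) (m x) < e"
      using d2(2)[of "x + h *\<^sub>R ?ej + t *\<^sub>R ?ek"] by (auto simp: dist_commute)
    then show ?thesis using d1(2) by (auto simp: dist_norm)
  qed
  show "\<exists>\<delta>>0. \<forall>t. \<bar>t\<bar> < \<delta> \<longrightarrow> norm (p (x + t *\<^sub>R ?ek) - p x - t *\<^sub>R m x) \<le> e * \<bar>t\<bar>"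
  proof (intro exI[of _ d] conjI allI impI \<open>d > 0\<close>)
    fix t :: real assume t: "\<bar>t\<bar> < d"
    define G where "G h s = f (x + h *\<^sub>R ?ej + s *\<^sub>R ?ek)" for h s
    have small: "\<bar>s\<bar> < d" if "s \<in> closed_segment 0 a" "\<bar>a\<bar> < d" for s a :: real
      using that by (auto simp: closed_segment_eq_real_ivl split: if_splits)
    have inner: "norm (q (x + h *\<^sub>R ?ej + s *\<^sub>R ?ek) - q (x + s *\<^sub>R ?ek) - h *\<^sub>R m x) \<le> e * \<bar>h\<bar>"
      if "\<bar>h\<bar> < d" "\<bar>s\<bar> < d" for h s
    proof -
      let ?Q = "\<lambda>r. q (x + s *\<^sub>R ?ek + r *\<^sub>R ?ej) - r *\<^sub>R m x"
      have "norm (?Q h - ?Q 0) \<le> e * \<bar>h - 0\<bar>"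
      proof (rule vector_mvt_bound[where f' = "\<lambda>r. m (x + s *\<^sub>R ?ek + r *\<^sub>R ?ej) - m x"])
        fix r assume "r \<in> closed_segment 0 h"
        then have r: "\<bar>r\<bar> < d" using small that by blast
        have "x + s *\<^sub>R ?ek + r *\<^sub>R ?ej \<in> U" "norm (m (x + s *\<^sub>R ?ek + r *\<^sub>R ?ej) - m x) \<le> e"
          using near[OF r that(2)] by (auto simp: algebra_simps)
        then show "(?Q has_vector_derivative (m (x + s *\<^sub>R ?ek + r *\<^sub>R ?ej) - m x)) (at r)"
          "norm (m (x + s *\<^sub>R ?ek + r *\<^sub>R ?ej) - m x) \<le> e"
          using has_pd_line[OF m[of "x + s *\<^sub>R ?ek + r *\<^sub>R ?ej"]]
          by (auto intro!: derivative_eq_intros)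
      qed
      then show ?thesis by (simp add: algebra_simps)
    qed
    \<comment> \<open>Mean value estimate in the direction \<open>k\<close>: the derivative in
      \<open>s\<close> of the second difference is the difference of values of \<open>q\<close>
      already estimated in \<open>inner\<close>.\<close>
    have outer: "norm (G h t - G 0 t - (G h 0 - G 0 0) - (t * h) *\<^sub>R m x) \<le> e * \<bar>h\<bar> * \<bar>t\<bar>" if h: "\<bar>h\<bar> < d" for h
    proof -
      let ?Q = "\<lambda>s. G h s - G 0 s - (s * h) *\<^sub>R m x"
      have "norm (?Q t - ?Q 0) \<le> (e * \<bar>h\<bar>) * \<bar>t - 0\<bar>"
      proof (rule vector_mvt_bound[where f' = "\<lambda>s. q (x + h *\<^sub>R ?ej + s *\<^sub>R ?ek) - q (x + s *\<^sub>R ?ek) - h *\<^sub>R m x"])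
        fix s assume "s \<in> closed_segment 0 t"
        then have s: "\<bar>s\<bar> < d" using small t by blast
        have "(G h has_vector_derivative q (x + h *\<^sub>R ?ej + s *\<^sub>R ?ek)) (at s)"
          unfolding G_def using has_pd_line[OF q] near[OF h s] by blast
        moreover have "(G 0 has_vector_derivative q (x + s *\<^sub>R ?ek)) (at s)"
          using has_pd_line[OF q, of x s] near[of 0 s] \<open>d > 0\<close> s unfolding G_def by simp
        ultimately show "(?Q has_vector_derivative (q (x + h *\<^sub>R ?ej + s *\<^sub>R ?ek) - q (x + s *\<^sub>R ?ek) - h *\<^sub>R m x)) (at s)"
          by (auto intro!: derivative_eq_intros)
      qed (use inner[OF h] small t in blast)
      then show ?thesis by (simp add: algebra_simps)
    qed
    have lim: "((\<lambda>h. (G h s - G 0 s) /\<^sub>R h) \<longlongrightarrow> p (x + s *\<^sub>R ?ek)) (at 0)" if "\<bar>s\<bar> < d" for s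
    proof -
      have "x + s *\<^sub>R ?ek \<in> U" using near[of 0 s] that \<open>d > 0\<close> by simp
      then have "((\<lambda>h. G h s) has_vector_derivative p (x + s *\<^sub>R ?ek)) (at 0)"
        using p[of "x + s *\<^sub>R ?ek"] unfolding has_pd_def G_def by (simp add: algebra_simps)
      then have "((\<lambda>h. ((G h s - G 0 s) - h *\<^sub>R p (x + s *\<^sub>R ?ek)) /\<^sub>R \<bar>h\<bar>) \<longlongrightarrow> 0) (at 0)"
        by (simp add: has_vector_derivative_def has_derivative_def divide_inverse)
      then have "((\<lambda>h. norm ((G h s - G 0 s) /\<^sub>R h - p (x + s *\<^sub>R ?ek))) \<longlongrightarrow> 0) (at 0)"
      proof (rule Lim_transform_eventually[OF tendsto_norm_zero])
        show "\<forall>\<^sub>F h in at 0. norm (((G h s - G 0 s) - h *\<^sub>R p (x + s *\<^sub>R ?ek)) /\<^sub>R \<bar>h\<bar>) = norm ((G h s - G 0 s) /\<^sub>R h - p (x + s *\<^sub>R ?ek))"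
          unfolding eventually_at_filter
        proof (intro always_eventually allI impI)
          fix h :: real assume "h \<noteq> 0"
          then have "(G h s - G 0 s) /\<^sub>R h - p (x + s *\<^sub>R ?ek) = ((G h s - G 0 s) - h *\<^sub>R p (x + s *\<^sub>R ?ek)) /\<^sub>R h"
            by (simp add: scaleR_diff_right)
          then show "norm (((G h s - G 0 s) - h *\<^sub>R p (x + s *\<^sub>R ?ek)) /\<^sub>R \<bar>h\<bar>) = norm ((G h s - G 0 s) /\<^sub>R h - p (x + s *\<^sub>R ?ek))"
            by simp
        qed
      qed
      then show ?thesis using tendsto_norm_zero_iff Lim_null by blast
    qed
    have "((\<lambda>h. norm ((G h t - G 0 t) /\<^sub>R h - (G h 0 - G 0 0) /\<^sub>R h - t *\<^sub>R m x)) \<longlongrightarrow> norm (p (x + t *\<^sub>R ?ek) - p (x + 0 *\<^sub>R ?ek) - t *\<^sub>R m x)) (at 0)"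
      by (intro tendsto_intros lim t) (use \<open>d > 0\<close> in simp)
    moreover have "\<forall>\<^sub>F h in at (0::real). norm ((G h t - G 0 t) /\<^sub>R h - (G h 0 - G 0 0) /\<^sub>R h - t *\<^sub>R m x) \<le> e * \<bar>t\<bar>"
      unfolding eventually_at
    proof (intro exI[of _ d] conjI ballI impI \<open>d > 0\<close>)
      fix h :: real assume "h \<noteq> 0 \<and> dist h 0 < d"
      then have h: "h \<noteq> 0" "\<bar>h\<bar> < d" by auto
      have "(G h t - G 0 t) /\<^sub>R h - (G h 0 - G 0 0) /\<^sub>R h - t *\<^sub>R m x = (G h t - G 0 t - (G h 0 - G 0 0) - (t * h) *\<^sub>R m x) /\<^sub>R h"
        using h by (simp add: algebra_simps)
      also have "norm \<dots> \<le> (e * \<bar>h\<bar> * \<bar>t\<bar>) / \<bar>h\<bar>"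
        using outer[OF h(2)] h by (simp add: divide_right_mono divide_inverse mult.commute[of _ "inverse \<bar>h\<bar>"] mult_left_mono)
      finally show "norm ((G h t - G 0 t) /\<^sub>R h - (G h 0 - G 0 0) /\<^sub>R h - t *\<^sub>R m x) \<le> e * \<bar>t\<bar>"
        using h by simp
    qed
    ultimately show "norm (p (x + t *\<^sub>R ?ek) - p x - t *\<^sub>R m x) \<le> e * \<bar>t\<bar>"
      using tendsto_upperbound[of _ _ "at (0::real)"] by fastforce
  qed
qed

lemma pdiff_commute:
  assumes "open U" "smth U f" "x \<in> U"
  shows "pdiff j (pdiff k f) x = pdiff k (pdiff j f) x"
proof (rule has_pd_imp_pdiff[symmetric])
  show "has_pd k (pdiff j f) (pdiff j (pdiff k f) x) x"
    by (rule has_pd_mixed[OF assms(1,3), of j f "pdiff j f" k "pdiff k f"])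
      (use assms smth_has_pd smth_pdiff smth_continuous in blast)+
qed

text \<open>\<open>dpart\<close> differentiates in direction 3 first and in direction 1 last. Only a
  further derivative in direction 1 extends this order directly; the other directions are carried
  inwards one derivative at a time by \<open>has_pd_mixed\<close>.\<close>

lemma smooth_on_imp_smth:
  assumes "open U" "smooth_on U f" shows "smth U f"
proof -
  define P where "P a b c = (pdiff 1 ^^ a) ((pdiff 2 ^^ b) ((pdiff 3 ^^ c) f))" for a b c
  have P: "P a b c = dpart (vector [a,b,c]) f" for a b c
    by (simp add: P_def dpart_def vector_3)
  have cont: "continuous_on U (P a b c)" for a b c
    using assms(2) unfolding P smooth_on_def by blast
  have pd: "has_pd k (P a b c) (pdiff k (P a b c) x) x" if "x \<in> U" for a b c k x
    using assms(2) that unfolding P smooth_on_def has_pd_def pdiff_def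
    by (simp add: vector_derivative_works[symmetric])
  have pd1: "has_pd 1 (P a b c) (P (Suc a) b c x) x" if "x \<in> U" for a b c x
    using pd[OF that, of 1 a b c] by (simp add: P_def)
  have pd2: "has_pd 2 (P a b c) (P a (Suc b) c x) x" if "x \<in> U" for a b c x
    using that
  proof (induction a arbitrary: x)
    case 0 then show ?case using pd[of x 2 0 b c] by (simp add: P_def)
  next
    case (Suc a)
    show ?case
      by (rule has_pd_mixed[OF assms(1) Suc.prems, of 1 "P a b c" _ _ "P a (Suc b) c" "P (Suc a) (Suc b) c"])
        (auto intro: Suc.IH pd1 cont)
  qed
  have pd3': "has_pd 3 (P 0 b c) (P 0 b (Suc c) x) x" if "x \<in> U" for b c x
    using that
  proof (induction b arbitrary: x)
    case 0 then show ?case using pd[of x 3 0 0 c] by (simp add: P_def)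
  next
    case (Suc b)
    show ?case
      by (rule has_pd_mixed[OF assms(1) Suc.prems, of 2 "P 0 b c" _ _ "P 0 b (Suc c)" "P 0 (Suc b) (Suc c)"])
        (auto intro: Suc.IH pd2 cont)
  qed
  have pd3: "has_pd 3 (P a b c) (P a b (Suc c) x) x" if "x \<in> U" for a b c x
    using that
  proof (induction a arbitrary: x)
    case 0 then show ?case using pd3' by blast
  next
    case (Suc a)
    show ?case
      by (rule has_pd_mixed[OF assms(1) Suc.prems, of 1 "P a b c" _ _ "P a b (Suc c)" "P (Suc a) b (Suc c)"])
        (auto intro: Suc.IH pd1 cont)
  qed
  have "smth U (P 0 0 0)"
  proof (rule smth_I[where P="\<lambda>g. \<exists>a b c. g = P a b c"])
    fix g k assume "\<exists>a b c. g = P a b c"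
    then obtain a b c where g: "g = P a b c" by blast
    show "\<exists>h. (\<exists>a b c. h = P a b c) \<and> (\<forall>x\<in>U. has_pd k g (h x) x)"
      using exhaust_3[of k] pd1 pd2 pd3 unfolding g by metis
  qed (use assms cont in auto)
  then show ?thesis by (simp add: P_def)
qed

text \<open>Words of directions, the head being differentiated last. Arbitrary orders arise in the
  Leibniz rule and in the bootstrap; \<open>pds_eq_dpart\<close> sorts them.\<close>

primrec pds :: "3 list \<Rightarrow> (point \<Rightarrow> 'b::real_normed_vector) \<Rightarrow> point \<Rightarrow> 'b" where
  "pds [] f = f"
| "pds (k # ks) f = pdiff k (pds ks f)"

lemma pds_append: "pds (ks @ js) f = pds ks (pds js f)"
  by (induction ks) auto

lemma dpart_eq_pds:
  "dpart \<beta> f = pds (replicate (\<beta> $ 1) 1 @ replicate (\<beta> $ 2) 2 @ replicate (\<beta> $ 3) 3) f"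
proof -
  have "(pdiff k ^^ n) g = pds (replicate n k) g" for k n and g :: "point \<Rightarrow> 'a"
    by (induction n) auto
  then show ?thesis by (simp add: dpart_def pds_append)
qed

lemma smth_pds: "smth U f \<Longrightarrow> smth U (pds ks f)"
  by (induction ks) (auto intro: smth_pdiff)

lemma smth_imp_smooth_on: "smth U f \<Longrightarrow> smooth_on U f"
  unfolding smooth_on_def dpart_eq_pds
  using smth_pds smth_continuous smth_has_pd unfolding has_pd_def
  by (metis differentiableI_vector)

lemma pds_cong:
  assumes "open U" "\<And>x. x \<in> U \<Longrightarrow> f x = g x" "smth U f" "x \<in> U"
  shows "pds ks f x = pds ks g x"
  using assms(4)
proof (induction ks arbitrary: x)
  case (Cons k ks)
  have "has_pd k (pds ks f) (pdiff k (pds ks f) x) x"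
    using smth_has_pd smth_pds assms Cons by blast
  then have "has_pd k (pds ks g) (pdiff k (pds ks f) x) x"
    by (rule has_pd_eq_on[OF assms(1) Cons.prems Cons.IH, rotated])
  then show ?case using has_pd_imp_pdiff by fastforce
qed (use assms in auto)

section \<open>Smooth elementary functions and the transition function\<close>

lemma Ck_exp: "open U \<Longrightarrow> Ck n U f \<Longrightarrow> Ck n U (\<lambda>x. exp (f x :: real))"
proof (induction n)
  case 0 then show ?case by (auto intro: continuous_intros)
next
  case (Suc n)
  show ?case
  proof (rule Ck_SucI[where g="\<lambda>k x. exp (f x) * pdiff k f x"])
    show "continuous_on U (\<lambda>x. exp (f x))" using Suc.prems by (auto intro: continuous_intros)
    show "has_pd k (\<lambda>x. exp (f x)) (exp (f x) * pdiff k f x) x" if "x \<in> U" for k x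
      by (rule has_pd_chain) (use Suc.prems that in \<open>auto intro!: derivative_eq_intros\<close>)
    show "Ck n U (\<lambda>x. exp (f x) * pdiff k f x)" for k
      by (rule Ck_bilinear[OF _ bounded_bilinear_mult]; (rule Suc.IH)?) (use Suc.prems Ck_lower in auto)
  qed (use Suc.prems in simp)
qed

lemma Ck_inverse:
  assumes "open U" "\<And>x. x \<in> U \<Longrightarrow> f x \<noteq> (0::real)"
  shows "Ck n U f \<Longrightarrow> Ck n U (\<lambda>x. inverse (f x))"
proof (induction n)
  case 0 then show ?case using assms by (auto intro!: continuous_intros)
next
  case (Suc n)
  show ?case
  proof (rule Ck_SucI[where g="\<lambda>k x. (- (inverse (f x) * inverse (f x))) * pdiff k f x"])
    show "continuous_on U (\<lambda>x. inverse (f x))" using Suc.prems assms by (auto intro!: continuous_intros)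
    show "has_pd k (\<lambda>x. inverse (f x)) ((- (inverse (f x) * inverse (f x))) * pdiff k f x) x" if "x \<in> U" for k x
      by (rule has_pd_chain) (use Suc.prems that assms in \<open>auto intro!: derivative_eq_intros\<close>)
    have "Ck n U (\<lambda>x. inverse (f x))" using Suc Ck_lower by blast
    then have "Ck n U (\<lambda>x. (inverse (f x) * inverse (f x)) * pdiff k f x)" for k
      using Suc.prems assms by (intro Ck_bilinear[OF _ bounded_bilinear_mult]) auto
    from Ck_linear[OF assms(1) bounded_linear_minus[OF bounded_linear_ident] this]
    show "Ck n U (\<lambda>x. (- (inverse (f x) * inverse (f x))) * pdiff k f x)" for k by simp
  qed (use assms in simp)
qed

lemma Ck_sqrt:
  assumes "open U" "\<And>x. x \<in> U \<Longrightarrow> f x > (0::real)"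
  shows "Ck n U f \<Longrightarrow> Ck n U (\<lambda>x. sqrt (f x))"
proof (induction n)
  case 0 then show ?case using assms by (auto intro!: continuous_intros)
next
  case (Suc n)
  show ?case
  proof (rule Ck_SucI[where g="\<lambda>k x. (inverse (sqrt (f x)) * (1/2)) * pdiff k f x"])
    show "continuous_on U (\<lambda>x. sqrt (f x))" using Suc.prems assms by (auto intro!: continuous_intros)
    show "has_pd k (\<lambda>x. sqrt (f x)) ((inverse (sqrt (f x)) * (1/2)) * pdiff k f x) x" if "x \<in> U" for k x
      by (rule has_pd_chain) (use Suc.prems that assms in \<open>auto intro!: DERIV_real_sqrt[THEN DERIV_cong] simp: field_simps\<close>)
    have "Ck n U (\<lambda>x. sqrt (f x))" using Suc Ck_lower by blast
    then have "Ck n U (\<lambda>x. inverse (sqrt (f x)))"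
      by (rule Ck_inverse[OF assms(1), rotated]) (use assms in force)
    then show "Ck n U (\<lambda>x. (inverse (sqrt (f x)) * (1/2)) * pdiff k f x)" for k
      using Suc.prems assms by (intro Ck_bilinear[OF _ bounded_bilinear_mult] Ck_const) auto
  qed (use assms in simp)
qed

text \<open>The powers of \<open>inverse t\<close> make the family closed under differentiation, so
  that smoothness of all members follows by one induction.\<close>

definition flat :: "nat \<Rightarrow> real \<Rightarrow> real" where
  "flat k t = (if t > 0 then exp (- inverse t) * inverse t ^ k else 0)"

lemma flat_pos: "t > 0 \<Longrightarrow> flat k t > 0" by (simp add: flat_def)
lemma flat_nonneg: "flat k t \<ge> 0" by (simp add: flat_def)
lemma flat_zero: "t \<le> 0 \<Longrightarrow> flat k t = 0" by (simp add: flat_def)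

lemma flat_tendsto_0: "(flat k \<longlongrightarrow> 0) (at 0)"
proof -
  have "((\<lambda>t. inverse t ^ k / exp (inverse t)) \<longlongrightarrow> 0) (at_right (0::real))"
    using filterlim_compose[OF tendsto_power_div_exp_0 filterlim_inverse_at_top_right, of k] by simp
  then have "(flat k \<longlongrightarrow> 0) (at_right 0)"
    by (rule Lim_transform_eventually)
      (auto simp: flat_def eventually_at_filter exp_minus field_simps)
  moreover have "(flat k \<longlongrightarrow> 0) (at_left 0)"
    by (rule tendsto_eventually) (auto simp: flat_def eventually_at_filter)
  ultimately show ?thesis by (simp add: filterlim_split_at)
qed

lemma flat_DERIV: "(flat k has_real_derivative flat (k + 2) t - k * flat (Suc k) t) (at t)"
proof -
  consider "t > 0" | "t < 0" | "t = 0" by linarith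
  then show ?thesis
  proof cases
    case 1
    have "((\<lambda>t. exp (- inverse t) * inverse t ^ k) has_real_derivative flat (k + 2) t - k * flat (Suc k) t) (at t)"
    proof -
      have "((\<lambda>t. inverse t ^ k) has_real_derivative - (real k * inverse t ^ Suc k)) (at t)"
      proof (induction k)
        case (Suc k)
        have "(inverse has_real_derivative - (inverse t * inverse t)) (at t)"
          using 1 by (auto intro!: derivative_eq_intros simp: power2_eq_square)
        from DERIV_mult[OF this Suc] show ?case by (simp add: algebra_simps)
      qed simp
      moreover have "((\<lambda>t. exp (- inverse t)) has_real_derivative exp (- inverse t) * (inverse t * inverse t)) (at t)"
        using 1 by (auto intro!: derivative_eq_intros simp: power2_eq_square)
      ultimately show ?thesis 
        using DERIV_mult 1 by (fastforce simp: flat_def algebra_simps)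
    qed
    then show ?thesis
      by (rule DERIV_cong_ev[OF refl _ refl, THEN iffD1, rotated], intro eventually_nhds_metric[THEN iffD2] exI[of _ t]) (use 1 in \<open>auto simp: flat_def dist_real_def\<close>)
  next
    case 2
    have "((\<lambda>t. 0) has_real_derivative flat (k + 2) t - k * flat (Suc k) t) (at t)"
      using 2 by (simp add: flat_def)
    then show ?thesis
      by (rule DERIV_cong_ev[OF refl _ refl, THEN iffD1, rotated], intro eventually_nhds_metric[THEN iffD2] exI[of _ "- t"]) (use 2 in \<open>auto simp: flat_def dist_real_def\<close>)
  next
    case 3
    \<comment> \<open>At 0 the difference quotient is \<open>flat (Suc k)\<close> itself, which
      tends to 0.\<close>
    have "((\<lambda>h. (flat k (0 + h) - flat k 0) / h) \<longlongrightarrow> 0) (at 0)"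
      by (rule Lim_transform_eventually[OF flat_tendsto_0[of "Suc k"]])
        (auto simp: flat_def eventually_at_filter field_simps)
    then show ?thesis using 3 by (simp add: DERIV_def flat_def)
  qed
qed

lemma Ck_flat: "open U \<Longrightarrow> Ck n U f \<Longrightarrow> Ck n U (\<lambda>x. flat k (f x))"
proof (induction n arbitrary: k)
  case 0
  have "continuous_on UNIV (flat k)"
    using flat_DERIV DERIV_isCont by (blast intro: continuous_at_imp_continuous_on)
  then show ?case using 0 by (auto intro: continuous_on_compose2)
next
  case (Suc n)
  have IH: "Ck n U (\<lambda>x. flat k (f x))" for k using Suc Ck_lower by blast
  show ?case
  proof (rule Ck_SucI[where g="\<lambda>j x. (flat (k + 2) (f x) + (- real k) * flat (Suc k) (f x)) * pdiff j f x"])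
    show "has_pd j (\<lambda>x. flat k (f x)) ((flat (k + 2) (f x) + (- real k) * flat (Suc k) (f x)) * pdiff j f x) x" if "x \<in> U" for j x
      using has_pd_chain[where g="flat k" and f=f, OF flat_DERIV, of j "pdiff j f x" x] Suc.prems that by simp
    show "Ck n U (\<lambda>x. (flat (k + 2) (f x) + (- real k) * flat (Suc k) (f x)) * pdiff j f x)" for j
      by (rule Ck_bilinear[OF _ bounded_bilinear_mult] Ck_add Ck_const Suc.prems IH)+ (use Suc.prems in auto)
    have "continuous_on UNIV (flat k)"
      using flat_DERIV DERIV_isCont by (blast intro: continuous_at_imp_continuous_on)
    then show "continuous_on U (\<lambda>x. flat k (f x))" 
      by (rule continuous_on_compose2) (use Suc.prems in auto)
  qed (use Suc.prems in simp)
qed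

lemma smth_exp: "open U \<Longrightarrow> smth U f \<Longrightarrow> smth U (\<lambda>x. exp (f x :: real))"
  by (simp add: smth_def Ck_exp)
lemma smth_inverse: "open U \<Longrightarrow> (\<And>x. x \<in> U \<Longrightarrow> f x \<noteq> (0::real)) \<Longrightarrow> smth U f \<Longrightarrow> smth U (\<lambda>x. inverse (f x))"
  by (simp add: smth_def Ck_inverse)
lemma smth_sqrt: "open U \<Longrightarrow> (\<And>x. x \<in> U \<Longrightarrow> f x > (0::real)) \<Longrightarrow> smth U f \<Longrightarrow> smth U (\<lambda>x. sqrt (f x))"
  by (simp add: smth_def Ck_sqrt)
lemma smth_flat: "open U \<Longrightarrow> smth U f \<Longrightarrow> smth U (\<lambda>x. flat k (f x))"
  by (simp add: smth_def Ck_flat)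

definition step :: "real \<Rightarrow> real" where
  "step t = flat 0 t * inverse (flat 0 t + flat 0 (1 - t))"

lemma step_denom_pos: "flat 0 t + flat 0 (1 - t) > 0"
  using flat_pos[of t 0] flat_pos[of "1 - t" 0] flat_nonneg[of 0 t] flat_nonneg[of 0 "1 - t"]
  by (cases "t > 0") (auto intro: add_pos_nonneg add_nonneg_pos)

lemma step_0: "t \<le> 0 \<Longrightarrow> step t = 0" by (simp add: step_def flat_zero)
lemma step_1: "t \<ge> 1 \<Longrightarrow> step t = 1" using flat_pos[of t 0] by (simp add: step_def flat_zero)
lemma step_nonneg: "step t \<ge> 0" 
  unfolding step_def using step_denom_pos[of t] by (simp add: flat_nonneg less_imp_le)
lemma step_le_1: "step t \<le> 1"
  unfolding step_def using step_denom_pos[of t] flat_nonneg[of 0 "1-t"] by (simp add: field_simps)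

lemma smth_step: 
  assumes "open U" "smth U f" shows "smth U (\<lambda>x. step (f x))"
proof -
  have "smth U (\<lambda>x. flat 0 (f x) + flat 0 (1 - f x))"
    by (intro smth_add smth_flat smth_diff smth_const assms)
  then have "smth U (\<lambda>x. inverse (flat 0 (f x) + flat 0 (1 - f x)))"
    by (intro smth_inverse assms(1)) (use step_denom_pos in \<open>auto simp: less_le\<close>)
  then show ?thesis unfolding step_def by (intro smth_mult smth_flat assms)
qed

text \<open>\<open>step'\<close> is continuous and vanishes outside the interval from 0 to 1, hence
  is bounded; 1 is added to the maximum to make \<open>K\<close> strictly positive. This
  \<open>K\<close> is the only quantity of the cut-offs that enters the decay constant.\<close>

lemma step_DERIV_bounded:
  obtains step' K where "\<And>t. (step has_real_derivative step' t) (at t)" "\<And>t. \<bar>step' t\<bar> \<le> K"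
    "\<And>t. t \<le> 0 \<or> t \<ge> 1 \<Longrightarrow> step' t = 0" "K > 0"
proof -
  define D where "D t = flat 0 t + flat 0 (1 - t)" for t
  define D' where "D' t = flat 2 t - flat 2 (1 - t)" for t
  define s' where "s' t = flat 2 t * inverse (D t) + flat 0 t * (- (inverse (D t) * D' t * inverse (D t)))" for t
  have D0: "D t \<noteq> 0" for t using step_denom_pos[of t] by (simp add: D_def)
  have d0: "(flat 0 has_real_derivative flat 2 t) (at t)" for t
    using flat_DERIV[of 0 t] by (simp add: numeral_2_eq_2)
  have d0': "((\<lambda>t. flat 0 (1 - t)) has_real_derivative - flat 2 (1 - t)) (at t)" for t
    by (rule DERIV_chain2[OF d0, where g="\<lambda>t. 1 - t", THEN DERIV_cong]) (auto intro!: derivative_eq_intros)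
  have Dd: "(D has_real_derivative D' t) (at t)" for t
    unfolding D_def D'_def using DERIV_add[OF d0 d0', of t] by simp
  have der: "(step has_real_derivative s' t) (at t)" for t
    unfolding step_def D_def[symmetric] s'_def
    by (rule derivative_eq_intros d0 Dd D0 refl)+ (simp add: algebra_simps)
  have cont_flat: "continuous_on UNIV (flat k)" for k
    using flat_DERIV DERIV_isCont by (blast intro: continuous_at_imp_continuous_on)
  have c1: "continuous_on UNIV (\<lambda>t. flat k (1 - t))" for k
    by (rule continuous_on_compose2[OF cont_flat]) (auto intro: continuous_intros)
  have cD: "continuous_on UNIV D" "continuous_on UNIV D'"
    unfolding D_def D'_def by (intro continuous_on_add continuous_on_diff cont_flat c1)+
  have "continuous_on UNIV (\<lambda>t. inverse (D t))"
    using D0 by (intro continuous_on_inverse cD) auto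
  then have "continuous_on UNIV s'"
    unfolding s'_def by (intro continuous_on_add continuous_on_mult continuous_on_minus cont_flat cD)
  then have "continuous_on {0..1} (\<lambda>t. \<bar>s' t\<bar>)" 
    by (intro continuous_on_rabs) (rule continuous_on_subset, auto)
  then obtain u where u: "u \<in> {0..1}" "\<And>t. t \<in> {0..1} \<Longrightarrow> \<bar>s' t\<bar> \<le> \<bar>s' u\<bar>"
    using continuous_attains_sup[of "{0..1::real}" "\<lambda>t. \<bar>s' t\<bar>"] by auto
  have zero: "s' t = 0" if "t \<le> 0 \<or> t \<ge> 1" for t
  proof -
    have "t > 0 \<Longrightarrow> t \<ge> 1 \<Longrightarrow> flat 2 t * inverse (flat 0 t) = flat 0 t * (inverse (flat 0 t) * flat 2 t * inverse (flat 0 t))"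
      using flat_pos[of t 0] by simp
    then show ?thesis using that by (auto simp: s'_def D'_def D_def flat_zero)
  qed
  have "\<bar>s' t\<bar> \<le> \<bar>s' u\<bar> + 1" for t
  proof (cases "t \<in> {0..1}")
    case True then show ?thesis using u(2)[of t] by linarith
  next
    case False then have "s' t = 0" by (intro zero) auto
    then show ?thesis by simp
  qed
  then show thesis using that[OF der _ zero, of "\<bar>s' u\<bar> + 1"] by auto
qed

section \<open>Mollification\<close>

lemma cball_borel[measurable]: "cball (a::'a::metric_space) r \<in> sets borel" by simp

lemma distr_lborel_reflect: "distr lborel borel (\<lambda>y. x - y) = (lborel :: 'a::euclidean_space measure)"
  using lborel_affine[of "-1" x] by (simp add: density_1)

lemma integral_lborel_reflect:
  fixes g :: "'a::euclidean_space \<Rightarrow> 'b::{banach,second_countable_topology}"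
  assumes "g \<in> borel_measurable borel"
  shows "(\<integral>y. g (x - y) \<partial>lborel) = (\<integral>y. g y \<partial>lborel)"
  by (subst (2) distr_lborel_reflect[of x, symmetric]) (simp add: integral_distr assms)

lemma nn_integral_lborel_reflect:
  assumes "g \<in> borel_measurable borel"
  shows "(\<integral>\<^sup>+y. g (x - y) \<partial>lborel) = (\<integral>\<^sup>+y. g (y::'a::euclidean_space) \<partial>lborel)"
  by (subst (2) distr_lborel_reflect[of x, symmetric]) (simp add: nn_integral_distr assms)

lemma continuous_supp_bounded:
  fixes f :: "'a::euclidean_space \<Rightarrow> 'b::real_normed_vector"
  assumes "continuous_on UNIV f" "\<And>z. norm z > R \<Longrightarrow> f z = 0"
  obtains B where "B > 0" "\<And>z. norm (f z) \<le> B"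
proof -
  have "compact (f ` cball 0 R)"
    by (rule compact_continuous_image[OF continuous_on_subset[OF assms(1)]]) auto
  then obtain B where "B > 0" "\<And>z. z \<in> cball 0 R \<Longrightarrow> norm (f z) \<le> B"
    using compact_imp_bounded bounded_pos by (metis imageI)
  then show thesis using that[of B] assms(2) 
    by (metis dist_0_norm less_eq_real_def mem_cball norm_zero not_le)
qed

text \<open>Serves both as convolution kernel and as compactly supported test function. The radius
  is carried along because the estimates near the singularity depend on how far a kernel
  reaches.\<close>

definition kern :: "real \<Rightarrow> (point \<Rightarrow> 'b::real_normed_vector) \<Rightarrow> bool" where
  "kern \<epsilon> \<kappa> \<longleftrightarrow> smth UNIV \<kappa> \<and> (\<forall>z. norm z > \<epsilon> \<longrightarrow> \<kappa> z = 0)"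

lemma pdiff_zero_outside:
  assumes "\<And>z. norm z > R \<Longrightarrow> f z = 0" "norm z > R" shows "pdiff k f z = 0"
proof (rule has_pd_imp_pdiff)
  have "open {z::point. norm z > R}" by (intro open_Collect_less continuous_intros)
  then show "has_pd k f 0 z"
    by (rule has_pd_eq_on[OF _ _ _ has_pd_const[of k 0], of _ z]) (use assms in auto)
qed

lemma kern_pdiff: "kern \<epsilon> \<kappa> \<Longrightarrow> kern \<epsilon> (pdiff k \<kappa>)"
  unfolding kern_def using smth_pdiff pdiff_zero_outside by blast

lemma kern_pds: "kern \<epsilon> \<kappa> \<Longrightarrow> kern \<epsilon> (pds ks \<kappa>)"
  by (induction ks) (auto intro: kern_pdiff)

lemma kern_bounded:
  assumes "kern \<epsilon> \<kappa>" obtains B where "B > 0" "\<And>z. norm (\<kappa> z) \<le> B"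
  using assms continuous_supp_bounded[of \<kappa> \<epsilon>] smth_continuous unfolding kern_def by blast

lemma kern_mono: "kern \<epsilon> \<kappa> \<Longrightarrow> \<epsilon> \<le> \<epsilon>' \<Longrightarrow> kern \<epsilon>' \<kappa>"
  unfolding kern_def by auto

lemma kern_measurable: "kern \<epsilon> \<kappa> \<Longrightarrow> \<kappa> \<in> borel_measurable borel"
  unfolding kern_def using smth_continuous borel_measurable_continuous_onI by blast

lemma smth_measurable: "smth UNIV f \<Longrightarrow> f \<in> borel_measurable borel"
  using smth_continuous borel_measurable_continuous_onI by blast

text \<open>Uniformity in \<open>z\<close> is what allows differentiation under the integral. Shifts
  have length at most 1, so the relevant points lie in the ball of radius
  \<open>\<epsilon> + 2\<close>, where \<open>pdiff k \<kappa>\<close> is uniformly continuous;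
  farther out both values vanish.\<close>

lemma kern_taylor:
  assumes "kern \<epsilon> \<kappa>" "e > 0"
  obtains \<delta> where "\<delta> > 0" "\<delta> \<le> 1"
    "\<And>t z. \<bar>t\<bar> < \<delta> \<Longrightarrow> norm (\<kappa> (z + t *\<^sub>R axis k 1) - \<kappa> z - t *\<^sub>R pdiff k \<kappa> z) \<le> e * \<bar>t\<bar>"
proof -
  have "kern \<epsilon> (pdiff k \<kappa>)" using assms kern_pdiff by blast
  then have c: "continuous_on UNIV (pdiff k \<kappa>)" and s: "\<And>z. norm z > \<epsilon> \<Longrightarrow> pdiff k \<kappa> z = 0"
    by (auto simp: kern_def smth_continuous)
  have "uniformly_continuous_on (cball 0 (\<epsilon> + 2)) (pdiff k \<kappa>)"
    by (rule compact_uniformly_continuous[OF continuous_on_subset[OF c]]) auto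
  then obtain d where d: "d > 0" "\<And>x y. x \<in> cball 0 (\<epsilon>+2) \<Longrightarrow> y \<in> cball 0 (\<epsilon>+2) \<Longrightarrow> dist x y < d \<Longrightarrow> dist (pdiff k \<kappa> x) (pdiff k \<kappa> y) < e"
    unfolding uniformly_continuous_on_def using assms(2) by metis
  define \<delta> where "\<delta> = min d 1"
  have near: "norm (pdiff k \<kappa> (z + t *\<^sub>R axis k 1) - pdiff k \<kappa> z) \<le> e" if "\<bar>t\<bar> < \<delta>" for t z
  proof (cases "norm z \<le> \<epsilon> + 1")
    case True
    have "norm (z + t *\<^sub>R axis k 1) \<le> \<epsilon> + 2"
      using norm_triangle_ineq[of z "t *\<^sub>R axis k 1"] True that by (simp add: \<delta>_def)
    then have "dist (pdiff k \<kappa> (z + t *\<^sub>R axis k 1)) (pdiff k \<kappa> z) < e"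
      using True that by (intro d(2)) (auto simp: \<delta>_def dist_norm norm_minus_commute mem_cball_0 simp del: mem_cball)
    then show ?thesis by (simp add: dist_norm)
  next
    case False
    have "norm z - \<bar>t\<bar> \<le> norm (z + t *\<^sub>R axis k 1)"
      using norm_triangle_ineq4[of "z + t *\<^sub>R axis k 1" "t *\<^sub>R axis k 1"] by simp
    then show ?thesis using False s[of z] s[of "z + t *\<^sub>R axis k 1"] that assms(2) by (auto simp: \<delta>_def)
  qed
  have "norm (\<kappa> (z + t *\<^sub>R axis k 1) - \<kappa> z - t *\<^sub>R pdiff k \<kappa> z) \<le> e * \<bar>t\<bar>" if "\<bar>t\<bar> < \<delta>" for t z
  proof -
    let ?Q = "\<lambda>s. \<kappa> (z + s *\<^sub>R axis k 1) - s *\<^sub>R pdiff k \<kappa> z"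
    have "norm (?Q t - ?Q 0) \<le> e * \<bar>t - 0\<bar>"
    proof (rule vector_mvt_bound[where f'="\<lambda>s. pdiff k \<kappa> (z + s *\<^sub>R axis k 1) - pdiff k \<kappa> z"])
      fix s assume "s \<in> closed_segment 0 t"
      then have s: "\<bar>s\<bar> < \<delta>" using that by (auto simp: closed_segment_eq_real_ivl split: if_splits)
      then show "norm (pdiff k \<kappa> (z + s *\<^sub>R axis k 1) - pdiff k \<kappa> z) \<le> e" by (rule near)
      have "has_pd k \<kappa> (pdiff k \<kappa> (z + s *\<^sub>R axis k 1)) (z + s *\<^sub>R axis k 1)"
        using assms(1) smth_has_pd[of UNIV \<kappa>] by (auto simp: kern_def)
      from has_pd_line[OF this] show "(?Q has_vector_derivative (pdiff k \<kappa> (z + s *\<^sub>R axis k 1) - pdiff k \<kappa> z)) (at s)"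
        by (auto intro!: derivative_eq_intros)
    qed
    then show ?thesis by (simp add: algebra_simps)
  qed
  then show thesis using that[of \<delta>] d(1) by (simp add: \<delta>_def)
qed

section \<open>Convolution with smooth kernels\<close>

definition loc_int :: "(point \<Rightarrow> 'b::euclidean_space) \<Rightarrow> bool" where
  "loc_int f \<longleftrightarrow> f \<in> borel_measurable borel \<and> (\<forall>r. integrable lborel (\<lambda>x. indicator (cball 0 r) x *\<^sub>R f x))"

definition conv :: "(point \<Rightarrow> real) \<Rightarrow> (point \<Rightarrow> 'b::euclidean_space) \<Rightarrow> point \<Rightarrow> 'b" where
  "conv \<kappa> f x = (\<integral>y. \<kappa> (x - y) *\<^sub>R f y \<partial>lborel)"

lemma loc_int_measurable[measurable_dest]: "loc_int f \<Longrightarrow> f \<in> borel_measurable borel"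
  by (simp add: loc_int_def)

lemma loc_int_continuous:
  assumes "continuous_on UNIV f" shows "loc_int f"
  unfolding loc_int_def
proof (intro conjI allI)
  show m: "f \<in> borel_measurable borel" using assms borel_measurable_continuous_onI by blast
  fix r
  have "set_integrable lborel (cball 0 r) f"
    by (rule borel_integrable_compact[unfolded set_integrable_def[symmetric]]) 
       (use assms continuous_on_subset in \<open>auto\<close>)
  then show "integrable lborel (\<lambda>x. indicator (cball 0 r) x *\<^sub>R f x)" by (simp add: set_integrable_def)
qed

lemma loc_int_bound_integrable:
  fixes g :: "point \<Rightarrow> 'c::euclidean_space" and f :: "point \<Rightarrow> 'b::euclidean_space"
  assumes "loc_int f" "g \<in> borel_measurable borel" "\<And>y. norm (g y) \<le> B * norm (f y)"
    "\<And>y. norm y > r \<Longrightarrow> g y = 0"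
  shows "integrable lborel g" 
    and "norm (integral\<^sup>L lborel g) \<le> B * (\<integral>y. norm (indicator (cball 0 r) y *\<^sub>R f y) \<partial>lborel)"
proof -
  have i: "integrable lborel (\<lambda>y. B * norm (indicator (cball 0 r) y *\<^sub>R f y))"
    using assms(1) unfolding loc_int_def by (intro integrable_mult_right integrable_norm) auto
  have le: "norm (g y) \<le> B * norm (indicator (cball 0 r) y *\<^sub>R f y)" for y
    using assms(3)[of y] assms(4)[of y] by (auto simp: indicator_def)
  show g: "integrable lborel g"
    by (rule Bochner_Integration.integrable_bound[OF i]) (use assms(2) le in \<open>auto intro: order_trans[OF _ abs_ge_self]\<close>)
  have "norm (integral\<^sup>L lborel g) \<le> (\<integral>y. B * norm (indicator (cball 0 r) y *\<^sub>R f y) \<partial>lborel)"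
    by (rule Bochner_Integration.integral_norm_bound_integral[OF g i]) (rule le)
  then show "norm (integral\<^sup>L lborel g) \<le> B * (\<integral>y. norm (indicator (cball 0 r) y *\<^sub>R f y) \<partial>lborel)"
    by simp
qed

lemma norm_ge_reflect: "norm y > norm x + \<epsilon> \<Longrightarrow> norm (x - y) > (\<epsilon>::real)"
  using norm_triangle_ineq2[of y x] by (simp add: norm_minus_commute)

lemma conv_integrable:
  assumes "kern \<epsilon> \<kappa>" "loc_int f" shows "integrable lborel (\<lambda>y. \<kappa> (x - y) *\<^sub>R f y)"
proof -
  obtain B where B: "\<And>z. norm (\<kappa> z) \<le> B" using kern_bounded assms by blast
  have [measurable]: "\<kappa> \<in> borel_measurable borel" using assms kern_measurable by blast
  have [measurable]: "f \<in> borel_measurable borel" using assms by (simp add: loc_int_def)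
  show ?thesis
    by (rule loc_int_bound_integrable(1)[OF assms(2), where B=B and r="norm x + \<epsilon>"])
      (use B assms(1) norm_ge_reflect[of x \<epsilon>] in \<open>auto simp: kern_def intro: mult_right_mono\<close>)
qed

lemma has_pd_conv:
  assumes "kern \<epsilon> \<kappa>" "loc_int f"
  shows "has_pd k (conv \<kappa> f) (conv (pdiff k \<kappa>) f x) x"
  unfolding has_pd_alt
proof (intro allI impI)
  fix e :: real assume "e > 0"
  define M where "M = (\<integral>y. norm (indicator (cball 0 (norm x + \<epsilon> + 1)) y *\<^sub>R f y) \<partial>lborel)"
  have "M \<ge> 0" unfolding M_def by simp
  have [measurable]: "\<kappa> \<in> borel_measurable borel" "pdiff k \<kappa> \<in> borel_measurable borel" "f \<in> borel_measurable borel"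
    using kern_measurable[OF assms(1)] kern_measurable[OF kern_pdiff[OF assms(1)]] assms(2) by (auto simp: loc_int_def)
  \<comment> \<open>The Taylor error is scaled by the mass \<open>M\<close> of \<open>f\<close> on
    the ball that carries the integrand; the added 1 covers \<open>M = 0\<close>.\<close>
  obtain \<delta> where \<delta>: "\<delta> > 0" "\<delta> \<le> 1" 
     "\<And>t z. \<bar>t\<bar> < \<delta> \<Longrightarrow> norm (\<kappa> (z + t *\<^sub>R axis k 1) - \<kappa> z - t *\<^sub>R pdiff k \<kappa> z) \<le> (e / (M + 1)) * \<bar>t\<bar>"
    using kern_taylor[OF assms(1), of "e / (M+1)"] \<open>e > 0\<close> \<open>M \<ge> 0\<close> by auto
  show "\<exists>\<delta>>0. \<forall>t. \<bar>t\<bar> < \<delta> \<longrightarrow> norm (conv \<kappa> f (x + t *\<^sub>R axis k 1) - conv \<kappa> f x - t *\<^sub>R conv (pdiff k \<kappa>) f x) \<le> e * \<bar>t\<bar>"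
  proof (intro exI[of _ \<delta>] conjI allI impI \<delta>(1))
    fix t :: real assume t: "\<bar>t\<bar> < \<delta>"
    let ?g = "\<lambda>y. (\<kappa> (x - y + t *\<^sub>R axis k 1) - \<kappa> (x - y) - t *\<^sub>R pdiff k \<kappa> (x - y)) *\<^sub>R f y"
    have i: "integrable lborel (\<lambda>y. \<kappa> (x + t *\<^sub>R axis k 1 - y) *\<^sub>R f y)" "integrable lborel (\<lambda>y. \<kappa> (x - y) *\<^sub>R f y)"
       "integrable lborel (\<lambda>y. pdiff k \<kappa> (x - y) *\<^sub>R f y)"
      using conv_integrable assms kern_pdiff by blast+
    have "integral\<^sup>L lborel ?g = (\<integral>y. \<kappa> (x + t *\<^sub>R axis k 1 - y) *\<^sub>R f y - \<kappa> (x - y) *\<^sub>R f y - t *\<^sub>R (pdiff k \<kappa> (x - y) *\<^sub>R f y) \<partial>lborel)"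
      by (intro Bochner_Integration.integral_cong) (auto simp: algebra_simps)
    also have "\<dots> = conv \<kappa> f (x + t *\<^sub>R axis k 1) - conv \<kappa> f x - t *\<^sub>R conv (pdiff k \<kappa>) f x"
      unfolding conv_def using i by (simp del: scaleR_scaleR)
    finally have eq: "conv \<kappa> f (x + t *\<^sub>R axis k 1) - conv \<kappa> f x - t *\<^sub>R conv (pdiff k \<kappa>) f x = integral\<^sup>L lborel ?g" ..
    have "norm (integral\<^sup>L lborel ?g) \<le> (e / (M + 1) * \<bar>t\<bar>) * M"
      unfolding M_def
    proof (rule loc_int_bound_integrable(2)[OF assms(2)])
      show "norm (?g y) \<le> e / ((\<integral>y. norm (indicat_real (cball 0 (norm x + \<epsilon> + 1)) y *\<^sub>R f y) \<partial>lborel) + 1) * \<bar>t\<bar> * norm (f y)" for y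
        using mult_right_mono[OF \<delta>(3)[OF t, of "x - y"], of "norm (f y)"] unfolding M_def by simp
      show "?g y = 0" if "norm y > norm x + \<epsilon> + 1" for y
      proof -
        have "norm (x - y) > \<epsilon> + 1" using that norm_ge_reflect[of x "\<epsilon> + 1" y] by simp
        moreover have "norm (x - y) - \<bar>t\<bar> \<le> norm (x - y + t *\<^sub>R axis k 1)"
          using norm_triangle_ineq4[of "x - y + t *\<^sub>R axis k 1" "t *\<^sub>R axis k 1"] by simp
        ultimately have "norm (x - y) > \<epsilon>" "norm (x - y + t *\<^sub>R axis k 1) > \<epsilon>" using t \<delta>(2) by auto
        then show ?thesis using assms(1) kern_pdiff[OF assms(1), of k] unfolding kern_def by simp
      qed
    qed measurable
    also have "\<dots> \<le> e * \<bar>t\<bar>"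
      using \<open>M \<ge> 0\<close> \<open>e > 0\<close> by (auto simp: field_simps mult_nonneg_nonneg intro!: mult_left_mono)
    finally show "norm (conv \<kappa> f (x + t *\<^sub>R axis k 1) - conv \<kappa> f x - t *\<^sub>R conv (pdiff k \<kappa>) f x) \<le> e * \<bar>t\<bar>"
      using eq by simp
  qed
qed

lemma pdiff_conv: "kern \<epsilon> \<kappa> \<Longrightarrow> loc_int f \<Longrightarrow> pdiff k (conv \<kappa> f) = conv (pdiff k \<kappa>) f"
  using has_pd_imp_pdiff[OF has_pd_conv] by blast

lemma pds_conv: "kern \<epsilon> \<kappa> \<Longrightarrow> loc_int f \<Longrightarrow> pds ks (conv \<kappa> f) = conv (pds ks \<kappa>) f"
  by (induction ks) (auto simp: pdiff_conv[OF kern_pds])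

text \<open>Only partial derivatives are available, so the segment from \<open>x\<close> to
  \<open>y\<close> is replaced by three axis-parallel pieces, whence the factor 3. A point on them
  differs from \<open>x\<close> by a vector that is componentwise no larger than
  \<open>y - x\<close>, so the path stays in the ball.\<close>

lemma axis_lipschitz:
  fixes f :: "point \<Rightarrow> 'b::real_normed_vector"
  assumes pd: "\<And>k z. norm (z - x) \<le> r \<Longrightarrow> has_pd k f (g k z) z"
    and B: "\<And>k z. norm (z - x) \<le> r \<Longrightarrow> norm (g k z) \<le> B" and "norm (y - x) \<le> r"
  shows "norm (f y - f x) \<le> 3 * B * norm (y - x)"
proof -
  define c where "c = y - x"
  have "B \<ge> 0" using B[of x] assms(3) norm_ge_zero order_trans by (metis norm_zero right_minus_eq)
  have seg: "norm (f (z + c $ k *\<^sub>R axis k 1) - f z) \<le> B * norm c"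
    if z: "\<And>t. t \<in> closed_segment 0 (c $ k) \<Longrightarrow> norm (z + t *\<^sub>R axis k 1 - x) \<le> norm c" for z k
  proof -
    have "norm (f (z + c $ k *\<^sub>R axis k 1) - f (z + 0 *\<^sub>R axis k 1)) \<le> B * \<bar>c $ k - 0\<bar>"
      by (rule vector_mvt_bound[where f'="\<lambda>t. g k (z + t *\<^sub>R axis k 1)"])
        (use z assms(3) in \<open>auto intro!: has_pd_line pd B simp: c_def intro: order_trans\<close>)
    also have "\<dots> \<le> B * norm c"
      using component_le_norm_cart[of c k] \<open>B \<ge> 0\<close> by (simp add: mult_left_mono)
    finally show ?thesis by simp
  qed
  have abs_le: "\<bar>t\<bar> \<le> \<bar>a\<bar>" if "t \<in> closed_segment 0 a" for t a :: real
    using that by (auto simp: closed_segment_eq_real_ivl split: if_splits)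
  let ?p1 = "x + c $ 1 *\<^sub>R axis 1 1" let ?p2 = "?p1 + c $ 2 *\<^sub>R axis 2 1"
  have y: "y = ?p2 + c $ 3 *\<^sub>R axis 3 1"
    by (simp add: vec_eq_iff forall_3 c_def axis_def)
  have 1: "norm (f ?p1 - f x) \<le> B * norm c"
    by (rule seg, rule norm_le_componentwise_cart) (use abs_le in \<open>auto simp: axis_def\<close>)
  have 2: "norm (f ?p2 - f ?p1) \<le> B * norm c"
    by (rule seg, rule norm_le_componentwise_cart) (use abs_le in \<open>auto simp: axis_def\<close>)
  have 3: "norm (f y - f ?p2) \<le> B * norm c"
    unfolding y by (rule seg, rule norm_le_componentwise_cart) (use abs_le in \<open>auto simp: axis_def\<close>)
  have "norm (f y - f x) \<le> norm (f y - f ?p2) + norm (f ?p2 - f ?p1) + norm (f ?p1 - f x)"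
    using norm_triangle_ineq[of "f y - f ?p2" "f ?p2 - f x"] norm_triangle_ineq[of "f ?p2 - f ?p1" "f ?p1 - f x"] by simp
  also have "\<dots> \<le> 3 * B * norm c" using 1 2 3 by simp
  finally show ?thesis by (simp add: c_def)
qed

lemma axis_lipschitz_continuous:
  fixes f :: "point \<Rightarrow> 'b::real_normed_vector"
  assumes "r > 0" and pd: "\<And>k z. norm (z - x) \<le> r \<Longrightarrow> has_pd k f (g k z) z"
    and B: "\<And>k z. norm (z - x) \<le> r \<Longrightarrow> norm (g k z) \<le> B"
  shows "isCont f x"
proof -
  have "((\<lambda>y. f y - f x) \<longlongrightarrow> 0) (at x)"
  proof (rule Lim_null_comparison)
    show "\<forall>\<^sub>F y in at x. norm (f y - f x) \<le> 3 * B * norm (y - x)"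
      unfolding eventually_at
    proof (intro exI[of _ r] conjI ballI impI assms(1))
      fix y assume "y \<noteq> x \<and> dist y x < r"
      then have "norm (y - x) \<le> r" by (simp add: dist_norm)
      then show "norm (f y - f x) \<le> 3 * B * norm (y - x)"
        using axis_lipschitz[of x r f g B y] pd B by blast
    qed
    show "((\<lambda>y. 3 * B * norm (y - x)) \<longlongrightarrow> 0) (at x)"
      by (auto intro!: tendsto_eq_intros)
  qed
  then show ?thesis unfolding isCont_def by (rule Lim_null[THEN iffD2])
qed

lemma conv_bounded:
  assumes "kern \<epsilon> \<kappa>" "loc_int f"
  obtains B where "\<And>x. norm x \<le> r \<Longrightarrow> norm (conv \<kappa> f x) \<le> B"
proof -
  obtain B where B: "B > 0" "\<And>z. norm (\<kappa> z) \<le> B" using kern_bounded assms by blast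
  have [measurable]: "\<kappa> \<in> borel_measurable borel" "f \<in> borel_measurable borel" 
    using assms kern_measurable by (auto simp: loc_int_def)
  have "norm (conv \<kappa> f x) \<le> B * (\<integral>y. norm (indicator (cball 0 (r + \<epsilon>)) y *\<^sub>R f y) \<partial>lborel)" if "norm x \<le> r" for x
    unfolding conv_def
  proof (rule loc_int_bound_integrable(2)[OF assms(2)])
    show "\<kappa> (x - y) *\<^sub>R f y = 0" if "norm y > r + \<epsilon>" for y
      using norm_ge_reflect[of x \<epsilon> y] that \<open>norm x \<le> r\<close> assms(1) unfolding kern_def by simp
  qed (use B in \<open>auto intro: mult_right_mono\<close>)
  then show thesis using that by blast
qed

text \<open>The class for \<open>smth_I\<close> consists of the convolutions of \<open>f\<close>
  with all kernels of radius \<open>\<epsilon>\<close>. Continuity comes from local bounds on the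
  partial derivatives, which are again of this form.\<close>

lemma smth_conv:
  assumes "kern \<epsilon> \<kappa>" "loc_int f" shows "smth UNIV (conv \<kappa> f)"
proof (rule smth_I[where P="\<lambda>g. \<exists>\<kappa>. kern \<epsilon> \<kappa> \<and> g = conv \<kappa> f"])
  fix g assume "\<exists>\<kappa>. kern \<epsilon> \<kappa> \<and> g = conv \<kappa> f"
  then obtain \<kappa> where k: "kern \<epsilon> \<kappa>" "g = conv \<kappa> f" by blast
  show "\<exists>h. (\<exists>\<kappa>. kern \<epsilon> \<kappa> \<and> h = conv \<kappa> f) \<and> (\<forall>x\<in>UNIV. has_pd j g (h x) x)" for j
    using has_pd_conv[OF k(1) assms(2)] kern_pdiff[OF k(1)] k(2) by blast
  show "continuous_on UNIV g"
  proof (rule continuous_at_imp_continuous_on, rule ballI)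
    fix x :: point
    have "\<exists>B. \<forall>z. norm z \<le> norm x + 1 \<longrightarrow> norm (conv (pdiff j \<kappa>) f z) \<le> B" for j
      using conv_bounded[OF kern_pdiff[OF k(1)] assms(2)] by metis
    then obtain B where B: "\<And>j z. norm z \<le> norm x + 1 \<Longrightarrow> norm (conv (pdiff j \<kappa>) f z) \<le> B j" by metis
    show "isCont g x"
    proof (rule axis_lipschitz_continuous[where r=1 and g="\<lambda>j z. conv (pdiff j \<kappa>) f z" and B="Max (range B)"])
      show "norm (conv (pdiff j \<kappa>) f z) \<le> Max (range B)" if "norm (z - x) \<le> 1" for j z
      proof -
        have "norm z \<le> norm x + 1" using norm_triangle_ineq2[of z x] that by simp
        then have "norm (conv (pdiff j \<kappa>) f z) \<le> B j" by (rule B)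
        also have "B j \<le> Max (range B)" by (intro Max_ge) auto
        finally show ?thesis .
      qed
    qed (use has_pd_conv[OF k(1) assms(2)] k(2) in auto)
  qed
qed (use assms in auto)

lemma kern_integrable:
  fixes f :: "point \<Rightarrow> 'b::euclidean_space"
  assumes "kern R f" shows "integrable lborel f"
proof (rule loc_int_bound_integrable(1)[where f=f and B=1 and r=R])
  show "loc_int f" using assms loc_int_continuous smth_continuous by (auto simp: kern_def)
qed (use assms kern_measurable in \<open>auto simp: kern_def\<close>)

lemma loc_int_const: "loc_int (\<lambda>x. c)" by (rule loc_int_continuous) auto

lemma smth_loc_int: "smth UNIV f \<Longrightarrow> loc_int f" by (rule loc_int_continuous) (rule smth_continuous)

text \<open>The convolution of \<open>f\<close> with the constant 1 is constant, and its derivative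
  is the convolution of \<open>pdiff k f\<close> with 1, that is, the integral in question.\<close>

lemma integral_pdiff_real:
  fixes f :: "point \<Rightarrow> real"
  assumes "kern R f" shows "(\<integral>x. pdiff k f x \<partial>lborel) = 0"
proof -
  have [measurable]: "f \<in> borel_measurable borel" "pdiff k f \<in> borel_measurable borel"
    using kern_measurable[OF assms] kern_measurable[OF kern_pdiff[OF assms]] by auto
  have "conv f (\<lambda>_. 1::real) = (\<lambda>x. integral\<^sup>L lborel f)"
    unfolding conv_def by (auto simp: integral_lborel_reflect)
  then have "has_pd k (\<lambda>x. integral\<^sup>L lborel f) (conv (pdiff k f) (\<lambda>_. 1) 0) 0"
    using has_pd_conv[OF assms loc_int_const[of "1::real"], of k 0] by simp
  then have "conv (pdiff k f) (\<lambda>_. 1::real) 0 = 0"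
    using has_pd_imp_pdiff has_pd_const by metis
  then show ?thesis unfolding conv_def by (simp add: integral_lborel_reflect[of _ 0, simplified])
qed

lemma kern_inner_const: "kern R f \<Longrightarrow> kern R (\<lambda>x. f x \<bullet> b)"
  using smth_inner[OF _ _ smth_const[of UNIV b], of f] by (auto simp: kern_def)

lemma integral_pdiff:
  fixes f :: "point \<Rightarrow> 'b::euclidean_space"
  assumes "kern R f" shows "(\<integral>x. pdiff k f x \<partial>lborel) = 0"
proof (rule euclidean_eqI)
  fix b :: 'b assume "b \<in> Basis"
  have "pdiff k (\<lambda>x. f x \<bullet> b) x = pdiff k f x \<bullet> b" for x
    by (rule has_pd_imp_pdiff, rule has_pd_linear[OF bounded_linear_inner_left])
       (use assms smth_has_pd[of UNIV f] in \<open>simp add: kern_def\<close>)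
  then have "(\<integral>x. pdiff k f x \<bullet> b \<partial>lborel) = 0"
    using integral_pdiff_real[OF kern_inner_const[OF assms, of b], of k] by simp
  then show "(\<integral>x. pdiff k f x \<partial>lborel) \<bullet> b = 0 \<bullet> b"
    using kern_integrable[OF kern_pdiff[OF assms]] by simp
qed

text \<open>The integral over \<open>y\<close> of a derivative of
  \<open>\<kappa> (x - y) *\<^sub>R f y\<close> vanishes. The reflection in the kernel supplies the
  minus sign, so the derivative moves from the kernel to \<open>f\<close>.\<close>

lemma conv_pdiff:
  assumes "kern \<epsilon> \<kappa>" "smth UNIV f"
  shows "conv (pdiff k \<kappa>) f = conv \<kappa> (pdiff k f)"
proof
  fix x
  let ?h = "\<lambda>y. \<kappa> (x - y) *\<^sub>R f y"
  have sm: "smth UNIV ?h" using assms smth_reflect by (intro smth_scaleR) (auto simp: kern_def)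
  have k: "kern (norm x + \<epsilon>) ?h"
    unfolding kern_def using sm norm_ge_reflect[of x \<epsilon>] assms(1) by (auto simp: kern_def)
  have "has_pd k ?h (\<kappa> (x - y) *\<^sub>R pdiff k f y + (- pdiff k \<kappa> (x - y)) *\<^sub>R f y) y" for y
    by (rule has_pd_bilinear[OF bounded_bilinear_scaleR has_pd_reflect])
       (use assms smth_has_pd[of UNIV \<kappa>] smth_has_pd[of UNIV f] in \<open>simp_all add: kern_def\<close>)
  then have eq: "pdiff k ?h y = \<kappa> (x - y) *\<^sub>R pdiff k f y - pdiff k \<kappa> (x - y) *\<^sub>R f y" for y
    using has_pd_imp_pdiff[of k ?h _ y] by simp
  have "(\<integral>y. \<kappa> (x - y) *\<^sub>R pdiff k f y - pdiff k \<kappa> (x - y) *\<^sub>R f y \<partial>lborel) = 0"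
    using integral_pdiff[OF k, of k] unfolding eq .
  moreover have "integrable lborel (\<lambda>y. \<kappa> (x - y) *\<^sub>R pdiff k f y)" "integrable lborel (\<lambda>y. pdiff k \<kappa> (x - y) *\<^sub>R f y)"
    using conv_integrable assms kern_pdiff smth_pdiff smth_loc_int by blast+
  ultimately show "conv (pdiff k \<kappa>) f x = conv \<kappa> (pdiff k f) x" by (simp add: conv_def)
qed

lemma pds_conv_smth:
  assumes "kern \<epsilon> \<kappa>" "smth UNIV f" shows "pds ks (conv \<kappa> f) = conv \<kappa> (pds ks f)"
proof (induction ks)
  case (Cons k ks)
  then show ?case using pdiff_conv[OF assms(1) smth_loc_int[OF smth_pds[OF assms(2)]]] conv_pdiff[OF assms(1) smth_pds[OF assms(2)]] by simp
qed simp

lemma conv_cong: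
  assumes "kern \<epsilon> \<kappa>" "\<And>y. norm (x - y) \<le> \<epsilon> \<Longrightarrow> f y = g y" shows "conv \<kappa> f x = conv \<kappa> g x"
  unfolding conv_def
proof (rule Bochner_Integration.integral_cong)
  show "\<kappa> (x - y) *\<^sub>R f y = \<kappa> (x - y) *\<^sub>R g y" for y
    using assms by (cases "norm (x - y) \<le> \<epsilon>") (auto simp: kern_def not_le)
qed simp

section \<open>Mollifiers: normalisation, contraction and commutation\<close>

lemma smth_id: "smth UNIV (\<lambda>x::point. x)"
proof -
  have "smth UNIV (\<lambda>z::point. \<Sum>k\<in>UNIV. z $ k *\<^sub>R axis k (1::real))"
    by (intro smth_sum smth_scaleR smth_nth smth_const) auto
  then show ?thesis
    by (rule smth_cong[rotated 2]) (auto simp: vec_eq_iff axis_def if_distrib sum.delta cong: if_cong)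
qed

definition moll :: "real \<Rightarrow> point \<Rightarrow> real" where
  "moll \<epsilon> z = flat 0 (\<epsilon>\<^sup>2 - z \<bullet> z) / (\<integral>z. flat 0 (\<epsilon>\<^sup>2 - z \<bullet> z) \<partial>(lborel :: point measure))"

definition prob_kern :: "real \<Rightarrow> (point \<Rightarrow> real) \<Rightarrow> bool" where
  "prob_kern \<epsilon> \<rho> \<longleftrightarrow> kern \<epsilon> \<rho> \<and> (\<forall>z. \<rho> z \<ge> 0) \<and> integral\<^sup>L lborel \<rho> = 1"

text \<open>The point to check is that the normalising integral is positive: on the ball of half the
  radius the bump is at least its value at the boundary of that ball.\<close>

lemma prob_kern_moll: assumes "\<epsilon> > 0" shows "prob_kern \<epsilon> (moll \<epsilon>)"
proof -
  let ?b = "\<lambda>z::point. flat 0 (\<epsilon>\<^sup>2 - z \<bullet> z)"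
  have zero: "?b z = 0" if "norm z > \<epsilon>" for z
    using that assms by (intro flat_zero) (simp add: power2_norm_eq_inner[symmetric] power_mono)
  have k: "kern \<epsilon> ?b"
    unfolding kern_def using zero by (auto intro!: smth_flat smth_diff smth_const smth_inner smth_id)
  have int: "integrable lborel ?b" by (rule kern_integrable[OF k])
  let ?c = "flat 0 (\<epsilon>\<^sup>2 - (\<epsilon>/2)\<^sup>2)"
  have "?c > 0" using assms by (intro flat_pos) (simp add: power2_eq_square)
  have flat_mono: "flat 0 s \<le> flat 0 t" if "s \<le> t" for s t
    using that by (cases "s > 0") (auto simp: flat_def)
  have "0 < ?c * measure lborel (cball (0::point) (\<epsilon>/2))"
    using \<open>?c > 0\<close> assms content_cball_pos[of "\<epsilon>/2" "0::point"] by simp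
  also have "\<dots> = (\<integral>z. ?c * indicator (cball 0 (\<epsilon>/2)) z \<partial>(lborel::point measure))"
    by simp
  also have "\<dots> \<le> integral\<^sup>L lborel ?b"
  proof (rule integral_mono)
    show "integrable lborel (\<lambda>z::point. ?c * indicator (cball 0 (\<epsilon>/2)) z)"
      by (intro integrable_mult_right integrable_real_indicator) (use emeasure_bounded_finite[OF bounded_cball] in \<open>auto simp: less_top\<close>)
    show "?c * indicator (cball 0 (\<epsilon>/2)) z \<le> ?b z" for z
    proof (cases "norm z \<le> \<epsilon>/2")
      case True
      then have "z \<bullet> z \<le> (\<epsilon>/2)\<^sup>2" by (simp add: power2_norm_eq_inner[symmetric] power_mono)
      then show ?thesis using True flat_mono by simp
    qed (simp add: flat_nonneg)
  qed (rule int)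
  finally have pos: "integral\<^sup>L lborel ?b > 0" .
  have mm: "moll \<epsilon> = (\<lambda>z. ?b z * inverse (integral\<^sup>L lborel ?b))"
    by (auto simp: moll_def divide_inverse)
  have "kern \<epsilon> (moll \<epsilon>)"
    using k smth_mult[of UNIV ?b "\<lambda>_. inverse (integral\<^sup>L lborel ?b)"] unfolding mm kern_def by (simp add: smth_const)
  moreover have "integral\<^sup>L lborel (moll \<epsilon>) = 1" using pos int unfolding mm by simp
  moreover have "moll \<epsilon> z \<ge> 0" for z using pos by (simp add: moll_def flat_nonneg)
  ultimately show ?thesis by (simp add: prob_kern_def)
qed

lemma prob_kern_translate:
  assumes "prob_kern \<epsilon> \<rho>"
  shows "integrable lborel (\<lambda>y. \<rho> (x - y))" "(\<integral>y. \<rho> (x - y) \<partial>lborel) = 1"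
    "(\<integral>\<^sup>+y. ennreal (\<rho> (x - y)) \<partial>lborel) = 1" "(\<integral>\<^sup>+y. ennreal (\<rho> (y - x)) \<partial>lborel) = 1"
proof -
  have k: "kern \<epsilon> \<rho>" and nn: "\<And>z. \<rho> z \<ge> 0" and i: "integral\<^sup>L lborel \<rho> = 1" using assms by (auto simp: prob_kern_def)
  have [measurable]: "\<rho> \<in> borel_measurable borel" using k kern_measurable by blast
  show "integrable lborel (\<lambda>y. \<rho> (x - y))" using conv_integrable[OF k loc_int_const[of "1::real"], of x] by simp
  show "(\<integral>y. \<rho> (x - y) \<partial>lborel) = 1" using i by (simp add: integral_lborel_reflect)
  have 1: "(\<integral>\<^sup>+y. ennreal (\<rho> y) \<partial>lborel) = 1"
    using nn_integral_eq_integral[OF kern_integrable[OF k]] nn i by simp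
  then show "(\<integral>\<^sup>+y. ennreal (\<rho> (x - y)) \<partial>lborel) = 1"
    using nn_integral_lborel_reflect[of "\<lambda>z. ennreal (\<rho> z)" x] by simp
  have "(\<integral>\<^sup>+y. ennreal (\<rho> (y - x)) \<partial>lborel) = (\<integral>\<^sup>+y. ennreal (\<rho> ((0 - y) - x)) \<partial>lborel)"
    using nn_integral_lborel_reflect[of "\<lambda>z. ennreal (\<rho> (z - x))" 0] by simp
  also have "\<dots> = (\<integral>\<^sup>+y. ennreal (\<rho> ((- x) - y)) \<partial>lborel)" by (simp add: minus_diff_commute[of _ x])
  also have "\<dots> = 1" using 1 nn_integral_lborel_reflect[of "\<lambda>z. ennreal (\<rho> z)" "-x"] by simp
  finally show "(\<integral>\<^sup>+y. ennreal (\<rho> (y - x)) \<partial>lborel) = 1" .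
qed

lemma conv_approx:
  assumes "prob_kern \<epsilon> \<rho>" "loc_int f" "\<And>y. norm (x - y) \<le> \<epsilon> \<Longrightarrow> norm (f y - c) \<le> M"
  shows "norm (conv \<rho> f x - c) \<le> M"
proof -
  have k: "kern \<epsilon> \<rho>" and nn: "\<And>z. \<rho> z \<ge> 0" using assms by (auto simp: prob_kern_def)
  note i = prob_kern_translate[OF assms(1), of x]
  have "conv \<rho> f x - c = (\<integral>y. \<rho> (x - y) *\<^sub>R f y - \<rho> (x - y) *\<^sub>R c \<partial>lborel)"
    using conv_integrable[OF k assms(2), of x] i(1,2) by (simp add: conv_def)
  also have "norm \<dots> \<le> (\<integral>y. \<rho> (x - y) * M \<partial>lborel)"
  proof (rule Bochner_Integration.integral_norm_bound_integral)
    show "integrable lborel (\<lambda>y. \<rho> (x - y) *\<^sub>R f y - \<rho> (x - y) *\<^sub>R c)"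
      using conv_integrable[OF k assms(2), of x] i(1) by simp
    show "integrable lborel (\<lambda>y. \<rho> (x - y) * M)" using i(1) by simp
    fix y
    have "norm (\<rho> (x - y) *\<^sub>R (f y - c)) \<le> \<rho> (x - y) * M"
      using assms(3)[of y] nn[of "x - y"] k by (cases "norm (x - y) \<le> \<epsilon>") (auto simp: kern_def mult_left_mono)
    then show "norm (\<rho> (x - y) *\<^sub>R f y - \<rho> (x - y) *\<^sub>R c) \<le> \<rho> (x - y) * M" by (simp add: scaleR_diff_right)
  qed
  also have "\<dots> = M" using i(2) by simp
  finally show ?thesis .
qed

text \<open>Jensen's inequality for the probability density \<open>\<rho> (x - y)\<close>, obtained
  from Cauchy-Schwarz after splitting the density into two square roots.\<close>

lemma norm_conv_square_le:
  assumes "prob_kern \<epsilon> \<rho>" "loc_int f"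
  shows "ennreal ((norm (conv \<rho> f x))\<^sup>2) \<le> (\<integral>\<^sup>+y. ennreal (\<rho> (x - y)) * ennreal ((norm (f y))\<^sup>2) \<partial>lborel)"
proof -
  have k: "kern \<epsilon> \<rho>" and nn: "\<And>z. \<rho> z \<ge> 0" using assms by (auto simp: prob_kern_def)
  have [measurable]: "\<rho> \<in> borel_measurable borel" using k kern_measurable by blast
  have [measurable]: "f \<in> borel_measurable borel" using assms by (simp add: loc_int_def)
  have "ennreal (norm (conv \<rho> f x)) \<le> (\<integral>\<^sup>+y. ennreal (norm (\<rho> (x - y) *\<^sub>R f y)) \<partial>lborel)"
    unfolding conv_def by (rule integral_norm_bound_ennreal[OF conv_integrable[OF k assms(2)]])
  also have "\<dots> = (\<integral>\<^sup>+y. ennreal (sqrt (\<rho> (x - y))) * ennreal (sqrt (\<rho> (x - y)) * norm (f y)) \<partial>lborel)"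
    by (intro nn_integral_cong) (simp add: nn ennreal_mult[symmetric] mult.assoc[symmetric])
  finally have "(ennreal (norm (conv \<rho> f x)))\<^sup>2 \<le> (\<integral>\<^sup>+y. ennreal (sqrt (\<rho> (x - y))) * ennreal (sqrt (\<rho> (x - y)) * norm (f y)) \<partial>lborel)\<^sup>2"
    by (intro power_mono) auto
  also have "\<dots> \<le> (\<integral>\<^sup>+y. (ennreal (sqrt (\<rho> (x - y))))\<^sup>2 \<partial>lborel) * (\<integral>\<^sup>+y. (ennreal (sqrt (\<rho> (x - y)) * norm (f y)))\<^sup>2 \<partial>lborel)"
    by (rule Cauchy_Schwarz_nn_integral) measurable
  also have "\<dots> = 1 * (\<integral>\<^sup>+y. ennreal (\<rho> (x - y)) * ennreal ((norm (f y))\<^sup>2) \<partial>lborel)"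
    using prob_kern_translate(3)[OF assms(1), of x] nn
    by (simp add: ennreal_power power_mult_distrib ennreal_mult)
  finally show ?thesis by (simp add: ennreal_power)
qed

text \<open>Tonelli applied to \<open>norm_conv_square_le\<close>. The local form, with
  \<open>T\<close> containing the neighbourhood of \<open>S\<close> of width
  \<open>\<epsilon>\<close>, lets bounds on balls pass to mollifications.\<close>

lemma nn_integral_conv_le:
  assumes "prob_kern \<epsilon> \<rho>" "loc_int f" and [measurable]: "S \<in> sets borel" "T \<in> sets borel"
    and ST: "\<And>x y. x \<in> S \<Longrightarrow> norm (x - y) \<le> \<epsilon> \<Longrightarrow> y \<in> T"
  shows "(\<integral>\<^sup>+x\<in>S. ennreal ((norm (conv \<rho> f x))\<^sup>2) \<partial>lborel) \<le> (\<integral>\<^sup>+x\<in>T. ennreal ((norm (f x))\<^sup>2) \<partial>lborel)"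
proof -
  have k: "kern \<epsilon> \<rho>" and nn: "\<And>z. \<rho> z \<ge> 0" using assms by (auto simp: prob_kern_def)
  have [measurable]: "\<rho> \<in> borel_measurable borel" using k kern_measurable by blast
  have [measurable]: "f \<in> borel_measurable borel" using assms by (simp add: loc_int_def)
  have "(\<integral>\<^sup>+x\<in>S. ennreal ((norm (conv \<rho> f x))\<^sup>2) \<partial>lborel) \<le> (\<integral>\<^sup>+x\<in>S. (\<integral>\<^sup>+y. ennreal (\<rho> (x - y)) * ennreal ((norm (f y))\<^sup>2) \<partial>lborel) \<partial>lborel)"
    by (intro nn_integral_mono mult_right_mono norm_conv_square_le[OF assms(1,2)]) auto
  also have "\<dots> = (\<integral>\<^sup>+x. (\<integral>\<^sup>+y. ennreal (\<rho> (x - y)) * ennreal ((norm (f y))\<^sup>2) * indicator S x \<partial>lborel) \<partial>lborel)"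
    by (simp add: nn_integral_multc)
  also have "\<dots> \<le> (\<integral>\<^sup>+x. (\<integral>\<^sup>+y. ennreal (\<rho> (x - y)) * (ennreal ((norm (f y))\<^sup>2) * indicator T y) \<partial>lborel) \<partial>lborel)"
  proof (intro nn_integral_mono)
    fix x y
    show "ennreal (\<rho> (x - y)) * ennreal ((norm (f y))\<^sup>2) * indicator S x \<le> ennreal (\<rho> (x - y)) * (ennreal ((norm (f y))\<^sup>2) * indicator T y)"
      using ST[of x y] k by (cases "norm (x - y) \<le> \<epsilon>") (auto simp: kern_def indicator_def)
  qed
  also have "\<dots> = (\<integral>\<^sup>+y. (\<integral>\<^sup>+x. ennreal (\<rho> (x - y)) * (ennreal ((norm (f y))\<^sup>2) * indicator T y) \<partial>lborel) \<partial>lborel)"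
    by (rule lborel_pair.Fubini') measurable
  also have "\<dots> = (\<integral>\<^sup>+y\<in>T. ennreal ((norm (f y))\<^sup>2) \<partial>lborel)"
    using prob_kern_translate(4)[OF assms(1)] by (simp add: nn_integral_multc)
  finally show ?thesis .
qed

lemma conv_conv:
  assumes "kern a \<kappa>" "kern b \<mu>" "loc_int f"
  shows "conv \<kappa> (conv \<mu> f) x = (\<integral>z. conv \<kappa> \<mu> (x - z) *\<^sub>R f z \<partial>lborel)"
proof -
  obtain B where B: "B > 0" "\<And>z. norm (\<kappa> z) \<le> B" using kern_bounded assms by blast
  obtain C where C: "C > 0" "\<And>z. norm (\<mu> z) \<le> C" using kern_bounded assms by blast
  have [measurable]: "\<kappa> \<in> borel_measurable borel" "\<mu> \<in> borel_measurable borel" "f \<in> borel_measurable borel"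
    using assms kern_measurable loc_int_measurable by blast+
  define R where "R = norm x + \<bar>a\<bar>"
  \<comment> \<open>A jointly integrable majorant for Fubini: an indicator in \<open>y\<close> times
    an integrable function of \<open>z\<close>. Both variables are confined to balls because
    \<open>x - y\<close> and \<open>y - z\<close> must lie in the supports of the kernels.\<close>
  define w where "w y z = indicator (cball 0 R) y * (B * C * norm (indicator (cball 0 (R + \<bar>b\<bar>)) z *\<^sub>R f z))" for y z :: point
  let ?F = "\<lambda>y z. (\<kappa> (x - y) * \<mu> (y - z)) *\<^sub>R f z"
  have le: "norm (?F y z) \<le> w y z" for y z
  proof (cases "norm y \<le> R \<and> norm z \<le> R + \<bar>b\<bar>")
    case True
    have "norm (?F y z) = \<bar>\<kappa> (x - y)\<bar> * \<bar>\<mu> (y - z)\<bar> * norm (f z)" by (simp add: abs_mult)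
    also have "\<dots> \<le> B * C * norm (f z)"
      using B C by (intro mult_right_mono mult_mono) auto
    finally show ?thesis using True by (simp add: w_def)
  next
    case False
    have "?F y z = 0"
    proof (cases "norm y \<le> R")
      case True
      then have "norm (y - z) > b" using False norm_ge_reflect[of y "\<bar>b\<bar>" z] by auto
      then show ?thesis using assms(2) by (simp add: kern_def)
    next
      case False
      then have "norm (x - y) > a" using norm_ge_reflect[of x "\<bar>a\<bar>" y] by (auto simp: R_def)
      then show ?thesis using assms(1) by (simp add: kern_def)
    qed
    then have "norm (?F y z) = 0" by simp
    moreover have "0 \<le> w y z" using B(1) C(1) by (simp add: w_def)
    ultimately show ?thesis by linarith
  qed
  have iw: "integrable lborel (\<lambda>z. B * C * norm (indicator (cball 0 (R + \<bar>b\<bar>)) z *\<^sub>R f z))"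
    using assms(3) unfolding loc_int_def by (intro integrable_mult_right integrable_norm) auto
  have ii: "integrable lborel (\<lambda>y::point. indicat_real (cball 0 R) y)"
    by (intro integrable_real_indicator) (use emeasure_bounded_finite[OF bounded_cball] in \<open>auto simp: less_top\<close>)
  have "integrable (lborel \<Otimes>\<^sub>M lborel) (\<lambda>(y, z). w y z)"
  proof (rule lborel_pair.Fubini_integrable)
    show "(\<lambda>(y, z). w y z) \<in> borel_measurable (lborel \<Otimes>\<^sub>M lborel)" unfolding w_def by measurable
    show "AE y in lborel. integrable lborel (\<lambda>z. case (y, z) of (y, z) \<Rightarrow> w y z)"
      unfolding w_def using iw by simp
    have "(\<integral>z. norm (case (y, z) of (y, z) \<Rightarrow> w y z) \<partial>lborel) = indicator (cball 0 R) y * (\<integral>z. B * C * norm (indicator (cball 0 (R + \<bar>b\<bar>)) z *\<^sub>R f z) \<partial>lborel)" for y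
      using B C by (simp add: w_def abs_mult)
    then show "integrable lborel (\<lambda>y. \<integral>z. norm (case (y, z) of (y, z) \<Rightarrow> w y z) \<partial>lborel)"
      using ii by simp
  qed
  then have int: "integrable (lborel \<Otimes>\<^sub>M lborel) (\<lambda>(y, z). ?F y z)"
  proof (rule Bochner_Integration.integrable_bound)
    show "AE p in lborel \<Otimes>\<^sub>M lborel. norm (case p of (y, z) \<Rightarrow> ?F y z) \<le> norm (case p of (y, z) \<Rightarrow> w y z)"
      using le by (intro AE_I2) (auto simp del: norm_scaleR intro: order_trans[OF _ abs_ge_self])
  qed measurable
  have "conv \<kappa> (conv \<mu> f) x = (\<integral>y. (\<integral>z. ?F y z \<partial>lborel) \<partial>lborel)"
    unfolding conv_def by (intro Bochner_Integration.integral_cong) (simp_all flip: scaleR_scaleR)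
  also have "\<dots> = (\<integral>z. (\<integral>y. ?F y z \<partial>lborel) \<partial>lborel)"
    using lborel_pair.Fubini_integral[OF int] by simp
  also have "\<dots> = (\<integral>z. conv \<kappa> \<mu> (x - z) *\<^sub>R f z \<partial>lborel)"
  proof (intro Bochner_Integration.integral_cong refl)
    fix z
    have "(\<integral>y. ?F y z \<partial>lborel) = (\<integral>y. \<kappa> (x - y) * \<mu> (y - z) \<partial>lborel) *\<^sub>R f z"
    proof (cases "f z = 0")
      case False
      have "integrable lborel (\<lambda>y. \<kappa> (x - y) *\<^sub>R \<mu> (y - z))"
        using smth_shift[of \<mu> "-z"] assms(2) by (intro conv_integrable[OF assms(1)] smth_loc_int) (auto simp: kern_def)
      then show ?thesis by simp
    qed simp
    also have "(\<integral>y. \<kappa> (x - y) * \<mu> (y - z) \<partial>lborel) = (\<integral>y. \<kappa> (x - z - y) * \<mu> y \<partial>lborel)"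
      using integral_lborel_reflect[of "\<lambda>u. \<kappa> u * \<mu> (x - z - u)" x] integral_lborel_reflect[of "\<lambda>u. \<kappa> u * \<mu> (x - z - u)" "x - z"]
      by (simp add: algebra_simps)
    finally show "(\<integral>y. ?F y z \<partial>lborel) = conv \<kappa> \<mu> (x - z) *\<^sub>R f z" by (simp add: conv_def)
  qed
  finally show ?thesis .
qed

lemma conv_commute_kern:
  assumes "kern a \<kappa>" "kern b \<mu>" shows "conv \<kappa> \<mu> x = conv \<mu> \<kappa> x"
proof -
  have [measurable]: "\<kappa> \<in> borel_measurable borel" "\<mu> \<in> borel_measurable borel"
    using assms kern_measurable by blast+
  show ?thesis unfolding conv_def
    using integral_lborel_reflect[of "\<lambda>y. \<kappa> (x - y) * \<mu> y" x] by (simp add: mult.commute)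
qed

lemma conv_commute:
  assumes "kern a \<kappa>" "kern b \<mu>" "loc_int f"
  shows "conv \<kappa> (conv \<mu> f) x = conv \<mu> (conv \<kappa> f) x"
  by (simp add: conv_conv[OF assms] conv_conv[OF assms(2,1,3)] conv_commute_kern[OF assms(1,2)])

section \<open>The squared norm with values in \<open>ennreal\<close>, and approximation in it by
  mollification\<close>

abbreviation nrm2 :: "('a::euclidean_space \<Rightarrow> 'b::real_normed_vector) \<Rightarrow> ennreal" where
  "nrm2 f \<equiv> (\<integral>\<^sup>+x. ennreal ((norm (f x))\<^sup>2) \<partial>lborel)"

text \<open>Young's inequality with a free weight. The value 1 of \<open>\<tau>\<close> gives the
  crude factor 2, while small \<open>\<tau>\<close> keeps the first factor close to 1, as limits
  with a sharp constant require.\<close>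

lemma nrm2_add_le:
  fixes f g :: "'a::euclidean_space \<Rightarrow> 'b::euclidean_space"
  assumes [measurable]: "f \<in> borel_measurable borel" "g \<in> borel_measurable borel" and "\<tau> > 0"
  shows "nrm2 (\<lambda>x. f x + g x) \<le> ennreal (1 + \<tau>) * nrm2 f + ennreal (1 + 1/\<tau>) * nrm2 g"
proof -
  have *: "(norm (f x + g x))\<^sup>2 \<le> (1 + \<tau>) * (norm (f x))\<^sup>2 + (1 + 1/\<tau>) * (norm (g x))\<^sup>2" for x
  proof -
    have "(norm (f x + g x))\<^sup>2 \<le> (norm (f x) + norm (g x))\<^sup>2" by (intro power_mono norm_triangle_ineq) simp
    also have "\<dots> \<le> (1 + \<tau>) * (norm (f x))\<^sup>2 + (1 + 1/\<tau>) * (norm (g x))\<^sup>2"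
    proof -
      have "0 \<le> (\<tau> * norm (f x) - norm (g x))\<^sup>2 / \<tau>" using assms(3) by simp
      also have "\<dots> = \<tau> * (norm (f x))\<^sup>2 - 2 * norm (f x) * norm (g x) + (norm (g x))\<^sup>2 / \<tau>"
        using assms(3) by (simp add: power2_eq_square field_simps)
      finally show ?thesis by (simp add: power2_eq_square algebra_simps)
    qed
    finally show ?thesis .
  qed
  have "nrm2 (\<lambda>x. f x + g x) \<le> (\<integral>\<^sup>+x. ennreal (1 + \<tau>) * ennreal ((norm (f x))\<^sup>2) + ennreal (1 + 1/\<tau>) * ennreal ((norm (g x))\<^sup>2) \<partial>lborel)"
    using * assms(3) by (intro nn_integral_mono) (simp flip: ennreal_mult ennreal_plus)
  also have "\<dots> = ennreal (1 + \<tau>) * nrm2 f + ennreal (1 + 1/\<tau>) * nrm2 g"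
    by (simp add: nn_integral_add nn_integral_cmult)
  finally show ?thesis .
qed

lemma ennreal_lincomb:
  assumes "a \<ge> 0" "b \<ge> 0" "c \<ge> 0" "d \<ge> 0"
  shows "ennreal a * ennreal b + ennreal c * ennreal d = ennreal (a * b + c * d)"
  using assms by (simp add: ennreal_mult ennreal_plus)

text \<open>Truncation first makes \<open>f\<close> bounded with bounded support. A measurable
  function is almost everywhere a limit of continuous ones; clipping their values by
  \<open>cl\<close> and multiplying by the cut-off \<open>\<eta>\<close> keeps them continuous and
  yields a dominating function without disturbing the limit.\<close>

lemma nrm2_dense_continuous:
  fixes f :: "'a::euclidean_space \<Rightarrow> 'b::euclidean_space"
  assumes [measurable]: "f \<in> borel_measurable borel" and fin: "nrm2 f < \<infinity>" and "e > 0"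
  obtains g R where "continuous_on UNIV g" "\<And>x. norm x > R \<Longrightarrow> g x = 0" "nrm2 (\<lambda>x. f x - g x) < ennreal e"
proof -
  define h where "h k x = (if norm x \<le> real k \<and> norm (f x) \<le> real k then f x else 0)" for k x
  have [measurable]: "h k \<in> borel_measurable borel" for k unfolding h_def by measurable
  have "(\<lambda>k. nrm2 (\<lambda>x. f x - h k x)) \<longlonglongrightarrow> (\<integral>\<^sup>+x. 0 \<partial>(lborel :: 'a measure))"
  proof (rule nn_integral_dominated_convergence[where w="\<lambda>x. ennreal ((norm (f x))\<^sup>2)"])
    show "AE x in lborel. ennreal ((norm (f x - h j x))\<^sup>2) \<le> ennreal ((norm (f x))\<^sup>2)" for j
      by (auto simp: h_def)
    show "AE x in lborel. (\<lambda>i. ennreal ((norm (f x - h i x))\<^sup>2)) \<longlonglongrightarrow> 0"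
    proof (rule AE_I2)
      fix x
      obtain k where k: "norm x \<le> real k" "norm (f x) \<le> real k" 
        using real_arch_simple[of "max (norm x) (norm (f x))"] by auto
      have "\<forall>\<^sub>F i in sequentially. ennreal ((norm (f x - h i x))\<^sup>2) = 0"
        using eventually_ge_at_top[of k] by eventually_elim (use k in \<open>auto simp: h_def\<close>)
      then show "(\<lambda>i. ennreal ((norm (f x - h i x))\<^sup>2)) \<longlonglongrightarrow> 0" by (rule tendsto_eventually)
    qed
  qed (use fin in auto)
  then have "\<forall>\<^sub>F k in sequentially. nrm2 (\<lambda>x. f x - h k x) < ennreal (e/8)"
    using assms(3) by (intro order_tendstoD(2)[of _ "\<integral>\<^sup>+x. 0 \<partial>(lborel :: 'a measure)"]) auto
  then have "\<forall>\<^sub>F k in sequentially. nrm2 (\<lambda>x. f x - h k x) < ennreal (e/8) \<and> k \<ge> 1"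
    using eventually_ge_at_top[of 1] by eventually_elim auto
  then obtain k where k: "nrm2 (\<lambda>x. f x - h k x) < ennreal (e/8)" "k \<ge> 1"
    by (auto simp: eventually_sequentially)
  have "h k \<in> borel_measurable lebesgue" by (intro measurable_completion) simp
  then have "h k measurable_on UNIV" by (intro lebesgue_measurable_imp_measurable_on) auto
  then obtain N G where G: "negligible N" "\<And>n. continuous_on UNIV (G n)" "\<And>x. x \<notin> N \<Longrightarrow> (\<lambda>n. G n x) \<longlonglongrightarrow> h k x"
    unfolding measurable_on_def by auto
  define cl where "cl v = (real k / max (real k) (norm v)) *\<^sub>R v" for v :: 'b
  define \<eta> where "\<eta> x = max 0 (min 1 (real k + 1 - norm x))" for x :: 'a
  have cl_cont: "continuous_on UNIV cl" unfolding cl_def using k(2) by (intro continuous_intros) auto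
  have cl_le: "norm (cl v) \<le> real k" for v
    using k(2) by (auto simp: cl_def max_def field_simps)
  have cl_id: "norm v \<le> real k \<Longrightarrow> cl v = v" for v using k(2) by (auto simp: cl_def max_def)
  define g where "g n x = \<eta> x *\<^sub>R cl (G n x)" for n x
  have g_cont: "continuous_on UNIV (g n)" for n
    unfolding g_def \<eta>_def by (intro continuous_intros continuous_on_compose2[OF cl_cont G(2)]) auto
  have [measurable]: "g n \<in> borel_measurable borel" for n
    using g_cont by (rule borel_measurable_continuous_onI)
  have \<eta>: "0 \<le> \<eta> x" "\<eta> x \<le> 1" "norm x > real k + 1 \<Longrightarrow> \<eta> x = 0" "norm x \<le> real k \<Longrightarrow> \<eta> x = 1" for x
    by (auto simp: \<eta>_def)
  have hk: "norm (h k x) \<le> real k" "norm x > real k \<Longrightarrow> h k x = 0" for x by (auto simp: h_def)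
  have bnd: "norm (h k x - g n x) \<le> 2 * real k * indicator (cball 0 (real k + 1)) x" for n x
  proof (cases "norm x \<le> real k + 1")
    case True
    have "norm (g n x) \<le> 1 * real k"
      unfolding g_def norm_scaleR by (intro mult_mono cl_le) (use \<eta> in auto)
    then show ?thesis using norm_triangle_ineq4[of "h k x" "g n x"] hk(1)[of x] True by simp
  next
    case False
    then have "\<eta> x = 0" "h k x = 0" using \<eta>(3)[of x] hk(2)[of x] by auto
    then show ?thesis by (simp add: g_def)
  qed
  have "(\<lambda>n. nrm2 (\<lambda>x. h k x - g n x)) \<longlonglongrightarrow> (\<integral>\<^sup>+x. 0 \<partial>(lborel :: 'a measure))"
  proof (rule nn_integral_dominated_convergence[where w="\<lambda>x. ennreal ((2 * real k)\<^sup>2) * indicator (cball 0 (real k + 1)) x"])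
    show "AE x in lborel. ennreal ((norm (h k x - g j x))\<^sup>2) \<le> ennreal ((2 * real k)\<^sup>2) * indicator (cball 0 (real k + 1)) x" for j
    proof (rule AE_I2)
      fix x
      show "ennreal ((norm (h k x - g j x))\<^sup>2) \<le> ennreal ((2 * real k)\<^sup>2) * indicator (cball 0 (real k + 1)) x"
      proof (cases "x \<in> cball 0 (real k + 1)")
        case True
        then have "(norm (h k x - g j x))\<^sup>2 \<le> (2 * real k)\<^sup>2" using bnd[of x j] by (intro power_mono) auto
        then show ?thesis using True by (simp only: indicator_simps mult_1_right ennreal_leI)
      next
        case False
        then have "h k x - g j x = 0" using bnd[of x j] by simp
        then show ?thesis by simp
      qed
    qed
    show "(\<integral>\<^sup>+x. ennreal ((2 * real k)\<^sup>2) * indicator (cball 0 (real k + 1)) x \<partial>(lborel :: 'a measure)) < \<infinity>"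
      using emeasure_bounded_finite[OF bounded_cball, of "0::'a" "real k + 1"]
      by (subst nn_integral_cmult_indicator) (auto intro!: ennreal_mult_less_top[THEN iffD2] simp: less_top)
    have "AE x in lebesgue. x \<notin> N" using G(1) negligible_iff_null_sets AE_not_in by blast
    then have "AE x in lborel. x \<notin> N" by (simp add: AE_completion_iff)
    then show "AE x in lborel. (\<lambda>i. ennreal ((norm (h k x - g i x))\<^sup>2)) \<longlonglongrightarrow> 0"
    proof eventually_elim
      case (elim x)
      have "(\<lambda>i. cl (G i x)) \<longlonglongrightarrow> cl (h k x)"
        using cl_cont G(3)[OF elim] by (rule continuous_on_tendsto_compose) auto
      then have "(\<lambda>i. g i x) \<longlonglongrightarrow> \<eta> x *\<^sub>R cl (h k x)" unfolding g_def by (intro tendsto_intros)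
      also have "\<eta> x *\<^sub>R cl (h k x) = h k x"
        using cl_id[OF hk(1)] hk(2)[of x] \<eta>(4)[of x] cl_id[of 0] by (cases "norm x \<le> real k") auto
      finally have "(\<lambda>i. (norm (h k x - g i x))\<^sup>2) \<longlonglongrightarrow> (norm (h k x - h k x))\<^sup>2" by (intro tendsto_intros)
      then have "(\<lambda>i. ennreal ((norm (h k x - g i x))\<^sup>2)) \<longlonglongrightarrow> ennreal ((norm (h k x - h k x))\<^sup>2)" by (rule tendsto_ennrealI)
      then show ?case by simp
    qed
  qed auto
  then have "\<forall>\<^sub>F n in sequentially. nrm2 (\<lambda>x. h k x - g n x) < ennreal (e/8)"
    using assms(3) by (intro order_tendstoD(2)[of _ "\<integral>\<^sup>+x. 0 \<partial>(lborel :: 'a measure)"]) auto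
  then obtain n where n: "nrm2 (\<lambda>x. h k x - g n x) < ennreal (e/8)" by (auto simp: eventually_sequentially)
  have "nrm2 (\<lambda>x. f x - g n x) = nrm2 (\<lambda>x. (f x - h k x) + (h k x - g n x))" by simp
  also have "\<dots> \<le> ennreal (1+1) * nrm2 (\<lambda>x. f x - h k x) + ennreal (1 + 1/1) * nrm2 (\<lambda>x. h k x - g n x)"
    by (rule nrm2_add_le) auto
  also have "\<dots> \<le> ennreal (1+1) * ennreal (e/8) + ennreal (1+1/1) * ennreal (e/8)"
    using k(1) n by (intro add_mono mult_left_mono) auto
  also have "\<dots> = ennreal (e/2)" using assms(3) by (subst ennreal_lincomb) auto
  also have "\<dots> < ennreal e" using assms(3) by (simp add: ennreal_less_iff)
  finally show thesis using that[of "g n" "real k + 1"] g_cont \<eta>(3) by (simp add: g_def)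
qed

lemma nrm2_loc_int:
  fixes f :: "point \<Rightarrow> 'b::euclidean_space"
  assumes [measurable]: "f \<in> borel_measurable borel" and loc: "\<And>r. (\<integral>\<^sup>+x\<in>cball 0 r. ennreal ((norm (f x))\<^sup>2) \<partial>lborel) < \<infinity>"
  shows "loc_int f"
  unfolding loc_int_def
proof (intro conjI allI)
  fix r
  have "(\<integral>\<^sup>+x. ennreal (norm (indicat_real (cball 0 r) x *\<^sub>R f x)) \<partial>lborel) \<le> (\<integral>\<^sup>+x. indicator (cball 0 r) x + ennreal ((norm (f x))\<^sup>2) * indicator (cball 0 r) x \<partial>lborel)"
  proof (intro nn_integral_mono)
    fix x
    have "norm (f x) \<le> 1 + (norm (f x))\<^sup>2" 
    proof -
      have "0 \<le> (norm (f x) - 1)\<^sup>2" by simp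
      then have "2 * norm (f x) \<le> 1 + (norm (f x))\<^sup>2" by (simp add: power2_diff)
      then show ?thesis using norm_ge_zero[of "f x"] by linarith
    qed
    then have "ennreal (norm (f x)) \<le> ennreal 1 + ennreal ((norm (f x))\<^sup>2)"
      by (subst ennreal_plus[symmetric]) (simp_all only: ennreal_leI zero_le_one zero_le_power2)
    then show "ennreal (norm (indicat_real (cball 0 r) x *\<^sub>R f x)) \<le> indicator (cball 0 r) x + ennreal ((norm (f x))\<^sup>2) * indicator (cball 0 r) x"
      by (cases "x \<in> cball 0 r") auto
  qed
  also have "\<dots> = emeasure lborel (cball (0::point) r) + (\<integral>\<^sup>+x\<in>cball 0 r. ennreal ((norm (f x))\<^sup>2) \<partial>lborel)"
    by (subst nn_integral_add) simp_all
  also have "\<dots> < \<infinity>" using loc[of r] emeasure_bounded_finite[OF bounded_cball, of "0::point" r] by simp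
  finally show "integrable lborel (\<lambda>x. indicat_real (cball 0 r) x *\<^sub>R f x)"
    by (intro integrableI_bounded) auto
qed simp

lemma nrm2_finite_loc_int:
  fixes f :: "point \<Rightarrow> 'b::euclidean_space"
  assumes "f \<in> borel_measurable borel" "nrm2 f < \<infinity>" shows "loc_int f"
proof (rule nrm2_loc_int[OF assms(1)])
  fix r
  have "(\<integral>\<^sup>+x\<in>cball 0 r. ennreal ((norm (f x))\<^sup>2) \<partial>lborel) \<le> nrm2 f"
    by (intro nn_integral_mono) (auto simp: indicator_def)
  then show "(\<integral>\<^sup>+x\<in>cball 0 r. ennreal ((norm (f x))\<^sup>2) \<partial>lborel) < \<infinity>" using assms(2) by order
qed

lemma conv_diff:
  assumes "kern \<epsilon> \<kappa>" "loc_int f" "loc_int g"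
  shows "conv \<kappa> (\<lambda>x. f x - g x) x = conv \<kappa> f x - conv \<kappa> g x"
  unfolding conv_def using conv_integrable[OF assms(1,2), of x] conv_integrable[OF assms(1,3), of x]
  by (simp add: scaleR_diff_right)

lemma nrm2_conv_le:
  assumes "prob_kern \<epsilon> \<rho>" "loc_int f" shows "nrm2 (conv \<rho> f) \<le> nrm2 f"
  using nn_integral_conv_le[OF assms, of UNIV UNIV] by simp

text \<open>Convolution contracts the norm, so it suffices to treat a continuous compactly supported
  approximation, where uniform continuity gives a bound that is the same for all kernels of small
  radius.\<close>

lemma nrm2_conv_tendsto:
  fixes f :: "point \<Rightarrow> 'b::euclidean_space"
  assumes [measurable]: "f \<in> borel_measurable borel" and fin: "nrm2 f < \<infinity>" and "e > 0"
  obtains \<delta> where "\<delta> > 0" "\<And>\<epsilon> \<rho>. prob_kern \<epsilon> \<rho> \<Longrightarrow> \<epsilon> \<le> \<delta> \<Longrightarrow> nrm2 (\<lambda>x. conv \<rho> f x - f x) \<le> ennreal e"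
proof -
  have lf: "loc_int f" using assms nrm2_finite_loc_int by blast
  obtain g R where g: "continuous_on UNIV g" "\<And>x. norm x > R \<Longrightarrow> g x = 0" "nrm2 (\<lambda>x. f x - g x) < ennreal (e/12)"
    using nrm2_dense_continuous[OF assms(1,2), of "e/12"] assms(3) by auto
  have lg: "loc_int g" using g(1) by (rule loc_int_continuous)
  have [measurable]: "g \<in> borel_measurable borel" using g(1) by (rule borel_measurable_continuous_onI)
  define V where "V = measure lborel (cball (0::point) (\<bar>R\<bar>+1))"
  have "V \<ge> 0" by (simp add: V_def)
  \<comment> \<open>A pointwise error \<open>s\<close> on a ball of volume \<open>V\<close> then
    costs at most \<open>e/12\<close>. The three errors of this size stay below \<open>e\<close>
    after the factors 2 of \<open>nrm2_add_le\<close>.\<close>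
  define s where "s = sqrt (e / (12 * (V + 1)))"
  have s: "s > 0" "s\<^sup>2 * V \<le> e/12"
  proof -
    show "s > 0" using assms(3) \<open>V \<ge> 0\<close> by (simp add: s_def)
    have "s\<^sup>2 * V = e/12 * (V / (V+1))" using assms(3) \<open>V \<ge> 0\<close> by (simp add: s_def)
    also have "\<dots> \<le> e/12 * 1" using assms(3) \<open>V \<ge> 0\<close> by (intro mult_left_mono) auto
    finally show "s\<^sup>2 * V \<le> e/12" by simp
  qed
  have "uniformly_continuous_on (cball 0 (\<bar>R\<bar> + 2)) g"
    by (rule compact_uniformly_continuous[OF continuous_on_subset[OF g(1)]]) auto
  then obtain d where d: "d > 0" "\<And>x y. x \<in> cball 0 (\<bar>R\<bar>+2) \<Longrightarrow> y \<in> cball 0 (\<bar>R\<bar>+2) \<Longrightarrow> dist x y < d \<Longrightarrow> dist (g x) (g y) < s"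
    unfolding uniformly_continuous_on_def using s(1) by metis
  have main: "nrm2 (\<lambda>x. conv \<rho> f x - f x) \<le> ennreal e" if pk: "prob_kern \<epsilon> \<rho>" and "\<epsilon> \<le> min (d/2) 1" for \<epsilon> \<rho>
  proof -
    have k: "kern \<epsilon> \<rho>" using pk by (simp add: prob_kern_def)
    have [measurable]: "conv \<rho> f \<in> borel_measurable borel" "conv \<rho> g \<in> borel_measurable borel"
      using smth_conv[OF k] lf lg smth_measurable by auto
    have 1: "norm (conv \<rho> g x - g x) \<le> s * indicator (cball 0 (\<bar>R\<bar>+1)) x" for x
    proof (cases "norm x \<le> \<bar>R\<bar> + 1")
      case True
      have "norm (conv \<rho> g x - g x) \<le> s"
      proof (rule conv_approx[OF pk lg])
        fix y assume y: "norm (x - y) \<le> \<epsilon>"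
        have "norm y \<le> \<bar>R\<bar> + 2" using norm_triangle_ineq2[of y x] y True that(2) by (simp add: norm_minus_commute)
        then have "dist (g y) (g x) < s"
          using True y that(2) d(1) by (intro d(2)) (auto simp: dist_norm norm_minus_commute mem_cball_0 simp del: mem_cball)
        then show "norm (g y - g x) \<le> s" by (simp add: dist_norm)
      qed
      then show ?thesis using True by simp
    next
      case False
      have "norm (conv \<rho> g x - 0) \<le> 0"
      proof (rule conv_approx[OF pk lg])
        fix y assume y: "norm (x - y) \<le> \<epsilon>"
        have "norm y > R" using norm_triangle_ineq2[of x y] y False that(2) by (simp; linarith)
        then show "norm (g y - 0) \<le> 0" using g(2) by simp
      qed
      then show ?thesis using False g(2)[of x] by simp
    qed
    have gg: "nrm2 (\<lambda>x. conv \<rho> g x - g x) \<le> ennreal (e/12)"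
    proof -
      have "ennreal ((norm (conv \<rho> g x - g x))\<^sup>2) \<le> ennreal (s\<^sup>2) * indicator (cball 0 (\<bar>R\<bar>+1)) x" for x
      proof -
        have "(norm (conv \<rho> g x - g x))\<^sup>2 \<le> (s * indicator (cball 0 (\<bar>R\<bar>+1)) x)\<^sup>2"
          by (intro power_mono 1) simp
        then have "ennreal ((norm (conv \<rho> g x - g x))\<^sup>2) \<le> ennreal ((s * indicator (cball 0 (\<bar>R\<bar>+1)) x)\<^sup>2)" by (rule ennreal_leI)
        then show ?thesis by (cases "x \<in> cball 0 (\<bar>R\<bar>+1)") auto
      qed
      note * = this
      have "nrm2 (\<lambda>x. conv \<rho> g x - g x) \<le> (\<integral>\<^sup>+x. ennreal (s\<^sup>2) * indicator (cball 0 (\<bar>R\<bar>+1)) x \<partial>(lborel :: point measure))"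
        by (intro nn_integral_mono *)
      also have "\<dots> = ennreal (s\<^sup>2) * ennreal V"
        using emeasure_bounded_finite[OF bounded_cball, of "0::point" "\<bar>R\<bar>+1"]
        by (simp add: nn_integral_cmult_indicator V_def emeasure_eq_ennreal_measure less_top)
      also have "\<dots> \<le> ennreal (e/12)" using s(2) \<open>V \<ge> 0\<close> by (simp flip: ennreal_mult add: ennreal_leI)
      finally show ?thesis .
    qed
    have "nrm2 (\<lambda>x. conv \<rho> f x - conv \<rho> g x) = nrm2 (conv \<rho> (\<lambda>x. f x - g x))"
      by (simp add: conv_diff[OF k lf lg])
    also have "\<dots> \<le> nrm2 (\<lambda>x. f x - g x)"
    proof (rule nrm2_conv_le[OF pk])
      show "loc_int (\<lambda>x. f x - g x)" by (rule nrm2_finite_loc_int) (use g(3) in \<open>auto intro: order.strict_trans\<close>)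
    qed
    finally have ff: "nrm2 (\<lambda>x. conv \<rho> f x - conv \<rho> g x) \<le> ennreal (e/12)" using g(3) by order
    have gf: "nrm2 (\<lambda>x. g x - f x) \<le> ennreal (e/12)" using g(3) by (simp add: norm_minus_commute)
    have 2: "nrm2 (\<lambda>x. (conv \<rho> f x - conv \<rho> g x) + (conv \<rho> g x - g x)) \<le> ennreal (1+1) * ennreal (e/12) + ennreal (1+1/1) * ennreal (e/12)"
      by (rule order_trans[OF nrm2_add_le[where \<tau>=1] add_mono[OF mult_left_mono[OF ff] mult_left_mono[OF gg]]]) auto
    also have "\<dots> = ennreal (e/3)" using assms(3) by (subst ennreal_lincomb) auto
    finally have 2: "nrm2 (\<lambda>x. conv \<rho> f x - g x) \<le> ennreal (e/3)" by simp
    have "nrm2 (\<lambda>x. (conv \<rho> f x - g x) + (g x - f x)) \<le> ennreal (1+1) * ennreal (e/3) + ennreal (1+1/1) * ennreal (e/12)"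
      by (rule order_trans[OF nrm2_add_le[where \<tau>=1] add_mono[OF mult_left_mono[OF 2] mult_left_mono[OF gf]]]) auto
    also have "\<dots> \<le> ennreal e" using assms(3) by (subst ennreal_lincomb) (auto intro!: ennreal_leI)
    finally show ?thesis by simp
  qed
  show thesis by (rule that[of "min (d/2) 1"]) (use d(1) main in auto)
qed

section \<open>Dirac matrices and energy inequalities\<close>

text \<open>The numeral 4 of type \<open>4\<close> is 0, so the enumeration 1, 2, 3, 4 of the index
  type is rewritten to the indices 0, 1, 2, 3 used by the matrices.\<close>

lemma UNIV4: "(UNIV :: 4 set) = {0, 1, 2, 3}"
proof -
  have "(4::4) = 0" by simp
  then show ?thesis unfolding UNIV_4 by auto
qed

lemma sum4: "(\<Sum>i\<in>(UNIV :: 4 set). f i) = f 0 + f 1 + f 2 + (f 3 :: 'a::comm_monoid_add)"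
proof -
  have "(0::4) \<noteq> 1 \<and> (0::4) \<noteq> 2 \<and> (0::4) \<noteq> 3 \<and> (1::4) \<noteq> 2 \<and> (1::4) \<noteq> 3 \<and> (2::4) \<noteq> 3" by simp
  then show ?thesis unfolding UNIV4 by (simp add: add.assoc)
qed

lemma all4: "(\<forall>i::4. P i) \<longleftrightarrow> P 0 \<and> P 1 \<and> P 2 \<and> P 3"
  using UNIV4 by (metis UNIV_I empty_iff insert_iff)

lemma alpha_entries:
  "dirac_alpha 1 *v v = (\<chi> i. if i = 0 then v $ 3 else if i = 1 then v $ 2 else if i = 2 then v $ 1 else v $ 0)"
  "dirac_alpha 2 *v v = (\<chi> i. if i = 0 then - \<i> * v $ 3 else if i = 1 then \<i> * v $ 2 else if i = 2 then - \<i> * v $ 1 else \<i> * v $ 0)"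
  "dirac_alpha 3 *v v = (\<chi> i. if i = 0 then v $ 2 else if i = 1 then - v $ 3 else if i = 2 then v $ 0 else - v $ 1)"
  by (simp_all add: vec_eq_iff all4 matrix_vector_mult_def sum4 dirac_alpha_def pauli_def upper_idx_def sub_idx_def)

lemma beta_entries: "dirac_beta *v v = (\<chi> i. if i = 0 \<or> i = 1 then v $ i else - v $ i)"
  by (simp_all add: vec_eq_iff all4 matrix_vector_mult_def sum4 dirac_beta_def upper_idx_def)

definition J :: "3 \<Rightarrow> spinor \<Rightarrow> spinor" where "J k v = (- \<i>) *s (dirac_alpha k *v v)"
definition Bt :: "spinor \<Rightarrow> spinor" where "Bt v = dirac_beta *v v"
definition AL :: "point \<Rightarrow> spinor \<Rightarrow> spinor" where "AL a v = alpha_dot a *v v"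

lemma scaleR_vec_mult: "(r *\<^sub>R (M::mat4)) *v v = r *\<^sub>R (M *v v)" "M *v (r *\<^sub>R v) = r *\<^sub>R (M *v (v::spinor))"
  by (auto simp: vec_eq_iff matrix_vector_mult_def scaleR_sum_right algebra_simps)

lemma bounded_linear_matvec: "bounded_linear (\<lambda>v::spinor. (M::mat4) *v v)"
  by (intro linear_linear[THEN iffD2] linearI) (auto simp: matrix_vector_right_distrib scaleR_vec_mult)

lemma bounded_linear_Bt: "bounded_linear Bt" unfolding Bt_def by (rule bounded_linear_matvec)
lemma bounded_linear_AL: "bounded_linear (AL a)" unfolding AL_def by (rule bounded_linear_matvec)
lemma bounded_linear_J: "bounded_linear (J k)"
  unfolding J_def
  by (intro linear_linear[THEN iffD2] linearI)
    (auto simp: matrix_vector_right_distrib scaleR_vec_mult vec_eq_iff algebra_simps)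

lemma AL_sum: "AL a v = (\<Sum>k\<in>UNIV. a $ k *\<^sub>R (dirac_alpha k *v v))"
  unfolding AL_def alpha_dot_def sum_3 by (simp add: matrix_vector_mult_add_rdistrib scaleR_vec_mult)

lemmas spinor_simps = vec_eq_iff all4 inner_vec_def sum4 alpha_entries beta_entries inner_complex_def

lemma J_skew: "J k u \<bullet> v = - (u \<bullet> J k v)"
  using exhaust_3[of k] by (elim disjE) (simp_all add: J_def spinor_simps algebra_simps)

lemma J_anticomm: "j \<noteq> k \<Longrightarrow> J j (J k v) = - J k (J j v)"
  using exhaust_3[of k] exhaust_3[of j] by (elim disjE) (simp_all add: J_def spinor_simps algebra_simps)

lemma J_square: "J k (J k v) = - v"
  using exhaust_3[of k] by (elim disjE) (simp_all add: J_def spinor_simps algebra_simps)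

lemma Bt_sym: "Bt u \<bullet> v = u \<bullet> Bt v"
  by (simp add: Bt_def spinor_simps)

lemma Bt_Bt: "Bt (Bt v) = v"
  by (simp add: Bt_def spinor_simps)

lemma Bt_J: "Bt (J k v) = - J k (Bt v)"
  using exhaust_3[of k] by (elim disjE) (simp_all add: J_def Bt_def spinor_simps algebra_simps)

lemma AL_sym: "AL a u \<bullet> v = u \<bullet> AL a v"
  unfolding AL_sum sum_3 by (simp add: spinor_simps algebra_simps)

lemma Bt_AL: "Bt (AL a v) = - AL a (Bt v)"
  unfolding AL_sum sum_3 Bt_def by (simp add: spinor_simps algebra_simps)

lemma norm_J [simp]: "norm (J k v) = norm v"
  by (simp add: norm_eq_sqrt_inner J_skew J_square)

lemma norm_Bt [simp]: "norm (Bt v) = norm v"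
  by (simp add: norm_eq_sqrt_inner Bt_sym Bt_Bt)

lemma J_self: "J k v \<bullet> v = 0"
  using J_skew[of k v v] by (simp add: inner_commute)

lemma J_self': "v \<bullet> J k v = 0"
  using J_self[of k v] by (simp add: inner_commute)

lemma J_orth: "j \<noteq> k \<Longrightarrow> J j v \<bullet> J k v = 0"
  using J_skew[of j v "J k v"] J_skew[of k v "J j v"] J_anticomm[of j k v] by (simp add: inner_commute)

text \<open>Pythagoras: for the real inner product, \<open>v\<close> and the three vectors
  \<open>J k v\<close> are pairwise orthogonal and have the same norm.\<close>

lemma norm_gradient_term:
  "(norm (l *\<^sub>R v + (\<Sum>k\<in>UNIV. c k *\<^sub>R J k v)))\<^sup>2 = (l\<^sup>2 + (\<Sum>k\<in>UNIV. (c k)\<^sup>2)) * (norm v)\<^sup>2"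
  unfolding power2_norm_eq_inner
  by (simp add: sum_3 inner_add_left inner_add_right J_orth J_self J_self')
     (simp add: J_skew J_square power2_eq_square algebra_simps)

text \<open>Up to the factor \<open>\<i>\<close>, which preserves norms, \<open>AL a v\<close> is
  the combination of the vectors \<open>J k v\<close> with coefficients \<open>a\<close>.\<close>

lemma norm_AL: "norm (AL a v) = norm a * norm v"
proof -
  have "AL a v = (\<Sum>k\<in>UNIV. a $ k *\<^sub>R (\<i> *s J k v))"
    by (simp add: AL_sum J_def vec_eq_iff algebra_simps)
  also have "\<dots> = \<i> *s (0 *\<^sub>R v + (\<Sum>k\<in>UNIV. a $ k *\<^sub>R J k v))"
    by (simp add: sum_3 vec_eq_iff algebra_simps)
  finally have "norm (AL a v) = norm (0 *\<^sub>R v + (\<Sum>k\<in>UNIV. a $ k *\<^sub>R J k v))"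
    by (simp add: norm_vec_def norm_mult)
  then have "(norm (AL a v))\<^sup>2 = (norm a)\<^sup>2 * (norm v)\<^sup>2"
    using norm_gradient_term[of 0 v "\<lambda>k. a $ k"]
    by (simp add: power2_norm_eq_inner[of a] inner_vec_def) (simp add: power2_eq_square)
  then show ?thesis by (simp add: power_mult_distrib[symmetric] power2_eq_iff_nonneg)
qed

lemma inner_spinor: "u \<bullet> v = Re (sp_inner u v)"
  by (simp add: sp_inner_def inner_vec_def inner_complex_def Re_sum)

lemma hermitian_sym:
  assumes "hermitian4 M" shows "((M::mat4) *v u) \<bullet> v = u \<bullet> (M *v v)"
proof -
  have "sp_inner (M *v u) v = sp_inner u (M *v v)"
  proof -
    have "sp_inner (M *v u) v = (\<Sum>j\<in>UNIV. \<Sum>i\<in>UNIV. cnj (M $ j $ i) * cnj (u $ i) * v $ j)"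
      by (simp add: sp_inner_def matrix_vector_mult_def sum_distrib_right)
    also have "\<dots> = (\<Sum>i\<in>UNIV. \<Sum>j\<in>UNIV. cnj (M $ j $ i) * cnj (u $ i) * v $ j)" by (rule sum.swap)
    also have "\<dots> = (\<Sum>i\<in>UNIV. \<Sum>j\<in>UNIV. cnj (u $ i) * (M $ i $ j * v $ j))"
      using assms unfolding hermitian4_def by (intro sum.cong refl) (metis complex_cnj_cnj mult.assoc mult.commute)
    also have "\<dots> = sp_inner u (M *v v)"
      by (simp add: sp_inner_def matrix_vector_mult_def sum_distrib_left)
    finally show ?thesis .
  qed
  then show ?thesis by (simp add: inner_spinor)
qed

lemma mat_norm_le: "norm ((M::mat4) *v v) \<le> mat_norm M * norm v"
  unfolding mat_norm_def by (rule onorm[OF bounded_linear_matvec])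

section \<open>Energy inequalities for smooth compactly supported spinors\<close>

definition Jd :: "(point \<Rightarrow> spinor) \<Rightarrow> point \<Rightarrow> spinor" where
  "Jd f x = (\<Sum>k\<in>UNIV. J k (pdiff k f x))"

lemma dirac_expr_eq: "dirac_expr A V \<psi> x = Jd \<psi> x + Bt (\<psi> x) + (AL (A x) (\<psi> x) + V x *v \<psi> x)"
  by (simp add: dirac_expr_def Jd_def J_def Bt_def AL_def matrix_vector_mult_add_rdistrib)

text \<open>Made for pointwise identities that hold up to terms of integral zero. Integrability of
  \<open>f\<close> comes out of the inequality: an infinite right-hand side is trivial, and
  otherwise \<open>f\<close> is dominated by \<open>g - w\<close>.\<close>

lemma nn_integral_le_add_divergence:
  fixes f g w :: "point \<Rightarrow> real"
  assumes [measurable]: "f \<in> borel_measurable borel" "g \<in> borel_measurable borel" "integrable lborel w"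
    and w: "integral\<^sup>L lborel w = 0" and f: "\<And>x. 0 \<le> f x" and g: "\<And>x. 0 \<le> g x" and le: "\<And>x. f x + w x \<le> g x"
  shows "(\<integral>\<^sup>+x. ennreal (f x) \<partial>lborel) \<le> (\<integral>\<^sup>+x. ennreal (g x) \<partial>lborel)"
proof (cases "(\<integral>\<^sup>+x. ennreal (g x) \<partial>lborel) = \<infinity>")
  case False
  then have ig: "integrable lborel g" using g by (intro integrableI_nonneg) (auto simp: less_top)
  have "integrable lborel (\<lambda>x. g x - w x)" using ig assms(3) by simp
  then have fi: "integrable lborel f"
  proof (rule Bochner_Integration.integrable_bound)
    show "AE x in lborel. norm (f x) \<le> norm (g x - w x)"
    proof (rule AE_I2)
      show "norm (f x) \<le> norm (g x - w x)" for x using f[of x] le[of x] by simp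
    qed
  qed simp
  have "integral\<^sup>L lborel f \<le> integral\<^sup>L lborel (\<lambda>x. g x - w x)"
  proof (rule integral_mono[OF fi])
    show "f x \<le> g x - w x" for x using le[of x] by simp
  qed (use ig assms(3) in simp)
  also have "\<dots> = integral\<^sup>L lborel g" using w ig assms(3) by simp
  finally show ?thesis
    using nn_integral_eq_integral[OF fi] nn_integral_eq_integral[OF ig] f g by (simp add: ennreal_leI)
qed simp

lemma kern_pd: "kern R u \<Longrightarrow> has_pd k u (pdiff k u x) x"
  unfolding kern_def using smth_has_pd by blast

lemma kern_linear: "bounded_linear h \<Longrightarrow> kern R f \<Longrightarrow> kern R (\<lambda>x. h (f x))"
  unfolding kern_def using smth_linear[of UNIV h f] linear_0[of h] by (auto simp: bounded_linear.linear)

lemma kern_inner: "kern R f \<Longrightarrow> kern R g \<Longrightarrow> kern R (\<lambda>x. f x \<bullet> g x)"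
  unfolding kern_def using smth_inner[of UNIV f g] by auto

lemma kern_sum: "(\<And>i. i \<in> I \<Longrightarrow> kern R (f i)) \<Longrightarrow> kern R (\<lambda>x. \<Sum>i\<in>I. f i x)"
  unfolding kern_def using smth_sum[of UNIV I f] by auto

lemma kern_Jd: "kern R u \<Longrightarrow> kern R (Jd u)"
  unfolding Jd_def[abs_def] by (intro kern_sum kern_linear[OF bounded_linear_J] kern_pdiff)

lemma AL_bilinear: "AL (a + b) v = AL a v + AL b v" "AL (r *\<^sub>R a) v = r *\<^sub>R AL a v"
  "AL a (v + w) = AL a v + AL a w" "AL a (r *\<^sub>R v) = r *\<^sub>R AL a v"
  unfolding AL_sum sum_3
  by (simp_all add: matrix_vector_right_distrib scaleR_vec_mult algebra_simps)

lemma bounded_bilinear_AL: "bounded_bilinear AL"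
  by (rule bounded_bilinear.intro) (auto simp: AL_bilinear norm_AL intro!: exI[of _ 1])

lemma AL_measurable[measurable (raw)]:
  assumes "a \<in> borel_measurable M" "f \<in> borel_measurable M"
  shows "(\<lambda>x. AL (a x) (f x)) \<in> borel_measurable M"
  by (rule borel_measurable_continuous_Pair[OF assms])
    (intro bounded_bilinear.continuous_on[OF bounded_bilinear_AL] continuous_on_fst continuous_on_snd continuous_on_id)

lemma linear_measurable[measurable (raw)]:
  assumes "f \<in> borel_measurable M"
  shows "(\<lambda>x. Bt (f x)) \<in> borel_measurable M" "(\<lambda>x. J k (f x)) \<in> borel_measurable M"
  using borel_measurable_continuous_onI[OF linear_continuous_on[OF bounded_linear_Bt]] 
     borel_measurable_continuous_onI[OF linear_continuous_on[OF bounded_linear_J]] assms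
  by (auto intro: measurable_compose)

text \<open>Since \<open>Bt\<close> anticommutes with the symmetric operator \<open>Jd + AL a\<close>, the cross term in
  the square of the Dirac operator is a divergence.\<close>

lemma dirac_lower_bound:
  assumes u: "kern R u" and [measurable]: "a \<in> borel_measurable borel"
  shows "nrm2 u \<le> nrm2 (\<lambda>x. Jd u x + Bt (u x) + AL (a x) (u x))"
proof -
  let ?w = "\<lambda>x. \<Sum>k\<in>UNIV. pdiff k (\<lambda>x. J k (u x) \<bullet> Bt (u x)) x"
  have k: "kern R (\<lambda>x. J k (u x) \<bullet> Bt (u x))" for k
    by (intro kern_inner kern_linear[OF bounded_linear_J] kern_linear[OF bounded_linear_Bt] u)
  have pdk: "pdiff k (\<lambda>x. J k (u x) \<bullet> Bt (u x)) x = 2 * (J k (pdiff k u x) \<bullet> Bt (u x))" for k x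
  proof -
    have "has_pd k (\<lambda>x. J k (u x) \<bullet> Bt (u x)) (J k (u x) \<bullet> Bt (pdiff k u x) + J k (pdiff k u x) \<bullet> Bt (u x)) x"
      by (intro has_pd_bilinear[OF bounded_bilinear_inner] has_pd_linear[OF bounded_linear_J] has_pd_linear[OF bounded_linear_Bt] kern_pd[OF u])
    then have "pdiff k (\<lambda>x. J k (u x) \<bullet> Bt (u x)) x = J k (u x) \<bullet> Bt (pdiff k u x) + J k (pdiff k u x) \<bullet> Bt (u x)"
      by (rule has_pd_imp_pdiff)
    also have "J k (u x) \<bullet> Bt (pdiff k u x) = J k (pdiff k u x) \<bullet> Bt (u x)"
      using J_skew[of k "Bt (u x)" "pdiff k u x"] Bt_sym[of "J k (u x)" "pdiff k u x"] Bt_J[of k "u x"]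
      by (simp add: inner_commute)
    finally show ?thesis by simp
  qed
  have [measurable]: "u \<in> borel_measurable borel" "Jd u \<in> borel_measurable borel"
    using u kern_measurable kern_Jd by blast+
  \<comment> \<open>The magnetic term is orthogonal to \<open>Bt v\<close> at every point, so no
    derivative of \<open>a\<close> appears and the inequality is blind to its size.\<close>
  have AB: "AL a v \<bullet> Bt v = 0" for a v
    using AL_sym[of a v "Bt v"] Bt_AL[of a v] Bt_sym[of v "AL a v"] by (simp add: inner_commute)
  show ?thesis
  proof (rule nn_integral_le_add_divergence[where w="?w"])
    show "integrable lborel ?w"
      by (intro Bochner_Integration.integrable_sum kern_integrable[OF kern_pdiff[OF k]])
    show "integral\<^sup>L lborel ?w = 0"
      by (subst Bochner_Integration.integral_sum) (auto intro: kern_integrable[OF kern_pdiff[OF k]] simp: integral_pdiff[OF k])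
    fix x
    let ?T = "Jd u x + AL (a x) (u x)"
    have "?w x = 2 * (?T \<bullet> Bt (u x))"
      unfolding pdk by (simp add: Jd_def inner_sum_left inner_add_left AB sum_distrib_left)
    \<comment> \<open>Expansion of the square: \<open>Bt\<close> is an isometry and the cross term
      is \<open>?w x\<close>. Dropping the square of \<open>?T\<close> gives the inequality
      needed.\<close>
    then have "(norm (u x))\<^sup>2 + ?w x + (norm ?T)\<^sup>2 = (norm (?T + Bt (u x)))\<^sup>2"
      using Bt_sym[of "u x" "Bt (u x)"] by (simp add: Bt_Bt power2_norm_eq_inner inner_add_left inner_add_right inner_commute)
    then show "(norm (u x))\<^sup>2 + ?w x \<le> (norm (Jd u x + Bt (u x) + AL (a x) (u x)))\<^sup>2"
    proof -
      assume *: "(norm (u x))\<^sup>2 + ?w x + (norm ?T)\<^sup>2 = (norm (?T + Bt (u x)))\<^sup>2"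
      have eq: "Jd u x + Bt (u x) + AL (a x) (u x) = ?T + Bt (u x)" by simp
      show ?thesis unfolding eq *[symmetric] using zero_le_power2[of "norm ?T"] by linarith
    qed
  qed auto
qed

text \<open>For distinct \<open>j\<close> and \<open>k\<close> the map \<open>J j (J k v)\<close> is
  skew in \<open>v\<close>, and second partial derivatives commute, so each mixed term in the square
  of \<open>Jd u\<close> is half a difference of two divergences. Only the sum of the squares of the
  partial derivatives survives integration.\<close>

lemma gradient_bound:
  assumes u: "kern R u"
  shows "nrm2 (pdiff j u) \<le> nrm2 (Jd u)"
proof -
  have ku: "kern R (pdiff k u)" for k by (rule kern_pdiff[OF u])
  have cross: "(\<integral>x. J j (pdiff j u x) \<bullet> J k (pdiff k u x) \<partial>lborel) = 0" if "j \<noteq> k" for j k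
  proof -
    let ?K = "\<lambda>v. J j (J k v)"
    have K: "bounded_linear ?K" by (rule bounded_linear_compose[OF bounded_linear_J bounded_linear_J])
    have sk: "?K p \<bullet> q = - (p \<bullet> ?K q)" for p q by (simp add: J_skew J_anticomm[OF that])
    let ?f = "\<lambda>x. pdiff j u x \<bullet> ?K (u x)" and ?g = "\<lambda>x. pdiff k u x \<bullet> ?K (u x)"
    have kf: "kern R ?f" "kern R ?g" by (intro kern_inner ku kern_linear[OF K] u)+
    have f: "pdiff k ?f x = pdiff j u x \<bullet> ?K (pdiff k u x) + pdiff k (pdiff j u) x \<bullet> ?K (u x)" for x
      by (rule has_pd_imp_pdiff) (intro has_pd_bilinear[OF bounded_bilinear_inner] has_pd_linear[OF K] kern_pd[OF u] kern_pd[OF ku])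
    have g: "pdiff j ?g x = pdiff k u x \<bullet> ?K (pdiff j u x) + pdiff j (pdiff k u) x \<bullet> ?K (u x)" for x
      by (rule has_pd_imp_pdiff) (intro has_pd_bilinear[OF bounded_bilinear_inner] has_pd_linear[OF K] kern_pd[OF u] kern_pd[OF ku])
    have c: "pdiff j (pdiff k u) x = pdiff k (pdiff j u) x" for x
      by (rule pdiff_commute[of UNIV]) (use u in \<open>auto simp: kern_def\<close>)
    have "J j (pdiff j u x) \<bullet> J k (pdiff k u x) = (pdiff j ?g x - pdiff k ?f x) / 2" for x
    proof -
      have "pdiff j ?g x - pdiff k ?f x = pdiff k u x \<bullet> ?K (pdiff j u x) - pdiff j u x \<bullet> ?K (pdiff k u x)"
        unfolding f g c by simp
      also have "pdiff k u x \<bullet> ?K (pdiff j u x) = - (pdiff j u x \<bullet> ?K (pdiff k u x))"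
        using sk[of "pdiff j u x" "pdiff k u x"] by (simp add: inner_commute)
      finally show ?thesis by (simp add: J_skew)
    qed
    then have "(\<integral>x. J j (pdiff j u x) \<bullet> J k (pdiff k u x) \<partial>lborel) = (\<integral>x. (pdiff j ?g x - pdiff k ?f x) / 2 \<partial>lborel)" by (simp only:)
    also have "\<dots> = 0"
      using kern_integrable[OF kern_pdiff[OF kf(1)]] kern_integrable[OF kern_pdiff[OF kf(2)]]
      by (simp add: integral_pdiff[OF kf(1)] integral_pdiff[OF kf(2)])
    finally show ?thesis .
  qed
  have ik: "integrable lborel (\<lambda>x. J i (pdiff i u x) \<bullet> J k (pdiff k u x))" for i k
    by (intro kern_integrable[of R] kern_inner kern_linear[OF bounded_linear_J] ku)
  let ?w = "\<lambda>x. \<Sum>i\<in>UNIV. \<Sum>k\<in>UNIV - {i}. J i (pdiff i u x) \<bullet> J k (pdiff k u x)"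
  have [measurable]: "pdiff k u \<in> borel_measurable borel" "Jd u \<in> borel_measurable borel" for k
    using ku u kern_measurable kern_Jd by blast+
  show ?thesis
  proof (rule nn_integral_le_add_divergence[where w="?w"])
    show "integrable lborel ?w" by (intro Bochner_Integration.integrable_sum ik)
    have "integral\<^sup>L lborel ?w = (\<Sum>i\<in>UNIV. \<Sum>k\<in>UNIV - {i}. \<integral>x. J i (pdiff i u x) \<bullet> J k (pdiff k u x) \<partial>lborel)"
      by (simp add: Bochner_Integration.integral_sum Bochner_Integration.integrable_sum ik)
    also have "\<dots> = 0" using cross by (intro sum.neutral ballI) auto
    finally show "integral\<^sup>L lborel ?w = 0" .
    fix x
    have "(norm (Jd u x))\<^sup>2 = (\<Sum>i\<in>UNIV. \<Sum>k\<in>UNIV. J i (pdiff i u x) \<bullet> J k (pdiff k u x))"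
      unfolding power2_norm_eq_inner Jd_def by (simp add: inner_sum_left inner_sum_right) (rule sum.swap)
    also have "\<dots> = (\<Sum>i\<in>UNIV. (norm (pdiff i u x))\<^sup>2 + (\<Sum>k\<in>UNIV - {i}. J i (pdiff i u x) \<bullet> J k (pdiff k u x)))"
    proof (intro sum.cong refl)
      show "(\<Sum>k\<in>UNIV. J i (pdiff i u x) \<bullet> J k (pdiff k u x)) = (norm (pdiff i u x))\<^sup>2 + (\<Sum>k\<in>UNIV - {i}. J i (pdiff i u x) \<bullet> J k (pdiff k u x))" for i
        using sum.remove[of UNIV i "\<lambda>k. J i (pdiff i u x) \<bullet> J k (pdiff k u x)"] by (simp add: power2_norm_eq_inner[symmetric])
    qed
    also have "\<dots> = (\<Sum>i\<in>UNIV. (norm (pdiff i u x))\<^sup>2) + ?w x" by (rule sum.distrib)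
    finally show "(norm (pdiff j u x))\<^sup>2 + ?w x \<le> (norm (Jd u x))\<^sup>2"
      using member_le_sum[of j UNIV "\<lambda>i. (norm (pdiff i u x))\<^sup>2"] by simp
  qed auto
qed

section \<open>Weak solutions away from the origin\<close>

definition weak_sol :: "real \<Rightarrow> (point \<Rightarrow> spinor) \<Rightarrow> (point \<Rightarrow> spinor) \<Rightarrow> bool" where
  "weak_sol r \<phi> g \<longleftrightarrow> (\<forall>\<psi>. (\<exists>R. kern R \<psi>) \<and> (\<forall>y. norm y \<le> r \<longrightarrow> \<psi> y = 0) \<longrightarrow>
     (\<integral>y. Jd \<psi> y \<bullet> \<phi> y \<partial>lborel) = (\<integral>y. \<psi> y \<bullet> g y \<partial>lborel))"

lemma loc_int_scaleR:
  fixes f :: "point \<Rightarrow> 'b::euclidean_space"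
  assumes "loc_int f" "continuous_on UNIV \<zeta>" shows "loc_int (\<lambda>x. \<zeta> x *\<^sub>R f x)"
  unfolding loc_int_def
proof (intro conjI allI)
  have [measurable]: "f \<in> borel_measurable borel" "\<zeta> \<in> borel_measurable borel"
    using assms borel_measurable_continuous_onI by (auto simp: loc_int_def)
  show "(\<lambda>x. \<zeta> x *\<^sub>R f x) \<in> borel_measurable borel" by measurable
  fix r
  have "compact (\<zeta> ` cball 0 r)"
    by (rule compact_continuous_image[OF continuous_on_subset[OF assms(2)]]) auto
  then obtain B where B: "\<And>x. x \<in> cball 0 r \<Longrightarrow> norm (\<zeta> x) \<le> B" "B > 0"
    using compact_imp_bounded bounded_pos by (metis imageI)
  show "integrable lborel (\<lambda>x. indicat_real (cball 0 r) x *\<^sub>R \<zeta> x *\<^sub>R f x)"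
  proof (rule loc_int_bound_integrable(1)[OF assms(1), where B=B and r=r])
    show "norm (indicat_real (cball 0 r) y *\<^sub>R \<zeta> y *\<^sub>R f y) \<le> B * norm (f y)" for y
      using B by (cases "y \<in> cball 0 r") (auto intro: mult_right_mono)
  qed auto
qed

lemma loc_int_add: "loc_int f \<Longrightarrow> loc_int g \<Longrightarrow> loc_int (\<lambda>x. f x + g x)"
  by (auto simp: loc_int_def scaleR_add_right)

lemma loc_int_linear:
  fixes h :: "'a::euclidean_space \<Rightarrow> 'b::euclidean_space"
  assumes "bounded_linear h" "loc_int f" shows "loc_int (\<lambda>x. h (f x))"
  unfolding loc_int_def
proof (intro conjI allI)
  show "(\<lambda>x. h (f x)) \<in> borel_measurable borel"
    using assms borel_measurable_continuous_onI[OF linear_continuous_on[OF assms(1)]]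
    by (auto simp: loc_int_def intro: measurable_compose)
  show "integrable lborel (\<lambda>x. indicat_real (cball 0 r) x *\<^sub>R h (f x))" for r
    using integrable_bounded_linear[OF assms(1), of lborel "\<lambda>x. indicat_real (cball 0 r) x *\<^sub>R f x"] assms
    by (simp add: loc_int_def linear_scale[OF bounded_linear.linear[OF assms(1)]])
qed

lemma loc_int_sum: "(\<And>i. i \<in> I \<Longrightarrow> loc_int (f i)) \<Longrightarrow> loc_int (\<lambda>x. \<Sum>i\<in>I. f i x)"
  by (induction I rule: infinite_finite_induct) (auto intro: loc_int_const loc_int_add)

lemma conv_inner:
  assumes "kern \<epsilon> \<kappa>" "loc_int f"
  shows "conv \<kappa> f x \<bullet> e = (\<integral>y. \<kappa> (x - y) * (f y \<bullet> e) \<partial>lborel)" "integrable lborel (\<lambda>y. \<kappa> (x - y) * (f y \<bullet> e))"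
proof -
  have "integrable lborel (\<lambda>y. \<kappa> (x - y) *\<^sub>R f y \<bullet> e)"
    using conv_integrable[OF assms, of x] by (rule integrable_inner_left)
  then show "integrable lborel (\<lambda>y. \<kappa> (x - y) * (f y \<bullet> e))" by simp
  show "conv \<kappa> f x \<bullet> e = (\<integral>y. \<kappa> (x - y) * (f y \<bullet> e) \<partial>lborel)"
    unfolding conv_def using conv_integrable[OF assms, of x] by (subst integral_inner_left[symmetric]) auto
qed

text \<open>The equation is tested with \<open>\<kappa> (x - y) * \<zeta> y\<close> times a fixed
  spinor \<open>e\<close>. Derivatives falling on the kernel give \<open>Jd\<close> of the
  mollification, those falling on \<open>\<zeta>\<close> give the gradient term. What has to vanish
  near the origin is the product of kernel and cut-off: in the decay estimate the cut-off does so,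
  in the regularity part the kernel.\<close>

lemma weak_sol_conv:
  assumes weak: "weak_sol r \<phi> g" and l\<phi>: "loc_int \<phi>" and lg: "loc_int g"
    and \<kappa>: "kern \<epsilon> \<kappa>" and \<zeta>: "smth UNIV \<zeta>" and sup: "\<And>y. norm y \<le> r \<Longrightarrow> \<kappa> (x - y) * \<zeta> y = 0"
  shows "Jd (conv \<kappa> (\<lambda>y. \<zeta> y *\<^sub>R \<phi> y)) x = conv \<kappa> (\<lambda>y. \<zeta> y *\<^sub>R g y + (\<Sum>k\<in>UNIV. pdiff k \<zeta> y *\<^sub>R J k (\<phi> y))) x"
    (is "Jd (conv \<kappa> ?u) x = conv \<kappa> ?h x")
proof (rule vector_eq_rdot[THEN iffD1], rule allI)
  fix e :: spinor
  have sk: "smth UNIV \<kappa>" using \<kappa> by (simp add: kern_def)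
  have lu: "loc_int ?u" using l\<phi> smth_continuous[OF \<zeta>] by (rule loc_int_scaleR)
  have lh: "loc_int ?h"
    by (intro loc_int_add loc_int_sum loc_int_scaleR lg loc_int_linear[OF bounded_linear_J] l\<phi> smth_continuous smth_pdiff \<zeta>)
  define \<psi> where "\<psi> y = (\<kappa> (x - y) * \<zeta> y) *\<^sub>R e" for y
  have k\<psi>: "kern (norm x + \<epsilon>) \<psi>"
  proof -
    have "smth UNIV \<psi>" unfolding \<psi>_def
      by (rule smth_scaleR[OF open_UNIV smth_mult[OF open_UNIV smth_reflect[OF sk] \<zeta>] smth_const])
    moreover have "\<psi> y = 0" if "norm y > norm x + \<epsilon>" for y
      using norm_ge_reflect[OF that] \<kappa> by (simp add: \<psi>_def kern_def)
    ultimately show ?thesis by (simp add: kern_def)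
  qed
  have pd\<psi>: "pdiff k \<psi> y = (\<kappa> (x - y) * pdiff k \<zeta> y - pdiff k \<kappa> (x - y) * \<zeta> y) *\<^sub>R e" for k y
  proof (rule has_pd_imp_pdiff)
    have "has_pd k (\<lambda>y. \<kappa> (x - y) * \<zeta> y) (\<kappa> (x - y) * pdiff k \<zeta> y + (- pdiff k \<kappa> (x - y)) * \<zeta> y) y"
      by (intro has_pd_bilinear[OF bounded_bilinear_mult] has_pd_reflect kern_pd[OF \<kappa>] smth_has_pd[OF \<zeta>]) simp
    then have "has_pd k \<psi> ((\<kappa> (x - y) * pdiff k \<zeta> y + (- pdiff k \<kappa> (x - y)) * \<zeta> y) *\<^sub>R e) y"
      unfolding \<psi>_def by (rule has_pd_linear[OF bounded_linear_scaleR_left])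
    then show "has_pd k \<psi> ((\<kappa> (x - y) * pdiff k \<zeta> y - pdiff k \<kappa> (x - y) * \<zeta> y) *\<^sub>R e) y" by simp
  qed
  let ?P1 = "\<lambda>y. \<Sum>k\<in>UNIV. pdiff k \<kappa> (x - y) * (\<zeta> y *\<^sub>R J k (\<phi> y) \<bullet> e)"
  let ?P2 = "\<lambda>y. \<kappa> (x - y) * (?h y \<bullet> e)"
  let ?P3 = "\<lambda>y. \<kappa> (x - y) * (\<zeta> y *\<^sub>R g y \<bullet> e)"
  have lJ: "loc_int (\<lambda>y. \<zeta> y *\<^sub>R J k (\<phi> y))" for k
    by (intro loc_int_scaleR loc_int_linear[OF bounded_linear_J] l\<phi> smth_continuous \<zeta>)
  have i1: "integrable lborel (\<lambda>y. pdiff k \<kappa> (x - y) * (\<zeta> y *\<^sub>R J k (\<phi> y) \<bullet> e))" for k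
    by (rule conv_inner(2)[OF kern_pdiff[OF \<kappa>] lJ])
  have i2: "integrable lborel ?P2" by (rule conv_inner(2)[OF \<kappa> lh])
  have i3: "integrable lborel ?P3" 
    by (rule conv_inner(2)[OF \<kappa>]) (intro loc_int_scaleR lg smth_continuous \<zeta>)
  have Jd\<psi>: "Jd \<psi> y \<bullet> \<phi> y = ?P1 y - (?P2 y - ?P3 y)" for y
  proof -
    have "Jd \<psi> y \<bullet> \<phi> y = (\<Sum>k\<in>UNIV. (\<kappa> (x - y) * pdiff k \<zeta> y - pdiff k \<kappa> (x - y) * \<zeta> y) * - (J k (\<phi> y) \<bullet> e))"
      unfolding Jd_def inner_sum_left pd\<psi> linear_scale[OF bounded_linear.linear[OF bounded_linear_J]]
    proof (intro sum.cong refl)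
      fix k
      have "J k e \<bullet> \<phi> y = - (J k (\<phi> y) \<bullet> e)" using J_skew[of k e "\<phi> y"] by (simp add: inner_commute)
      then show "(\<kappa> (x - y) * pdiff k \<zeta> y - pdiff k \<kappa> (x - y) * \<zeta> y) *\<^sub>R J k e \<bullet> \<phi> y =
          (\<kappa> (x - y) * pdiff k \<zeta> y - pdiff k \<kappa> (x - y) * \<zeta> y) * - (J k (\<phi> y) \<bullet> e)" by simp
    qed
    also have "\<dots> = ?P1 y - (?P2 y - ?P3 y)"
      by (simp add: inner_add_left inner_sum_left sum_3 algebra_simps)
    finally show ?thesis .
  qed
  have "\<psi> y \<bullet> g y = ?P3 y" for y by (simp add: \<psi>_def inner_commute mult_ac)
  moreover have "(\<integral>y. Jd \<psi> y \<bullet> \<phi> y \<partial>lborel) = (\<integral>y. \<psi> y \<bullet> g y \<partial>lborel)"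
    using weak k\<psi> sup unfolding weak_sol_def by (auto simp: \<psi>_def)
  ultimately have "(\<integral>y. ?P1 y - (?P2 y - ?P3 y) \<partial>lborel) = (\<integral>y. ?P3 y \<partial>lborel)"
    unfolding Jd\<psi> by simp
  moreover have "(\<integral>y. ?P1 y - (?P2 y - ?P3 y) \<partial>lborel) = (\<integral>y. ?P1 y \<partial>lborel) - ((\<integral>y. ?P2 y \<partial>lborel) - (\<integral>y. ?P3 y \<partial>lborel))"
    by (simp only: Bochner_Integration.integral_diff Bochner_Integration.integrable_diff Bochner_Integration.integrable_sum i1 i2 i3)
  ultimately have "(\<integral>y. ?P1 y \<partial>lborel) = (\<integral>y. ?P2 y \<partial>lborel)" by linarith
  moreover have "Jd (conv \<kappa> ?u) x \<bullet> e = (\<integral>y. ?P1 y \<partial>lborel)"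
  proof -
    have "Jd (conv \<kappa> ?u) x \<bullet> e = (\<Sum>k\<in>UNIV. - (conv (pdiff k \<kappa>) ?u x \<bullet> J k e))"
      unfolding Jd_def inner_sum_left pdiff_conv[OF \<kappa> lu] J_skew ..
    also have "\<dots> = (\<Sum>k\<in>UNIV. (\<integral>y. pdiff k \<kappa> (x - y) * (\<zeta> y *\<^sub>R J k (\<phi> y) \<bullet> e) \<partial>lborel))"
      unfolding conv_inner(1)[OF kern_pdiff[OF \<kappa>] lu] integral_minus[symmetric]
      by (simp add: J_skew)
    also have "\<dots> = (\<integral>y. ?P1 y \<partial>lborel)" 
      by (rule Bochner_Integration.integral_sum[symmetric]) (rule i1)
    finally show ?thesis .
  qed
  ultimately show "Jd (conv \<kappa> ?u) x \<bullet> e = conv \<kappa> ?h x \<bullet> e" by (simp add: conv_inner(1)[OF \<kappa> lh])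
qed

lemma nrm2_le_limit:
  fixes f :: "'a::euclidean_space \<Rightarrow> 'b::euclidean_space" and v :: "'a \<Rightarrow> 'c::euclidean_space"
  assumes [measurable]: "f \<in> borel_measurable borel" "v \<in> borel_measurable borel"
    and approx: "\<And>e. e > 0 \<Longrightarrow> \<exists>f' v'. f' \<in> borel_measurable borel \<and> v' \<in> borel_measurable borel \<and>
      nrm2 (\<lambda>x. f' x - f x) \<le> ennreal e \<and> nrm2 (\<lambda>x. v' x - v x) \<le> ennreal e \<and> nrm2 f' \<le> nrm2 v'"
  shows "nrm2 f \<le> nrm2 v"
proof (cases "nrm2 v = \<infinity>")
  case False
  define V where "V = enn2real (nrm2 v)"
  have V: "nrm2 v = ennreal V" "V \<ge> 0" using False by (auto simp: V_def less_top)
  have key: "nrm2 f \<le> ennreal (V + \<tau> * (3 * V + 2))" if t: "0 < \<tau>" "\<tau> \<le> 1" for \<tau>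
  proof -
    \<comment> \<open>Quadratic in \<open>\<tau>\<close>, because \<open>nrm2_add_le\<close>
      multiplies the error by \<open>1 + 1/\<tau>\<close>; what remains is of order
      \<open>\<tau>\<close> and tends to 0.\<close>
    define e where "e = \<tau>\<^sup>2 / 4"
    have e: "e > 0" using t by (simp add: e_def)
    obtain f' v' where [measurable]: "f' \<in> borel_measurable borel" "v' \<in> borel_measurable borel"
      and a: "nrm2 (\<lambda>x. f' x - f x) \<le> ennreal e" "nrm2 (\<lambda>x. v' x - v x) \<le> ennreal e" "nrm2 f' \<le> nrm2 v'"
      using approx[OF e] by blast
    have "nrm2 v' = nrm2 (\<lambda>x. v x + (v' x - v x))" by simp
    also have "\<dots> \<le> ennreal (1 + \<tau>) * nrm2 v + ennreal (1 + 1/\<tau>) * nrm2 (\<lambda>x. v' x - v x)"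
      by (rule nrm2_add_le) (use t in auto)
    also have "\<dots> \<le> ennreal (1 + \<tau>) * ennreal V + ennreal (1 + 1/\<tau>) * ennreal e"
      unfolding V(1) by (intro add_mono mult_left_mono a) auto
    also have "\<dots> = ennreal ((1 + \<tau>) * V + (1 + 1/\<tau>) * e)" using t e V by (subst ennreal_lincomb) auto
    finally have v': "nrm2 v' \<le> ennreal ((1 + \<tau>) * V + (1 + 1/\<tau>) * e)" .
    have "nrm2 f = nrm2 (\<lambda>x. f' x + (f x - f' x))" by simp
    also have "\<dots> \<le> ennreal (1 + \<tau>) * nrm2 f' + ennreal (1 + 1/\<tau>) * nrm2 (\<lambda>x. f x - f' x)"
      by (rule nrm2_add_le) (use t in auto)
    also have "\<dots> \<le> ennreal (1 + \<tau>) * ennreal ((1 + \<tau>) * V + (1 + 1/\<tau>) * e) + ennreal (1 + 1/\<tau>) * ennreal e"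
      using a(1) by (intro add_mono mult_left_mono order_trans[OF a(3) v']) (auto simp: norm_minus_commute)
    also have "\<dots> = ennreal ((1 + \<tau>) * ((1 + \<tau>) * V + (1 + 1/\<tau>) * e) + (1 + 1/\<tau>) * e)" 
      using t e V by (subst ennreal_lincomb) auto
    also have "\<dots> \<le> ennreal (V + \<tau> * (3 * V + 2))"
    proof (rule ennreal_leI)
      have "(1 + \<tau>) * ((1 + \<tau>) * V + (1 + 1/\<tau>) * e) + (1 + 1/\<tau>) * e = V + \<tau> * (2 * V + \<tau> * V + (\<tau> + 1) * (2 + \<tau>) / 4)"
        using t by (simp add: e_def power2_eq_square field_simps)
      also have "\<dots> \<le> V + \<tau> * (3 * V + 2)"
      proof -
        have "\<tau> * V \<le> V" using t V by (simp add: mult_left_le_one_le)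
        moreover have "(\<tau> + 1) * (2 + \<tau>) \<le> 2 * 3" using t by (intro mult_mono) auto
        ultimately show ?thesis using t by (intro add_left_mono mult_left_mono) auto
      qed
      finally show "(1 + \<tau>) * ((1 + \<tau>) * V + (1 + 1/\<tau>) * e) + (1 + 1/\<tau>) * e \<le> V + \<tau> * (3 * V + 2)" .
    qed
    finally show ?thesis .
  qed
  have eps: "nrm2 f \<le> ennreal V + ennreal e" if "e > 0" for e :: real
  proof -
    define \<tau> where "\<tau> = min 1 (e / (3 * V + 2))"
    have \<tau>: "0 < \<tau>" "\<tau> \<le> 1" using that V by (auto simp: \<tau>_def)
    have "\<tau> * (3 * V + 2) \<le> e"
      using V mult_right_mono[of \<tau> "e / (3 * V + 2)" "3 * V + 2"] by (simp add: \<tau>_def)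
    then have "nrm2 f \<le> ennreal (V + e)" using key[OF \<tau>] by (meson add_left_mono ennreal_leI order_trans)
    then show ?thesis using V that by simp
  qed
  show ?thesis unfolding V(1) by (rule ennreal_le_epsilon) (rule eps)
qed auto

text \<open>The smooth inequality is applied to mollifications of \<open>u\<close>, whose image
  under \<open>Jd\<close> is the mollification of \<open>h\<close>. The bound \<open>M\<close> makes
  the magnetic terms converge but does not appear in the result, so it may depend on the potential
  and on the support of \<open>u\<close>.\<close>

lemma dirac_lower_bound_weak:
  assumes [measurable]: "u \<in> borel_measurable borel" "h \<in> borel_measurable borel" "a \<in> borel_measurable borel"
    and uf: "nrm2 u < \<infinity>" and hf: "nrm2 h < \<infinity>" and sup: "\<And>x. norm x > R \<Longrightarrow> u x = 0"
    and a: "\<And>x. norm (a x) \<le> M"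
    and weak: "\<And>\<kappa> x. kern 1 \<kappa> \<Longrightarrow> Jd (conv \<kappa> u) x = conv \<kappa> h x"
  shows "nrm2 u \<le> nrm2 (\<lambda>x. h x + Bt (u x) + AL (a x) (u x))"
proof (rule nrm2_le_limit)
  fix e :: real assume "e > 0"
  \<comment> \<open>The errors in \<open>h\<close> and in the \<open>Bt\<close> and
    \<open>AL\<close> terms pass at most twice through \<open>nrm2_add_le\<close> with factor 2, and
    the \<open>AL\<close> error carries the square of \<open>M\<close>; the denominator 6 (1 + M^2)
    covers their sum.\<close>
  define e' where "e' = e / (6 * (1 + M\<^sup>2))"
  have M: "M \<ge> 0" using a[of 0] norm_ge_zero order_trans by blast
  have pos: "1 + M\<^sup>2 > 0" by (simp add: add_pos_nonneg)
  have e': "e' > 0" "e' \<le> e" "2 * e' + 2 * (2 * e' + 2 * (M\<^sup>2 * e')) \<le> e"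
  proof -
    show "e' > 0" using \<open>e > 0\<close> pos by (simp add: e'_def)
    define c where "c = 6 * (1 + M\<^sup>2)"
    have "e' * c = e" using pos by (simp add: e'_def flip: c_def) (simp add: c_def)
    then have "e = 6 * e' * (1 + M\<^sup>2)" by (simp add: c_def algebra_simps)
    then show "e' \<le> e" "2 * e' + 2 * (2 * e' + 2 * (M\<^sup>2 * e')) \<le> e"
      using \<open>e' > 0\<close> mult_nonneg_nonneg[of e' "M\<^sup>2"] by (auto simp: algebra_simps)
  qed
  obtain d1 where d1: "d1 > 0" "\<And>\<epsilon> \<rho>. prob_kern \<epsilon> \<rho> \<Longrightarrow> \<epsilon> \<le> d1 \<Longrightarrow> nrm2 (\<lambda>x. conv \<rho> u x - u x) \<le> ennreal e'"
    using nrm2_conv_tendsto[of u e'] uf e' by auto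
  obtain d2 where d2: "d2 > 0" "\<And>\<epsilon> \<rho>. prob_kern \<epsilon> \<rho> \<Longrightarrow> \<epsilon> \<le> d2 \<Longrightarrow> nrm2 (\<lambda>x. conv \<rho> h x - h x) \<le> ennreal e'"
    using nrm2_conv_tendsto[of h e'] hf e' by auto
  define d where "d = min (min d1 d2) 1"
  have "d > 0" using d1 d2 by (simp add: d_def)
  let ?\<rho> = "moll d"
  have pk: "prob_kern d ?\<rho>" using \<open>d > 0\<close> by (rule prob_kern_moll)
  then have k: "kern 1 ?\<rho>" unfolding prob_kern_def by (auto intro: kern_mono simp: d_def)
  have lu: "loc_int u" "loc_int h" using nrm2_finite_loc_int[of u] nrm2_finite_loc_int[of h] uf hf by auto
  have sm: "smth UNIV (conv ?\<rho> u)" "smth UNIV (conv ?\<rho> h)" using smth_conv[OF k] lu by auto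
  have [measurable]: "conv ?\<rho> u \<in> borel_measurable borel" "conv ?\<rho> h \<in> borel_measurable borel"
    using sm smth_measurable by auto
  have ku: "kern (R + 1) (conv ?\<rho> u)"
    unfolding kern_def
  proof (intro conjI allI impI sm)
    fix z :: point assume z: "norm z > R + 1"
    have "conv ?\<rho> u z = conv ?\<rho> (\<lambda>_. 0) z"
    proof (rule conv_cong[OF k])
      fix y assume "norm (z - y) \<le> 1"
      then show "u y = 0" using z norm_triangle_ineq2[of z y] by (intro sup) simp
    qed
    then show "conv ?\<rho> u z = 0" by (simp add: conv_def)
  qed
  have eu: "nrm2 (\<lambda>x. conv ?\<rho> u x - u x) \<le> ennreal e'" using d1(2)[OF pk] by (simp add: d_def)
  have eh: "nrm2 (\<lambda>x. conv ?\<rho> h x - h x) \<le> ennreal e'" using d2(2)[OF pk] by (simp add: d_def)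
  let ?v = "\<lambda>x. conv ?\<rho> h x + Bt (conv ?\<rho> u x) + AL (a x) (conv ?\<rho> u x)"
  have B: "nrm2 (\<lambda>x. Bt (conv ?\<rho> u x - u x)) \<le> ennreal e'" using eu by simp
  have A: "nrm2 (\<lambda>x. AL (a x) (conv ?\<rho> u x - u x)) \<le> ennreal (M\<^sup>2 * e')"
  proof -
    have "nrm2 (\<lambda>x. AL (a x) (conv ?\<rho> u x - u x)) \<le> (\<integral>\<^sup>+x. ennreal (M\<^sup>2) * ennreal ((norm (conv ?\<rho> u x - u x))\<^sup>2) \<partial>lborel)"
      using a by (intro nn_integral_mono)
        (auto simp: norm_AL power_mult_distrib simp flip: ennreal_mult intro!: ennreal_leI mult_right_mono power_mono)
    also have "\<dots> \<le> ennreal (M\<^sup>2) * ennreal e'"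
      using eu by (subst nn_integral_cmult) (auto intro: mult_left_mono)
    finally show ?thesis using e'(1) by (simp add: ennreal_mult)
  qed
  have AB: "nrm2 (\<lambda>x. Bt (conv ?\<rho> u x - u x) + AL (a x) (conv ?\<rho> u x - u x)) \<le> ennreal (1+1) * ennreal e' + ennreal (1+1/1) * ennreal (M\<^sup>2 * e')"
    by (rule order_trans[OF nrm2_add_le[where \<tau>=1] add_mono[OF mult_left_mono[OF B] mult_left_mono[OF A]]]) auto
  also have "\<dots> = ennreal (2 * e' + 2 * (M\<^sup>2 * e'))" using e'(1) by (subst ennreal_lincomb) auto
  finally have AB: "nrm2 (\<lambda>x. Bt (conv ?\<rho> u x - u x) + AL (a x) (conv ?\<rho> u x - u x)) \<le> ennreal (2 * e' + 2 * (M\<^sup>2 * e'))" .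
  have "nrm2 (\<lambda>x. (conv ?\<rho> h x - h x) + (Bt (conv ?\<rho> u x - u x) + AL (a x) (conv ?\<rho> u x - u x))) \<le> ennreal (1+1) * ennreal e' + ennreal (1+1/1) * ennreal (2 * e' + 2 * (M\<^sup>2 * e'))"
    by (rule order_trans[OF nrm2_add_le[where \<tau>=1] add_mono[OF mult_left_mono[OF eh] mult_left_mono[OF AB]]]) auto
  also have "\<dots> = ennreal (2 * e' + 2 * (2 * e' + 2 * (M\<^sup>2 * e')))"
    using e'(1) by (subst ennreal_lincomb) (auto simp del: ennreal_plus)
  also have "\<dots> \<le> ennreal e" by (rule ennreal_leI[OF e'(3)])
  finally have V: "nrm2 (\<lambda>x. ?v x - (h x + Bt (u x) + AL (a x) (u x))) \<le> ennreal e"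
    by (simp add: linear_diff[OF bounded_linear.linear[OF bounded_linear_Bt]] linear_diff[OF bounded_linear.linear[OF bounded_linear_AL]] algebra_simps)
  have "nrm2 (conv ?\<rho> u) \<le> nrm2 ?v"
    using dirac_lower_bound[OF ku, of a] weak[OF k] by simp
  then show "\<exists>f' v'. f' \<in> borel_measurable borel \<and> v' \<in> borel_measurable borel \<and>
      nrm2 (\<lambda>x. f' x - u x) \<le> ennreal e \<and> nrm2 (\<lambda>x. v' x - (h x + Bt (u x) + AL (a x) (u x))) \<le> ennreal e \<and> nrm2 f' \<le> nrm2 v'"
    using V eu e'(2) by (intro exI[of _ "conv ?\<rho> u"] exI[of _ ?v]) (auto intro: order_trans ennreal_leI)
qed measurable

section \<open>Exponential decay in the mean\<close>

text \<open>The hypotheses speak of Lebesgue measurable functions, while convolution and Fubini's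
  theorem are used over \<open>lborel\<close> with Borel functions. The representative is built
  coordinate by coordinate.\<close>

lemma ex_borel_representative:
  fixes f :: "point \<Rightarrow> 'b::euclidean_space"
  assumes "f \<in> borel_measurable lebesgue"
  obtains f' where "f' \<in> borel_measurable borel" "AE x in lborel. f x = f' x"
proof -
  have "\<exists>h. h \<in> borel_measurable lborel \<and> (AE x in lborel. f x \<bullet> b = h x)" for b
    using completion_ex_borel_measurable_real[of "\<lambda>x. f x \<bullet> b" lborel] assms by auto
  then obtain h where h: "\<And>b. h b \<in> borel_measurable lborel" "\<And>b. AE x in lborel. f x \<bullet> b = h b x" by metis
  define f' where "f' x = (\<Sum>b\<in>Basis. h b x *\<^sub>R b)" for x
  have [measurable]: "h b \<in> borel_measurable borel" for b using h(1) by simp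
  have "AE x in lborel. \<forall>b\<in>Basis. f x \<bullet> b = h b x"
    using h(2) by (intro AE_finite_allI) auto
  then have "AE x in lborel. f x = f' x"
  proof eventually_elim
    case (elim x)
    have "f x = (\<Sum>b\<in>Basis. (f x \<bullet> b) *\<^sub>R b)" by (simp add: euclidean_representation)
    then show ?case unfolding f'_def using elim by (simp cong: sum.cong)
  qed
  moreover have "f' \<in> borel_measurable borel" unfolding f'_def by measurable
  ultimately show thesis using that by blast
qed

lemma norm_sp_inner_le: "norm (sp_inner u v) \<le> 4 * ((norm u)\<^sup>2 + (norm v)\<^sup>2)"
proof -
  have "norm (sp_inner u v) \<le> (\<Sum>j\<in>(UNIV::4 set). (norm u)\<^sup>2 + (norm v)\<^sup>2)"
    unfolding sp_inner_def
  proof (rule order_trans[OF norm_sum sum_mono])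
    fix j
    have "norm (cnj (u $ j) * v $ j) \<le> norm u * norm v"
      by (auto simp: norm_mult intro!: mult_mono Finite_Cartesian_Product.norm_nth_le)
    also have "\<dots> \<le> (norm u)\<^sup>2 + (norm v)\<^sup>2"
    proof -
      have "0 \<le> norm u * norm v" by simp
      moreover have "2 * norm u * norm v = 2 * (norm u * norm v)" by simp
      ultimately show ?thesis using sum_squares_bound[of "norm u" "norm v"] by linarith
    qed
    finally show "norm (cnj (u $ j) * v $ j) \<le> (norm u)\<^sup>2 + (norm v)\<^sup>2" .
  qed
  then show ?thesis by simp
qed

lemma L2_inner:
  assumes "L2 f" "L2 g"
  shows "integrable lebesgue (\<lambda>x. f x \<bullet> g x)" "Re (l2_inner f g) = (\<integral>x. f x \<bullet> g x \<partial>lebesgue)"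
proof -
  have [measurable]: "f \<in> borel_measurable lebesgue" "g \<in> borel_measurable lebesgue" using assms by (auto simp: L2_def)
  have m: "(\<lambda>x. sp_inner (f x) (g x)) \<in> borel_measurable lebesgue"
    unfolding sp_inner_def
    by (rule borel_measurable_continuous_Pair) (auto intro!: continuous_intros)
  have "integrable lebesgue (\<lambda>x. 4 * ((norm (f x))\<^sup>2 + (norm (g x))\<^sup>2))"
    using assms by (auto simp: L2_def)
  then have i: "integrable lebesgue (\<lambda>x. sp_inner (f x) (g x))"
    by (rule Bochner_Integration.integrable_bound[OF _ m]) (use norm_sp_inner_le in \<open>auto intro: order_trans[OF _ abs_ge_self]\<close>)
  show "integrable lebesgue (\<lambda>x. f x \<bullet> g x)" unfolding inner_spinor using i by (rule integrable_Re)
  show "Re (l2_inner f g) = (\<integral>x. f x \<bullet> g x \<partial>lebesgue)"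
    unfolding inner_spinor l2_inner_def using i by (rule integral_Re[symmetric])
qed

lemma kern_test_fun:
  assumes "kern R \<psi>" shows "test_fun \<psi>"
proof -
  have "{x. \<psi> x \<noteq> 0} \<subseteq> cball 0 R" using assms by (auto simp: kern_def not_less[symmetric])
  then have "bounded (csupp \<psi>)" unfolding csupp_def using bounded_closure bounded_subset bounded_cball by metis
  then have "compact (csupp \<psi>)" by (simp add: compact_eq_bounded_closed csupp_def)
  then show ?thesis using assms smth_imp_smooth_on[of UNIV \<psi>] by (simp add: test_fun_def kern_def)
qed

lemma bounded_bilinear_matvec: "bounded_bilinear (\<lambda>(M::mat4) (v::spinor). M *v v)"
proof -
  have "bilinear (\<lambda>(M::mat4) (v::spinor). M *v v)"
    unfolding bilinear_def
    by (intro conjI allI linearI) (auto simp: matrix_vector_mult_add_rdistrib matrix_vector_right_distrib scaleR_vec_mult)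
  then show ?thesis by (simp add: bilinear_conv_bounded_bilinear)
qed

lemma matvec_measurable[measurable (raw)]:
  assumes "V \<in> borel_measurable M" "f \<in> borel_measurable M"
  shows "(\<lambda>x. (V x :: mat4) *v (f x :: spinor)) \<in> borel_measurable M"
  by (rule borel_measurable_continuous_Pair[OF assms])
    (intro bounded_bilinear.continuous_on[OF bounded_bilinear_matvec] continuous_on_fst continuous_on_snd continuous_on_id)

text \<open>The test function lies in the domain, so symmetry moves the operator onto it, where it
  is an explicit differential expression. The zero-order terms are then moved back pointwise, the
  potential by hermiticity away from the origin. The real part of the inner product carries all
  this.\<close>

lemma eigvec_weak:
  assumes ext: "distinguished_ext A V Ddom Dop" and eig: "normalized_eigvec Ddom Dop lam \<phi>"
    and V: "\<And>x. x \<noteq> 0 \<Longrightarrow> hermitian4 (V x)"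
    and [measurable]: "\<phi>' \<in> borel_measurable borel" "A' \<in> borel_measurable borel" "V' \<in> borel_measurable borel"
    and ae: "AE x in lborel. \<phi> x = \<phi>' x" "AE x in lborel. A x = A' x" "AE x in lborel. V x = V' x"
    and l\<phi>: "loc_int \<phi>'" and \<psi>: "kern R \<psi>"
  shows "(\<integral>y. Jd \<psi> y \<bullet> \<phi>' y \<partial>lborel) = (\<integral>y. \<psi> y \<bullet> (lam *\<^sub>R \<phi>' y - Bt (\<phi>' y) - AL (A' y) (\<phi>' y) - V' y *v \<phi>' y) \<partial>lborel)"
proof -
  have sa: "self_adjoint_op Ddom Dop" and tf: "\<psi> \<in> Ddom" "AE x in lebesgue. Dop \<psi> x = dirac_expr A V \<psi> x"
    using ext kern_test_fun[OF \<psi>] by (auto simp: distinguished_ext_def)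
  have e: "\<phi> \<in> Ddom" "AE x in lebesgue. Dop \<phi> x = lam *\<^sub>R \<phi> x" using eig by (auto simp: normalized_eigvec_def)
  have L: "L2 \<psi>" "L2 (Dop \<psi>)" "L2 \<phi>" "L2 (Dop \<phi>)" 
    using conjunct1[OF sa[unfolded self_adjoint_op_def]] tf(1) e(1) by blast+
  have sym: "l2_inner (Dop \<psi>) \<phi> = l2_inner \<psi> (Dop \<phi>)"
    using conjunct1[OF conjunct2[OF conjunct2[OF sa[unfolded self_adjoint_op_def]]]] tf(1) e(1) by blast
  have [measurable]: "\<psi> \<in> borel_measurable borel" "Jd \<psi> \<in> borel_measurable borel"
    using \<psi> kern_measurable kern_Jd by blast+
  have [measurable]: "Dop \<psi> \<in> borel_measurable lebesgue" "\<phi> \<in> borel_measurable lebesgue" "Dop \<phi> \<in> borel_measurable lebesgue"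
    "\<psi> \<in> borel_measurable lebesgue" using L by (auto simp: L2_def)
  let ?D = "\<lambda>x. Jd \<psi> x + Bt (\<psi> x) + (AL (A' x) (\<psi> x) + V' x *v \<psi> x)"
  let ?G = "\<lambda>x. ?D x \<bullet> \<phi>' x" and ?H = "\<lambda>x. \<psi> x \<bullet> (lam *\<^sub>R \<phi>' x)"
  have "?G \<in> borel_measurable lborel" "?H \<in> borel_measurable lborel" by measurable
  then have [measurable]: "?G \<in> borel_measurable lebesgue" "?H \<in> borel_measurable lebesgue"
    by (simp_all only: measurable_completion)
  have ae': "AE x in lebesgue. \<phi> x = \<phi>' x" "AE x in lebesgue. A x = A' x" "AE x in lebesgue. V x = V' x"
    by (rule AE_completion[OF ae(1)], rule AE_completion[OF ae(2)], rule AE_completion[OF ae(3)])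
  have aeG: "AE x in lebesgue. Dop \<psi> x \<bullet> \<phi> x = ?G x"
    using tf(2) ae' by eventually_elim (simp add: dirac_expr_eq)
  have aeH: "AE x in lebesgue. \<psi> x \<bullet> Dop \<phi> x = ?H x"
    using e(2) ae'(1) by eventually_elim simp
  have iG: "integrable lborel ?G"
  proof -
    have "integrable lebesgue ?G"
      using L2_inner(1)[OF L(2,3)] aeG by (subst integrable_cong_AE[symmetric]) auto
    then show ?thesis by (simp add: integrable_completion)
  qed
  have "(\<integral>x. ?G x \<partial>lborel) = (\<integral>x. ?G x \<partial>lebesgue)" by (intro integral_completion[symmetric]) simp
  also have "\<dots> = (\<integral>x. Dop \<psi> x \<bullet> \<phi> x \<partial>lebesgue)" by (rule integral_cong_AE[OF _ _ aeG, symmetric]; measurable)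
  also have "\<dots> = (\<integral>x. \<psi> x \<bullet> Dop \<phi> x \<partial>lebesgue)"
    using arg_cong[OF sym, of Re] L2_inner(2)[OF L(2,3)] L2_inner(2)[OF L(1,4)] by simp
  also have "\<dots> = (\<integral>x. ?H x \<partial>lebesgue)" by (rule integral_cong_AE[OF _ _ aeH]; measurable)
  also have "\<dots> = (\<integral>x. ?H x \<partial>lborel)" by (intro integral_completion) simp
  finally have GH: "(\<integral>x. ?G x \<partial>lborel) = (\<integral>x. ?H x \<partial>lborel)" .
  have int: "integrable lborel (\<lambda>x. f x \<bullet> \<phi>' x)" if f: "kern R f" for f :: "point \<Rightarrow> spinor"
  proof -
    obtain B where B: "\<And>z. norm (f z) \<le> B" using kern_bounded[OF f] by blast
    have [measurable]: "f \<in> borel_measurable borel" using f by (rule kern_measurable)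
    show ?thesis
    proof (rule loc_int_bound_integrable(1)[OF l\<phi>, where B=B and r=R])
      show "norm (f y \<bullet> \<phi>' y) \<le> B * norm (\<phi>' y)" for y
        using Cauchy_Schwarz_ineq2[of "f y" "\<phi>' y"] mult_right_mono[OF B[of y], of "norm (\<phi>' y)"] by simp
      show "f y \<bullet> \<phi>' y = 0" if "norm y > R" for y using f that by (simp add: kern_def)
    qed measurable
  qed
  have iJ: "integrable lborel (\<lambda>x. Jd \<psi> x \<bullet> \<phi>' x)" by (rule int[OF kern_Jd[OF \<psi>]])
  have iH: "integrable lborel ?H" using int[OF \<psi>] by simp
  have "AE x in lborel. x \<noteq> (0::point)" by (rule AE_lborel_singleton)
  \<comment> \<open>The potential terms stay inside \<open>?G\<close>, which is integrable as a
    whole, so nothing has to be known about the integrability of the singular term by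
    itself.\<close>
  then have ae2: "AE x in lborel. \<psi> x \<bullet> (lam *\<^sub>R \<phi>' x - Bt (\<phi>' x) - AL (A' x) (\<phi>' x) - V' x *v \<phi>' x) = ?H x - (?G x - Jd \<psi> x \<bullet> \<phi>' x)"
    using ae(3)
  proof eventually_elim
    case (elim x)
    then have "hermitian4 (V' x)" using V by metis
    then show ?case
      by (simp add: inner_add_left inner_diff_right Bt_sym AL_sym hermitian_sym)
  qed
  have "(\<integral>y. \<psi> y \<bullet> (lam *\<^sub>R \<phi>' y - Bt (\<phi>' y) - AL (A' y) (\<phi>' y) - V' y *v \<phi>' y) \<partial>lborel) = (\<integral>x. ?H x - (?G x - Jd \<psi> x \<bullet> \<phi>' x) \<partial>lborel)"
    using ae2 by (intro integral_cong_AE) auto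
  also have "\<dots> = (\<integral>x. ?H x \<partial>lborel) - ((\<integral>x. ?G x \<partial>lborel) - (\<integral>x. Jd \<psi> x \<bullet> \<phi>' x \<partial>lborel))"
    by (simp only: Bochner_Integration.integral_diff Bochner_Integration.integrable_diff iH iG iJ)
  also have "\<dots> = (\<integral>x. Jd \<psi> x \<bullet> \<phi>' x \<partial>lborel)" using GH by simp
  finally show ?thesis ..
qed

lemma nrm2_normalized:
  assumes "normalized_eigvec Ddom Dop lam \<phi>" "\<phi>' \<in> borel_measurable borel" "AE x in lborel. \<phi> x = \<phi>' x"
  shows "nrm2 \<phi>' = 1"
proof -
  have "(\<integral>\<^sup>+x. ennreal ((norm (\<phi> x))\<^sup>2) \<partial>lebesgue) = (\<integral>\<^sup>+x. ennreal ((norm (\<phi>' x))\<^sup>2) \<partial>lebesgue)"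
    using AE_completion[OF assms(3)] by (intro nn_integral_cong_AE) auto
  then show ?thesis using assms(1,2) by (simp add: normalized_eigvec_def nn_integral_completion)
qed

text \<open>The primed functions are the Borel representatives used in all integrals. The original
  \<open>V\<close> is kept, because its bounds at large radii and its hermiticity are pointwise
  statements, whereas \<open>V'\<close> agrees with it only almost everywhere.\<close>

locale dirac_eigenvector =
  fixes V :: "point \<Rightarrow> mat4" and A :: "point \<Rightarrow> point" and Ddom Dop lam \<phi>
    and \<phi>' :: "point \<Rightarrow> spinor" and A' :: "point \<Rightarrow> point" and V' :: "point \<Rightarrow> mat4"
  assumes pot: "potential_hyp V" and A: "Linf_loc A"
    and ext: "distinguished_ext A V Ddom Dop" and eig: "normalized_eigvec Ddom Dop lam \<phi>"
    and meas [measurable]: "\<phi>' \<in> borel_measurable borel" "A' \<in> borel_measurable borel" "V' \<in> borel_measurable borel"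
    and ae: "AE x in lborel. \<phi> x = \<phi>' x" "AE x in lborel. A x = A' x" "AE x in lborel. V x = V' x"
begin

lemma nrm2_phi: "nrm2 \<phi>' = 1"
  using nrm2_normalized[OF eig meas(1) ae(1)] .

lemma loc_int_phi: "loc_int \<phi>'"
  by (rule nrm2_finite_loc_int) (simp_all add: nrm2_phi)

text \<open>The right-hand side of the eigenvalue equation solved for \<open>Jd\<close>, cut to 0 on
  a ball around the singularity to make it locally integrable.\<close>

definition source :: "real \<Rightarrow> point \<Rightarrow> spinor" where
  "source r x = (if norm x \<le> r then 0 else lam *\<^sub>R \<phi>' x - Bt (\<phi>' x) - AL (A' x) (\<phi>' x) - V' x *v \<phi>' x)"

lemma source_measurable[measurable]: "source r \<in> borel_measurable borel"
  unfolding source_def[abs_def] by measurable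

lemma A_bound: obtains M where "M \<ge> 0" "AE x in lborel. norm x \<le> R \<longrightarrow> norm (A' x) \<le> M"
proof -
  obtain M where "AE x in lebesgue. x \<in> cball 0 R \<longrightarrow> norm (A x) \<le> M"
    using A compact_cball unfolding Linf_loc_def by blast
  then have "AE x in lborel. x \<in> cball 0 R \<longrightarrow> norm (A x) \<le> M" by (simp add: AE_completion_iff)
  then have "AE x in lborel. norm x \<le> R \<longrightarrow> norm (A' x) \<le> max M 0"
    using ae(2) by eventually_elim auto
  then show thesis using that[of "max M 0"] by simp
qed

lemma V_bound:
  assumes "r > 0"
  obtains M where "M \<ge> 0" "AE x in lborel. r < norm x \<and> norm x \<le> R \<longrightarrow> mat_norm (V' x) \<le> M"
proof -
  have "compact (cball 0 R - ball 0 r :: point set)" by (intro compact_diff) auto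
  moreover have "0 \<notin> cball 0 R - ball (0::point) r" using assms by simp
  ultimately obtain M where "AE x in lebesgue. x \<in> cball 0 R - ball 0 r \<longrightarrow> mat_norm (V x) \<le> M"
    using pot unfolding potential_hyp_def by meson
  then have "AE x in lborel. x \<in> cball 0 R - ball 0 r \<longrightarrow> mat_norm (V x) \<le> M" by (simp add: AE_completion_iff)
  then have "AE x in lborel. r < norm x \<and> norm x \<le> R \<longrightarrow> mat_norm (V' x) \<le> max M 0"
    using ae(3) by eventually_elim auto
  then show thesis using that[of "max M 0"] by simp
qed

lemma source_bound:
  assumes "r > 0" obtains C where "C \<ge> 0" "AE x in lborel. norm x \<le> R \<longrightarrow> norm (source r x) \<le> C * norm (\<phi>' x)"
proof -
  obtain M where M: "M \<ge> 0" "AE x in lborel. norm x \<le> R \<longrightarrow> norm (A' x) \<le> M" using A_bound by blast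
  obtain N where N: "N \<ge> 0" "AE x in lborel. r < norm x \<and> norm x \<le> R \<longrightarrow> mat_norm (V' x) \<le> N" using V_bound assms by blast
  let ?C = "\<bar>lam\<bar> + 1 + M + N"
  have "AE x in lborel. norm x \<le> R \<longrightarrow> norm (source r x) \<le> ?C * norm (\<phi>' x)"
    using M(2) N(2)
  proof eventually_elim
    case (elim x)
    show ?case
    proof (cases "norm x \<le> R \<and> r < norm x")
      case True
      have "norm (source r x) \<le> norm (lam *\<^sub>R \<phi>' x) + norm (Bt (\<phi>' x)) + norm (AL (A' x) (\<phi>' x)) + norm (V' x *v \<phi>' x)"
        using True by (simp add: source_def) (smt (verit) norm_triangle_ineq4 norm_scaleR norm_Bt)
      also have "\<dots> \<le> \<bar>lam\<bar> * norm (\<phi>' x) + norm (\<phi>' x) + M * norm (\<phi>' x) + N * norm (\<phi>' x)"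
        using True elim mat_norm_le[of "V' x" "\<phi>' x"] mult_right_mono[of "norm (A' x)" M "norm (\<phi>' x)"] mult_right_mono[of "mat_norm (V' x)" N "norm (\<phi>' x)"]
        by (simp add: norm_AL)
      finally show ?thesis by (simp add: algebra_simps)
    next
      case False
      then show ?thesis using M(1) N(1) by (auto simp: source_def)
    qed
  qed
  then show thesis using that[of ?C] M N by simp
qed

lemma loc_int_source:
  assumes "r > 0" shows "loc_int (source r)"
  unfolding loc_int_def
proof (intro conjI allI)
  fix R
  obtain C where C: "C \<ge> 0" "AE x in lborel. norm x \<le> R \<longrightarrow> norm (source r x) \<le> C * norm (\<phi>' x)"
    using source_bound[OF assms] by blast
  have "integrable lborel (\<lambda>x. C * norm (indicat_real (cball 0 R) x *\<^sub>R \<phi>' x))"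
    using loc_int_phi unfolding loc_int_def by (intro integrable_mult_right integrable_norm) auto
  then show "integrable lborel (\<lambda>x. indicat_real (cball 0 R) x *\<^sub>R source r x)"
  proof (rule Bochner_Integration.integrable_bound)
    show "AE x in lborel. norm (indicat_real (cball 0 R) x *\<^sub>R source r x) \<le> norm (C * norm (indicat_real (cball 0 R) x *\<^sub>R \<phi>' x))"
      using C(2) by eventually_elim (use C(1) in \<open>auto simp: indicator_def\<close>)
  qed measurable
qed measurable

lemma weak_sol_source:
  assumes "r > 0" shows "weak_sol r \<phi>' (source r)"
  unfolding weak_sol_def
proof (intro allI impI, elim conjE exE)
  fix \<psi> :: "point \<Rightarrow> spinor" and R assume \<psi>: "kern R \<psi>" "\<forall>y. norm y \<le> r \<longrightarrow> \<psi> y = 0"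
  have "\<And>x. x \<noteq> 0 \<Longrightarrow> hermitian4 (V x)" using pot by (simp add: potential_hyp_def)
  note eigvec_weak[OF ext eig this meas ae loc_int_phi \<psi>(1)]
  also have "(\<integral>y. \<psi> y \<bullet> (lam *\<^sub>R \<phi>' y - Bt (\<phi>' y) - AL (A' y) (\<phi>' y) - V' y *v \<phi>' y) \<partial>lborel) = (\<integral>y. \<psi> y \<bullet> source r y \<partial>lborel)"
    using \<psi>(2) by (intro Bochner_Integration.integral_cong) (auto simp: source_def)
  finally show "(\<integral>y. Jd \<psi> y \<bullet> \<phi>' y \<partial>lborel) = (\<integral>y. \<psi> y \<bullet> source r y \<partial>lborel)" .
qed

lemma cutoff_energy:
  assumes r: "r > 0" and \<epsilon>: "\<epsilon> \<ge> 0" "\<And>x. norm x \<ge> r \<Longrightarrow> mat_norm (V x) \<le> \<epsilon>"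
    and \<zeta>: "smth UNIV \<zeta>" "\<And>y. norm y \<le> r \<Longrightarrow> \<zeta> y = 0" "\<And>y. norm y > R \<Longrightarrow> \<zeta> y = 0"
  shows "nrm2 (\<lambda>x. \<zeta> x *\<^sub>R \<phi>' x) \<le>
    (\<integral>\<^sup>+x. ennreal (((sqrt ((lam * \<zeta> x)\<^sup>2 + (\<Sum>k\<in>UNIV. (pdiff k \<zeta> x)\<^sup>2)) + \<epsilon> * \<bar>\<zeta> x\<bar>) * norm (\<phi>' x))\<^sup>2) \<partial>lborel)"
proof -
  have k\<zeta>: "kern R \<zeta>" using \<zeta> by (simp add: kern_def)
  have [measurable]: "\<zeta> \<in> borel_measurable borel" "pdiff k \<zeta> \<in> borel_measurable borel" for k
    using kern_measurable k\<zeta> kern_pdiff by blast+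
  obtain Z where Z: "Z > 0" "\<And>x. norm (\<zeta> x) \<le> Z" using kern_bounded k\<zeta> by blast
  have "\<exists>B. B > 0 \<and> (\<forall>x. norm (pdiff k \<zeta> x) \<le> B)" for k using kern_bounded[OF kern_pdiff[OF k\<zeta>]] by metis
  then obtain Y where Y: "\<And>k. Y k > 0" "\<And>k x. norm (pdiff k \<zeta> x) \<le> Y k" by metis
  obtain M where M: "M \<ge> 0" "AE x in lborel. norm x \<le> R \<longrightarrow> norm (A' x) \<le> M" using A_bound by blast
  obtain C where C: "C \<ge> 0" "AE x in lborel. norm x \<le> R \<longrightarrow> norm (source r x) \<le> C * norm (\<phi>' x)"
    using source_bound[OF r] by blast
  \<comment> \<open>A globally bounded version of the magnetic potential, equal to \<open>A'\<close>
    almost everywhere on the support of \<open>\<zeta>\<close>. Its bound drops out of the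
    estimate.\<close>
  define a where "a x = (if norm x \<le> R \<and> norm (A' x) \<le> M then A' x else 0)" for x
  define u where "u x = \<zeta> x *\<^sub>R \<phi>' x" for x
  define h where "h x = \<zeta> x *\<^sub>R source r x + (\<Sum>k\<in>UNIV. pdiff k \<zeta> x *\<^sub>R J k (\<phi>' x))" for x
  have [measurable]: "a \<in> borel_measurable borel" "u \<in> borel_measurable borel" "h \<in> borel_measurable borel"
    unfolding a_def[abs_def] u_def[abs_def] h_def[abs_def] by measurable
  have fin: "nrm2 f < \<infinity>" if f: "AE x in lborel. norm (f x) \<le> D * norm (\<phi>' x)" for f :: "point \<Rightarrow> spinor" and D
  proof -
    have "nrm2 f \<le> (\<integral>\<^sup>+x. ennreal (D\<^sup>2) * ennreal ((norm (\<phi>' x))\<^sup>2) \<partial>lborel)"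
      using f by (intro nn_integral_mono_AE, eventually_elim)
        (auto simp flip: ennreal_mult power_mult_distrib intro!: ennreal_leI power_mono)
    also have "\<dots> = ennreal (D\<^sup>2)" by (subst nn_integral_cmult) (auto simp: nrm2_phi)
    finally show ?thesis by (rule order_le_less_trans) simp
  qed
  have uf: "nrm2 u < \<infinity>"
    by (rule fin[of _ Z]) (use Z in \<open>auto simp: u_def intro!: mult_right_mono\<close>)
  have hf: "nrm2 h < \<infinity>"
  proof (rule fin)
    show "AE x in lborel. norm (h x) \<le> (Z * C + (\<Sum>k\<in>UNIV. Y k)) * norm (\<phi>' x)"
      using C(2)
    proof eventually_elim
      case (elim x)
      have "norm (\<zeta> x *\<^sub>R source r x) \<le> Z * C * norm (\<phi>' x)"
      proof (cases "norm x \<le> R")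
        case True
        then show ?thesis using elim Z(1) Z(2)[of x] mult_mono[of "norm (\<zeta> x)" Z "norm (source r x)" "C * norm (\<phi>' x)"] by simp
      next
        case False
        then show ?thesis using \<zeta>(3)[of x] Z C by simp
      qed
      moreover have "norm (\<Sum>k\<in>UNIV. pdiff k \<zeta> x *\<^sub>R J k (\<phi>' x)) \<le> (\<Sum>k\<in>UNIV. Y k * norm (\<phi>' x))"
        by (rule order_trans[OF norm_sum sum_mono]) (use Y(2)[of _ x] in \<open>auto intro: mult_right_mono\<close>)
      ultimately show ?case
        unfolding h_def using norm_triangle_ineq[of "\<zeta> x *\<^sub>R source r x" "\<Sum>k\<in>UNIV. pdiff k \<zeta> x *\<^sub>R J k (\<phi>' x)"]
        by (simp add: distrib_right sum_distrib_right)
    qed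
  qed
  have "nrm2 u \<le> nrm2 (\<lambda>x. h x + Bt (u x) + AL (a x) (u x))"
  proof (rule dirac_lower_bound_weak[OF _ _ _ uf hf])
    show "u x = 0" if "norm x > R" for x using that \<zeta>(3) by (simp add: u_def)
    show "norm (a x) \<le> M" for x using M(1) by (simp add: a_def)
    show "Jd (conv \<kappa> u) x = conv \<kappa> h x" if "kern 1 \<kappa>" for \<kappa> x
      unfolding u_def[abs_def] h_def[abs_def]
      by (rule weak_sol_conv[OF weak_sol_source[OF r] loc_int_phi loc_int_source[OF r] that \<zeta>(1)]) (simp add: \<zeta>(2))
  qed measurable
  also have "\<dots> \<le> (\<integral>\<^sup>+x. ennreal (((sqrt ((lam * \<zeta> x)\<^sup>2 + (\<Sum>k\<in>UNIV. (pdiff k \<zeta> x)\<^sup>2)) + \<epsilon> * \<bar>\<zeta> x\<bar>) * norm (\<phi>' x))\<^sup>2) \<partial>lborel)"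
    using M(2) ae(3)
  proof (intro nn_integral_mono_AE, eventually_elim)
    case (elim x)
    let ?g = "(lam * \<zeta> x) *\<^sub>R \<phi>' x + (\<Sum>k\<in>UNIV. pdiff k \<zeta> x *\<^sub>R J k (\<phi>' x))"
    \<comment> \<open>The mass and magnetic terms inside \<open>source\<close> cancel those of the
      operator. What is left is the gradient term of \<open>norm_gradient_term\<close> and the
      potential.\<close>
    have eq: "h x + Bt (u x) + AL (a x) (u x) = ?g - \<zeta> x *\<^sub>R (V' x *v \<phi>' x)"
    proof (cases "\<zeta> x = 0")
      case True
      then show ?thesis by (simp add: h_def u_def Bt_def AL_def)
    next
      case False
      then have x: "norm x \<le> R" "\<not> norm x \<le> r" using \<zeta>(2,3) by (auto simp: not_less[symmetric])
      then have "a x = A' x" using elim by (simp add: a_def)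
      then show ?thesis using x
        by (simp add: h_def u_def source_def linear_scale[OF bounded_linear.linear[OF bounded_linear_Bt]] linear_scale[OF bounded_linear.linear[OF bounded_linear_AL]] algebra_simps)
    qed
    have g: "norm ?g = sqrt ((lam * \<zeta> x)\<^sup>2 + (\<Sum>k\<in>UNIV. (pdiff k \<zeta> x)\<^sup>2)) * norm (\<phi>' x)"
      by (rule power2_eq_imp_eq) (auto simp: norm_gradient_term power_mult_distrib sum_nonneg)
    have v: "norm (\<zeta> x *\<^sub>R (V' x *v \<phi>' x)) \<le> \<epsilon> * \<bar>\<zeta> x\<bar> * norm (\<phi>' x)"
    proof (cases "\<zeta> x = 0")
      case False
      then have "norm x \<ge> r" using \<zeta>(2)[of x] by linarith
      then have "mat_norm (V' x) \<le> \<epsilon>" using \<epsilon>(2) elim by metis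
      then have "norm (V' x *v \<phi>' x) \<le> \<epsilon> * norm (\<phi>' x)"
        using mat_norm_le[of "V' x" "\<phi>' x"] mult_right_mono[of "mat_norm (V' x)" \<epsilon> "norm (\<phi>' x)"] by simp
      then show ?thesis using mult_left_mono[of "norm (V' x *v \<phi>' x)" "\<epsilon> * norm (\<phi>' x)" "\<bar>\<zeta> x\<bar>"] by (simp add: mult_ac)
    qed simp
    have "norm (h x + Bt (u x) + AL (a x) (u x)) \<le> (sqrt ((lam * \<zeta> x)\<^sup>2 + (\<Sum>k\<in>UNIV. (pdiff k \<zeta> x)\<^sup>2)) + \<epsilon> * \<bar>\<zeta> x\<bar>) * norm (\<phi>' x)"
      unfolding eq using norm_triangle_ineq4[of ?g "\<zeta> x *\<^sub>R (V' x *v \<phi>' x)"] g v by (simp add: distrib_right)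
    then show ?case by (intro ennreal_leI power_mono) auto
  qed
  finally show ?thesis by (simp add: u_def)
qed

end

section \<open>Exponential weights in the smoothed distance to the origin\<close>

definition bracket :: "point \<Rightarrow> real" where "bracket x = sqrt (1 + x \<bullet> x)"

lemma bracket_ge_1: "bracket x \<ge> 1" by (simp add: bracket_def)

lemma norm_le_bracket: "norm x \<le> bracket x"
  by (simp add: bracket_def norm_eq_sqrt_inner)

lemma bracket_le: "bracket x \<le> 1 + norm x"
  unfolding bracket_def
  by (rule real_le_lsqrt) (auto simp: power2_sum power2_norm_eq_inner[symmetric])

lemma smth_bracket: "smth UNIV bracket"
  unfolding bracket_def[abs_def]
  by (intro smth_sqrt smth_add smth_const smth_inner smth_id) (auto simp: add_pos_nonneg)

text \<open>\<open>bracket\<close> replaces the norm because it is smooth at the origin. Its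
  gradient is shorter than 1, so the gradient of a function of \<open>bracket x\<close> is no larger
  than the derivative of that function.\<close>

lemma has_pd_bracket: "has_pd k bracket (x $ k / bracket x) x"
proof -
  have "((\<lambda>t. x + t *\<^sub>R axis k 1) has_vector_derivative 0 + 1 *\<^sub>R axis k 1) (at (0::real))"
    by (rule has_vector_derivative_add[OF has_vector_derivative_const]) 
      (rule bounded_linear.has_vector_derivative[OF bounded_linear_scaleR_left], auto intro: derivative_eq_intros)
  then have id: "has_pd k (\<lambda>x. x) (axis k 1) x" unfolding has_pd_def by simp
  have "has_pd k (\<lambda>x. x \<bullet> x) (2 * x $ k) x"
    using has_pd_bilinear[OF bounded_bilinear_inner id id] by (simp add: inner_axis inner_axis')
  from has_pd_add[OF has_pd_const[of k "1::real"] this]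
  have 1: "has_pd k (\<lambda>x. 1 + x \<bullet> x) (2 * x $ k) x" by simp
  have pos: "1 + x \<bullet> x > 0" by (simp add: add_pos_nonneg)
  have "has_pd k (\<lambda>x. sqrt (1 + x \<bullet> x)) (inverse (sqrt (1 + x \<bullet> x)) / 2 * (2 * x $ k)) x"
    by (rule has_pd_chain[where g=sqrt and f="\<lambda>x. 1 + x \<bullet> x", OF DERIV_real_sqrt[OF pos] 1])
  moreover have "inverse s / 2 * (2 * y) = y / s" for s y :: real
    by (cases "s = 0") (auto simp: field_simps)
  ultimately show ?thesis unfolding bracket_def[abs_def] by metis
qed

text \<open>The exponent is a bounded regularisation of \<open>a * t\<close> whose slope never exceeds \<open>a\<close>.\<close>

definition weight :: "real \<Rightarrow> real \<Rightarrow> real \<Rightarrow> real \<Rightarrow> real \<Rightarrow> real" where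
  "weight a t0 \<delta> L t = step (t - t0) * exp (a * t * inverse (1 + \<delta> * t)) * step (2 - t / L)"

lemma weight_nonneg: "weight a t0 \<delta> L t \<ge> 0"
  by (simp add: weight_def step_nonneg)

lemma smth_weight:
  assumes "\<delta> > 0" shows "smth UNIV (\<lambda>x. weight a t0 \<delta> L (bracket x))"
proof -
  note b = smth_bracket
  have c: "smth UNIV (\<lambda>x. c * bracket x)" for c by (intro smth_mult smth_const b) auto
  have nz: "1 + \<delta> * bracket x \<noteq> 0" for x
    using assms bracket_ge_1[of x] by (smt (verit) mult_nonneg_nonneg)
  have 1: "smth UNIV (\<lambda>x. step (bracket x - t0))" by (intro smth_step smth_diff smth_const b) auto
  have "smth UNIV (\<lambda>x. inverse (1 + \<delta> * bracket x))" 
    by (intro smth_inverse smth_add smth_const c) (use nz in auto)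
  then have "smth UNIV (\<lambda>x. (a * bracket x) * inverse (1 + \<delta> * bracket x))" by (intro smth_mult c) auto
  then have 2: "smth UNIV (\<lambda>x. exp ((a * bracket x) * inverse (1 + \<delta> * bracket x)))" by (intro smth_exp) auto
  have "smth UNIV (\<lambda>x. 2 - (1 / L) * bracket x)" by (intro smth_diff smth_const c) auto
  then have 3: "smth UNIV (\<lambda>x. step (2 - bracket x / L))" by (intro smth_step) auto
  show ?thesis unfolding weight_def using 1 2 3 by (intro smth_mult) auto
qed

text \<open>The product rule gives three terms. The inner cut-off varies only for \<open>t\<close>
  up to \<open>t0 + 1\<close> and costs a constant. The exponent has slope at most \<open>a\<close>
  and reproduces the weight. The outer cut-off has slope at most \<open>K / L\<close>, and choosing
  \<open>L\<close> after \<open>\<delta>\<close> balances this against the bound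
  \<open>exp (a / \<delta>)\<close> of the exponential.\<close>

lemma weight_derivative:
  assumes st: "\<And>t. (step has_real_derivative step' t) (at t)" "\<And>t. \<bar>step' t\<bar> \<le> K" 
      "\<And>t. t \<le> 0 \<or> t \<ge> 1 \<Longrightarrow> step' t = 0" "K > 0"
    and "a > 0" "\<delta> > 0" and L: "L > 0" "K * exp (a / \<delta>) \<le> L" and "t \<ge> 0"
  obtains d where "(weight a t0 \<delta> L has_real_derivative d) (at t)"
    "\<bar>d\<bar> \<le> a * weight a t0 \<delta> L t + (K * exp (a * (t0 + 1)) + 1)"
proof -
  define F where "F t = a * t * inverse (1 + \<delta> * t)" for t
  have pos: "1 + \<delta> * t > 0" using assms by (simp add: add_pos_nonneg)
  define F' where "F' = a * inverse ((1 + \<delta> * t)\<^sup>2)"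
  have dF: "(F has_real_derivative F') (at t)"
    unfolding F_def[abs_def] F'_def using pos
    by (auto intro!: derivative_eq_intros simp: field_simps power2_eq_square)
  have F': "0 \<le> F'" "F' \<le> a"
  proof -
    have "(1 + \<delta> * t)\<^sup>2 \<ge> 1" using assms by (simp add: one_le_power)
    then have "inverse ((1 + \<delta> * t)\<^sup>2) \<le> 1" by (simp add: inverse_le_1_iff)
    then show "0 \<le> F'" "F' \<le> a" using assms by (auto simp: F'_def mult_left_le)
  qed
  have F: "F t \<le> a * t" "F t \<le> a / \<delta>"
  proof -
    have "inverse (1 + \<delta> * t) \<le> 1" using pos assms by (simp add: inverse_le_1_iff)
    then show "F t \<le> a * t" using assms by (simp add: F_def mult_left_le)
    show "F t \<le> a / \<delta>" unfolding F_def using pos assms by (simp add: field_simps)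
  qed
  let ?s = "step (t - t0)" and ?\<theta> = "step (2 - t / L)"
  let ?d = "step' (t - t0) * exp (F t) * ?\<theta> + ?s * (exp (F t) * F') * ?\<theta> + ?s * exp (F t) * (step' (2 - t / L) * (- 1 / L))"
  have d1: "((\<lambda>t. step (t - t0)) has_real_derivative step' (t - t0)) (at t)"
    by (rule DERIV_chain2[OF st(1), where g="\<lambda>t. t - t0", THEN DERIV_cong]) (auto intro!: derivative_eq_intros)
  have d2: "((\<lambda>t. exp (F t)) has_real_derivative exp (F t) * F') (at t)"
    using dF by (rule DERIV_fun_exp)
  have d3: "((\<lambda>t. step (2 - t / L)) has_real_derivative step' (2 - t / L) * (- 1 / L)) (at t)"
    by (rule DERIV_chain2[OF st(1), where g="\<lambda>t. 2 - t / L", THEN DERIV_cong]) (use L in \<open>auto intro!: derivative_eq_intros\<close>)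
  have der: "(weight a t0 \<delta> L has_real_derivative ?d) (at t)"
    unfolding weight_def[abs_def] F_def[symmetric]
    by (rule DERIV_cong[OF DERIV_mult[OF DERIV_mult[OF d1 d2] d3]]) (simp add: algebra_simps)
  have s: "0 \<le> ?s" "?s \<le> 1" and \<theta>: "0 \<le> ?\<theta>" "?\<theta> \<le> 1" using step_nonneg step_le_1 by auto
  have t1: "\<bar>step' (t - t0) * exp (F t) * ?\<theta>\<bar> \<le> K * exp (a * (t0 + 1))"
  proof (cases "t - t0 \<ge> 1")
    case True
    then show ?thesis using st(3)[of "t - t0"] st(4) by simp
  next
    case False
    then have "exp (F t) \<le> exp (a * (t0 + 1))" using F(1) assms by (simp add: order_trans[OF F(1)])
    then have "\<bar>step' (t - t0)\<bar> * exp (F t) * ?\<theta> \<le> K * exp (a * (t0 + 1)) * 1"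
      using st(2,4) \<theta> by (intro mult_mono) auto
    then show ?thesis using \<theta> by (simp add: abs_mult)
  qed
  have t2: "\<bar>?s * (exp (F t) * F') * ?\<theta>\<bar> \<le> a * weight a t0 \<delta> L t"
  proof -
    have "\<bar>?s * (exp (F t) * F') * ?\<theta>\<bar> = F' * weight a t0 \<delta> L t"
      using F' s \<theta> by (simp add: weight_def F_def[symmetric] abs_mult)
    then show ?thesis using F' weight_nonneg by (simp add: mult_right_mono)
  qed
  have t3: "\<bar>?s * exp (F t) * (step' (2 - t / L) * (- 1 / L))\<bar> \<le> 1"
  proof -
    have "\<bar>?s * exp (F t) * (step' (2 - t / L) * (- 1 / L))\<bar> = ?s * exp (F t) * (\<bar>step' (2 - t / L)\<bar> / L)"
      using s L by (simp add: abs_mult)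
    also have "\<dots> \<le> 1 * exp (a / \<delta>) * (K / L)"
      using s L st(2,4) F(2) by (intro mult_mono divide_right_mono) auto
    also have "\<dots> \<le> 1" using L by (simp add: field_simps)
    finally show ?thesis .
  qed
  have "\<bar>?d\<bar> \<le> a * weight a t0 \<delta> L t + (K * exp (a * (t0 + 1)) + 1)"
    using t1 t2 t3 by linarith
  then show thesis using that der by blast
qed

context dirac_eigenvector
begin

text \<open>For the weighted norm \<open>n\<close> the energy inequality becomes
  \<open>n \<le> c * n\<close> plus a constant, and \<open>c < 1\<close> absorbs the main term. The
  constant contains neither \<open>\<delta>\<close> nor \<open>L\<close>, so both can be sent to
  their limits afterwards.\<close>

lemma weighted_bound:
  assumes a: "0 < a" and c: "c = sqrt (lam\<^sup>2 + a\<^sup>2) + \<epsilon>" "c < 1" and r: "r > 0"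
    and \<epsilon>: "\<epsilon> > 0" "\<And>x. norm x \<ge> r \<Longrightarrow> mat_norm (V x) \<le> \<epsilon>"
    and st: "\<And>t. (step has_real_derivative step' t) (at t)" "\<And>t. \<bar>step' t\<bar> \<le> K" 
      "\<And>t. t \<le> 0 \<or> t \<ge> 1 \<Longrightarrow> step' t = 0" "K > 0"
    and \<delta>: "\<delta> > 0" and L: "L > 0" "K * exp (a / \<delta>) \<le> L"
  shows "nrm2 (\<lambda>x. weight a (1 + r) \<delta> L (bracket x) *\<^sub>R \<phi>' x) \<le> ennreal (((K * exp (a * (r + 2)) + 1) / (1 - c))\<^sup>2)"
proof -
  define \<zeta> where "\<zeta> x = weight a (1 + r) \<delta> L (bracket x)" for x
  define B where "B = K * exp (a * (r + 2)) + 1"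
  define \<kappa> where "\<kappa> = sqrt (lam\<^sup>2 + a\<^sup>2)"
  have B: "B > 0" unfolding B_def using st(4) by (simp add: add_pos_pos)
  have \<kappa>: "a \<le> \<kappa>" "\<kappa>\<^sup>2 = lam\<^sup>2 + a\<^sup>2" using a by (auto simp: \<kappa>_def intro: real_le_rsqrt)
  have c0: "c = \<kappa> + \<epsilon>" "c > 0" using c(1) \<epsilon>(1) a \<kappa>(1) unfolding \<kappa>_def[symmetric] by linarith+
  have \<zeta>0: "\<zeta> x \<ge> 0" for x by (simp add: \<zeta>_def weight_nonneg)
  have sm: "smth UNIV \<zeta>" unfolding \<zeta>_def[abs_def] using \<delta> by (rule smth_weight)
  \<comment> \<open>The weight starts at \<open>1 + r\<close> because \<open>bracket y\<close> can
    exceed \<open>norm y\<close> by up to 1.\<close>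
  have z1: "\<zeta> y = 0" if "norm y \<le> r" for y
    using bracket_le[of y] that by (simp add: \<zeta>_def weight_def step_0)
  have z2: "\<zeta> y = 0" if "norm y > 2 * L" for y
  proof -
    have "bracket y / L \<ge> 2" using norm_le_bracket[of y] that L(1) by (simp add: field_simps)
    then show ?thesis by (simp add: \<zeta>_def weight_def step_0)
  qed
  have [measurable]: "\<zeta> \<in> borel_measurable borel" using sm by (rule smth_measurable)
  have "nrm2 (\<lambda>x. \<zeta> x *\<^sub>R \<phi>' x) \<le>
    (\<integral>\<^sup>+x. ennreal (((sqrt ((lam * \<zeta> x)\<^sup>2 + (\<Sum>k\<in>UNIV. (pdiff k \<zeta> x)\<^sup>2)) + \<epsilon> * \<bar>\<zeta> x\<bar>) * norm (\<phi>' x))\<^sup>2) \<partial>lborel)"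
    by (rule cutoff_energy[OF r less_imp_le[OF \<epsilon>(1)] \<epsilon>(2) sm z1 z2])
  also have "\<dots> \<le> (\<integral>\<^sup>+x. ennreal c * ennreal ((norm (\<zeta> x *\<^sub>R \<phi>' x))\<^sup>2) + ennreal (B\<^sup>2 / (1 - c)) * ennreal ((norm (\<phi>' x))\<^sup>2) \<partial>lborel)"
  proof (intro nn_integral_mono)
    fix x :: point
    obtain d where d: "(weight a (1 + r) \<delta> L has_real_derivative d) (at (bracket x))"
      "\<bar>d\<bar> \<le> a * \<zeta> x + B"
      using weight_derivative[OF st a \<delta> L, of "bracket x" "1 + r"] bracket_ge_1[of x]
      unfolding B_def \<zeta>_def by (auto simp: add.commute add.left_commute)
    have pk: "pdiff k \<zeta> x = d * (x $ k / bracket x)" for k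
      unfolding \<zeta>_def[abs_def] by (rule has_pd_imp_pdiff[OF has_pd_chain[OF d(1) has_pd_bracket]])
    have "(\<Sum>k\<in>UNIV. (pdiff k \<zeta> x)\<^sup>2) = (d / bracket x)\<^sup>2 * (x \<bullet> x)"
      by (simp add: pk inner_vec_def sum_distrib_left power_mult_distrib power_divide) (simp add: power2_eq_square field_simps)
    also have "\<dots> = d\<^sup>2 * ((x \<bullet> x) / (1 + x \<bullet> x))"
      by (simp add: bracket_def power_divide add_nonneg_nonneg)
    also have "\<dots> \<le> d\<^sup>2 * 1"
      by (intro mult_left_mono) (simp_all add: divide_le_eq add_pos_nonneg)
    also have "\<dots> \<le> (a * \<zeta> x + B)\<^sup>2" using d(2) abs_le_square_iff[of d "a * \<zeta> x + B"] by (simp add: abs_le_iff)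
    finally have "(lam * \<zeta> x)\<^sup>2 + (\<Sum>k\<in>UNIV. (pdiff k \<zeta> x)\<^sup>2) \<le> (lam * \<zeta> x)\<^sup>2 + (a * \<zeta> x + B)\<^sup>2" by simp
    also have "\<dots> = \<kappa>\<^sup>2 * (\<zeta> x)\<^sup>2 + 2 * a * \<zeta> x * B + B\<^sup>2"
      unfolding \<kappa>(2) by (simp add: power2_eq_square algebra_simps)
    also have "\<dots> \<le> (\<kappa> * \<zeta> x + B)\<^sup>2"
      using \<kappa>(1) \<zeta>0[of x] B mult_right_mono[of a \<kappa> "2 * \<zeta> x * B"] by (simp add: power2_eq_square algebra_simps)
    finally have "sqrt ((lam * \<zeta> x)\<^sup>2 + (\<Sum>k\<in>UNIV. (pdiff k \<zeta> x)\<^sup>2)) \<le> \<kappa> * \<zeta> x + B"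
      using \<zeta>0[of x] B \<kappa>(1) a by (intro real_le_lsqrt) (auto intro: add_nonneg_nonneg mult_nonneg_nonneg)
    then have s: "sqrt ((lam * \<zeta> x)\<^sup>2 + (\<Sum>k\<in>UNIV. (pdiff k \<zeta> x)\<^sup>2)) + \<epsilon> * \<bar>\<zeta> x\<bar> \<le> c * \<zeta> x + B"
      using \<zeta>0[of x] by (simp add: c0(1) distrib_right)
    have s0: "0 \<le> sqrt ((lam * \<zeta> x)\<^sup>2 + (\<Sum>k\<in>UNIV. (pdiff k \<zeta> x)\<^sup>2)) + \<epsilon> * \<bar>\<zeta> x\<bar>"
      using \<epsilon>(1) by (intro add_nonneg_nonneg real_sqrt_ge_zero sum_nonneg) auto
    have "((sqrt ((lam * \<zeta> x)\<^sup>2 + (\<Sum>k\<in>UNIV. (pdiff k \<zeta> x)\<^sup>2)) + \<epsilon> * \<bar>\<zeta> x\<bar>) * norm (\<phi>' x))\<^sup>2 \<le> ((c * \<zeta> x + B) * norm (\<phi>' x))\<^sup>2"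
      using s s0 by (intro power_mono mult_right_mono) auto
    also have "\<dots> = (c * \<zeta> x + B)\<^sup>2 * (norm (\<phi>' x))\<^sup>2" by (simp add: power_mult_distrib)
    also have "\<dots> \<le> (c * (\<zeta> x)\<^sup>2 + B\<^sup>2 / (1 - c)) * (norm (\<phi>' x))\<^sup>2"
    proof (intro mult_right_mono)
      \<comment> \<open>Convexity of the square, for the average of \<open>\<zeta> x\<close> and
        \<open>B / (1 - c)\<close> with weights \<open>c\<close> and \<open>1 - c\<close>.\<close>
      have "0 \<le> c / (1 - c) * ((1 - c) * \<zeta> x - B)\<^sup>2" using c(2) c0(2) by simp
      also have "\<dots> = c * (\<zeta> x)\<^sup>2 + B\<^sup>2 / (1 - c) - (c * \<zeta> x + B)\<^sup>2"
        using c(2) by (simp add: power2_eq_square field_simps)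
      finally show "(c * \<zeta> x + B)\<^sup>2 \<le> c * (\<zeta> x)\<^sup>2 + B\<^sup>2 / (1 - c)" by simp
    qed simp
    also have "\<dots> = c * (norm (\<zeta> x *\<^sub>R \<phi>' x))\<^sup>2 + B\<^sup>2 / (1 - c) * (norm (\<phi>' x))\<^sup>2"
      by (simp add: power_mult_distrib distrib_right)
    finally have "((sqrt ((lam * \<zeta> x)\<^sup>2 + (\<Sum>k\<in>UNIV. (pdiff k \<zeta> x)\<^sup>2)) + \<epsilon> * \<bar>\<zeta> x\<bar>) * norm (\<phi>' x))\<^sup>2
      \<le> c * (norm (\<zeta> x *\<^sub>R \<phi>' x))\<^sup>2 + B\<^sup>2 / (1 - c) * (norm (\<phi>' x))\<^sup>2" .
    moreover have "ennreal c * ennreal ((norm (\<zeta> x *\<^sub>R \<phi>' x))\<^sup>2) + ennreal (B\<^sup>2 / (1 - c)) * ennreal ((norm (\<phi>' x))\<^sup>2)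
      = ennreal (c * (norm (\<zeta> x *\<^sub>R \<phi>' x))\<^sup>2 + B\<^sup>2 / (1 - c) * (norm (\<phi>' x))\<^sup>2)"
      using c(2) c0(2) by (intro ennreal_lincomb) auto
    ultimately show "ennreal (((sqrt ((lam * \<zeta> x)\<^sup>2 + (\<Sum>k\<in>UNIV. (pdiff k \<zeta> x)\<^sup>2)) + \<epsilon> * \<bar>\<zeta> x\<bar>) * norm (\<phi>' x))\<^sup>2)
      \<le> ennreal c * ennreal ((norm (\<zeta> x *\<^sub>R \<phi>' x))\<^sup>2) + ennreal (B\<^sup>2 / (1 - c)) * ennreal ((norm (\<phi>' x))\<^sup>2)"
      by (simp only: ennreal_leI)
  qed
  also have "\<dots> = ennreal c * nrm2 (\<lambda>x. \<zeta> x *\<^sub>R \<phi>' x) + ennreal (B\<^sup>2 / (1 - c)) * nrm2 \<phi>'"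
    by (subst nn_integral_add) (simp_all add: nn_integral_cmult)
  finally have main: "nrm2 (\<lambda>x. \<zeta> x *\<^sub>R \<phi>' x) \<le> ennreal c * nrm2 (\<lambda>x. \<zeta> x *\<^sub>R \<phi>' x) + ennreal (B\<^sup>2 / (1 - c))"
    by (simp add: nrm2_phi)
  \<comment> \<open>The compactly supported weight is bounded, so the weighted norm is finite and
    may be subtracted from both sides.\<close>
  have "kern (2 * L) \<zeta>" using sm z2 by (simp add: kern_def)
  then obtain Z where Z: "\<And>x. norm (\<zeta> x) \<le> Z" using kern_bounded by blast
  have "nrm2 (\<lambda>x. \<zeta> x *\<^sub>R \<phi>' x) \<le> (\<integral>\<^sup>+x. ennreal (Z\<^sup>2) * ennreal ((norm (\<phi>' x))\<^sup>2) \<partial>lborel)"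
    using Z by (intro nn_integral_mono)
      (auto simp flip: ennreal_mult simp: power_mult_distrib[symmetric] intro!: ennreal_leI power_mono mult_right_mono)
  also have "\<dots> = ennreal (Z\<^sup>2)" by (subst nn_integral_cmult) (auto simp: nrm2_phi)
  finally have "nrm2 (\<lambda>x. \<zeta> x *\<^sub>R \<phi>' x) < \<infinity>" by (rule order_le_less_trans) simp
  then obtain n where n: "nrm2 (\<lambda>x. \<zeta> x *\<^sub>R \<phi>' x) = ennreal n" "n \<ge> 0" by (cases "nrm2 (\<lambda>x. \<zeta> x *\<^sub>R \<phi>' x)") auto
  have "ennreal n \<le> ennreal (c * n + B\<^sup>2 / (1 - c))"
    using main n(2) c(2) c0(2) unfolding n(1) by (simp add: ennreal_mult)
  then have "n \<le> c * n + B\<^sup>2 / (1 - c)" using c(2) c0(2) n(2) by (subst (asm) ennreal_le_iff) auto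
  then have "(1 - c) * n \<le> B\<^sup>2 / (1 - c)" by (simp add: algebra_simps)
  then have "n * (1 - c) \<le> B\<^sup>2 / (1 - c)" by (simp only: mult.commute)
  then have "n \<le> B\<^sup>2 / (1 - c) / (1 - c)" using c(2) by (subst pos_le_divide_eq) simp_all
  then have "n \<le> (B / (1 - c))\<^sup>2" by (simp add: power2_eq_square)
  then show ?thesis using n(1) unfolding \<zeta>_def B_def by (simp add: ennreal_leI)
qed

lemma exp_bound:
  assumes a: "0 < a" and c: "c = sqrt (lam\<^sup>2 + a\<^sup>2) + \<epsilon>" "c < 1" and r: "r > 0"
    and \<epsilon>: "\<epsilon> > 0" "\<And>x. norm x \<ge> r \<Longrightarrow> mat_norm (V x) \<le> \<epsilon>"
    and st: "\<And>t. (step has_real_derivative step' t) (at t)" "\<And>t. \<bar>step' t\<bar> \<le> K" 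
      "\<And>t. t \<le> 0 \<or> t \<ge> 1 \<Longrightarrow> step' t = 0" "K > 0"
  shows "nrm2 (\<lambda>x. exp (a * norm x) *\<^sub>R \<phi>' x) \<le> ennreal (((K * exp (a * (r + 2)) + 1) / (1 - c))\<^sup>2 + (exp (a * (r + 2)))\<^sup>2)"
proof -
  \<comment> \<open>With damping \<open>1 / Suc n\<close> the exponential is at most
    \<open>exp (a * Suc n)\<close>, which dictates the second summand of the outer radius; the
    summand \<open>Suc n\<close> makes the radius exceed any given \<open>bracket x\<close>
    eventually.\<close>
  define \<zeta> where "\<zeta> n x = weight a (1 + r) (1 / Suc n) (Suc n + K * exp (a * Suc n)) (bracket x)" for n x
  define f where "f x = step (bracket x - (1 + r)) * exp (a * bracket x)" for x
  have [measurable]: "\<zeta> n \<in> borel_measurable borel" for n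
    unfolding \<zeta>_def[abs_def] by (rule smth_measurable[OF smth_weight]) simp
  have [measurable]: "bracket \<in> borel_measurable borel" by (rule smth_measurable[OF smth_bracket])
  have bound: "nrm2 (\<lambda>x. \<zeta> n x *\<^sub>R \<phi>' x) \<le> ennreal (((K * exp (a * (r + 2)) + 1) / (1 - c))\<^sup>2)" for n
    unfolding \<zeta>_def by (rule weighted_bound[OF a c r \<epsilon> st]) (use st(4) in \<open>auto intro: add_pos_pos\<close>)
  have lim: "(\<lambda>n. \<zeta> n x) \<longlonglongrightarrow> f x" for x
  proof -
    have "(\<lambda>n. 1 + 1 / real (Suc n) * bracket x) \<longlonglongrightarrow> 1 + 0 * bracket x"
      by (intro tendsto_intros) (rule LIMSEQ_Suc[OF lim_1_over_n])
    then have "(\<lambda>n. inverse (1 + 1 / real (Suc n) * bracket x)) \<longlonglongrightarrow> inverse (1 + 0 * bracket x)"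
      by (rule tendsto_inverse) simp
    then have "(\<lambda>n. exp (a * bracket x * inverse (1 + 1 / real (Suc n) * bracket x))) \<longlonglongrightarrow> exp (a * bracket x * inverse (1 + 0 * bracket x))"
      by (intro tendsto_exp tendsto_mult[OF tendsto_const])
    moreover have "(\<lambda>n. step (2 - bracket x / (Suc n + K * exp (a * Suc n)))) \<longlonglongrightarrow> 1"
    proof (rule tendsto_eventually)
      obtain N :: nat where N: "bracket x \<le> real N" using real_arch_simple by blast
      show "\<forall>\<^sub>F n in sequentially. step (2 - bracket x / (Suc n + K * exp (a * Suc n))) = 1"
        using eventually_ge_at_top[of N]
      proof eventually_elim
        case (elim n)
        have p: "real (Suc n) + K * exp (a * Suc n) > 0" "K * exp (a * Suc n) > 0" using st(4) by (auto intro: add_pos_pos)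
        then have "bracket x \<le> real (Suc n) + K * exp (a * Suc n)" using N elim by simp
        then have "bracket x / (real (Suc n) + K * exp (a * Suc n)) \<le> 1" using p(1) by (simp add: divide_le_eq_1)
        then show ?case by (intro step_1) simp
      qed
    qed
    ultimately have "(\<lambda>n. step (bracket x - (1 + r)) * exp (a * bracket x * inverse (1 + 1 / real (Suc n) * bracket x)) * step (2 - bracket x / (Suc n + K * exp (a * Suc n))))
      \<longlonglongrightarrow> step (bracket x - (1 + r)) * exp (a * bracket x * inverse (1 + 0 * bracket x)) * 1"
      by (intro tendsto_mult tendsto_const)
    then show ?thesis by (simp add: \<zeta>_def weight_def f_def)
  qed
  have "nrm2 (\<lambda>x. f x *\<^sub>R \<phi>' x) = (\<integral>\<^sup>+x. liminf (\<lambda>n. ennreal ((norm (\<zeta> n x *\<^sub>R \<phi>' x))\<^sup>2)) \<partial>lborel)"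
  proof (intro nn_integral_cong)
    fix x
    have "(\<lambda>n. ennreal ((norm (\<zeta> n x *\<^sub>R \<phi>' x))\<^sup>2)) \<longlonglongrightarrow> ennreal ((norm (f x *\<^sub>R \<phi>' x))\<^sup>2)"
      by (intro tendsto_ennrealI tendsto_intros lim)
    then show "ennreal ((norm (f x *\<^sub>R \<phi>' x))\<^sup>2) = liminf (\<lambda>n. ennreal ((norm (\<zeta> n x *\<^sub>R \<phi>' x))\<^sup>2))"
      by (intro lim_imp_Liminf[symmetric] trivial_limit_sequentially)
  qed
  also have "\<dots> \<le> liminf (\<lambda>n. nrm2 (\<lambda>x. \<zeta> n x *\<^sub>R \<phi>' x))" by (rule nn_integral_liminf) simp
  also have "\<dots> \<le> ennreal (((K * exp (a * (r + 2)) + 1) / (1 - c))\<^sup>2)"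
  proof -
    have "liminf (\<lambda>n. nrm2 (\<lambda>x. \<zeta> n x *\<^sub>R \<phi>' x)) \<le> limsup (\<lambda>n. nrm2 (\<lambda>x. \<zeta> n x *\<^sub>R \<phi>' x))"
      by (rule Liminf_le_Limsup) simp
    also have "\<dots> \<le> ennreal (((K * exp (a * (r + 2)) + 1) / (1 - c))\<^sup>2)"
      by (rule Limsup_bounded, rule always_eventually, rule allI, rule bound)
    finally show ?thesis .
  qed
  finally have 1: "nrm2 (\<lambda>x. f x *\<^sub>R \<phi>' x) \<le> ennreal (((K * exp (a * (r + 2)) + 1) / (1 - c))\<^sup>2)" .
  have "nrm2 (\<lambda>x. exp (a * norm x) *\<^sub>R \<phi>' x) \<le> (\<integral>\<^sup>+x. ennreal ((norm (f x *\<^sub>R \<phi>' x))\<^sup>2) + ennreal ((exp (a * (r + 2)))\<^sup>2) * ennreal ((norm (\<phi>' x))\<^sup>2) \<partial>lborel)"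
  proof (intro nn_integral_mono)
    fix x :: point
    \<comment> \<open>Beyond \<open>r + 2\<close> the inner cut-off equals 1; inside, the
      exponential is bounded and the normalisation of the eigenvector takes care of the
      rest.\<close>
    have "(norm (exp (a * norm x) *\<^sub>R \<phi>' x))\<^sup>2 \<le> (norm (f x *\<^sub>R \<phi>' x))\<^sup>2 + (exp (a * (r + 2)))\<^sup>2 * (norm (\<phi>' x))\<^sup>2"
    proof (cases "bracket x \<ge> r + 2")
      case True
      then have "f x = exp (a * bracket x)" by (simp add: f_def step_1)
      then have "norm (exp (a * norm x) *\<^sub>R \<phi>' x) \<le> norm (f x *\<^sub>R \<phi>' x)"
        using norm_le_bracket[of x] a by (simp add: mult_right_mono)
      then have "(norm (exp (a * norm x) *\<^sub>R \<phi>' x))\<^sup>2 \<le> (norm (f x *\<^sub>R \<phi>' x))\<^sup>2" by (intro power_mono) auto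
      then show ?thesis by (simp add: add_increasing2)
    next
      case False
      then have "exp (a * norm x) \<le> exp (a * (r + 2))" using norm_le_bracket[of x] a by simp
      then have "norm (exp (a * norm x) *\<^sub>R \<phi>' x) \<le> exp (a * (r + 2)) * norm (\<phi>' x)" by (simp add: mult_right_mono)
      then have "(norm (exp (a * norm x) *\<^sub>R \<phi>' x))\<^sup>2 \<le> (exp (a * (r + 2)) * norm (\<phi>' x))\<^sup>2" by (intro power_mono) auto
      then show ?thesis by (simp add: add_increasing power_mult_distrib)
    qed
    then show "ennreal ((norm (exp (a * norm x) *\<^sub>R \<phi>' x))\<^sup>2) \<le> ennreal ((norm (f x *\<^sub>R \<phi>' x))\<^sup>2) + ennreal ((exp (a * (r + 2)))\<^sup>2) * ennreal ((norm (\<phi>' x))\<^sup>2)"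
      by (simp flip: ennreal_mult ennreal_plus add: ennreal_leI)
  qed
  also have "\<dots> = nrm2 (\<lambda>x. f x *\<^sub>R \<phi>' x) + ennreal ((exp (a * (r + 2)))\<^sup>2) * nrm2 \<phi>'"
  proof -
    have [measurable]: "f \<in> borel_measurable borel"
      unfolding f_def[abs_def] by (rule smth_measurable) 
        (intro smth_mult smth_step smth_diff smth_exp smth_const smth_bracket; simp)
    show ?thesis by (subst nn_integral_add) (simp_all add: nn_integral_cmult)
  qed
  also have "\<dots> \<le> ennreal (((K * exp (a * (r + 2)) + 1) / (1 - c))\<^sup>2) + ennreal ((exp (a * (r + 2)))\<^sup>2)"
    using 1 by (simp add: nrm2_phi add_right_mono)
  also have "\<dots> = ennreal (((K * exp (a * (r + 2)) + 1) / (1 - c))\<^sup>2 + (exp (a * (r + 2)))\<^sup>2)" by simp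
  finally show ?thesis .
qed

end

text \<open>All choices precede A, the operator and the eigenvector: \<open>\<epsilon>\<close> is
  half the gap between \<open>sqrt (lam\<^sup>2 + a\<^sup>2)\<close> and 1, and \<open>r\<close> is
  the radius beyond which V stays below \<open>\<epsilon>\<close>. This is what makes the constant
  uniform in A.\<close>

theorem exponential_decay_L2:
  assumes pot: "potential_hyp V" and lam: "-1 < lam" "lam < 1" and a: "0 < a" "a < sqrt (1 - lam\<^sup>2)"
  shows "\<exists>C>0. \<forall>A Ddom Dop \<phi> \<phi>' A' V'. dirac_eigenvector V A Ddom Dop lam \<phi> \<phi>' A' V' \<longrightarrow>
     nrm2 (\<lambda>x. exp (a * norm x) *\<^sub>R \<phi>' x) \<le> ennreal (C\<^sup>2)"
proof -
  obtain step' K where st: "\<And>t. (step has_real_derivative step' t) (at t)" "\<And>t. \<bar>step' t\<bar> \<le> K"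
    "\<And>t. t \<le> 0 \<or> t \<ge> 1 \<Longrightarrow> step' t = 0" "K > 0" using step_DERIV_bounded by metis
  have "a\<^sup>2 < (sqrt (1 - lam\<^sup>2))\<^sup>2" using a by (intro power_strict_mono) auto
  moreover have "lam\<^sup>2 < 1" using lam abs_square_less_1[of lam] by (simp add: abs_less_iff)
  ultimately have "lam\<^sup>2 + a\<^sup>2 < 1" by simp
  then have \<kappa>: "sqrt (lam\<^sup>2 + a\<^sup>2) < 1" by (simp add: real_sqrt_lt_1_iff)
  define \<epsilon> where "\<epsilon> = (1 - sqrt (lam\<^sup>2 + a\<^sup>2)) / 2"
  have \<epsilon>: "\<epsilon> > 0" unfolding \<epsilon>_def using \<kappa> by (intro divide_pos_pos) (simp_all only: diff_gt_0_iff_gt zero_less_numeral)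
  define c where "c = sqrt (lam\<^sup>2 + a\<^sup>2) + \<epsilon>"
  have "s + (1 - s) / 2 < 1" if "s < 1" for s :: real using that by (simp add: field_simps)
  then have c: "c < 1" unfolding c_def \<epsilon>_def using \<kappa> by blast
  have "((\<lambda>x. mat_norm (V x)) \<longlongrightarrow> 0) at_infinity" using pot by (simp add: potential_hyp_def)
  then have "\<forall>\<^sub>F x in at_infinity. mat_norm (V x) < \<epsilon>" using \<epsilon> by (rule order_tendstoD)
  then obtain b where b: "\<And>x. norm x \<ge> b \<Longrightarrow> mat_norm (V x) < \<epsilon>" by (auto simp: eventually_at_infinity)
  define r where "r = max b 1"
  have r: "r > 0" "\<And>x. norm x \<ge> r \<Longrightarrow> mat_norm (V x) \<le> \<epsilon>" using b by (auto simp: r_def less_imp_le)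
  let ?Q = "((K * exp (a * (r + 2)) + 1) / (1 - c))\<^sup>2 + (exp (a * (r + 2)))\<^sup>2"
  have Q: "?Q > 0" by (simp add: add_nonneg_pos)
  show ?thesis
  proof (intro exI[of _ "sqrt ?Q"] conjI allI impI)
    show "sqrt ?Q > 0" using Q by simp
    fix A Ddom Dop \<phi> \<phi>' A' V' assume "dirac_eigenvector V A Ddom Dop lam \<phi> \<phi>' A' V'"
    then interpret dirac_eigenvector V A Ddom Dop lam \<phi> \<phi>' A' V' .
    have "(sqrt ?Q)\<^sup>2 = ?Q" by (rule real_sqrt_pow2) (use Q in simp)
    then show "nrm2 (\<lambda>x. exp (a * norm x) *\<^sub>R \<phi>' x) \<le> ennreal ((sqrt ?Q)\<^sup>2)"
      using exp_bound[OF a(1) c_def c r(1) \<epsilon> r(2) st] by simp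
  qed
qed

section \<open>Pointwise decay of the derivatives\<close>

text \<open>Comparing boxes identifies Lebesgue measure on \<open>real^3\<close> with a triple
  product, so that the three line integrals of the Sobolev inequality combine into one volume
  integral.\<close>

lemma lborel_vec3:
  "distr (lborel \<Otimes>\<^sub>M (lborel \<Otimes>\<^sub>M lborel)) borel (\<lambda>(a, b, c). a *\<^sub>R axis 1 1 + b *\<^sub>R axis 2 1 + c *\<^sub>R axis 3 1)
    = (lborel :: point measure)" (is "distr ?M borel ?f = _")
proof (rule lborel_eqI[symmetric])
  have nth: "(a *\<^sub>R axis 1 1 + b *\<^sub>R axis 2 1 + c *\<^sub>R axis 3 1 :: point) $ 1 = a"
    "(a *\<^sub>R axis 1 1 + b *\<^sub>R axis 2 1 + c *\<^sub>R axis 3 1 :: point) $ 2 = b"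
    "(a *\<^sub>R axis 1 1 + b *\<^sub>R axis 2 1 + c *\<^sub>R axis 3 1 :: point) $ 3 = c" for a b c
    by (simp_all add: axis_def)
  have m[measurable]: "?f \<in> measurable ?M borel" by measurable
  fix l u :: point assume lu: "\<And>b. b \<in> Basis \<Longrightarrow> l \<bullet> b \<le> u \<bullet> b"
  have le: "l $ k \<le> u $ k" for k using lu[of "axis k 1"] by (simp add: inner_axis)
  have box: "x \<in> box l u \<longleftrightarrow> (\<forall>k. l $ k < x $ k \<and> x $ k < u $ k)" for x by (simp add: mem_box_cart)
  have pre: "?f -` box l u \<inter> space ?M = {l $ 1<..<u $ 1} \<times> ({l $ 2<..<u $ 2} \<times> {l $ 3<..<u $ 3})"
    by (auto simp: box forall_3 axis_def space_pair_measure)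
  have p2: "emeasure (lborel \<Otimes>\<^sub>M lborel) ({l $ 2<..<u $ 2} \<times> {l $ 3<..<u $ 3}) = ennreal ((u $ 2 - l $ 2) * (u $ 3 - l $ 3))"
    using le[of 2] le[of 3] by (subst lborel.emeasure_pair_measure_Times) (auto simp: ennreal_mult)
  have "emeasure (distr ?M borel ?f) (box l u) = emeasure ?M ({l $ 1<..<u $ 1} \<times> ({l $ 2<..<u $ 2} \<times> {l $ 3<..<u $ 3}))"
    unfolding pre[symmetric] by (rule emeasure_distr[OF m]) simp
  also have "\<dots> = emeasure lborel {l $ 1<..<u $ 1} * emeasure (lborel \<Otimes>\<^sub>M lborel) ({l $ 2<..<u $ 2} \<times> {l $ 3<..<u $ 3})"
  proof -
    have "sigma_finite_measure (lborel \<Otimes>\<^sub>M lborel :: (real \<times> real) measure)"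
      unfolding lborel_prod by (rule sigma_finite_lborel)
    then show ?thesis by (rule sigma_finite_measure.emeasure_pair_measure_Times) auto
  qed
  also have "\<dots> = ennreal ((u $ 1 - l $ 1) * ((u $ 2 - l $ 2) * (u $ 3 - l $ 3)))"
    using le[of 1] le[of 2] le[of 3] unfolding p2 by (simp add: ennreal_mult)
  also have "(u $ 1 - l $ 1) * ((u $ 2 - l $ 2) * (u $ 3 - l $ 3)) = (\<Prod>k\<in>UNIV. (u - l) $ k)"
    unfolding UNIV_3 by simp
  also have "\<dots> = (\<Prod>b\<in>Basis. (u - l) \<bullet> b)"
  proof -
    have B: "Basis = range (\<lambda>k. axis k (1::real) :: point)" by (auto simp: Basis_vec_def)
    have "inj (\<lambda>k. axis k (1::real) :: point)" by (auto simp: inj_def axis_eq_axis)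
    then show ?thesis unfolding B by (simp add: prod.reindex inner_axis)
  qed
  finally show "emeasure (distr ?M borel ?f) (box l u) = ennreal (\<Prod>b\<in>Basis. (u - l) \<bullet> b)" .
qed simp

lemma nn_integral_vec3:
  assumes [measurable]: "G \<in> borel_measurable borel"
  shows "(\<integral>\<^sup>+c. \<integral>\<^sup>+b. \<integral>\<^sup>+a. G (a *\<^sub>R axis 1 1 + b *\<^sub>R axis 2 1 + c *\<^sub>R axis 3 1) \<partial>lborel \<partial>lborel \<partial>lborel)
    = (\<integral>\<^sup>+y. G (y :: point) \<partial>lborel)"
proof -
  interpret p: sigma_finite_measure "lborel \<Otimes>\<^sub>M lborel :: (real \<times> real) measure"
    unfolding lborel_prod by (rule sigma_finite_lborel)
  interpret q: pair_sigma_finite "lborel :: real measure" "lborel \<Otimes>\<^sub>M lborel :: (real \<times> real) measure" ..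
  let ?g = "\<lambda>a b c. G (a *\<^sub>R axis 1 1 + b *\<^sub>R axis 2 1 + c *\<^sub>R axis 3 1)"
  have "(\<integral>\<^sup>+y. G y \<partial>lborel) = (\<integral>\<^sup>+z. (case z of (a, b, c) \<Rightarrow> ?g a b c) \<partial>(lborel \<Otimes>\<^sub>M (lborel \<Otimes>\<^sub>M lborel)))"
  proof -
    have "(\<integral>\<^sup>+y. G y \<partial>lborel) = (\<integral>\<^sup>+z. G (case z of (a, b, c) \<Rightarrow> a *\<^sub>R axis 1 1 + b *\<^sub>R axis 2 1 + c *\<^sub>R axis 3 1) \<partial>(lborel \<Otimes>\<^sub>M (lborel \<Otimes>\<^sub>M lborel)))"
      by (subst lborel_vec3[symmetric], rule nn_integral_distr) measurable
    also have "\<dots> = (\<integral>\<^sup>+z. (case z of (a, b, c) \<Rightarrow> ?g a b c) \<partial>(lborel \<Otimes>\<^sub>M (lborel \<Otimes>\<^sub>M lborel)))"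
      by (intro nn_integral_cong) (simp split: prod.split)
    finally show ?thesis .
  qed
  also have "\<dots> = (\<integral>\<^sup>+bc. \<integral>\<^sup>+a. (case bc of (b, c) \<Rightarrow> ?g a b c) \<partial>lborel \<partial>(lborel \<Otimes>\<^sub>M lborel))"
    by (subst q.nn_integral_snd[symmetric]) (auto simp: split_beta)
  also have "\<dots> = (\<integral>\<^sup>+c. \<integral>\<^sup>+b. \<integral>\<^sup>+a. ?g a b c \<partial>lborel \<partial>lborel \<partial>lborel)"
    by (subst lborel_pair.nn_integral_snd[symmetric]) (auto simp: split_beta)
  finally show ?thesis ..
qed

lemma kern_line_bound:
  fixes u :: "point \<Rightarrow> 'b::euclidean_space"
  assumes u: "kern R u"
  shows "ennreal (norm (u x)) \<le> (\<integral>\<^sup>+t. ennreal (norm (pdiff k u (x + t *\<^sub>R axis k 1))) \<partial>lborel)"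
proof -
  \<comment> \<open>Far enough that the starting point of the segment lies outside the support,
    where \<open>u\<close> vanishes.\<close>
  define T where "T = \<bar>R\<bar> + norm x + 1"
  have T: "T \<ge> 0" by (simp add: T_def)
  let ?v = "\<lambda>t. u (x + t *\<^sub>R axis k 1)" and ?d = "\<lambda>t. pdiff k u (x + t *\<^sub>R axis k 1)"
  have cont: "continuous_on UNIV (pdiff k u)" using kern_pdiff[OF u] by (auto simp: kern_def intro: smth_continuous)
  have cd: "continuous_on UNIV ?d" by (rule continuous_on_compose2[OF cont]) (auto intro!: continuous_intros)
  have "(\<integral>t. indicator {-T..0} t *\<^sub>R ?d t \<partial>lborel) = ?v 0 - ?v (- T)"
  proof (rule integral_FTC_Icc)
    show "(?v has_vector_derivative ?d t) (at t within {-T..0})" for t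
      by (rule has_vector_derivative_at_within[OF has_pd_line[OF kern_pd[OF u]]])
    show "continuous_on {-T..0} ?d" using cd by (rule continuous_on_subset) simp
  qed (use T in simp)
  also have "?v (- T) = 0"
  proof -
    have "norm (x + (- T) *\<^sub>R axis k 1) \<ge> T - norm x"
      using norm_triangle_ineq2[of "(- T) *\<^sub>R axis k 1 :: point" "- x"] T by (simp add: add.commute)
    then have "norm (x + (- T) *\<^sub>R axis k 1) > R" by (simp add: T_def)
    then show ?thesis using u by (simp add: kern_def)
  qed
  finally have eq: "u x = (\<integral>t. indicator {-T..0} t *\<^sub>R ?d t \<partial>lborel)" by simp
  have "integrable lborel (\<lambda>t. indicator {-T..0} t *\<^sub>R ?d t)"
    by (rule borel_integrable_compact) (use cd in \<open>auto intro: continuous_on_subset\<close>)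
  then have "ennreal (norm (u x)) \<le> (\<integral>\<^sup>+t. ennreal (norm (indicator {-T..0} t *\<^sub>R ?d t)) \<partial>lborel)"
    unfolding eq by (rule integral_norm_bound_ennreal)
  also have "\<dots> \<le> (\<integral>\<^sup>+t. ennreal (norm (?d t)) \<partial>lborel)"
    by (intro nn_integral_mono) (auto simp: indicator_def)
  finally show ?thesis .
qed

text \<open>The line bound is applied in the three directions in turn, each time to the derivative
  left under the integral. The three line integrals together range over all of space.\<close>

lemma sobolev_pointwise:
  fixes u :: "point \<Rightarrow> 'b::euclidean_space"
  assumes u: "kern R u"
  shows "ennreal (norm (u x)) \<le> (\<integral>\<^sup>+y. ennreal (norm (pds [1,2,3] u y)) \<partial>lborel)"
proof -
  let ?g = "pds [1,2,3] u"
  have [measurable]: "?g \<in> borel_measurable borel" by (rule kern_measurable[OF kern_pds[OF u]])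
  have "ennreal (norm (u x)) \<le> (\<integral>\<^sup>+c. ennreal (norm (pds [3] u (x + c *\<^sub>R axis 3 1))) \<partial>lborel)"
    using kern_line_bound[OF u, of x 3] by simp
  also have "\<dots> \<le> (\<integral>\<^sup>+c. \<integral>\<^sup>+b. ennreal (norm (pds [2,3] u (x + c *\<^sub>R axis 3 1 + b *\<^sub>R axis 2 1))) \<partial>lborel \<partial>lborel)"
    using kern_line_bound[OF kern_pds[OF u, of "[3]"], of _ 2] by (intro nn_integral_mono) simp
  also have "\<dots> \<le> (\<integral>\<^sup>+c. \<integral>\<^sup>+b. \<integral>\<^sup>+a. ennreal (norm (?g (x + c *\<^sub>R axis 3 1 + b *\<^sub>R axis 2 1 + a *\<^sub>R axis 1 1))) \<partial>lborel \<partial>lborel \<partial>lborel)"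
    using kern_line_bound[OF kern_pds[OF u, of "[2,3]"], of _ 1] by (intro nn_integral_mono) simp
  also have "\<dots> = (\<integral>\<^sup>+c. \<integral>\<^sup>+b. \<integral>\<^sup>+a. ennreal (norm (?g (x + (a *\<^sub>R axis 1 1 + b *\<^sub>R axis 2 1 + c *\<^sub>R axis 3 1)))) \<partial>lborel \<partial>lborel \<partial>lborel)"
    by (simp add: ac_simps)
  also have "\<dots> = (\<integral>\<^sup>+y. ennreal (norm (?g (x + y))) \<partial>lborel)"
    by (rule nn_integral_vec3[of "\<lambda>y. ennreal (norm (?g (x + y)))"]) measurable
  also have "\<dots> = (\<integral>\<^sup>+y. ennreal (norm (?g (x - y))) \<partial>lborel)"
  proof -
    have m: "(\<lambda>y. ennreal (norm (?g (x + y)))) \<in> borel_measurable borel" by measurable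
    show ?thesis using nn_integral_lborel_reflect[OF m, of 0] by simp
  qed
  also have "\<dots> = (\<integral>\<^sup>+y. ennreal (norm (?g y)) \<partial>lborel)"
    by (rule nn_integral_lborel_reflect) measurable
  finally show ?thesis .
qed

text \<open>The radius \<open>s\<close>, the constant and the threshold may depend on
  \<open>a\<close> and \<open>r\<close>, but not on \<open>x\<close> or on the index. All rates
  below \<open>a0\<close> are required at once, so that subexponential factors can be absorbed.
  Small indices are excluded because the mollification radius must be small compared with
  \<open>r\<close>. The rate is doubled because the norm is squared.\<close>

definition decay0 :: "real \<Rightarrow> (nat \<Rightarrow> point \<Rightarrow> 'b::euclidean_space) \<Rightarrow> bool" where
  "decay0 a0 F \<longleftrightarrow> (\<forall>a r. 0 < a \<and> a < a0 \<and> 0 < r \<longrightarrow> (\<exists>s>0. \<exists>C\<ge>0. \<exists>N. \<forall>n\<ge>N. \<forall>x. r \<le> norm x \<longrightarrow>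
     (\<integral>\<^sup>+y\<in>cball x s. ennreal ((norm (F n y))\<^sup>2) \<partial>lborel) \<le> ennreal (C * exp (- 2 * a * norm x))))"

lemma decay0_D:
  assumes "decay0 a0 F" "0 < a" "a < a0" "0 < r"
  obtains s C N where "s > 0" "C \<ge> 0" "\<And>n x. n \<ge> N \<Longrightarrow> r \<le> norm x \<Longrightarrow>
     (\<integral>\<^sup>+y\<in>cball x s. ennreal ((norm (F n y))\<^sup>2) \<partial>lborel) \<le> ennreal (C * exp (- 2 * a * norm x))"
proof -
  from assms have "\<exists>s>0. \<exists>C\<ge>0. \<exists>N. \<forall>n\<ge>N. \<forall>x. r \<le> norm x \<longrightarrow>
     (\<integral>\<^sup>+y\<in>cball x s. ennreal ((norm (F n y))\<^sup>2) \<partial>lborel) \<le> ennreal (C * exp (- 2 * a * norm x))"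
    unfolding decay0_def by blast
  then show thesis using that by blast
qed

lemma decay0_I:
  assumes "\<And>a r. 0 < a \<Longrightarrow> a < a0 \<Longrightarrow> 0 < r \<Longrightarrow> \<exists>s>0. \<exists>C\<ge>0. \<exists>N. \<forall>n\<ge>N. \<forall>x. r \<le> norm x \<longrightarrow>
     (\<integral>\<^sup>+y\<in>cball x s. ennreal ((norm (F n y))\<^sup>2) \<partial>lborel) \<le> ennreal (C * exp (- 2 * a * norm x))"
  shows "decay0 a0 F"
  unfolding decay0_def by (intro allI impI, elim conjE) (rule assms)

lemma decay0_witness:
  assumes "s > 0" "C \<ge> 0" "\<And>n x. N \<le> n \<Longrightarrow> r \<le> norm x \<Longrightarrow>
     (\<integral>\<^sup>+y\<in>cball x s. ennreal ((norm (F n y))\<^sup>2) \<partial>lborel) \<le> ennreal (C * exp (- 2 * a * norm x))"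
  shows "\<exists>s>0. \<exists>C\<ge>0. \<exists>N. \<forall>n\<ge>N. \<forall>x. r \<le> norm (x::point) \<longrightarrow>
     (\<integral>\<^sup>+y\<in>cball x s. ennreal ((norm (F n y))\<^sup>2) \<partial>lborel) \<le> ennreal (C * exp (- 2 * a * norm x))"
  using assms by blast

lemma nn_integral_cball_mono:
  assumes "s \<le> s'" shows "(\<integral>\<^sup>+y\<in>cball x s. g y \<partial>lborel) \<le> (\<integral>\<^sup>+y\<in>cball (x::point) s'. g y \<partial>lborel)"
  using assms by (intro nn_integral_mono) (auto simp: indicator_def)

lemma decay0_add:
  assumes [measurable]: "\<And>n. F n \<in> borel_measurable borel" "\<And>n. G n \<in> borel_measurable borel"
    and F: "decay0 a0 F" and G: "decay0 a0 G"
  shows "decay0 a0 (\<lambda>n x. F n x + G n x)"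
proof (rule decay0_I)
  fix a r :: real assume ar: "0 < a" "a < a0" "0 < r"
  obtain s1 C1 N1 where 1: "s1 > 0" "C1 \<ge> 0" "\<And>n x. n \<ge> N1 \<Longrightarrow> r \<le> norm x \<Longrightarrow>
     (\<integral>\<^sup>+y\<in>cball x s1. ennreal ((norm (F n y))\<^sup>2) \<partial>lborel) \<le> ennreal (C1 * exp (- 2 * a * norm x))"
    using decay0_D[OF F ar] by blast
  obtain s2 C2 N2 where 2: "s2 > 0" "C2 \<ge> 0" "\<And>n x. n \<ge> N2 \<Longrightarrow> r \<le> norm x \<Longrightarrow>
     (\<integral>\<^sup>+y\<in>cball x s2. ennreal ((norm (G n y))\<^sup>2) \<partial>lborel) \<le> ennreal (C2 * exp (- 2 * a * norm x))"
    using decay0_D[OF G ar] by blast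
  show "\<exists>s>0. \<exists>C\<ge>0. \<exists>N. \<forall>n\<ge>N. \<forall>x. r \<le> norm x \<longrightarrow>
     (\<integral>\<^sup>+y\<in>cball x s. ennreal ((norm (F n y + G n y))\<^sup>2) \<partial>lborel) \<le> ennreal (C * exp (- 2 * a * norm x))"
  proof (rule decay0_witness[where s="min s1 s2" and C="2 * C1 + 2 * C2" and N="max N1 N2"])
    fix n x assume n: "n \<ge> max N1 N2" and x: "r \<le> norm (x::point)"
    let ?s = "min s1 s2" and ?e = "exp (- 2 * a * norm x)"
    have "(\<integral>\<^sup>+y\<in>cball x ?s. ennreal ((norm (F n y + G n y))\<^sup>2) \<partial>lborel) \<le>
      (\<integral>\<^sup>+y. ennreal 2 * (ennreal ((norm (F n y))\<^sup>2) * indicator (cball x ?s) y) + ennreal 2 * (ennreal ((norm (G n y))\<^sup>2) * indicator (cball x ?s) y) \<partial>lborel)"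
    proof (intro nn_integral_mono)
      fix y
      have "(norm (F n y + G n y))\<^sup>2 \<le> (norm (F n y) + norm (G n y))\<^sup>2" by (intro power_mono norm_triangle_ineq) simp
      also have "\<dots> \<le> 2 * (norm (F n y))\<^sup>2 + 2 * (norm (G n y))\<^sup>2"
        using sum_squares_bound[of "norm (F n y)" "norm (G n y)"] by (simp add: power2_sum)
      finally have "ennreal ((norm (F n y + G n y))\<^sup>2) \<le> ennreal 2 * ennreal ((norm (F n y))\<^sup>2) + ennreal 2 * ennreal ((norm (G n y))\<^sup>2)"
        by (subst ennreal_lincomb) (auto intro: ennreal_leI simp del: ennreal_plus)
      then show "ennreal ((norm (F n y + G n y))\<^sup>2) * indicator (cball x ?s) y \<le> ennreal 2 * (ennreal ((norm (F n y))\<^sup>2) * indicator (cball x ?s) y) + ennreal 2 * (ennreal ((norm (G n y))\<^sup>2) * indicator (cball x ?s) y)"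
        by (cases "y \<in> cball x ?s") auto
    qed
    also have "\<dots> = ennreal 2 * (\<integral>\<^sup>+y\<in>cball x ?s. ennreal ((norm (F n y))\<^sup>2) \<partial>lborel) + ennreal 2 * (\<integral>\<^sup>+y\<in>cball x ?s. ennreal ((norm (G n y))\<^sup>2) \<partial>lborel)"
      by (subst nn_integral_add, measurable, subst nn_integral_cmult, measurable, subst nn_integral_cmult, measurable)
    also have "\<dots> \<le> ennreal 2 * ennreal (C1 * ?e) + ennreal 2 * ennreal (C2 * ?e)"
      by (intro add_mono mult_left_mono order_trans[OF nn_integral_cball_mono 1(3)] order_trans[OF nn_integral_cball_mono 2(3)]) (use n x in auto)
    also have "\<dots> = ennreal ((2 * C1 + 2 * C2) * ?e)"
      using 1(2) 2(2) by (subst ennreal_lincomb) (auto simp: algebra_simps)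
    finally show "(\<integral>\<^sup>+y\<in>cball x ?s. ennreal ((norm (F n y + G n y))\<^sup>2) \<partial>lborel) \<le> ennreal ((2 * C1 + 2 * C2) * ?e)" .
  qed (use 1 2 in auto)
qed

text \<open>The growth of \<open>w\<close> is paid for with a part of the rate: the hypothesis is
  used at \<open>a + \<epsilon>\<close>, where \<open>\<epsilon>\<close> is half the gap
  \<open>a0 - a\<close>. On a ball of radius \<open>s\<close> the values of
  \<open>exp (\<epsilon> * norm y)\<close> are comparable to the value at the centre.\<close>

lemma decay0_mono:
  assumes F: "decay0 a0 F" and le: "\<And>n y. norm (G n y) \<le> w y * norm (F n y)"
    and w: "\<And>\<epsilon>. \<epsilon> > 0 \<Longrightarrow> \<exists>K. \<forall>y. w y \<le> K * exp (\<epsilon> * norm y)"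
    and [measurable]: "\<And>n. F n \<in> borel_measurable borel"
  shows "decay0 a0 G"
proof (rule decay0_I)
  fix a r :: real assume ar: "0 < a" "a < a0" "0 < r"
  define \<epsilon> where "\<epsilon> = (a0 - a) / 2"
  have \<epsilon>: "\<epsilon> > 0" "a + \<epsilon> < a0" using ar by (auto simp: \<epsilon>_def field_simps)
  obtain K where K: "\<And>y. w y \<le> K * exp (\<epsilon> * norm y)" using w[OF \<epsilon>(1)] by blast
  obtain s C N where 1: "s > 0" "C \<ge> 0" "\<And>n x. n \<ge> N \<Longrightarrow> r \<le> norm x \<Longrightarrow>
     (\<integral>\<^sup>+y\<in>cball x s. ennreal ((norm (F n y))\<^sup>2) \<partial>lborel) \<le> ennreal (C * exp (- 2 * (a + \<epsilon>) * norm x))"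
    using decay0_D[OF F, of "a + \<epsilon>" r] ar \<epsilon> by auto
  define D where "D = (\<bar>K\<bar> * exp (\<epsilon> * s))\<^sup>2"
  show "\<exists>s>0. \<exists>C\<ge>0. \<exists>N. \<forall>n\<ge>N. \<forall>x. r \<le> norm x \<longrightarrow>
     (\<integral>\<^sup>+y\<in>cball x s. ennreal ((norm (G n y))\<^sup>2) \<partial>lborel) \<le> ennreal (C * exp (- 2 * a * norm x))"
  proof (rule decay0_witness[where s=s and C="D * C" and N=N])
    fix n x assume n: "n \<ge> N" and x: "r \<le> norm (x::point)"
    let ?E = "(exp (\<epsilon> * norm x))\<^sup>2"
    have "(\<integral>\<^sup>+y\<in>cball x s. ennreal ((norm (G n y))\<^sup>2) \<partial>lborel) \<le> (\<integral>\<^sup>+y. ennreal (D * ?E) * (ennreal ((norm (F n y))\<^sup>2) * indicator (cball x s) y) \<partial>lborel)"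
    proof (intro nn_integral_mono)
      fix y
      show "ennreal ((norm (G n y))\<^sup>2) * indicator (cball x s) y \<le> ennreal (D * ?E) * (ennreal ((norm (F n y))\<^sup>2) * indicator (cball x s) y)"
      proof (cases "y \<in> cball x s")
        case True
        then have y: "norm y \<le> norm x + s" using norm_triangle_ineq2[of y x] by (simp add: dist_norm norm_minus_commute)
        have "w y \<le> \<bar>K\<bar> * exp (\<epsilon> * norm y)" using K[of y] by (rule order_trans) (simp add: mult_right_mono)
        also have "\<dots> \<le> \<bar>K\<bar> * exp (\<epsilon> * (norm x + s))" using y \<epsilon> by (intro mult_left_mono) auto
        also have "\<dots> = \<bar>K\<bar> * exp (\<epsilon> * s) * exp (\<epsilon> * norm x)" by (simp add: distrib_left exp_add)
        finally have "norm (G n y) \<le> \<bar>K\<bar> * exp (\<epsilon> * s) * exp (\<epsilon> * norm x) * norm (F n y)"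
          by (intro order_trans[OF le mult_right_mono]) auto
        then have "(norm (G n y))\<^sup>2 \<le> (\<bar>K\<bar> * exp (\<epsilon> * s) * exp (\<epsilon> * norm x) * norm (F n y))\<^sup>2" by (rule power_mono) simp
        then have "(norm (G n y))\<^sup>2 \<le> D * ?E * (norm (F n y))\<^sup>2" unfolding D_def by (simp only: power_mult_distrib)
        then have "ennreal ((norm (G n y))\<^sup>2) \<le> ennreal (D * ?E) * ennreal ((norm (F n y))\<^sup>2)"
          by (subst ennreal_mult[symmetric]) (auto simp: D_def intro: ennreal_leI)
        then show ?thesis using True by simp
      qed simp
    qed
    also have "\<dots> = ennreal (D * ?E) * (\<integral>\<^sup>+y\<in>cball x s. ennreal ((norm (F n y))\<^sup>2) \<partial>lborel)"
      by (rule nn_integral_cmult) measurable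
    also have "\<dots> \<le> ennreal (D * ?E) * ennreal (C * exp (- 2 * (a + \<epsilon>) * norm x))"
      by (intro mult_left_mono 1(3) n x) simp
    also have "\<dots> = ennreal (D * C * exp (- 2 * a * norm x))"
    proof -
      have "?E * exp (- 2 * (a + \<epsilon>) * norm x) = exp (- 2 * a * norm x)"
        by (simp add: power2_eq_square exp_add[symmetric] algebra_simps)
      then have "D * ?E * (C * exp (- 2 * (a + \<epsilon>) * norm x)) = D * C * exp (- 2 * a * norm x)"
        by (metis mult.assoc mult.commute)
      moreover have "0 \<le> D * ?E" "0 \<le> C * exp (- 2 * (a + \<epsilon>) * norm x)" using 1(2) by (auto simp: D_def)
      ultimately show ?thesis by (metis ennreal_mult)
    qed
    finally show "(\<integral>\<^sup>+y\<in>cball x s. ennreal ((norm (G n y))\<^sup>2) \<partial>lborel) \<le> ennreal (D * C * exp (- 2 * a * norm x))" .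
  qed (use 1 in \<open>auto simp: D_def\<close>)
qed

lemma decay0_scale:
  assumes "decay0 a0 F" "\<And>n y. norm (G n y) \<le> c * norm (F n y)" "\<And>n. F n \<in> borel_measurable borel"
  shows "decay0 a0 G"
proof (rule decay0_mono[OF assms(1,2) _ assms(3)])
  fix \<epsilon> :: real assume "\<epsilon> > 0"
  then have "c \<le> \<bar>c\<bar> * exp (\<epsilon> * norm y)" for y :: point
    using mult_left_mono[of 1 "exp (\<epsilon> * norm y)" "\<bar>c\<bar>"] by simp
  then show "\<exists>K. \<forall>y::point. c \<le> K * exp (\<epsilon> * norm y)" by blast
qed

definition decay :: "real \<Rightarrow> nat \<Rightarrow> (nat \<Rightarrow> point \<Rightarrow> 'b::euclidean_space) \<Rightarrow> bool" where
  "decay a0 k F \<longleftrightarrow> (\<forall>ks. length ks \<le> k \<longrightarrow> decay0 a0 (\<lambda>n. pds ks (F n)))"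

lemma decay_0: "decay a0 0 F \<longleftrightarrow> decay0 a0 F" by (simp add: decay_def)

text \<open>Words are split at their last letter, the innermost derivative, so that an induction on
  the order can replace \<open>F n\<close> by \<open>pdiff j (F n)\<close>.\<close>

lemma decay_Suc:
  "decay a0 (Suc k) F \<longleftrightarrow> decay0 a0 F \<and> (\<forall>j. decay a0 k (\<lambda>n. pdiff j (F n)))"
proof safe
  assume "decay a0 (Suc k) F"
  then have *: "\<And>ks. length ks \<le> Suc k \<Longrightarrow> decay0 a0 (\<lambda>n. pds ks (F n))" by (simp add: decay_def)
  show "decay0 a0 F" using *[of "[]"] by simp
  show "decay a0 k (\<lambda>n. pdiff j (F n))" for j
    unfolding decay_def using *[of "_ @ [j]"] by (auto simp: pds_append)
next
  assume *: "decay0 a0 F" "\<forall>j. decay a0 k (\<lambda>n. pdiff j (F n))"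
  show "decay a0 (Suc k) F" unfolding decay_def
  proof (intro allI impI)
    fix ks :: "3 list" assume "length ks \<le> Suc k"
    then show "decay0 a0 (\<lambda>n. pds ks (F n))"
      using * by (cases ks rule: rev_cases) (auto simp: decay_def pds_append)
  qed
qed

text \<open>The common form of the two coefficients: the magnetic potential, and the electric
  potential after a cut-off near the origin.\<close>

definition tempered :: "(point \<Rightarrow> 'b::real_normed_vector) \<Rightarrow> bool" where
  "tempered w \<longleftrightarrow> smth UNIV w \<and> (\<forall>ks. \<forall>\<epsilon>>0. \<exists>K. \<forall>y. norm (pds ks w y) \<le> K * exp (\<epsilon> * norm y))"

lemma tempered_pdiff: "tempered w \<Longrightarrow> tempered (pdiff j w)"
  unfolding tempered_def using smth_pdiff[of UNIV w j] pds_append[of _ "[j]" w] by (metis pds.simps)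

lemma decay_add:
  assumes "\<And>n. smth UNIV (F n)" "\<And>n. smth UNIV (G n)" "decay a0 k F" "decay a0 k G"
  shows "decay a0 k (\<lambda>n x. F n x + G n x)"
  using assms
proof (induction k arbitrary: F G)
  case 0
  then show ?case unfolding decay_0 by (intro decay0_add smth_measurable)
next
  case (Suc k)
  have eq: "pdiff j (\<lambda>x. F n x + G n x) = (\<lambda>x. pdiff j (F n) x + pdiff j (G n) x)" for j n
    using has_pd_imp_pdiff[OF has_pd_add[OF smth_has_pd smth_has_pd]] Suc.prems(1,2) by blast
  show ?case unfolding decay_Suc eq
    using Suc.prems unfolding decay_Suc by (intro conjI allI Suc.IH decay0_add smth_measurable smth_pdiff) auto
qed

text \<open>In the product rule a derivative either falls on \<open>F n\<close> and lowers the
  order, or replaces \<open>w\<close> by a derivative, which is again tempered.\<close>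

lemma decay_bilinear:
  fixes h :: "'a::euclidean_space \<Rightarrow> 'b::euclidean_space \<Rightarrow> 'c::euclidean_space"
  assumes h: "bounded_bilinear h"
  shows "tempered w \<Longrightarrow> (\<And>n. smth UNIV (F n)) \<Longrightarrow> decay a0 k F \<Longrightarrow> decay a0 k (\<lambda>n x. h (w x) (F n x))"
proof (induction k arbitrary: w F)
  have base: "decay0 a0 (\<lambda>n x. h (w x) (F n x))"
    if w: "tempered w" and s: "\<And>n. smth UNIV (F n)" and F: "decay0 a0 F" for w F
  proof -
    obtain K where K: "K > 0" "\<And>a b. norm (h a b) \<le> norm a * norm b * K"
      using bounded_bilinear.pos_bounded[OF h] by blast
    show ?thesis
    proof (rule decay0_mono[OF F, where w="\<lambda>y. norm (w y) * K"])
      show "norm (h (w y) (F n y)) \<le> norm (w y) * K * norm (F n y)" for n y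
        using K(2)[of "w y" "F n y"] by (simp add: mult_ac)
      fix \<epsilon> :: real assume "\<epsilon> > 0"
      then obtain L where L: "\<And>y. norm (w y) \<le> L * exp (\<epsilon> * norm y)" 
        using w unfolding tempered_def by (metis pds.simps(1))
      have "norm (w y) * K \<le> (L * K) * exp (\<epsilon> * norm y)" for y
        using mult_right_mono[OF L[of y], of K] K(1) by (simp add: mult_ac)
      then show "\<exists>K'. \<forall>y. norm (w y) * K \<le> K' * exp (\<epsilon> * norm y)" by blast
    qed (use s smth_measurable in blast)
  qed
  {
    case 0
    then show ?case unfolding decay_0 by (rule base)
  next
    case (Suc k)
    have sw: "smth UNIV w" using Suc.prems(1) by (simp add: tempered_def)
    have eq: "pdiff j (\<lambda>x. h (w x) (F n x)) = (\<lambda>x. h (w x) (pdiff j (F n) x) + h (pdiff j w x) (F n x))" for j n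
      using has_pd_imp_pdiff[OF has_pd_bilinear[OF h smth_has_pd smth_has_pd]] sw Suc.prems(2) by blast
    have k: "decay a0 k F" using Suc.prems(3) by (auto simp: decay_def)
    show ?case unfolding decay_Suc eq
    proof (intro conjI allI)
      show "decay0 a0 (\<lambda>n x. h (w x) (F n x))" by (rule base) (use Suc.prems in \<open>auto simp: decay_Suc\<close>)
      fix j
      show "decay a0 k (\<lambda>n x. h (w x) (pdiff j (F n) x) + h (pdiff j w x) (F n x))"
      proof (rule decay_add)
        show "smth UNIV (\<lambda>x. h (w x) (pdiff j (F n) x))" "smth UNIV (\<lambda>x. h (pdiff j w x) (F n x))" for n
          using Suc.prems(2) sw by (auto intro!: smth_bilinear[OF _ h] smth_pdiff)
        show "decay a0 k (\<lambda>n x. h (w x) (pdiff j (F n) x))"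
          by (rule Suc.IH) (use Suc.prems in \<open>auto simp: decay_Suc intro: smth_pdiff\<close>)
        show "decay a0 k (\<lambda>n x. h (pdiff j w x) (F n x))"
          by (rule Suc.IH) (use Suc.prems k in \<open>auto intro: tempered_pdiff\<close>)
      qed
    qed
  }
qed

text \<open>With the factor 4/3 the argument of \<open>step\<close> reaches 1 at
  \<open>norm z = s / 2\<close> and 0 at \<open>norm z = s\<close>.\<close>

definition bump :: "real \<Rightarrow> point \<Rightarrow> real" where
  "bump s z = step (4/3 * (1 - (z \<bullet> z) / s\<^sup>2))"

lemma kern_bump:
  assumes "s > 0" shows "kern s (bump s)"
proof -
  have "smth UNIV (\<lambda>z::point. (1 / s\<^sup>2) * (z \<bullet> z))" by (intro smth_mult smth_const smth_inner smth_id) auto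
  then have "smth UNIV (\<lambda>z::point. 4/3 * (1 - (z \<bullet> z) / s\<^sup>2))" by (intro smth_mult smth_const smth_diff) auto
  then have "smth UNIV (bump s)" unfolding bump_def[abs_def] by (intro smth_step) auto
  moreover have "bump s z = 0" if "norm z > s" for z
  proof -
    have "s\<^sup>2 \<le> z \<bullet> z" using that assms by (simp add: power2_norm_eq_inner[symmetric] power_mono)
    then have "(z \<bullet> z) / s\<^sup>2 \<ge> 1" using assms by simp
    then show ?thesis unfolding bump_def by (intro step_0) simp
  qed
  ultimately show ?thesis by (simp add: kern_def)
qed

lemma bump_eq_1:
  assumes "s > 0" "norm z \<le> s / 2" shows "bump s z = 1"
proof -
  have "z \<bullet> z \<le> (s / 2)\<^sup>2" using assms by (simp only: power2_norm_eq_inner[symmetric]) (intro power_mono; simp)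
  moreover have "(s / 2)\<^sup>2 = s\<^sup>2 / 4" by (simp add: power_divide)
  ultimately have "4 * (z \<bullet> z) \<le> s\<^sup>2" by linarith
  moreover have "s\<^sup>2 > 0" using assms(1) by simp
  ultimately have "(z \<bullet> z) / s\<^sup>2 \<le> 1/4" by (simp only: pos_divide_le_eq)
  moreover have "1 \<le> 4/3 * (1 - q)" if "q \<le> 1/4" for q :: real using that by simp
  ultimately show ?thesis unfolding bump_def by (intro step_1) blast
qed

lemma bump_bounds: "0 \<le> bump s z" "bump s z \<le> 1"
  by (simp_all add: bump_def step_nonneg step_le_1)

lemma bump_cutoff:
  fixes f :: "point \<Rightarrow> 'b::euclidean_space"
  assumes "s > 0" "smth UNIV f"
  shows "kern (norm x + s) (\<lambda>y. bump s (y - x) *\<^sub>R f y)"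
    and "pdiff k (\<lambda>y. bump s (y - x) *\<^sub>R f y) y = bump s (y - x) *\<^sub>R pdiff k f y + pdiff k (bump s) (y - x) *\<^sub>R f y"
proof -
  have kb: "kern s (bump s)" using kern_bump assms by blast
  have sb: "smth UNIV (\<lambda>y. bump s (y - x))" using smth_shift[of "bump s" "- x"] kb by (simp add: kern_def)
  have "bump s (y - x) = 0" if "norm y > norm x + s" for y
    using norm_ge_reflect[OF that] kb by (simp add: kern_def norm_minus_commute)
  then show "kern (norm x + s) (\<lambda>y. bump s (y - x) *\<^sub>R f y)"
    unfolding kern_def using smth_scaleR[OF _ sb assms(2)] by simp
  have "has_pd k (\<lambda>y. bump s (y + (- x))) (pdiff k (bump s) (y - x)) y"
    by (rule has_pd_shift) (use kern_pd[OF kb] in simp)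
  then show "pdiff k (\<lambda>y. bump s (y - x) *\<^sub>R f y) y = bump s (y - x) *\<^sub>R pdiff k f y + pdiff k (bump s) (y - x) *\<^sub>R f y"
    using has_pd_imp_pdiff[OF has_pd_bilinear[OF bounded_bilinear_scaleR _ smth_has_pd[OF assms(2)]]] by simp
qed

text \<open>\<open>gradient_bound\<close> for the function localised by \<open>bump\<close>. The
  commutator with the cut-off is of order zero and goes into \<open>E\<close>, which depends only on
  \<open>s\<close> and serves all centres. The ball of radius \<open>s/4\<close> lies strictly
  inside the region where the cut-off is constant, so that the derivative of the cut-off vanishes
  there as well.\<close>

lemma elliptic_local:
  assumes s: "s > 0"
  obtains E where "E \<ge> 0" "\<And>f x. smth UNIV f \<Longrightarrow>
    (\<integral>\<^sup>+y\<in>cball x (s/4). ennreal ((norm (pdiff j f y))\<^sup>2) \<partial>lborel) \<le>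
      ennreal 2 * (\<integral>\<^sup>+y\<in>cball x s. ennreal ((norm (Jd f y))\<^sup>2) \<partial>lborel) + ennreal E * (\<integral>\<^sup>+y\<in>cball x s. ennreal ((norm (f y))\<^sup>2) \<partial>lborel)"
proof -
  have kb: "kern s (bump s)" using kern_bump s by blast
  have "\<exists>B. B > 0 \<and> (\<forall>x. norm (pdiff k (bump s) x) \<le> B)" for k using kern_bounded[OF kern_pdiff[OF kb]] by metis
  then obtain Y where Y: "\<And>k. Y k > 0" "\<And>k x. norm (pdiff k (bump s) x) \<le> Y k" by metis
  define S where "S = (\<Sum>k\<in>UNIV. Y k)"
  have "(\<integral>\<^sup>+y\<in>cball x (s/4). ennreal ((norm (pdiff j f y))\<^sup>2) \<partial>lborel) \<le>
      ennreal 2 * (\<integral>\<^sup>+y\<in>cball x s. ennreal ((norm (Jd f y))\<^sup>2) \<partial>lborel) + ennreal (2 * S\<^sup>2) * (\<integral>\<^sup>+y\<in>cball x s. ennreal ((norm (f y))\<^sup>2) \<partial>lborel)"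
    if f: "smth UNIV f" for f x
  proof -
    have [measurable]: "f \<in> borel_measurable borel" "pdiff k f \<in> borel_measurable borel" for k
      using f smth_measurable smth_pdiff by blast+
    have [measurable]: "Jd f \<in> borel_measurable borel" unfolding Jd_def[abs_def] by measurable
    define u where "u y = bump s (y - x) *\<^sub>R f y" for y
    have ku: "kern (norm x + s) u" unfolding u_def[abs_def] by (rule bump_cutoff(1)[OF s f])
    have pu: "pdiff k u y = bump s (y - x) *\<^sub>R pdiff k f y + pdiff k (bump s) (y - x) *\<^sub>R f y" for k y
      unfolding u_def[abs_def] by (rule bump_cutoff(2)[OF s f])
    have out: "bump s z = 0" "pdiff k (bump s) z = 0" if "norm z > s" for z k
      using that kb kern_pdiff[OF kb, of k] by (auto simp: kern_def)
    have inn: "pdiff k (bump s) z = 0" if "norm z < s / 2" for z k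
    proof (rule has_pd_imp_pdiff, rule has_pd_eq_on[OF _ _ _ has_pd_const[of k "1::real"]])
      show "open (ball (0::point) (s/2))" "z \<in> ball 0 (s/2)" using that by auto
      show "1 = bump s y" if "y \<in> ball 0 (s/2)" for y using bump_eq_1[OF s, of y] that by simp
    qed
    have "(\<integral>\<^sup>+y\<in>cball x (s/4). ennreal ((norm (pdiff j f y))\<^sup>2) \<partial>lborel) \<le> nrm2 (pdiff j u)"
    proof (intro nn_integral_mono)
      fix y
      show "ennreal ((norm (pdiff j f y))\<^sup>2) * indicator (cball x (s/4)) y \<le> ennreal ((norm (pdiff j u y))\<^sup>2)"
      proof (cases "y \<in> cball x (s/4)")
        case True
        then have "norm (y - x) \<le> s / 2" "norm (y - x) < s/2" using s by (auto simp: dist_norm norm_minus_commute)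
        then show ?thesis using True pu[of j y] bump_eq_1[OF s] inn by simp
      qed simp
    qed
    also have "\<dots> \<le> nrm2 (Jd u)" by (rule gradient_bound[OF ku])
    also have "\<dots> \<le> (\<integral>\<^sup>+y. ennreal 2 * (ennreal ((norm (Jd f y))\<^sup>2) * indicator (cball x s) y) + ennreal (2 * S\<^sup>2) * (ennreal ((norm (f y))\<^sup>2) * indicator (cball x s) y) \<partial>lborel)"
    proof (intro nn_integral_mono)
      fix y
      let ?G = "\<Sum>k\<in>UNIV. pdiff k (bump s) (y - x) *\<^sub>R J k (f y)"
      have Ju: "Jd u y = bump s (y - x) *\<^sub>R Jd f y + ?G"
        unfolding Jd_def pu
        by (simp add: linear_add[OF bounded_linear.linear[OF bounded_linear_J]] linear_scale[OF bounded_linear.linear[OF bounded_linear_J]] sum.distrib scaleR_sum_right)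
      show "ennreal ((norm (Jd u y))\<^sup>2) \<le> ennreal 2 * (ennreal ((norm (Jd f y))\<^sup>2) * indicator (cball x s) y) + ennreal (2 * S\<^sup>2) * (ennreal ((norm (f y))\<^sup>2) * indicator (cball x s) y)"
      proof (cases "y \<in> cball x s")
        case True
        have G: "norm ?G \<le> S * norm (f y)"
          unfolding S_def sum_distrib_right
          by (rule order_trans[OF norm_sum sum_mono]) (use Y(2)[of _ "y - x"] in \<open>auto intro: mult_right_mono\<close>)
        have "norm (Jd u y) \<le> norm (Jd f y) + S * norm (f y)"
          unfolding Ju using bump_bounds[of s "y - x"] G
          by (intro order_trans[OF norm_triangle_ineq] add_mono) (auto intro: mult_left_le_one_le)
        then have "(norm (Jd u y))\<^sup>2 \<le> (norm (Jd f y) + S * norm (f y))\<^sup>2" by (intro power_mono) auto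
        also have "\<dots> \<le> 2 * (norm (Jd f y))\<^sup>2 + 2 * S\<^sup>2 * (norm (f y))\<^sup>2"
          using sum_squares_bound[of "norm (Jd f y)" "S * norm (f y)"] by (simp add: power2_sum power_mult_distrib)
        finally have "ennreal ((norm (Jd u y))\<^sup>2) \<le> ennreal 2 * ennreal ((norm (Jd f y))\<^sup>2) + ennreal (2 * S\<^sup>2) * ennreal ((norm (f y))\<^sup>2)"
          by (subst ennreal_lincomb) (auto intro: ennreal_leI simp del: ennreal_plus)
        then show ?thesis using True by simp
      next
        case False
        then have "norm (y - x) > s" by (simp add: dist_norm norm_minus_commute)
        then have "Jd u y = 0" unfolding Ju by (simp add: out)
        then show ?thesis by simp
      qed
    qed
    also have "\<dots> = ennreal 2 * (\<integral>\<^sup>+y\<in>cball x s. ennreal ((norm (Jd f y))\<^sup>2) \<partial>lborel) + ennreal (2 * S\<^sup>2) * (\<integral>\<^sup>+y\<in>cball x s. ennreal ((norm (f y))\<^sup>2) \<partial>lborel)"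
      by (subst nn_integral_add, measurable, subst nn_integral_cmult, measurable, subst nn_integral_cmult, measurable)
    finally show ?thesis .
  qed
  then show thesis using that[of "2 * S\<^sup>2"] by simp
qed

section \<open>Sorting words of derivatives, and the potentials as tempered coefficients\<close>

lemma Ck_Un: "open U \<Longrightarrow> open W \<Longrightarrow> Ck n U f \<Longrightarrow> Ck n W f \<Longrightarrow> Ck n (U \<union> W) f"
  by (induction n arbitrary: f) (auto intro: continuous_on_open_Un)

lemma smth_Un: "open U \<Longrightarrow> open W \<Longrightarrow> smth U f \<Longrightarrow> smth W f \<Longrightarrow> smth (U \<union> W) f"
  by (simp add: smth_def Ck_Un)

lemma pds_move:
  assumes "open U" "smth U f" "x \<in> U"
  shows "pds (k # js @ ls) f x = pds (js @ k # ls) f x"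
  using assms(3)
proof (induction js arbitrary: x)
  case (Cons j js)
  have "pds (k # (j # js) @ ls) f x = pdiff k (pdiff j (pds (js @ ls) f)) x" by simp
  also have "\<dots> = pdiff j (pdiff k (pds (js @ ls) f)) x"
    by (rule pdiff_commute[OF assms(1) smth_pds[OF assms(2)] Cons.prems])
  also have "\<dots> = pdiff j (pds (js @ k # ls) f) x"
  proof (rule has_pd_imp_pdiff, rule has_pd_eq_on[OF assms(1) Cons.prems])
    show "pds (js @ k # ls) f y = pdiff k (pds (js @ ls) f) y" if "y \<in> U" for y using Cons.IH[OF that] by simp
    show "has_pd j (pds (js @ k # ls) f) (pdiff j (pds (js @ k # ls) f) x) x"
      by (rule smth_has_pd[OF smth_pds[OF assms(2)] Cons.prems])
  qed
  finally show ?case by simp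
qed simp

text \<open>A new letter is moved past the smaller directions that precede it in the sorted word.
  This turns the hypotheses on \<open>dpart\<close> into bounds for all words.\<close>

lemma pds_eq_dpart:
  assumes "open U" "smth U f"
  obtains \<beta> where "\<And>x. x \<in> U \<Longrightarrow> pds ks f x = dpart \<beta> f x"
proof -
  have "\<exists>a b c. \<forall>x\<in>U. pds ks f x = pds (replicate a 1 @ replicate b 2 @ replicate c 3) f x"
  proof (induction ks)
    case Nil
    then show ?case by (intro exI[of _ 0]) simp
  next
    case (Cons k ks)
    then obtain a b c where abc: "\<And>x. x \<in> U \<Longrightarrow> pds ks f x = pds (replicate a 1 @ replicate b 2 @ replicate c 3) f x" by blast
    let ?w = "replicate a 1 @ replicate b 2 @ replicate c 3"
    have *: "pds (k # ks) f x = pds (k # ?w) f x" if "x \<in> U" for x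
    proof -
      have "has_pd k (pds ks f) (pdiff k (pds ?w f) x) x"
        by (rule has_pd_eq_on[OF assms(1) that _ smth_has_pd[OF smth_pds[OF assms(2)] that]]) (simp add: abc)
      then show ?thesis using has_pd_imp_pdiff by simp blast
    qed
    consider "k = 1" | "k = 2" | "k = 3" using exhaust_3 by blast
    then show ?case
    proof cases
      case 1
      have "\<forall>x\<in>U. pds (k # ks) f x = pds (replicate (Suc a) 1 @ replicate b 2 @ replicate c 3) f x"
        using * 1 by simp
      then show ?thesis by blast
    next
      case 2
      have "\<forall>x\<in>U. pds (k # ks) f x = pds (replicate a 1 @ replicate (Suc b) 2 @ replicate c 3) f x"
        using * 2 pds_move[OF assms, of _ k "replicate a 1" "replicate b 2 @ replicate c 3"] by simp
      then show ?thesis by blast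
    next
      case 3
      have "\<forall>x\<in>U. pds (k # ks) f x = pds (replicate a 1 @ replicate b 2 @ replicate (Suc c) 3) f x"
        using * 3 pds_move[OF assms, of _ k "replicate a 1 @ replicate b 2" "replicate c 3"] by simp
      then show ?thesis by blast
    qed
  qed
  then obtain a b c where abc: "\<And>x. x \<in> U \<Longrightarrow> pds ks f x = pds (replicate a 1 @ replicate b 2 @ replicate c 3) f x" by blast
  show thesis by (rule that[of "vector [a, b, c]"]) (simp add: abc dpart_eq_pds vector_3)
qed

text \<open>The hypothesis on V bounds operator norms, whereas \<open>tempered\<close> uses the
  Euclidean norm. Each of the 16 entries is at most the operator norm.\<close>

lemma norm_le_mat_norm: "norm (M::mat4) \<le> 16 * mat_norm M"
proof -
  have e: "norm (M $ i $ j) \<le> mat_norm M" for i j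
  proof -
    have "M *v axis j 1 = (\<chi> i. M $ i $ j)"
      by (simp add: vec_eq_iff matrix_vector_mult_def axis_def if_distrib cong: if_cong)
    then have "norm (M $ i $ j) \<le> norm (M *v axis j 1)"
      using Finite_Cartesian_Product.norm_nth_le[of "M *v axis j 1" i] by simp
    also have "\<dots> \<le> mat_norm M * norm (axis j (1::complex) :: spinor)" by (rule mat_norm_le)
    finally show ?thesis by simp
  qed
  have "norm M \<le> (\<Sum>i\<in>UNIV. norm (M $ i))" unfolding norm_vec_def by (rule L2_set_le_sum) simp
  also have "\<dots> \<le> (\<Sum>i\<in>(UNIV::4 set). \<Sum>j\<in>(UNIV::4 set). mat_norm M)"
  proof (rule sum_mono)
    fix i
    have "norm (M $ i) \<le> (\<Sum>j\<in>UNIV. norm (M $ i $ j))" unfolding norm_vec_def by (rule L2_set_le_sum) simp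
    also have "\<dots> \<le> (\<Sum>j\<in>(UNIV::4 set). mat_norm M)" by (rule sum_mono) (rule e)
    finally show "norm (M $ i) \<le> (\<Sum>j\<in>(UNIV::4 set). mat_norm M)" .
  qed
  also have "\<dots> = 16 * mat_norm M" by simp
  finally show ?thesis .
qed

text \<open>The argument of \<open>step\<close> is 0 at \<open>norm z = r / 4\<close> and 1 at
  \<open>norm z = r / 2\<close>; the singularity lies in the inner ball.\<close>

definition outer :: "real \<Rightarrow> point \<Rightarrow> real" where
  "outer r z = step ((16 * (z \<bullet> z) / r\<^sup>2 - 1) / 3)"

lemma smth_outer: "smth UNIV (outer r)"
proof -
  have "smth UNIV (\<lambda>z::point. ((16 / r\<^sup>2) * (z \<bullet> z) - 1) * (1/3))"
    by (intro smth_mult smth_const smth_diff smth_inner smth_id) auto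
  then show ?thesis unfolding outer_def[abs_def] by (intro smth_step) simp_all
qed

lemma outer_0:
  assumes "r > 0" "norm z \<le> r / 4" shows "outer r z = 0"
proof -
  have "z \<bullet> z \<le> (r / 4)\<^sup>2" using assms by (simp only: power2_norm_eq_inner[symmetric]) (intro power_mono; simp)
  then show ?thesis unfolding outer_def using assms by (intro step_0) (simp add: field_simps power2_eq_square)
qed

lemma outer_1:
  assumes "r > 0" "norm z \<ge> r / 2" shows "outer r z = 1"
proof -
  have "(r / 2)\<^sup>2 \<le> z \<bullet> z" using assms by (simp only: power2_norm_eq_inner[symmetric]) (intro power_mono; simp)
  then show ?thesis unfolding outer_def using assms by (intro step_1) (simp add: field_simps power2_eq_square)
qed

lemma tempered_magnetic:
  assumes "smooth_hyp A V" shows "tempered A"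
proof -
  have s: "smth UNIV A" using assms by (auto simp: smooth_hyp_def intro: smooth_on_imp_smth)
  have "\<exists>K. \<forall>y. norm (pds ks A y) \<le> K * exp (\<epsilon> * norm y)" if "\<epsilon> > 0" for ks \<epsilon>
  proof -
    obtain \<beta> where "\<And>x. pds ks A x = dpart \<beta> A x" using pds_eq_dpart[OF open_UNIV s, of ks] by auto
    then show ?thesis using assms that unfolding smooth_hyp_def by simp
  qed
  then show ?thesis using s by (simp add: tempered_def)
qed

text \<open>Near the origin the product is identically 0, off the origin it is smooth as a product,
  and the two open regions cover the space. For \<open>norm x \<ge> r\<close> it coincides with V,
  whose derivatives are bounded there; the remaining ball is compact.\<close>

lemma tempered_electric:
  assumes "smooth_hyp A V" and r: "r > 0" shows "tempered (\<lambda>x. outer r x *\<^sub>R V x)" (is "tempered ?W")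
proof -
  have sV: "smth (- {0}) V" using assms by (auto simp: smooth_hyp_def intro: smooth_on_imp_smth)
  have "smth (- {0}) ?W" by (intro smth_scaleR smth_subset[OF _ smth_outer] sV) auto
  moreover have "smth (ball 0 (r/4)) ?W"
    by (rule smth_cong[OF _ _ smth_const[of _ 0]]) (use outer_0[OF r] in auto)
  moreover have "- {0} \<union> ball (0::point) (r/4) = UNIV" using r by auto
  moreover have "open (- {0 :: point})" by (simp add: open_Compl)
  ultimately have s: "smth UNIV ?W" using smth_Un[of "- {0}" "ball 0 (r/4)" ?W] by simp
  have "\<exists>K. \<forall>y. norm (pds ks ?W y) \<le> K * exp (\<epsilon> * norm y)" if \<epsilon>: "\<epsilon> > 0" for ks \<epsilon>
  proof -
    obtain \<beta> where \<beta>: "\<And>x. x \<in> - {0} \<Longrightarrow> pds ks V x = dpart \<beta> V x" using pds_eq_dpart[OF _ sV, of ks] by auto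
    obtain M where M: "\<And>x. norm x \<ge> r \<Longrightarrow> mat_norm (dpart \<beta> V x) \<le> M"
      using assms unfolding smooth_hyp_def by meson
    have far: "norm (pds ks ?W y) \<le> 16 * M" if y: "norm y \<ge> r" for y
    proof -
      have U: "open {x::point. norm x > r / 2}" by (intro open_Collect_less continuous_intros)
      have "pds ks V y = pds ks ?W y"
      proof (rule pds_cong[OF U])
        show "V x = ?W x" if "x \<in> {x. norm x > r / 2}" for x using outer_1[OF r, of x] that by simp
        show "smth {x. norm x > r / 2} V" by (rule smth_subset[OF _ sV]) (use r in auto)
      qed (use y r in auto)
      then have "pds ks ?W y = dpart \<beta> V y" using \<beta>[of y] y r by (cases "y = 0") auto
      then show ?thesis using norm_le_mat_norm[of "dpart \<beta> V y"] M[OF y] by simp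
    qed
    have "compact (pds ks ?W ` cball 0 r)"
      by (rule compact_continuous_image[OF continuous_on_subset[OF smth_continuous[OF smth_pds[OF s]]]]) auto
    then have "bounded (pds ks ?W ` cball 0 r)" by (rule compact_imp_bounded)
    then obtain B where "B > 0" "\<forall>z\<in>pds ks ?W ` cball 0 r. norm z \<le> B" unfolding bounded_pos by blast
    then have B: "B > 0" "\<And>x. x \<in> cball 0 r \<Longrightarrow> norm (pds ks ?W x) \<le> B" by blast+
    have "norm (pds ks ?W y) \<le> (B + \<bar>16 * M\<bar>) * exp (\<epsilon> * norm y)" for y
    proof -
      have "norm (pds ks ?W y) \<le> B + \<bar>16 * M\<bar>"
      proof (cases "norm y \<ge> r")
        case True
        then show ?thesis using far[OF True] B(1) by linarith
      next
        case False
        then have "norm (pds ks ?W y) \<le> B" by (intro B(2)) simp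
        then show ?thesis by linarith
      qed
      also have "\<dots> \<le> (B + \<bar>16 * M\<bar>) * exp (\<epsilon> * norm y)"
        using mult_left_mono[of 1 "exp (\<epsilon> * norm y)" "B + \<bar>16 * M\<bar>"] \<epsilon> B(1) by simp
      finally show ?thesis .
    qed
    then show ?thesis by blast
  qed
  then show ?thesis using s by (simp add: tempered_def)
qed

section \<open>Bootstrap for the mollified eigenvector\<close>

locale smooth_dirac_eigenvector = dirac_eigenvector +
  assumes smooth: "smooth_hyp A V" and lam: "-1 < lam" "lam < 1"
begin

abbreviation a0 :: real where "a0 \<equiv> sqrt (1 - lam\<^sup>2)"
abbreviation eps :: "nat \<Rightarrow> real" where "eps n \<equiv> 1 / real (Suc n)"

definition \<rho> :: "nat \<Rightarrow> point \<Rightarrow> real" where "\<rho> n = moll (eps n)"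
definition \<Phi> :: "nat \<Rightarrow> point \<Rightarrow> spinor" where "\<Phi> n = conv (\<rho> n) \<phi>'"

lemma prob_\<rho>: "prob_kern (eps n) (\<rho> n)"
  unfolding \<rho>_def by (rule prob_kern_moll) simp

lemma kern_\<rho>: "kern (eps n) (\<rho> n)"
  using prob_\<rho> by (simp add: prob_kern_def)

lemma smth_\<Phi>: "smth UNIV (\<Phi> n)"
  unfolding \<Phi>_def by (rule smth_conv[OF kern_\<rho> loc_int_phi])

lemma pds_\<Phi>: "pds ks (\<Phi> n) = conv (pds ks (\<rho> n)) \<phi>'"
  unfolding \<Phi>_def by (rule pds_conv[OF kern_\<rho> loc_int_phi])

lemma eps_small: assumes "s > 0" obtains N where "\<And>n. N \<le> n \<Longrightarrow> eps n \<le> s"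
proof -
  obtain N where N: "1 / real (Suc N) < s" using nat_approx_posE[OF assms] by blast
  have "eps n \<le> s" if "N \<le> n" for n
  proof -
    have "eps n \<le> eps N" using that by (simp add: frac_le)
    then show ?thesis using N by simp
  qed
  then show thesis using that by blast
qed

text \<open>\<open>exponential_decay_L2\<close> restricted to balls. Mollification enlarges the
  radius from 1 to at most 2, and on the larger ball \<open>exp (a * norm y)\<close> is at least
  \<open>exp (a * norm x)\<close> divided by \<open>exp (2 * a)\<close>.\<close>

lemma decay_\<Phi>_0: "decay0 a0 \<Phi>"
proof (rule decay0_I)
  fix a r :: real assume a: "0 < a" "a < a0" "0 < r"
  have "dirac_eigenvector V A Ddom Dop lam \<phi> \<phi>' A' V'" by unfold_locales
  then obtain C where C: "nrm2 (\<lambda>x. exp (a * norm x) *\<^sub>R \<phi>' x) \<le> ennreal (C\<^sup>2)"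
    using exponential_decay_L2[OF pot lam a(1,2)] by blast
  have dom: "(\<integral>\<^sup>+y\<in>cball x 1. ennreal ((norm (\<Phi> n y))\<^sup>2) \<partial>lborel) \<le> ennreal (C\<^sup>2 * (exp (2 * a))\<^sup>2 * exp (- 2 * a * norm x))" for n x
  proof -
    have "(\<integral>\<^sup>+y\<in>cball x 1. ennreal ((norm (\<Phi> n y))\<^sup>2) \<partial>lborel) \<le> (\<integral>\<^sup>+y\<in>cball x 2. ennreal ((norm (\<phi>' y))\<^sup>2) \<partial>lborel)"
      unfolding \<Phi>_def
    proof (rule nn_integral_conv_le[OF prob_\<rho> loc_int_phi])
      fix y z assume *: "y \<in> cball x 1" "norm (y - z) \<le> eps n"
      have "eps n \<le> 1" by simp
      with *(2) have "norm (y - z) \<le> 1" by (rule order_trans)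
      then show "z \<in> cball x 2" using *(1) dist_triangle[of x z y] by (simp add: dist_norm)
    qed measurable
    also have "\<dots> \<le> (\<integral>\<^sup>+y. ennreal ((exp (2 * a))\<^sup>2 * exp (- 2 * a * norm x)) * ennreal ((norm (exp (a * norm y) *\<^sub>R \<phi>' y))\<^sup>2) \<partial>lborel)"
    proof (intro nn_integral_mono)
      fix y
      show "ennreal ((norm (\<phi>' y))\<^sup>2) * indicator (cball x 2) y \<le> ennreal ((exp (2 * a))\<^sup>2 * exp (- 2 * a * norm x)) * ennreal ((norm (exp (a * norm y) *\<^sub>R \<phi>' y))\<^sup>2)"
      proof (cases "y \<in> cball x 2")
        case True
        then have "norm x \<le> norm y + 2" using norm_triangle_ineq2[of x y] by (simp add: dist_norm)
        then have "1 \<le> exp (a * (2 + norm y - norm x))" using a by simp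
        then have "norm (\<phi>' y) \<le> exp (a * (2 + norm y - norm x)) * norm (\<phi>' y)" using mult_right_mono[of 1 _ "norm (\<phi>' y)"] by simp
        then have "(norm (\<phi>' y))\<^sup>2 \<le> (exp (a * (2 + norm y - norm x)) * norm (\<phi>' y))\<^sup>2" by (rule power_mono) simp
        also have "exp (a * (2 + norm y - norm x)) = exp (2 * a) * exp (- (a * norm x)) * exp (a * norm y)"
          by (simp add: exp_add[symmetric] algebra_simps)
        also have "(exp (2 * a) * exp (- (a * norm x)) * exp (a * norm y) * norm (\<phi>' y))\<^sup>2 = (exp (2 * a))\<^sup>2 * exp (- 2 * a * norm x) * (norm (exp (a * norm y) *\<^sub>R \<phi>' y))\<^sup>2"
          by (simp add: power_mult_distrib exp_double[symmetric] mult.assoc)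
        finally have "ennreal ((norm (\<phi>' y))\<^sup>2) \<le> ennreal ((exp (2 * a))\<^sup>2 * exp (- 2 * a * norm x)) * ennreal ((norm (exp (a * norm y) *\<^sub>R \<phi>' y))\<^sup>2)"
          by (subst ennreal_mult[symmetric]) (auto intro: ennreal_leI)
        then show ?thesis using True by simp
      qed simp
    qed
    also have "\<dots> = ennreal ((exp (2 * a))\<^sup>2 * exp (- 2 * a * norm x)) * nrm2 (\<lambda>x. exp (a * norm x) *\<^sub>R \<phi>' x)"
      by (rule nn_integral_cmult) measurable
    also have "\<dots> \<le> ennreal ((exp (2 * a))\<^sup>2 * exp (- 2 * a * norm x)) * ennreal (C\<^sup>2)"
      by (rule mult_left_mono[OF C]) simp
    also have "\<dots> = ennreal (C\<^sup>2 * (exp (2 * a))\<^sup>2 * exp (- 2 * a * norm x))"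
      by (subst ennreal_mult[symmetric]) (auto simp: mult_ac)
    finally show ?thesis .
  qed
  show "\<exists>s>0. \<exists>C\<ge>0. \<exists>N. \<forall>n\<ge>N. \<forall>x. r \<le> norm x \<longrightarrow>
     (\<integral>\<^sup>+y\<in>cball x s. ennreal ((norm (\<Phi> n y))\<^sup>2) \<partial>lborel) \<le> ennreal (C * exp (- 2 * a * norm x))"
    by (rule decay0_witness[where s=1 and C="C\<^sup>2 * (exp (2 * a))\<^sup>2" and N=0, OF _ _ dom]) auto
qed

lemma \<Phi>_tendsto:
  assumes "e > 0" obtains M where "\<And>m. M \<le> m \<Longrightarrow> nrm2 (\<lambda>x. \<Phi> m x - \<phi>' x) \<le> ennreal e"
proof -
  have fin: "nrm2 \<phi>' < \<infinity>" by (simp add: nrm2_phi)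
  obtain d where d: "d > 0" "\<And>\<epsilon> \<rho>. prob_kern \<epsilon> \<rho> \<Longrightarrow> \<epsilon> \<le> d \<Longrightarrow> nrm2 (\<lambda>x. conv \<rho> \<phi>' x - \<phi>' x) \<le> ennreal e"
    using nrm2_conv_tendsto[OF meas(1) fin assms] by blast
  obtain N where N: "\<And>n. N \<le> n \<Longrightarrow> eps n \<le> d" using eps_small[OF d(1)] by blast
  show thesis by (rule that[of N]) (use d(2)[OF prob_\<rho> N] in \<open>simp add: \<Phi>_def\<close>)
qed

lemma loc_int_bilinear:
  fixes h :: "'a::euclidean_space \<Rightarrow> 'b::euclidean_space \<Rightarrow> 'c::euclidean_space"
  assumes h: "bounded_bilinear h" and w: "continuous_on UNIV w" and f: "loc_int f"
  shows "loc_int (\<lambda>x. h (w x) (f x))"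
  unfolding loc_int_def
proof (intro conjI allI)
  have [measurable]: "w \<in> borel_measurable borel" by (rule borel_measurable_continuous_onI[OF w])
  have [measurable]: "f \<in> borel_measurable borel" using f by (simp add: loc_int_def)
  show m[measurable]: "(\<lambda>x. h (w x) (f x)) \<in> borel_measurable borel"
    by (rule borel_measurable_continuous_Pair[where H=h], measurable)
      (intro bounded_bilinear.continuous_on[OF h] continuous_on_fst continuous_on_snd continuous_on_id)
  fix r
  have "compact (w ` cball 0 r)"
    by (rule compact_continuous_image[OF continuous_on_subset[OF w]]) auto
  then obtain B where B: "\<And>x. x \<in> cball 0 r \<Longrightarrow> norm (w x) \<le> B" "B > 0"
    using compact_imp_bounded bounded_pos by (metis imageI)
  obtain K where K: "K > 0" "\<And>a b. norm (h a b) \<le> norm a * norm b * K"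
    using bounded_bilinear.pos_bounded[OF h] by blast
  show "integrable lborel (\<lambda>x. indicat_real (cball 0 r) x *\<^sub>R h (w x) (f x))"
  proof (rule loc_int_bound_integrable(1)[OF f, where B="B * K" and r=r])
    show "norm (indicat_real (cball 0 r) y *\<^sub>R h (w y) (f y)) \<le> B * K * norm (f y)" for y
    proof (cases "y \<in> cball 0 r")
      case True
      have "norm (h (w y) (f y)) \<le> norm (w y) * norm (f y) * K" by (rule K)
      also have "\<dots> \<le> B * norm (f y) * K" using B(1)[OF True] K(1) by (intro mult_right_mono) auto
      finally show ?thesis using True by (simp add: mult_ac)
    qed (use B K in simp)
  qed auto
qed

lemma conv_bilinear_tendsto:
  fixes h :: "'a::euclidean_space \<Rightarrow> spinor \<Rightarrow> 'c::euclidean_space"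
  assumes h: "bounded_bilinear h" and w: "continuous_on UNIV w" and \<kappa>: "kern \<epsilon> \<kappa>"
  shows "(\<lambda>m. conv \<kappa> (\<lambda>y. h (w y) (\<Phi> m y)) x) \<longlonglongrightarrow> conv \<kappa> (\<lambda>y. h (w y) (\<phi>' y)) x"
proof (rule LIMSEQ_I)
  fix e :: real assume "e > 0"
  obtain B where B: "B > 0" "\<And>z. norm (\<kappa> z) \<le> B" using kern_bounded \<kappa> by blast
  define S where "S = cball (0::point) (norm x + \<bar>\<epsilon>\<bar>)"
  have "compact (w ` S)"
    by (rule compact_continuous_image[OF continuous_on_subset[OF w]]) (auto simp: S_def)
  then obtain W where W: "\<And>x. x \<in> S \<Longrightarrow> norm (w x) \<le> W" "W > 0"
    using compact_imp_bounded bounded_pos by (metis imageI)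
  obtain K where K: "K > 0" "\<And>a b. norm (h a b) \<le> norm a * norm b * K"
    using bounded_bilinear.pos_bounded[OF h] by blast
  have [measurable]: "S \<in> sets borel" by (simp add: S_def)
  have [measurable]: "\<kappa> \<in> borel_measurable borel" "\<Phi> m \<in> borel_measurable borel" for m
    using kern_measurable[OF \<kappa>] smth_measurable[OF smth_\<Phi>] by auto
  define v where "v = measure lborel S"
  have v: "emeasure lborel S = ennreal v" "v \<ge> 0"
    using emeasure_bounded_finite[OF bounded_cball, of "0::point" "norm x + \<bar>\<epsilon>\<bar>"]
    unfolding v_def S_def by (auto simp: emeasure_eq_ennreal_measure less_top)
  define D where "D = B * (W * K)"
  have D: "D > 0" using B(1) W(2) K(1) by (simp add: D_def)
  \<comment> \<open>Cauchy-Schwarz on \<open>S\<close> bounds the squared difference by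
    \<open>D\<^sup>2 * v\<close> times the squared norm of \<open>\<Phi> m - \<phi>'\<close>; with
    that norm at most \<open>e'\<close> the product stays below \<open>e\<^sup>2\<close>. The added
    1 covers \<open>v = 0\<close>.\<close>
  define e' where "e' = e\<^sup>2 / (2 * (D\<^sup>2 * v + 1))"
  have pos: "D\<^sup>2 * v + 1 > 0" using v(2) by (simp add: add_nonneg_pos)
  have e': "e' > 0" "D\<^sup>2 * (v * e') < e\<^sup>2"
  proof -
    show "e' > 0" using \<open>e > 0\<close> pos by (simp add: e'_def)
    have "2 * (D\<^sup>2 * v + 1) * e' = e\<^sup>2" using pos unfolding e'_def by (metis less_irrefl mult_eq_0_iff nonzero_mult_div_cancel_left times_divide_eq_right zero_neq_numeral)
    moreover have "0 \<le> D\<^sup>2 * v * e'" using \<open>e' > 0\<close> v(2) by simp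
    ultimately show "D\<^sup>2 * (v * e') < e\<^sup>2" using \<open>e' > 0\<close> by (simp add: algebra_simps)
  qed
  obtain M where M: "\<And>m. M \<le> m \<Longrightarrow> nrm2 (\<lambda>x. \<Phi> m x - \<phi>' x) \<le> ennreal e'" using \<Phi>_tendsto[OF e'(1)] by blast
  show "\<exists>no. \<forall>m\<ge>no. norm (conv \<kappa> (\<lambda>y. h (w y) (\<Phi> m y)) x - conv \<kappa> (\<lambda>y. h (w y) (\<phi>' y)) x) < e"
  proof (intro exI[of _ M] allI impI)
    fix m assume m: "M \<le> m"
    let ?d = "\<lambda>y. \<Phi> m y - \<phi>' y"
    have l: "loc_int (\<lambda>y. h (w y) (\<Phi> m y))" "loc_int (\<lambda>y. h (w y) (\<phi>' y))"
      using loc_int_bilinear[OF h w] smth_loc_int[OF smth_\<Phi>] loc_int_phi by auto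
    have i: "integrable lborel (\<lambda>y. \<kappa> (x - y) *\<^sub>R h (w y) (?d y))"
    proof -
      have "integrable lborel (\<lambda>y. \<kappa> (x - y) *\<^sub>R h (w y) (\<Phi> m y) - \<kappa> (x - y) *\<^sub>R h (w y) (\<phi>' y))"
        by (intro Bochner_Integration.integrable_diff conv_integrable[OF \<kappa>] l)
      then show ?thesis by (simp add: bounded_bilinear.diff_right[OF h] scaleR_diff_right)
    qed
    have eq: "conv \<kappa> (\<lambda>y. h (w y) (\<Phi> m y)) x - conv \<kappa> (\<lambda>y. h (w y) (\<phi>' y)) x = (\<integral>y. \<kappa> (x - y) *\<^sub>R h (w y) (?d y) \<partial>lborel)"
      unfolding conv_diff[OF \<kappa> l, symmetric] by (simp add: conv_def bounded_bilinear.diff_right[OF h])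
    have "ennreal (norm (conv \<kappa> (\<lambda>y. h (w y) (\<Phi> m y)) x - conv \<kappa> (\<lambda>y. h (w y) (\<phi>' y)) x)) \<le> (\<integral>\<^sup>+y. ennreal (norm (\<kappa> (x - y) *\<^sub>R h (w y) (?d y))) \<partial>lborel)"
      unfolding eq by (rule integral_norm_bound_ennreal[OF i])
    also have "\<dots> \<le> (\<integral>\<^sup>+y. (ennreal D * indicator S y) * ennreal (norm (?d y)) \<partial>lborel)"
    proof (intro nn_integral_mono)
      fix y
      show "ennreal (norm (\<kappa> (x - y) *\<^sub>R h (w y) (?d y))) \<le> (ennreal D * indicator S y) * ennreal (norm (?d y))"
      proof (cases "y \<in> S")
        case True
        have "norm (h (w y) (?d y)) \<le> W * norm (?d y) * K"
          by (rule order_trans[OF K(2)]) (use W(1)[OF True] K(1) in \<open>auto intro!: mult_right_mono\<close>)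
        then have "norm (\<kappa> (x - y)) * norm (h (w y) (?d y)) \<le> B * (W * norm (?d y) * K)"
          using B by (intro mult_mono) auto
        then have "norm (\<kappa> (x - y) *\<^sub>R h (w y) (?d y)) \<le> D * norm (?d y)" by (simp add: D_def mult_ac)
        then show ?thesis using True D by (simp add: ennreal_mult[symmetric] ennreal_leI)
      next
        case False
        then have "norm (x - y) > \<epsilon>" using norm_ge_reflect[of x "\<bar>\<epsilon>\<bar>" y] by (simp add: S_def)
        then show ?thesis using \<kappa> by (simp add: kern_def)
      qed
    qed
    finally have "(ennreal (norm (conv \<kappa> (\<lambda>y. h (w y) (\<Phi> m y)) x - conv \<kappa> (\<lambda>y. h (w y) (\<phi>' y)) x)))\<^sup>2 \<le> (\<integral>\<^sup>+y. (ennreal D * indicator S y) * ennreal (norm (?d y)) \<partial>lborel)\<^sup>2"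
      by (intro power_mono) auto
    also have "\<dots> \<le> (\<integral>\<^sup>+y. (ennreal D * indicator S y)\<^sup>2 \<partial>lborel) * (\<integral>\<^sup>+y. (ennreal (norm (?d y)))\<^sup>2 \<partial>lborel)"
      by (rule Cauchy_Schwarz_nn_integral) measurable
    also have "(\<integral>\<^sup>+y. (ennreal D * indicator S y)\<^sup>2 \<partial>lborel) = (\<integral>\<^sup>+y. ennreal (D\<^sup>2) * indicator S y \<partial>lborel)"
      using D by (intro nn_integral_cong) (auto simp: indicator_def ennreal_power)
    also have "\<dots> = ennreal (D\<^sup>2 * v)" using v by (simp add: nn_integral_cmult_indicator ennreal_mult)
    also have "(\<integral>\<^sup>+y. (ennreal (norm (?d y)))\<^sup>2 \<partial>lborel) = nrm2 ?d" by (simp add: ennreal_power)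
    also have "ennreal (D\<^sup>2 * v) * nrm2 ?d \<le> ennreal (D\<^sup>2 * v) * ennreal e'"
      by (rule mult_left_mono[OF M[OF m]]) simp
    also have "\<dots> = ennreal (D\<^sup>2 * (v * e'))" using v(2) e'(1) by (simp add: ennreal_mult mult.assoc)
    also have "\<dots> < ennreal (e\<^sup>2)" using e'(2) \<open>e > 0\<close> by (intro ennreal_lessI) auto
    finally have "(norm (conv \<kappa> (\<lambda>y. h (w y) (\<Phi> m y)) x - conv \<kappa> (\<lambda>y. h (w y) (\<phi>' y)) x))\<^sup>2 < e\<^sup>2"
      by (simp add: ennreal_power ennreal_less_iff)
    then show "norm (conv \<kappa> (\<lambda>y. h (w y) (\<Phi> m y)) x - conv \<kappa> (\<lambda>y. h (w y) (\<phi>' y)) x) < e"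
      using \<open>e > 0\<close> by (simp add: power_less_imp_less_base less_imp_le)
  qed
qed

text \<open>Multiplication by \<open>w\<close> does not commute with mollification; the bound on the mollified product is
  obtained by Fatou's lemma from products with the smooth functions \<open>\<Phi> m\<close>.\<close>

lemma decay0_conv_bilinear:
  fixes h :: "'a::euclidean_space \<Rightarrow> spinor \<Rightarrow> 'c::euclidean_space"
  assumes h: "bounded_bilinear h" and w: "tempered w" and dk: "decay a0 k \<Phi>" and ks: "length ks \<le> k"
  shows "decay0 a0 (\<lambda>n. conv (pds ks (\<rho> n)) (\<lambda>y. h (w y) (\<phi>' y)))"
proof (rule decay0_I)
  fix a r :: real assume a: "0 < a" "a < a0" "0 < r"
  have sw: "smth UNIV w" using w by (simp add: tempered_def)
  have cw: "continuous_on UNIV w" by (rule smth_continuous[OF sw])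
  have sh: "smth UNIV (\<lambda>y. h (w y) (\<Phi> m y))" for m by (intro smth_bilinear[OF _ h] sw smth_\<Phi>) simp
  have "decay a0 k (\<lambda>n x. h (w x) (\<Phi> n x))" by (rule decay_bilinear[OF h w smth_\<Phi> dk])
  then have "decay0 a0 (\<lambda>m. pds ks (\<lambda>x. h (w x) (\<Phi> m x)))" using ks by (simp add: decay_def)
  then obtain s C N where 1: "s > 0" "C \<ge> 0" "\<And>m x. m \<ge> N \<Longrightarrow> r \<le> norm x \<Longrightarrow>
     (\<integral>\<^sup>+y\<in>cball x s. ennreal ((norm (pds ks (\<lambda>x. h (w x) (\<Phi> m x)) y))\<^sup>2) \<partial>lborel) \<le> ennreal (C * exp (- 2 * a * norm x))"
    using decay0_D[OF _ a] by blast
  obtain N' where N': "\<And>n. N' \<le> n \<Longrightarrow> eps n \<le> s / 2" using eps_small[of "s/2"] 1(1) by auto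
  show "\<exists>s>0. \<exists>C\<ge>0. \<exists>N. \<forall>n\<ge>N. \<forall>x. r \<le> norm x \<longrightarrow>
     (\<integral>\<^sup>+y\<in>cball x s. ennreal ((norm (conv (pds ks (\<rho> n)) (\<lambda>y. h (w y) (\<phi>' y)) y))\<^sup>2) \<partial>lborel) \<le> ennreal (C * exp (- 2 * a * norm x))"
  proof (rule decay0_witness[where s="s/2" and C=C and N=N'])
    fix n x assume n: "N' \<le> n" and x: "r \<le> norm (x::point)"
    let ?\<kappa> = "pds ks (\<rho> n)"
    have k\<kappa>: "kern (eps n) ?\<kappa>" by (rule kern_pds[OF kern_\<rho>])
    have [measurable]: "conv ?\<kappa> (\<lambda>y. h (w y) (\<Phi> m y)) \<in> borel_measurable borel" for m
      by (rule smth_measurable[OF smth_conv[OF k\<kappa> smth_loc_int[OF sh]]])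
    have bd: "(\<integral>\<^sup>+y\<in>cball x (s/2). ennreal ((norm (conv ?\<kappa> (\<lambda>y. h (w y) (\<Phi> m y)) y))\<^sup>2) \<partial>lborel) \<le> ennreal (C * exp (- 2 * a * norm x))" if "m \<ge> N" for m
    proof -
      \<comment> \<open>With the smooth factor \<open>\<Phi> m\<close> the derivatives pass from the
        kernel to the product, where the bound is uniform in \<open>m\<close>. The remaining
        mollification only enlarges the ball from radius \<open>s/2\<close> to at most
        \<open>s\<close>.\<close>
      have "conv ?\<kappa> (\<lambda>y. h (w y) (\<Phi> m y)) = conv (\<rho> n) (pds ks (\<lambda>y. h (w y) (\<Phi> m y)))"
        using pds_conv[OF kern_\<rho> smth_loc_int[OF sh], of ks n m] pds_conv_smth[OF kern_\<rho> sh, of ks n m] by simp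
      then have "(\<integral>\<^sup>+y\<in>cball x (s/2). ennreal ((norm (conv ?\<kappa> (\<lambda>y. h (w y) (\<Phi> m y)) y))\<^sup>2) \<partial>lborel)
         \<le> (\<integral>\<^sup>+y\<in>cball x s. ennreal ((norm (pds ks (\<lambda>y. h (w y) (\<Phi> m y)) y))\<^sup>2) \<partial>lborel)"
      proof (simp only:, intro nn_integral_conv_le[OF prob_\<rho> smth_loc_int[OF smth_pds[OF sh]]])
        fix y z assume "y \<in> cball x (s/2)" "norm (y - z) \<le> eps n"
        then show "z \<in> cball x s" using dist_triangle[of x z y] N'[OF n] by (simp add: dist_norm)
      qed measurable
      also have "\<dots> \<le> ennreal (C * exp (- 2 * a * norm x))" by (rule 1(3)[OF that x])
      finally show ?thesis .
    qed
    have "(\<integral>\<^sup>+y\<in>cball x (s/2). ennreal ((norm (conv ?\<kappa> (\<lambda>y. h (w y) (\<phi>' y)) y))\<^sup>2) \<partial>lborel) =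
      (\<integral>\<^sup>+y. liminf (\<lambda>m. ennreal ((norm (conv ?\<kappa> (\<lambda>y. h (w y) (\<Phi> m y)) y))\<^sup>2) * indicator (cball x (s/2)) y) \<partial>lborel)"
    proof (intro nn_integral_cong)
      fix y
      have "(\<lambda>m. ennreal ((norm (conv ?\<kappa> (\<lambda>y. h (w y) (\<Phi> m y)) y))\<^sup>2) * indicator (cball x (s/2)) y) \<longlonglongrightarrow> ennreal ((norm (conv ?\<kappa> (\<lambda>y. h (w y) (\<phi>' y)) y))\<^sup>2) * indicator (cball x (s/2)) y"
        by (cases "y \<in> cball x (s/2)") (auto intro!: tendsto_ennrealI tendsto_intros conv_bilinear_tendsto[OF h cw k\<kappa>])
      then show "ennreal ((norm (conv ?\<kappa> (\<lambda>y. h (w y) (\<phi>' y)) y))\<^sup>2) * indicator (cball x (s/2)) y = liminf (\<lambda>m. ennreal ((norm (conv ?\<kappa> (\<lambda>y. h (w y) (\<Phi> m y)) y))\<^sup>2) * indicator (cball x (s/2)) y)"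
        by (intro lim_imp_Liminf[symmetric] trivial_limit_sequentially)
    qed
    also have "\<dots> \<le> liminf (\<lambda>m. \<integral>\<^sup>+y\<in>cball x (s/2). ennreal ((norm (conv ?\<kappa> (\<lambda>y. h (w y) (\<Phi> m y)) y))\<^sup>2) \<partial>lborel)"
      by (rule nn_integral_liminf) measurable
    also have "\<dots> \<le> limsup (\<lambda>m. \<integral>\<^sup>+y\<in>cball x (s/2). ennreal ((norm (conv ?\<kappa> (\<lambda>y. h (w y) (\<Phi> m y)) y))\<^sup>2) \<partial>lborel)"
      by (rule Liminf_le_Limsup) simp
    also have "\<dots> \<le> ennreal (C * exp (- 2 * a * norm x))"
      by (rule Limsup_bounded, rule eventually_mono[OF eventually_ge_at_top[of N]], rule bd)
    finally show "(\<integral>\<^sup>+y\<in>cball x (s/2). ennreal ((norm (conv ?\<kappa> (\<lambda>y. h (w y) (\<phi>' y)) y))\<^sup>2) \<partial>lborel) \<le> ennreal (C * exp (- 2 * a * norm x))" .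
  qed (use 1 in auto)
qed

end

context smooth_dirac_eigenvector
begin

lemma continuous_A: "continuous_on UNIV A"
  using tempered_magnetic[OF smooth] by (auto simp: tempered_def intro: smth_continuous)

lemma continuous_outer_V: "r > 0 \<Longrightarrow> continuous_on UNIV (\<lambda>x. outer r x *\<^sub>R V x)"
  using tempered_electric[OF smooth] by (auto simp: tempered_def intro: smth_continuous)

text \<open>The margins fit together: from \<open>norm y \<ge> 3 * r / 4\<close> a kernel of radius
  at most \<open>r / 4\<close> only sees points with \<open>norm z \<ge> r / 2\<close>, where
  \<open>outer r\<close> is 1 and \<open>source (r/4)\<close> is the full right-hand side. The
  support of the kernel thus keeps the test function off the singularity, and the cut-off is the
  constant 1.\<close>

lemma Jd_conv:
  assumes r: "r > 0" and \<kappa>: "kern \<epsilon> \<kappa>" "\<epsilon> \<le> r / 4" and y: "norm y \<ge> 3 * r / 4"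
  shows "Jd (conv \<kappa> \<phi>') y = (lam *\<^sub>R conv \<kappa> \<phi>' y - Bt (conv \<kappa> \<phi>' y))
    - conv \<kappa> (\<lambda>z. AL (A z) (\<phi>' z)) y - conv \<kappa> (\<lambda>z. (outer r z *\<^sub>R V z) *v \<phi>' z) y"
proof -
  have r4: "r / 4 > 0" using r by simp
  have far: "norm z \<ge> r / 2" if "norm (y - z) \<le> \<epsilon>" for z
    using norm_triangle_ineq2[of y z] that y \<kappa>(2) by linarith
  have sup: "\<kappa> (y - z) * 1 = 0" if "norm z \<le> r / 4" for z
  proof -
    have "\<not> norm (y - z) \<le> \<epsilon>" using far[of z] that r by linarith
    then show ?thesis using \<kappa>(1) by (simp add: kern_def)
  qed
  have "pdiff k (\<lambda>_. 1::real) z = 0" for k z by (rule has_pd_imp_pdiff[OF has_pd_const])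
  then have 1: "Jd (conv \<kappa> \<phi>') y = conv \<kappa> (source (r/4)) y"
    using weak_sol_conv[OF weak_sol_source[OF r4] loc_int_phi loc_int_source[OF r4] \<kappa>(1) smth_const[of UNIV 1] sup] by simp
  let ?L = "\<lambda>v. lam *\<^sub>R v - Bt v"
  have L: "bounded_linear ?L" by (intro bounded_linear_sub bounded_linear_Bt bounded_linear_scaleR_right)
  let ?P = "\<lambda>z. AL (A z) (\<phi>' z)" and ?Q = "\<lambda>z. (outer r z *\<^sub>R V z) *v \<phi>' z"
  have l: "loc_int (\<lambda>z. ?L (\<phi>' z))" "loc_int ?P" "loc_int ?Q"
    by (rule loc_int_linear[OF L loc_int_phi], rule loc_int_bilinear[OF bounded_bilinear_AL continuous_A loc_int_phi],
        rule loc_int_bilinear[OF bounded_bilinear_matvec continuous_outer_V[OF r] loc_int_phi])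
  note i = conv_integrable[OF \<kappa>(1) l(1), of y] conv_integrable[OF \<kappa>(1) l(2), of y] conv_integrable[OF \<kappa>(1) l(3), of y]
  have [measurable]: "\<kappa> \<in> borel_measurable borel" by (rule kern_measurable[OF \<kappa>(1)])
  have "conv \<kappa> (source (r/4)) y = (\<integral>z. \<kappa> (y - z) *\<^sub>R ?L (\<phi>' z) - \<kappa> (y - z) *\<^sub>R ?P z - \<kappa> (y - z) *\<^sub>R ?Q z \<partial>lborel)"
    unfolding conv_def
  proof (rule integral_cong_AE)
    show "(\<lambda>z. \<kappa> (y - z) *\<^sub>R ?L (\<phi>' z) - \<kappa> (y - z) *\<^sub>R ?P z - \<kappa> (y - z) *\<^sub>R ?Q z) \<in> borel_measurable lborel"
      by (intro borel_measurable_diff borel_measurable_integrable i)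
    show "AE z in lborel. \<kappa> (y - z) *\<^sub>R source (r/4) z = \<kappa> (y - z) *\<^sub>R ?L (\<phi>' z) - \<kappa> (y - z) *\<^sub>R ?P z - \<kappa> (y - z) *\<^sub>R ?Q z"
      using ae(2,3)
    proof eventually_elim
      case (elim z)
      show ?case
      proof (cases "norm (y - z) \<le> \<epsilon>")
        case True
        then have z: "norm z \<ge> r / 2" by (rule far)
        then have "outer r z = 1" by (rule outer_1[OF r])
        moreover have "\<not> norm z \<le> r / 4" using z r by linarith
        ultimately show ?thesis using elim by (simp add: source_def scaleR_diff_right)
      next
        case False
        then show ?thesis using \<kappa>(1) by (simp add: kern_def)
      qed
    qed
  qed measurable
  also have "\<dots> = conv \<kappa> (\<lambda>z. ?L (\<phi>' z)) y - conv \<kappa> ?P y - conv \<kappa> ?Q y"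
    unfolding conv_def by (simp only: Bochner_Integration.integral_diff Bochner_Integration.integrable_diff i)
  also have "conv \<kappa> (\<lambda>z. ?L (\<phi>' z)) y = ?L (conv \<kappa> \<phi>' y)"
  proof -
    have "conv \<kappa> (\<lambda>z. ?L (\<phi>' z)) y = (\<integral>z. ?L (\<kappa> (y - z) *\<^sub>R \<phi>' z) \<partial>lborel)"
      unfolding conv_def
      by (simp add: linear_scale[OF bounded_linear.linear[OF bounded_linear_Bt]] scaleR_diff_right mult.commute)
    also have "\<dots> = ?L (conv \<kappa> \<phi>' y)"
      unfolding conv_def by (rule integral_bounded_linear[OF L conv_integrable[OF \<kappa>(1) loc_int_phi]])
    finally show ?thesis .
  qed
  finally show ?thesis unfolding 1 .
qed

text \<open>For \<open>f n = pds ks (\<Phi> n)\<close> the equation expresses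
  \<open>Jd (f n)\<close> by convolving the eigenvector and its products with the two potentials
  with \<open>pds ks (\<rho> n)\<close>. These terms decay by the hypothesis of order
  \<open>k\<close>, and ellipticity then bounds the outermost derivative \<open>j\<close>.\<close>

lemma decay_step:
  assumes dk: "decay a0 k \<Phi>" shows "decay a0 (Suc k) \<Phi>"
  unfolding decay_def
proof (intro allI impI)
  fix js :: "3 list" assume js: "length js \<le> Suc k"
  show "decay0 a0 (\<lambda>n. pds js (\<Phi> n))"
  proof (cases js)
    case Nil
    then show ?thesis using decay_\<Phi>_0 by simp
  next
    case (Cons j ks)
    then have ks: "length ks \<le> k" using js by simp
    define f where "f n = pds ks (\<Phi> n)" for n
    have sf: "smth UNIV (f n)" for n unfolding f_def by (rule smth_pds[OF smth_\<Phi>])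
    have df: "decay0 a0 f" using dk ks unfolding f_def[abs_def] decay_def by blast
    have fe: "f n = conv (pds ks (\<rho> n)) \<phi>'" for n unfolding f_def by (rule pds_\<Phi>)
    have k\<kappa>: "kern (eps n) (pds ks (\<rho> n))" for n by (rule kern_pds[OF kern_\<rho>])
    show ?thesis
    proof (rule decay0_I)
      fix a r :: real assume a: "0 < a" "a < a0" "0 < r"
      define P where "P n = conv (pds ks (\<rho> n)) (\<lambda>z. AL (A z) (\<phi>' z))" for n
      define Q where "Q n = conv (pds ks (\<rho> n)) (\<lambda>z. (outer r z *\<^sub>R V z) *v \<phi>' z)" for n
      have [measurable]: "f n \<in> borel_measurable borel" for n by (rule smth_measurable[OF sf])
      have [measurable]: "P n \<in> borel_measurable borel" for n
        unfolding P_def by (rule smth_measurable[OF smth_conv[OF k\<kappa> loc_int_bilinear[OF bounded_bilinear_AL continuous_A loc_int_phi]]])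
      have [measurable]: "Q n \<in> borel_measurable borel" for n
        unfolding Q_def by (rule smth_measurable[OF smth_conv[OF k\<kappa> loc_int_bilinear[OF bounded_bilinear_matvec continuous_outer_V[OF a(3)] loc_int_phi]]])
      have "decay0 a0 P" unfolding P_def[abs_def] by (rule decay0_conv_bilinear[OF bounded_bilinear_AL tempered_magnetic[OF smooth] dk ks])
      then have dP: "decay0 a0 (\<lambda>n x. - P n x)" by (rule decay0_scale[where c=1]) simp_all
      have "decay0 a0 Q" unfolding Q_def[abs_def] by (rule decay0_conv_bilinear[OF bounded_bilinear_matvec tempered_electric[OF smooth a(3)] dk ks])
      then have dQ: "decay0 a0 (\<lambda>n x. - Q n x)" by (rule decay0_scale[where c=1]) simp_all
      have dL: "decay0 a0 (\<lambda>n x. lam *\<^sub>R f n x - Bt (f n x))"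
      proof (rule decay0_scale[OF df])
        show "norm (lam *\<^sub>R f n x - Bt (f n x)) \<le> (\<bar>lam\<bar> + 1) * norm (f n x)" for n x
          using norm_triangle_ineq4[of "lam *\<^sub>R f n x" "Bt (f n x)"] by (simp add: distrib_right)
      qed measurable
      let ?H = "\<lambda>n x. (lam *\<^sub>R f n x - Bt (f n x)) + (- P n x + - Q n x)"
      have "decay0 a0 ?H" by (intro decay0_add dL dP dQ) measurable
      then obtain s1 C1 N1 where 1: "s1 > 0" "C1 \<ge> 0" "\<And>n x. n \<ge> N1 \<Longrightarrow> r \<le> norm x \<Longrightarrow>
        (\<integral>\<^sup>+y\<in>cball x s1. ennreal ((norm (?H n y))\<^sup>2) \<partial>lborel) \<le> ennreal (C1 * exp (- 2 * a * norm x))"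
        using decay0_D[OF _ a] by blast
      obtain s2 C2 N2 where 2: "s2 > 0" "C2 \<ge> 0" "\<And>n x. n \<ge> N2 \<Longrightarrow> r \<le> norm x \<Longrightarrow>
        (\<integral>\<^sup>+y\<in>cball x s2. ennreal ((norm (f n y))\<^sup>2) \<partial>lborel) \<le> ennreal (C2 * exp (- 2 * a * norm x))"
        using decay0_D[OF df a] by blast
      have r4: "r / 4 > 0" using a(3) by simp
      obtain N3 where N3: "\<And>n. N3 \<le> n \<Longrightarrow> eps n \<le> r / 4" using eps_small[OF r4] by blast
      \<comment> \<open>The bound \<open>r / 4\<close> keeps the ball around \<open>x\<close> inside
        \<open>norm y \<ge> 3 * r / 4\<close>, as \<open>Jd_conv\<close> requires.\<close>
      define s where "s = min (min s1 s2) (r / 4)"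
      have s: "s > 0" "s \<le> s1" "s \<le> s2" "s \<le> r / 4" using 1(1) 2(1) r4 by (auto simp: s_def)
      obtain E where E: "E \<ge> 0" "\<And>f x. smth UNIV f \<Longrightarrow>
        (\<integral>\<^sup>+y\<in>cball x (s/4). ennreal ((norm (pdiff j f y))\<^sup>2) \<partial>lborel) \<le>
          ennreal 2 * (\<integral>\<^sup>+y\<in>cball x s. ennreal ((norm (Jd f y))\<^sup>2) \<partial>lborel) + ennreal E * (\<integral>\<^sup>+y\<in>cball x s. ennreal ((norm (f y))\<^sup>2) \<partial>lborel)"
        using elliptic_local[OF s(1)] by blast
      show "\<exists>s>0. \<exists>C\<ge>0. \<exists>N. \<forall>n\<ge>N. \<forall>x. r \<le> norm x \<longrightarrow>
        (\<integral>\<^sup>+y\<in>cball x s. ennreal ((norm (pds js (\<Phi> n) y))\<^sup>2) \<partial>lborel) \<le> ennreal (C * exp (- 2 * a * norm x))"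
      proof (rule decay0_witness[where s="s/4" and C="2 * C1 + E * C2" and N="max N1 (max N2 N3)"])
        fix n x assume n: "max N1 (max N2 N3) \<le> n" and x: "r \<le> norm (x::point)"
        let ?e = "exp (- 2 * a * norm x)"
        have JH: "Jd (f n) y = ?H n y" if "y \<in> cball x s" for y
        proof -
          have "norm y \<ge> 3 * r / 4" using norm_triangle_ineq2[of x y] that s(4) x by (simp add: dist_norm)
          then show ?thesis unfolding fe P_def Q_def using Jd_conv[OF a(3) k\<kappa> N3] n by simp
        qed
        have "(\<integral>\<^sup>+y\<in>cball x (s/4). ennreal ((norm (pdiff j (f n) y))\<^sup>2) \<partial>lborel) \<le>
          ennreal 2 * (\<integral>\<^sup>+y\<in>cball x s. ennreal ((norm (Jd (f n) y))\<^sup>2) \<partial>lborel) + ennreal E * (\<integral>\<^sup>+y\<in>cball x s. ennreal ((norm (f n y))\<^sup>2) \<partial>lborel)"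
          by (rule E(2)[OF sf])
        also have "(\<integral>\<^sup>+y\<in>cball x s. ennreal ((norm (Jd (f n) y))\<^sup>2) \<partial>lborel) = (\<integral>\<^sup>+y\<in>cball x s. ennreal ((norm (?H n y))\<^sup>2) \<partial>lborel)"
          using JH by (intro nn_integral_cong) (auto simp: indicator_def)
        also have "ennreal 2 * \<dots> + ennreal E * (\<integral>\<^sup>+y\<in>cball x s. ennreal ((norm (f n y))\<^sup>2) \<partial>lborel) \<le> ennreal 2 * ennreal (C1 * ?e) + ennreal E * ennreal (C2 * ?e)"
          by (intro add_mono mult_left_mono order_trans[OF nn_integral_cball_mono[OF s(2)] 1(3)] order_trans[OF nn_integral_cball_mono[OF s(3)] 2(3)]) (use n x in auto)
        also have "\<dots> = ennreal ((2 * C1 + E * C2) * ?e)"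
          using 1(2) 2(2) E(1) by (subst ennreal_lincomb) (auto simp: algebra_simps)
        finally show "(\<integral>\<^sup>+y\<in>cball x (s/4). ennreal ((norm (pds js (\<Phi> n) y))\<^sup>2) \<partial>lborel) \<le> ennreal ((2 * C1 + E * C2) * ?e)"
          using Cons by (simp add: f_def)
      qed (use s 1 2 E in auto)
    qed
  qed
qed

lemma decay_all: "decay a0 k \<Phi>"
  by (induction k) (auto simp: decay_0 decay_\<Phi>_0 intro: decay_step)

lemma decay_pds: "decay0 a0 (\<lambda>n. pds ks (\<Phi> n))"
  using decay_all[of "length ks"] unfolding decay_def by blast

end

section \<open>From local bounds in the mean to pointwise bounds\<close>

primrec leibniz :: "3 list \<Rightarrow> (3 list \<times> 3 list) list" where
  "leibniz [] = [([], [])]"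
| "leibniz (k # ks) = map (\<lambda>(w, v). (k # w, v)) (leibniz ks) @ map (\<lambda>(w, v). (w, k # v)) (leibniz ks)"

lemma has_pd_sum_list: "(\<And>p. p \<in> set l \<Longrightarrow> has_pd k (g p) (d p) x) \<Longrightarrow> has_pd k (\<lambda>x. \<Sum>p\<leftarrow>l. g p x) (\<Sum>p\<leftarrow>l. d p) x"
  by (induction l) (auto intro: has_pd_const has_pd_add)

text \<open>\<open>leibniz\<close> lists every distribution of the letters over the two factors,
  with repetitions, so no binomial coefficients occur.\<close>

lemma pds_leibniz:
  fixes b :: "point \<Rightarrow> real"
  assumes b: "smth UNIV b" and f: "smth UNIV f"
  shows "pds ks (\<lambda>y. b y *\<^sub>R f y) = (\<lambda>y. \<Sum>p\<leftarrow>leibniz ks. pds (fst p) b y *\<^sub>R pds (snd p) f y)"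
proof (induction ks)
  case (Cons k ks)
  show ?case
  proof
    fix y
    have "has_pd k (\<lambda>y. pds (fst p) b y *\<^sub>R pds (snd p) f y)
       (pds (fst p) b y *\<^sub>R pds (k # snd p) f y + pds (k # fst p) b y *\<^sub>R pds (snd p) f y) y" for p
      using has_pd_bilinear[OF bounded_bilinear_scaleR smth_has_pd[OF smth_pds[OF b]] smth_has_pd[OF smth_pds[OF f]]] by simp
    then have "has_pd k (\<lambda>y. \<Sum>p\<leftarrow>leibniz ks. pds (fst p) b y *\<^sub>R pds (snd p) f y)
       (\<Sum>p\<leftarrow>leibniz ks. pds (fst p) b y *\<^sub>R pds (k # snd p) f y + pds (k # fst p) b y *\<^sub>R pds (snd p) f y) y"
      by (intro has_pd_sum_list)
    then have "pds (k # ks) (\<lambda>y. b y *\<^sub>R f y) y = (\<Sum>p\<leftarrow>leibniz ks. pds (fst p) b y *\<^sub>R pds (k # snd p) f y + pds (k # fst p) b y *\<^sub>R pds (snd p) f y)"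
      unfolding pds.simps(2)[of k ks "\<lambda>y. b y *\<^sub>R f y"] Cons.IH by (rule has_pd_imp_pdiff)
    then show "pds (k # ks) (\<lambda>y. b y *\<^sub>R f y) y = (\<Sum>p\<leftarrow>leibniz (k # ks). pds (fst p) b y *\<^sub>R pds (snd p) f y)"
      by (simp add: sum_list_addf o_def split_beta add.commute del: pds.simps(2))
  qed
qed simp

lemma pds_shift:
  assumes "smth UNIV b" shows "pds ks (\<lambda>y. b (y + c)) = (\<lambda>y. pds ks b (y + c))"
proof (induction ks)
  case (Cons k ks)
  then show ?case
    using has_pd_imp_pdiff[OF has_pd_shift[OF smth_has_pd[OF smth_pds[OF assms]]]] by auto
qed simp

text \<open>A squared bound at rate \<open>2 * a\<close> becomes a bound at rate \<open>a\<close>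
  through \<open>t \<le> \<theta> + t\<^sup>2 / \<theta>\<close>, where
  \<open>\<theta> = exp (- a * norm x)\<close> is the scale at which the two terms balance. The
  volume of the ball does not depend on its centre. Smaller radii are included so that several
  functions can share one radius.\<close>

lemma decay0_L1:
  assumes F: "decay0 a0 F" and [measurable]: "\<And>n. F n \<in> borel_measurable borel" and a: "0 < a" "a < a0" "0 < r"
  obtains s C N where "s > 0" "C \<ge> 0" "\<And>n x s'. n \<ge> N \<Longrightarrow> r \<le> norm x \<Longrightarrow> s' \<le> s \<Longrightarrow>
     (\<integral>\<^sup>+y\<in>cball x s'. ennreal (norm (F n y)) \<partial>lborel) \<le> ennreal (C * exp (- a * norm x))"
proof -
  obtain s C N where 1: "s > 0" "C \<ge> 0" "\<And>n x. n \<ge> N \<Longrightarrow> r \<le> norm x \<Longrightarrow>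
     (\<integral>\<^sup>+y\<in>cball x s. ennreal ((norm (F n y))\<^sup>2) \<partial>lborel) \<le> ennreal (C * exp (- 2 * a * norm x))"
    using decay0_D[OF F a] by blast
  define v where "v = measure lborel (cball (0::point) s)"
  have v: "emeasure lborel (cball x s) = ennreal v" for x :: point
  proof -
    have "emeasure lborel (cball x s) = ennreal (measure lborel (cball x s))"
      using emeasure_bounded_finite[OF bounded_cball, of x s] by (intro emeasure_eq_ennreal_measure) (simp add: less_top)
    also have "measure lborel (cball x s) = v" unfolding v_def using 1(1) by (simp add: content_cball)
    finally show ?thesis .
  qed
  have v0: "v \<ge> 0" by (simp add: v_def)
  have "(\<integral>\<^sup>+y\<in>cball x s'. ennreal (norm (F n y)) \<partial>lborel) \<le> ennreal ((v + C) * exp (- a * norm x))"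
    if n: "n \<ge> N" and x: "r \<le> norm x" and s': "s' \<le> s" for n x s'
  proof -
    let ?\<theta> = "exp (- a * norm x)"
    have "(\<integral>\<^sup>+y\<in>cball x s'. ennreal (norm (F n y)) \<partial>lborel) \<le> (\<integral>\<^sup>+y\<in>cball x s. ennreal (norm (F n y)) \<partial>lborel)"
      by (rule nn_integral_cball_mono[OF s'])
    also have "\<dots> \<le> (\<integral>\<^sup>+y. ennreal ?\<theta> * indicator (cball x s) y + ennreal (1 / ?\<theta>) * (ennreal ((norm (F n y))\<^sup>2) * indicator (cball x s) y) \<partial>lborel)"
    proof (intro nn_integral_mono)
      fix y
      have "0 \<le> (?\<theta> - norm (F n y))\<^sup>2 / ?\<theta>" by simp
      also have "\<dots> = ?\<theta> - 2 * norm (F n y) + 1 / ?\<theta> * (norm (F n y))\<^sup>2"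
        by (simp add: power2_eq_square field_simps)
      finally have "norm (F n y) \<le> ?\<theta> * 1 + 1 / ?\<theta> * (norm (F n y))\<^sup>2" using norm_ge_zero[of "F n y"] by linarith
      then have "ennreal (norm (F n y)) \<le> ennreal ?\<theta> * ennreal 1 + ennreal (1 / ?\<theta>) * ennreal ((norm (F n y))\<^sup>2)"
        by (subst ennreal_lincomb) (simp_all only: ennreal_leI exp_ge_zero zero_le_one zero_le_divide_iff zero_le_power2, simp)
      then show "ennreal (norm (F n y)) * indicator (cball x s) y \<le> ennreal ?\<theta> * indicator (cball x s) y + ennreal (1 / ?\<theta>) * (ennreal ((norm (F n y))\<^sup>2) * indicator (cball x s) y)"
        by (cases "y \<in> cball x s") auto
    qed
    also have "\<dots> = ennreal ?\<theta> * ennreal v + ennreal (1 / ?\<theta>) * (\<integral>\<^sup>+y\<in>cball x s. ennreal ((norm (F n y))\<^sup>2) \<partial>lborel)"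
      by (subst nn_integral_add, measurable, subst nn_integral_cmult_indicator, measurable, subst nn_integral_cmult, measurable) (simp add: v)
    also have "\<dots> \<le> ennreal ?\<theta> * ennreal v + ennreal (1 / ?\<theta>) * ennreal (C * exp (- 2 * a * norm x))"
      by (intro add_left_mono mult_left_mono 1(3) n x) simp
    also have "\<dots> = ennreal ((v + C) * ?\<theta>)"
    proof -
      have "1 / ?\<theta> * (C * exp (- 2 * a * norm x)) = C * ?\<theta>"
        by (simp add: exp_minus[symmetric] divide_inverse exp_add[symmetric] mult_exp_exp)
      then show ?thesis using v0 1(2) by (subst ennreal_lincomb) (auto simp: algebra_simps)
    qed
    finally show ?thesis .
  qed
  then show thesis using that[of s "v + C" N] 1 v0 by simp
qed

lemma ennreal_norm_sum_list:
  "(\<And>p. ennreal (norm (g p)) \<le> H p) \<Longrightarrow> ennreal (norm (\<Sum>p\<leftarrow>l. g p)) \<le> (\<Sum>p\<leftarrow>l. H p)"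
proof (induction l)
  case (Cons p l)
  have "ennreal (norm (\<Sum>p\<leftarrow>p # l. g p)) \<le> ennreal (norm (g p) + norm (\<Sum>p\<leftarrow>l. g p))"
    by (simp add: norm_triangle_ineq ennreal_leI del: ennreal_plus)
  also have "\<dots> = ennreal (norm (g p)) + ennreal (norm (\<Sum>p\<leftarrow>l. g p))" by simp
  also have "\<dots> \<le> H p + (\<Sum>p\<leftarrow>l. H p)" by (intro add_mono Cons.IH Cons.prems)
  finally show ?case by simp
qed simp

lemma nn_integral_sum_list:
  "(\<And>p. g p \<in> borel_measurable M) \<Longrightarrow> (\<integral>\<^sup>+x. (\<Sum>p\<leftarrow>l. g p x) \<partial>M) = (\<Sum>p\<leftarrow>l. \<integral>\<^sup>+x. g p x \<partial>M)"
proof (induction l)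
  case (Cons p l)
  have "(\<lambda>x. \<Sum>p\<leftarrow>l. g p x) \<in> borel_measurable M" using Cons.prems by (induction l) auto
  then show ?case using Cons by (simp add: nn_integral_add)
qed simp

lemma sum_list_ennreal_mult:
  "(\<And>p. g p \<ge> 0) \<Longrightarrow> (\<Sum>p\<leftarrow>l. ennreal (g p) * K) = ennreal (\<Sum>p\<leftarrow>l. g p) * K"
proof (induction l)
  case (Cons p l)
  have "0 \<le> (\<Sum>p\<leftarrow>l. g p)" using Cons.prems by (intro sum_list_nonneg) auto
  then show ?case using Cons by (simp add: distrib_right)
qed simp

context smooth_dirac_eigenvector
begin

lemma a0_pos: "a0 > 0"
proof -
  have "lam\<^sup>2 < 1" using lam abs_square_less_1[of lam] by (simp add: abs_less_iff)
  then show ?thesis by simp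
qed

text \<open>Finitely many words get a common radius, constant and threshold, as the Leibniz
  expansion in \<open>pointwise_bound\<close> needs.\<close>

lemma local_L1_bound:
  assumes a: "0 < a" "a < a0" "0 < r"
  shows "\<exists>s>0. \<exists>C\<ge>0. \<exists>N. \<forall>p\<in>set l. \<forall>n\<ge>N. \<forall>x. r \<le> norm x \<longrightarrow> (\<forall>s'\<le>s.
    (\<integral>\<^sup>+y\<in>cball x s'. ennreal (norm (pds p (\<Phi> n) y)) \<partial>lborel) \<le> ennreal (C * exp (- a * norm x)))"
proof (induction l)
  case Nil
  show ?case by (intro exI[of _ 1]) auto
next
  case (Cons q l)
  then obtain s C N where 1: "s > 0" "C \<ge> 0" "\<And>p n x s'. p \<in> set l \<Longrightarrow> n \<ge> N \<Longrightarrow> r \<le> norm x \<Longrightarrow> s' \<le> s \<Longrightarrow>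
    (\<integral>\<^sup>+y\<in>cball x s'. ennreal (norm (pds p (\<Phi> n) y)) \<partial>lborel) \<le> ennreal (C * exp (- a * norm x))" by blast
  have m: "pds q (\<Phi> n) \<in> borel_measurable borel" for n by (rule smth_measurable[OF smth_pds[OF smth_\<Phi>]])
  obtain t D N' where 2: "t > 0" "D \<ge> 0" "\<And>n x s'. n \<ge> N' \<Longrightarrow> r \<le> norm x \<Longrightarrow> s' \<le> t \<Longrightarrow>
    (\<integral>\<^sup>+y\<in>cball x s'. ennreal (norm (pds q (\<Phi> n) y)) \<partial>lborel) \<le> ennreal (D * exp (- a * norm x))"
    using decay0_L1[OF decay_pds m a] by blast
  have C: "ennreal (C * exp (- a * norm x)) \<le> ennreal ((C + D) * exp (- a * norm x))"
    "ennreal (D * exp (- a * norm x)) \<le> ennreal ((C + D) * exp (- a * norm x))" for x :: point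
    using 1(2) 2(2) by (auto intro!: ennreal_leI mult_right_mono)
  have "(\<integral>\<^sup>+y\<in>cball x s'. ennreal (norm (pds p (\<Phi> n) y)) \<partial>lborel) \<le> ennreal ((C + D) * exp (- a * norm x))"
    if p: "p \<in> set (q # l)" and n: "n \<ge> max N N'" and x: "r \<le> norm x" and s': "s' \<le> min s t" for p n x s'
  proof (cases "p = q")
    case True
    then show ?thesis using 2(3)[of n x s'] n x s' C(2)[of x] by (auto intro: order_trans)
  next
    case False
    then show ?thesis using 1(3)[of p n x s'] p n x s' C(1)[of x] by (auto intro: order_trans)
  qed
  moreover have "min s t > 0" "C + D \<ge> 0" using 1 2 by auto
  ultimately show ?case by blast
qed

text \<open>The Sobolev inequality for \<open>pds ks (\<Phi> n)\<close> multiplied by a bump around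
  \<open>x\<close>, which is 1 at \<open>x\<close> itself. The Leibniz rule spreads the three
  derivatives over finitely many words, all controlled on the same ball by
  \<open>local_L1_bound\<close>.\<close>

lemma pointwise_bound:
  assumes a: "0 < a" "a < a0" "0 < r"
  obtains C N where "C \<ge> 0" "\<And>n x. n \<ge> N \<Longrightarrow> r \<le> norm x \<Longrightarrow> norm (pds ks (\<Phi> n) x) \<le> C * exp (- a * norm x)"
proof -
  let ?L = "leibniz [1,2,3]"
  obtain s C N where 1: "s > 0" "C \<ge> 0" "\<And>p n x s'. p \<in> set (map (\<lambda>p. snd p @ ks) ?L) \<Longrightarrow> n \<ge> N \<Longrightarrow> r \<le> norm x \<Longrightarrow> s' \<le> s \<Longrightarrow>
    (\<integral>\<^sup>+y\<in>cball x s'. ennreal (norm (pds p (\<Phi> n) y)) \<partial>lborel) \<le> ennreal (C * exp (- a * norm x))"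
    using local_L1_bound[OF a, of "map (\<lambda>p. snd p @ ks) ?L"] by blast
  have kb: "kern s (bump s)" using kern_bump 1(1) by blast
  have sb: "smth UNIV (bump s)" using kb by (simp add: kern_def)
  have "\<exists>B. B > 0 \<and> (\<forall>z. norm (pds w (bump s) z) \<le> B)" for w using kern_bounded[OF kern_pds[OF kb]] by metis
  then obtain Bd where Bd: "\<And>w. Bd w > 0" "\<And>w z. norm (pds w (bump s) z) \<le> Bd w" by metis
  define M where "M = (\<Sum>p\<leftarrow>?L. Bd (fst p))"
  have M: "M \<ge> 0" unfolding M_def using Bd(1) by (intro sum_list_nonneg) (auto intro: less_imp_le)
  have "norm (pds ks (\<Phi> n) x) \<le> (M * C) * exp (- a * norm x)" if n: "n \<ge> N" and x: "r \<le> norm x" for n x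
  proof -
    define f where "f = pds ks (\<Phi> n)"
    have sf: "smth UNIV f" unfolding f_def by (rule smth_pds[OF smth_\<Phi>])
    have [measurable]: "pds v f \<in> borel_measurable borel" for v by (rule smth_measurable[OF smth_pds[OF sf]])
    define u where "u y = bump s (y - x) *\<^sub>R f y" for y
    have ku: "kern (norm x + s) u" unfolding u_def[abs_def] by (rule bump_cutoff(1)[OF 1(1) sf])
    have sbx: "smth UNIV (\<lambda>y. bump s (y + - x))" by (rule smth_shift[OF sb])
    have pu: "pds [1,2,3] u y = (\<Sum>p\<leftarrow>?L. pds (fst p) (bump s) (y - x) *\<^sub>R pds (snd p) f y)" for y
    proof -
      have "u = (\<lambda>y. bump s (y + - x) *\<^sub>R f y)" by (simp add: u_def[abs_def])
      then have "pds [1,2,3] u = (\<lambda>y. \<Sum>p\<leftarrow>?L. pds (fst p) (\<lambda>y. bump s (y + - x)) y *\<^sub>R pds (snd p) f y)"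
        using pds_leibniz[OF sbx sf] by metis
      then show ?thesis unfolding pds_shift[OF sb] by simp
    qed
    have "ennreal (norm (f x)) = ennreal (norm (u x))" using bump_eq_1[OF 1(1), of 0] 1(1) by (simp add: u_def)
    also have "\<dots> \<le> (\<integral>\<^sup>+y. ennreal (norm (pds [1,2,3] u y)) \<partial>lborel)" by (rule sobolev_pointwise[OF ku])
    also have "\<dots> \<le> (\<integral>\<^sup>+y. (\<Sum>p\<leftarrow>?L. ennreal (Bd (fst p)) * (ennreal (norm (pds (snd p) f y)) * indicator (cball x s) y)) \<partial>lborel)"
    proof (intro nn_integral_mono)
      fix y
      show "ennreal (norm (pds [1,2,3] u y)) \<le> (\<Sum>p\<leftarrow>?L. ennreal (Bd (fst p)) * (ennreal (norm (pds (snd p) f y)) * indicator (cball x s) y))"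
        unfolding pu
      proof (rule ennreal_norm_sum_list)
        fix p :: "3 list \<times> 3 list"
        show "ennreal (norm (pds (fst p) (bump s) (y - x) *\<^sub>R pds (snd p) f y)) \<le> ennreal (Bd (fst p)) * (ennreal (norm (pds (snd p) f y)) * indicator (cball x s) y)"
        proof (cases "y \<in> cball x s")
          case True
          have "norm (pds (fst p) (bump s) (y - x) *\<^sub>R pds (snd p) f y) \<le> Bd (fst p) * norm (pds (snd p) f y)"
            using Bd(2)[of "fst p" "y - x"] by (auto intro: mult_right_mono)
          then show ?thesis using True Bd(1)[of "fst p"] by (simp add: ennreal_leI flip: ennreal_mult)
        next
          case False
          then have "norm (y - x) > s" by (simp add: dist_norm norm_minus_commute)
          then show ?thesis using kern_pds[OF kb, of "fst p"] by (simp add: kern_def)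
        qed
      qed
    qed
    also have "\<dots> = (\<Sum>p\<leftarrow>?L. \<integral>\<^sup>+y. ennreal (Bd (fst p)) * (ennreal (norm (pds (snd p) f y)) * indicator (cball x s) y) \<partial>lborel)"
      by (rule nn_integral_sum_list) measurable
    also have "\<dots> \<le> (\<Sum>p\<leftarrow>?L. ennreal (Bd (fst p)) * ennreal (C * exp (- a * norm x)))"
    proof (rule sum_list_mono)
      fix p assume p: "p \<in> set ?L"
      have "(\<integral>\<^sup>+y. ennreal (Bd (fst p)) * (ennreal (norm (pds (snd p) f y)) * indicator (cball x s) y) \<partial>lborel) = ennreal (Bd (fst p)) * (\<integral>\<^sup>+y\<in>cball x s. ennreal (norm (pds (snd p) f y)) \<partial>lborel)"
        by (rule nn_integral_cmult) measurable
      also have "\<dots> \<le> ennreal (Bd (fst p)) * ennreal (C * exp (- a * norm x))"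
        using 1(3)[OF _ n x order_refl, of "snd p @ ks"] p by (intro mult_left_mono) (auto simp: f_def pds_append[symmetric])
      finally show "(\<integral>\<^sup>+y. ennreal (Bd (fst p)) * (ennreal (norm (pds (snd p) f y)) * indicator (cball x s) y) \<partial>lborel) \<le> ennreal (Bd (fst p)) * ennreal (C * exp (- a * norm x))" .
    qed
    also have "\<dots> = ennreal M * ennreal (C * exp (- a * norm x))"
      unfolding M_def by (rule sum_list_ennreal_mult) (simp add: Bd(1) less_imp_le)
    also have "\<dots> = ennreal (M * C * exp (- a * norm x))" using M 1(2) by (simp add: ennreal_mult[symmetric] mult.assoc)
    finally show ?thesis using M 1(2) by (subst (asm) ennreal_le_iff) (auto simp: f_def)
  qed
  then show thesis using that[of "M * C" N] M 1(2) by simp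
qed

text \<open>Taken at the rate \<open>a0 / 2\<close>, of which only boundedness is kept. Constants
  and thresholds for the three directions are merged by maxima.\<close>

lemma uniform_bound:
  assumes r: "r > 0"
  obtains B N where "B \<ge> 0" "\<And>n x k. n \<ge> N \<Longrightarrow> r \<le> norm x \<Longrightarrow> norm (pds (k # ks) (\<Phi> n) x) \<le> B"
proof -
  have a: "0 < a0 / 2" "a0 / 2 < a0" using a0_pos by auto
  have "\<exists>C N. C \<ge> 0 \<and> (\<forall>n x. n \<ge> N \<longrightarrow> r \<le> norm x \<longrightarrow> norm (pds (k # ks) (\<Phi> n) x) \<le> C)" for k
  proof -
    obtain C N where C: "C \<ge> 0" "\<And>n x. n \<ge> N \<Longrightarrow> r \<le> norm x \<Longrightarrow> norm (pds (k # ks) (\<Phi> n) x) \<le> C * exp (- (a0/2) * norm x)"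
      using pointwise_bound[OF a r, of "k # ks"] by blast
    have "norm (pds (k # ks) (\<Phi> n) x) \<le> C" if "n \<ge> N" "r \<le> norm x" for n x
    proof -
      have "exp (- (a0/2) * norm x) \<le> 1" using a0_pos by simp
      then have "C * exp (- (a0/2) * norm x) \<le> C" using C(1) by (rule mult_left_le)
      with C(2)[OF that] show ?thesis by (rule order_trans)
    qed
    then show ?thesis using C(1) by blast
  qed
  then obtain C N where C: "\<And>k. C k \<ge> 0" "\<And>k n x. n \<ge> N k \<Longrightarrow> r \<le> norm x \<Longrightarrow> norm (pds (k # ks) (\<Phi> n) x) \<le> C k" by metis
  have "norm (pds (k # ks) (\<Phi> n) x) \<le> Max (range C)" if "n \<ge> Max (range N)" "r \<le> norm x" for k n x
  proof -
    have "N k \<le> n" using that(1) Max_ge[of "range N" "N k"] by (auto intro: order_trans)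
    then have "norm (pds (k # ks) (\<Phi> n) x) \<le> C k" using that(2) by (rule C(2))
    also have "C k \<le> Max (range C)" by (intro Max_ge) auto
    finally show ?thesis .
  qed
  moreover have "Max (range C) \<ge> 0"
    using C(1)[of 0] Max_ge[of "range C" "C 0"] by (auto intro: order_trans)
  ultimately show thesis using that by blast
qed

text \<open>Both sides are the same derivative of the double mollification of the eigenvector, in
  which the two kernels commute.\<close>

lemma conv_swap: "conv (\<rho> m) (pds ks (\<Phi> n)) x = conv (\<rho> n) (pds ks (\<Phi> m)) x"
proof -
  have "conv (\<rho> m) (pds ks (\<Phi> n)) x = conv (pds ks (\<rho> n)) (\<Phi> m) x"
    unfolding pds_\<Phi> \<Phi>_def[of m] by (rule conv_commute[OF kern_\<rho> kern_pds[OF kern_\<rho>] loc_int_phi])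
  also have "\<dots> = conv (\<rho> n) (pds ks (\<Phi> m)) x"
    using pds_conv[OF kern_\<rho> smth_loc_int[OF smth_\<Phi>], of ks n m] pds_conv_smth[OF kern_\<rho> smth_\<Phi>, of ks n m] by simp
  finally show ?thesis .
qed

text \<open>Two mollifications of a uniformly Lipschitz family commute, so \<open>pds ks (\<Phi> n)\<close> and
  \<open>pds ks (\<Phi> m)\<close> are compared through their common double mollification.\<close>

lemma pds_\<Phi>_convergent:
  assumes x: "x \<noteq> 0" shows "convergent (\<lambda>n. pds ks (\<Phi> n) x)"
proof (rule Cauchy_convergent, rule CauchyI)
  fix e :: real assume e: "e > 0"
  define r where "r = norm x / 2"
  have r: "r > 0" using x by (simp add: r_def)
  obtain B N where B: "B \<ge> 0" "\<And>n x k. n \<ge> N \<Longrightarrow> r \<le> norm x \<Longrightarrow> norm (pds (k # ks) (\<Phi> n) x) \<le> B"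
    using uniform_bound[OF r, of ks] by blast
  \<comment> \<open>The Lipschitz constant is \<open>3 * B\<close>, so two comparisons cost
    \<open>6 * B\<close> times the kernel radius, which stays below \<open>e\<close>; the added 1
    covers \<open>B = 0\<close>. The bound by \<open>r\<close> keeps the kernel away from the
    origin.\<close>
  have e': "min r (e / (6 * B + 1) / 2) > 0" using r e B(1) by simp
  obtain N' where N': "\<And>n. N' \<le> n \<Longrightarrow> eps n \<le> min r (e / (6 * B + 1) / 2)" using eps_small[OF e'] by blast
  have approx: "norm (conv (\<rho> m) (pds ks (\<Phi> n)) x - pds ks (\<Phi> n) x) \<le> 3 * B * (e / (6 * B + 1) / 2)"
    if n: "n \<ge> N" and m: "m \<ge> N'" for n m
  proof (rule conv_approx[OF prob_\<rho> smth_loc_int[OF smth_pds[OF smth_\<Phi>]]])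
    fix y assume y: "norm (x - y) \<le> eps m"
    have far: "r \<le> norm z" if "norm (z - x) \<le> eps m" for z
      using norm_triangle_ineq2[of x z] that N'[OF m] by (simp add: r_def norm_minus_commute)
    have "norm (pds ks (\<Phi> n) y - pds ks (\<Phi> n) x) \<le> 3 * B * norm (y - x)"
    proof (rule axis_lipschitz[where r="eps m" and g="\<lambda>k. pds (k # ks) (\<Phi> n)"])
      show "has_pd k (pds ks (\<Phi> n)) (pds (k # ks) (\<Phi> n) z) z" for k z
        using smth_has_pd[OF smth_pds[OF smth_\<Phi>]] by simp
      show "norm (pds (k # ks) (\<Phi> n) z) \<le> B" if "norm (z - x) \<le> eps m" for k z
        by (rule B(2)[OF n far[OF that]])
    qed (use y in \<open>simp add: norm_minus_commute\<close>)
    also have "\<dots> \<le> 3 * B * (e / (6 * B + 1) / 2)"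
      using y N'[OF m] B(1) by (intro mult_left_mono) (auto simp: norm_minus_commute)
    finally show "norm (pds ks (\<Phi> n) y - pds ks (\<Phi> n) x) \<le> 3 * B * (e / (6 * B + 1) / 2)" .
  qed
  show "\<exists>M. \<forall>m\<ge>M. \<forall>n\<ge>M. norm (pds ks (\<Phi> m) x - pds ks (\<Phi> n) x) < e"
  proof (intro exI[of _ "max N N'"] allI impI)
    fix m n assume m: "m \<ge> max N N'" and n: "n \<ge> max N N'"
    let ?c = "conv (\<rho> m) (pds ks (\<Phi> n)) x"
    have 1: "norm (?c - pds ks (\<Phi> n) x) \<le> 3 * B * (e / (6 * B + 1) / 2)" using approx m n by simp
    have 2: "norm (?c - pds ks (\<Phi> m) x) \<le> 3 * B * (e / (6 * B + 1) / 2)" unfolding conv_swap[of m ks n] using approx m n by simp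
    have "norm (pds ks (\<Phi> m) x - pds ks (\<Phi> n) x) \<le> norm (?c - pds ks (\<Phi> n) x) + norm (?c - pds ks (\<Phi> m) x)"
      using norm_triangle_ineq4[of "?c - pds ks (\<Phi> n) x" "?c - pds ks (\<Phi> m) x"] by simp
    also have "\<dots> \<le> 3 * B * (e / (6 * B + 1) / 2) + 3 * B * (e / (6 * B + 1) / 2)" by (rule add_mono[OF 1 2])
    also have "\<dots> = 3 * B * (e / (6 * B + 1))" using distrib_left[of "3 * B"] by (metis field_sum_of_halves)
    also have "\<dots> < e"
    proof -
      have "3 * B * e < e * (6 * B + 1)" using e B(1) by (simp add: algebra_simps add_pos_nonneg)
      then show ?thesis using B(1) by (simp add: divide_less_eq)
    qed
    finally show "norm (pds ks (\<Phi> m) x - pds ks (\<Phi> n) x) < e" .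
  qed
qed

section \<open>The smooth representative as limit of the mollifications\<close>

definition \<Psi> :: "3 list \<Rightarrow> point \<Rightarrow> spinor" where "\<Psi> ks x = lim (\<lambda>n. pds ks (\<Phi> n) x)"

lemma \<Psi>_tendsto: "x \<noteq> 0 \<Longrightarrow> (\<lambda>n. pds ks (\<Phi> n) x) \<longlonglongrightarrow> \<Psi> ks x"
  unfolding \<Psi>_def using pds_\<Phi>_convergent convergent_LIMSEQ_iff by blast

lemma \<Psi>_bound:
  assumes "0 < a" "a < a0" "0 < r"
  obtains C where "C \<ge> 0" "\<And>x. r \<le> norm x \<Longrightarrow> norm (\<Psi> ks x) \<le> C * exp (- a * norm x)"
proof -
  obtain C N where C: "C \<ge> 0" "\<And>n x. n \<ge> N \<Longrightarrow> r \<le> norm x \<Longrightarrow> norm (pds ks (\<Phi> n) x) \<le> C * exp (- a * norm x)"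
    using pointwise_bound[OF assms] by blast
  have "norm (\<Psi> ks x) \<le> C * exp (- a * norm x)" if x: "r \<le> norm x" for x
  proof (rule tendsto_upperbound[OF tendsto_norm[OF \<Psi>_tendsto]])
    show "x \<noteq> 0" using x assms(3) by auto
    show "\<forall>\<^sub>F n in sequentially. norm (pds ks (\<Phi> n) x) \<le> C * exp (- a * norm x)"
      by (rule eventually_mono[OF eventually_ge_at_top[of N]]) (rule C(2)[OF _ x])
  qed simp
  then show thesis using that C(1) by blast
qed

text \<open>The first-order Taylor remainder of \<open>pds ks (\<Phi> n)\<close> is at most
  \<open>B * t\<^sup>2\<close> with \<open>B\<close> independent of \<open>n\<close>. Such a bound
  survives pointwise limits of the function and its derivative.\<close>

lemma has_pd_\<Psi>:
  assumes x: "x \<noteq> 0" shows "has_pd k (\<Psi> ks) (\<Psi> (k # ks) x) x"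
  unfolding has_pd_alt
proof (intro allI impI)
  fix e :: real assume e: "e > 0"
  define r where "r = norm x / 2"
  have r: "r > 0" using x by (simp add: r_def)
  obtain B N where B: "B \<ge> 0" "\<And>n x j. n \<ge> N \<Longrightarrow> r \<le> norm x \<Longrightarrow> norm (pds (j # k # ks) (\<Phi> n) x) \<le> B"
    using uniform_bound[OF r, of "k # ks"] by blast
  define \<delta> where "\<delta> = min r (e / (B + 1))"
  have \<delta>: "\<delta> > 0" using r e B(1) by (simp add: \<delta>_def)
  show "\<exists>\<delta>>0. \<forall>t. \<bar>t\<bar> < \<delta> \<longrightarrow> norm (\<Psi> ks (x + t *\<^sub>R axis k 1) - \<Psi> ks x - t *\<^sub>R \<Psi> (k # ks) x) \<le> e * \<bar>t\<bar>"
  proof (intro exI[of _ \<delta>] conjI allI impI \<delta>)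
    fix t :: real assume t: "\<bar>t\<bar> < \<delta>"
    have far: "r \<le> norm (x + s *\<^sub>R axis k 1)" if "\<bar>s\<bar> < \<delta>" for s
    proof -
      have "norm x - \<bar>s\<bar> \<le> norm (x + s *\<^sub>R axis k 1)"
        using norm_triangle_ineq4[of "x + s *\<^sub>R axis k 1" "s *\<^sub>R axis k 1"] by simp
      then show ?thesis using that by (simp add: \<delta>_def r_def)
    qed
    have nz: "x + t *\<^sub>R axis k 1 \<noteq> 0" using far[OF t] r by auto
    have seg: "\<bar>s\<bar> \<le> \<bar>u\<bar>" if "s \<in> closed_segment 0 u" for s u :: real
      using that by (auto simp: closed_segment_eq_real_ivl split: if_splits)
    have "norm (pds ks (\<Phi> n) (x + t *\<^sub>R axis k 1) - pds ks (\<Phi> n) x - t *\<^sub>R pds (k # ks) (\<Phi> n) x) \<le> e * \<bar>t\<bar>" if n: "n \<ge> N" for n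
    proof -
      let ?f = "pds ks (\<Phi> n)" and ?g = "pds (k # ks) (\<Phi> n)"
      have pf: "has_pd k ?f (?g y) y" for y using smth_has_pd[OF smth_pds[OF smth_\<Phi>]] by simp
      have pg: "has_pd k ?g (pds (k # k # ks) (\<Phi> n) y) y" for y using smth_has_pd[OF smth_pds[OF smth_\<Phi>, of "k # ks"]] by simp
      have g: "norm (?g (x + s *\<^sub>R axis k 1) - ?g x) \<le> B * \<bar>s\<bar>" if s: "\<bar>s\<bar> < \<delta>" for s
      proof -
        have "norm (?g (x + s *\<^sub>R axis k 1) - ?g (x + 0 *\<^sub>R axis k 1)) \<le> B * \<bar>s - 0\<bar>"
        proof (rule vector_mvt_bound[where f'="\<lambda>s. pds (k # k # ks) (\<Phi> n) (x + s *\<^sub>R axis k 1)"])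
          fix v assume "v \<in> closed_segment 0 s"
          then have "\<bar>v\<bar> < \<delta>" using seg s by fastforce
          then show "norm (pds (k # k # ks) (\<Phi> n) (x + v *\<^sub>R axis k 1)) \<le> B" by (intro B(2) n far)
        qed (rule has_pd_line[OF pg])
        then show ?thesis by simp
      qed
      let ?Q = "\<lambda>s. ?f (x + s *\<^sub>R axis k 1) - s *\<^sub>R ?g x"
      have "norm (?Q t - ?Q 0) \<le> (B * \<bar>t\<bar>) * \<bar>t - 0\<bar>"
      proof (rule vector_mvt_bound[where f'="\<lambda>s. ?g (x + s *\<^sub>R axis k 1) - ?g x"])
        fix s assume s: "s \<in> closed_segment 0 t"
        show "(?Q has_vector_derivative (?g (x + s *\<^sub>R axis k 1) - ?g x)) (at s)"
          using has_pd_line[OF pf] by (auto intro!: derivative_eq_intros simp del: pds.simps)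
        have "\<bar>s\<bar> \<le> \<bar>t\<bar>" by (rule seg[OF s])
        then show "norm (?g (x + s *\<^sub>R axis k 1) - ?g x) \<le> B * \<bar>t\<bar>"
          using g[of s] t B(1) mult_left_mono[of "\<bar>s\<bar>" "\<bar>t\<bar>" B] by linarith
      qed
      then have 1: "norm (?f (x + t *\<^sub>R axis k 1) - ?f x - t *\<^sub>R ?g x) \<le> (B * \<bar>t\<bar>) * \<bar>t\<bar>" by (simp add: algebra_simps)
      have "B * \<bar>t\<bar> \<le> (B + 1) * \<bar>t\<bar>" by (simp add: mult_right_mono)
      also have "\<dots> \<le> (B + 1) * (e / (B + 1))" using t B(1) by (intro mult_left_mono) (auto simp: \<delta>_def)
      also have "\<dots> = e" using B(1) by simp
      finally have "(B * \<bar>t\<bar>) * \<bar>t\<bar> \<le> e * \<bar>t\<bar>" by (rule mult_right_mono) simp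
      with 1 show ?thesis by (rule order_trans)
    qed
    then have "\<forall>\<^sub>F n in sequentially. norm (pds ks (\<Phi> n) (x + t *\<^sub>R axis k 1) - pds ks (\<Phi> n) x - t *\<^sub>R pds (k # ks) (\<Phi> n) x) \<le> e * \<bar>t\<bar>"
      by (rule eventually_mono[OF eventually_ge_at_top[of N]])
    moreover have "(\<lambda>n. norm (pds ks (\<Phi> n) (x + t *\<^sub>R axis k 1) - pds ks (\<Phi> n) x - t *\<^sub>R pds (k # ks) (\<Phi> n) x)) \<longlonglongrightarrow> norm (\<Psi> ks (x + t *\<^sub>R axis k 1) - \<Psi> ks x - t *\<^sub>R \<Psi> (k # ks) x)"
      by (intro tendsto_norm tendsto_diff tendsto_scaleR tendsto_const \<Psi>_tendsto x nz)
    ultimately show "norm (\<Psi> ks (x + t *\<^sub>R axis k 1) - \<Psi> ks x - t *\<^sub>R \<Psi> (k # ks) x) \<le> e * \<bar>t\<bar>"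
      using tendsto_upperbound trivial_limit_sequentially by blast
  qed
qed

text \<open>Bounds on the next partial derivatives, taken from \<open>\<Psi>_bound\<close> at the
  rate \<open>a0 / 2\<close>, give a Lipschitz estimate around each point other than the
  origin.\<close>

lemma continuous_\<Psi>: "continuous_on (- {0}) (\<Psi> ks)"
proof (rule continuous_at_imp_continuous_on, rule ballI)
  fix x :: point assume "x \<in> - {0}"
  then have r: "norm x / 2 > 0" by simp
  have a: "0 < a0 / 2" "a0 / 2 < a0" using a0_pos by auto
  have "\<exists>C. \<forall>z. norm x / 2 \<le> norm z \<longrightarrow> norm (\<Psi> (k # ks) z) \<le> C" for k
  proof -
    obtain C where C: "C \<ge> 0" "\<And>z. norm x / 2 \<le> norm z \<Longrightarrow> norm (\<Psi> (k # ks) z) \<le> C * exp (- (a0/2) * norm z)"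
      using \<Psi>_bound[OF a r] by blast
    have "norm (\<Psi> (k # ks) z) \<le> C" if "norm x / 2 \<le> norm z" for z
    proof -
      have "exp (- (a0/2) * norm z) \<le> 1" using a0_pos by simp
      then have "C * exp (- (a0/2) * norm z) \<le> C" using C(1) by (rule mult_left_le)
      with C(2)[OF that] show ?thesis by (rule order_trans)
    qed
    then show ?thesis by blast
  qed
  then obtain C where C: "\<And>k z. norm x / 2 \<le> norm z \<Longrightarrow> norm (\<Psi> (k # ks) z) \<le> C k" by metis
  have far: "norm x / 2 \<le> norm z" if "norm (z - x) \<le> norm x / 2" for z
    using norm_triangle_ineq2[of x z] that by (simp add: norm_minus_commute)
  show "isCont (\<Psi> ks) x"
  proof (rule axis_lipschitz_continuous[OF r, where g="\<lambda>k. \<Psi> (k # ks)" and B="Max (range C)"])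
    fix k z assume z: "norm (z - x) \<le> norm x / 2"
    then have "z \<noteq> 0" using far[OF z] r by auto
    then show "has_pd k (\<Psi> ks) (\<Psi> (k # ks) z) z" by (rule has_pd_\<Psi>)
    have "norm (\<Psi> (k # ks) z) \<le> C k" by (rule C[OF far[OF z]])
    also have "C k \<le> Max (range C)" by (intro Max_ge) auto
    finally show "norm (\<Psi> (k # ks) z) \<le> Max (range C)" .
  qed
qed

lemma open_punctured: "open (- {0 :: point})" by (simp add: open_Compl)

lemma smth_\<Psi>: "smth (- {0}) (\<Psi> [])"
proof (rule smth_I[where P="\<lambda>g. \<exists>ks. g = \<Psi> ks", OF open_punctured])
  fix f k assume "\<exists>ks. f = \<Psi> ks"
  then obtain ks where f: "f = \<Psi> ks" by blast
  show "\<exists>g. (\<exists>ks. g = \<Psi> ks) \<and> (\<forall>x\<in>- {0}. has_pd k f (g x) x)"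
    unfolding f using has_pd_\<Psi> by (intro exI[of _ "\<Psi> (k # ks)"]) auto
qed (use continuous_\<Psi> in auto)

lemma pds_\<Psi>: "x \<noteq> 0 \<Longrightarrow> pds ks (\<Psi> []) x = \<Psi> ks x"
proof (induction ks arbitrary: x)
  case (Cons k ks)
  have "has_pd k (pds ks (\<Psi> [])) (\<Psi> (k # ks) x) x"
    by (rule has_pd_eq_on[OF open_punctured _ _ has_pd_\<Psi>]) (use Cons in auto)
  then show ?case using has_pd_imp_pdiff by simp blast
qed simp

text \<open>The mollifications converge in the mean to \<open>\<phi>'\<close> and pointwise to
  \<open>\<Psi> []\<close>. By Fatou's lemma the lower limit of the squared differences has integral
  0, which identifies the two limits without passing to a subsequence.\<close>

lemma phi_eq_\<Psi>: "AE x in lborel. \<phi>' x = \<Psi> [] x"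
proof -
  have [measurable]: "\<Phi> m \<in> borel_measurable borel" for m by (rule smth_measurable[OF smth_\<Phi>])
  define q where "q x = liminf (\<lambda>m. ennreal ((norm (\<Phi> m x - \<phi>' x))\<^sup>2))" for x
  have [measurable]: "q \<in> borel_measurable borel" unfolding q_def[abs_def] by measurable
  have "(\<integral>\<^sup>+x. q x \<partial>lborel) \<le> 0 + ennreal e" if e: "e > 0" for e
  proof -
    obtain M where M: "\<And>m. M \<le> m \<Longrightarrow> nrm2 (\<lambda>x. \<Phi> m x - \<phi>' x) \<le> ennreal e" using \<Phi>_tendsto[OF e] by blast
    have "(\<integral>\<^sup>+x. q x \<partial>lborel) \<le> liminf (\<lambda>m. nrm2 (\<lambda>x. \<Phi> m x - \<phi>' x))"
      unfolding q_def by (rule nn_integral_liminf) measurable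
    also have "\<dots> \<le> limsup (\<lambda>m. nrm2 (\<lambda>x. \<Phi> m x - \<phi>' x))" by (rule Liminf_le_Limsup) simp
    also have "\<dots> \<le> ennreal e" by (rule Limsup_bounded, rule eventually_mono[OF eventually_ge_at_top[of M]], rule M)
    finally show ?thesis by simp
  qed
  then have "(\<integral>\<^sup>+x. q x \<partial>lborel) \<le> 0" by (rule ennreal_le_epsilon)
  then have "AE x in lborel. q x = 0" by (subst nn_integral_0_iff_AE[symmetric]) auto
  moreover have "AE x in lborel. x \<noteq> (0::point)" by (rule AE_lborel_singleton)
  ultimately show ?thesis
  proof eventually_elim
    case (elim x)
    have "(\<lambda>m. ennreal ((norm (\<Phi> m x - \<phi>' x))\<^sup>2)) \<longlonglongrightarrow> ennreal ((norm (\<Psi> [] x - \<phi>' x))\<^sup>2)"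
      using \<Psi>_tendsto[OF elim(2), of "[]"] by (intro tendsto_ennrealI tendsto_intros) simp
    then have "q x = ennreal ((norm (\<Psi> [] x - \<phi>' x))\<^sup>2)"
      unfolding q_def by (intro lim_imp_Liminf trivial_limit_sequentially)
    then show ?case using elim(1) by simp
  qed
qed

end

section \<open>Choice of representatives and conclusion\<close>

lemma ex_representatives:
  assumes "potential_hyp V" "Linf_loc A" "distinguished_ext A V Ddom Dop" "normalized_eigvec Ddom Dop lam \<phi>"
  obtains \<phi>' A' V' where "dirac_eigenvector V A Ddom Dop lam \<phi> \<phi>' A' V'"
proof -
  have "\<phi> \<in> Ddom" using assms(4) by (simp add: normalized_eigvec_def)
  moreover have "self_adjoint_op Ddom Dop" using assms(3) unfolding distinguished_ext_def by (rule conjunct1)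
  ultimately have "L2 \<phi>" using conjunct1[of "\<forall>f\<in>Ddom. L2 f \<and> L2 (Dop f)"] unfolding self_adjoint_op_def by blast
  then have m: "\<phi> \<in> borel_measurable lebesgue" by (simp add: L2_def)
  have mA: "A \<in> borel_measurable lebesgue" using assms(2) by (simp add: Linf_loc_def)
  have mV: "V \<in> borel_measurable lebesgue" using assms(1) unfolding potential_hyp_def by (rule conjunct1)
  obtain \<phi>' where 1: "\<phi>' \<in> borel_measurable borel" "AE x in lborel. \<phi> x = \<phi>' x" by (rule ex_borel_representative[OF m])
  obtain A' where 2: "A' \<in> borel_measurable borel" "AE x in lborel. A x = A' x" by (rule ex_borel_representative[OF mA])
  obtain V' where 3: "V' \<in> borel_measurable borel" "AE x in lborel. V x = V' x" by (rule ex_borel_representative[OF mV])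
  have "dirac_eigenvector V A Ddom Dop lam \<phi> \<phi>' A' V'" by (rule dirac_eigenvector.intro) (fact assms 1 2 3)+
  then show thesis by (rule that)
qed

theorem theorem2p6:
  fixes V :: "point \<Rightarrow> mat4" and lam :: real
  assumes "potential_hyp V"
    and "-1 < lam" and "lam < 1"
  shows "(\<forall>a. 0 < a \<and> a < sqrt (1 - lam\<^sup>2) \<longrightarrow>
           (\<exists>C>0. \<forall>A Ddom Dop \<phi>.
              Linf_loc A \<and> distinguished_ext A V Ddom Dop \<and> normalized_eigvec Ddom Dop lam \<phi> \<longrightarrow>
              (\<integral>\<^sup>+x. ennreal ((exp (a * norm x) * norm (\<phi> x))\<^sup>2) \<partial>lebesgue) \<le> ennreal (C\<^sup>2))) \<and>
         (\<forall>A Ddom Dop \<phi>.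
           Linf_loc A \<and> smooth_hyp A V \<and> distinguished_ext A V Ddom Dop \<and>
           normalized_eigvec Ddom Dop lam \<phi> \<longrightarrow>
           (\<exists>\<psi>. smooth_on (- {0}) \<psi> \<and> (AE x in lebesgue. \<phi> x = \<psi> x) \<and>
              (\<forall>a \<beta>. 0 < a \<and> a < sqrt (1 - lam\<^sup>2) \<longrightarrow>
                 (\<exists>C>0. \<forall>x. norm x \<ge> 1 \<longrightarrow> norm (dpart \<beta> \<psi> x) \<le> C * exp (- a * norm x)))))"
proof (intro conjI allI impI, elim conjE)
  fix a :: real assume a: "0 < a" "a < sqrt (1 - lam\<^sup>2)"
  obtain C where C: "C > 0" "\<And>A Ddom Dop \<phi> \<phi>' A' V'. dirac_eigenvector V A Ddom Dop lam \<phi> \<phi>' A' V' \<Longrightarrow>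
     nrm2 (\<lambda>x. exp (a * norm x) *\<^sub>R \<phi>' x) \<le> ennreal (C\<^sup>2)"
    using exponential_decay_L2[OF assms a] by blast
  show "\<exists>C>0. \<forall>A Ddom Dop \<phi>.
     Linf_loc A \<and> distinguished_ext A V Ddom Dop \<and> normalized_eigvec Ddom Dop lam \<phi> \<longrightarrow>
     (\<integral>\<^sup>+x. ennreal ((exp (a * norm x) * norm (\<phi> x))\<^sup>2) \<partial>lebesgue) \<le> ennreal (C\<^sup>2)"
  proof (intro exI[of _ C] conjI C(1) allI impI, elim conjE)
    fix A Ddom Dop \<phi>
    assume "Linf_loc A" "distinguished_ext A V Ddom Dop" "normalized_eigvec Ddom Dop lam \<phi>"
    then obtain \<phi>' A' V' where d: "dirac_eigenvector V A Ddom Dop lam \<phi> \<phi>' A' V'"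
      using ex_representatives[OF assms(1)] by blast
    then interpret dirac_eigenvector V A Ddom Dop lam \<phi> \<phi>' A' V' .
    have "(\<integral>\<^sup>+x. ennreal ((exp (a * norm x) * norm (\<phi> x))\<^sup>2) \<partial>lebesgue) = (\<integral>\<^sup>+x. ennreal ((norm (exp (a * norm x) *\<^sub>R \<phi>' x))\<^sup>2) \<partial>lebesgue)"
      using AE_completion[OF ae(1)] by (intro nn_integral_cong_AE, eventually_elim) simp
    also have "\<dots> = nrm2 (\<lambda>x. exp (a * norm x) *\<^sub>R \<phi>' x)" by (simp add: nn_integral_completion)
    also have "\<dots> \<le> ennreal (C\<^sup>2)" by (rule C(2)[OF d])
    finally show "(\<integral>\<^sup>+x. ennreal ((exp (a * norm x) * norm (\<phi> x))\<^sup>2) \<partial>lebesgue) \<le> ennreal (C\<^sup>2)" .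
  qed
next
  fix A Ddom Dop \<phi>
  assume *: "Linf_loc A \<and> smooth_hyp A V \<and> distinguished_ext A V Ddom Dop \<and> normalized_eigvec Ddom Dop lam \<phi>"
  then obtain \<phi>' A' V' where d: "dirac_eigenvector V A Ddom Dop lam \<phi> \<phi>' A' V'"
    using ex_representatives[OF assms(1)] by blast
  interpret smooth_dirac_eigenvector V A Ddom Dop lam \<phi> \<phi>' A' V'
    by (rule smooth_dirac_eigenvector.intro[OF d]) (unfold_locales, use * assms in auto)
  have "smooth_on (- {0}) (\<Psi> [])" by (rule smth_imp_smooth_on[OF smth_\<Psi>])
  moreover have "AE x in lebesgue. \<phi> x = \<Psi> [] x"
  proof (rule AE_completion)
    show "AE x in lborel. \<phi> x = \<Psi> [] x" using ae(1) phi_eq_\<Psi> by eventually_elim simp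
  qed
  moreover have "\<exists>C>0. \<forall>x. norm x \<ge> 1 \<longrightarrow> norm (dpart \<beta> (\<Psi> []) x) \<le> C * exp (- a * norm x)"
    if a: "0 < a" "a < sqrt (1 - lam\<^sup>2)" for a \<beta>
  proof -
    define ks where "ks = replicate (\<beta> $ 1) (1::3) @ replicate (\<beta> $ 2) 2 @ replicate (\<beta> $ 3) 3"
    obtain C where C: "C \<ge> 0" "\<And>x. 1 \<le> norm x \<Longrightarrow> norm (\<Psi> ks x) \<le> C * exp (- a * norm x)"
      using \<Psi>_bound[OF a zero_less_one] by blast
    \<comment> \<open>The constant of \<open>\<Psi>_bound\<close> may be 0, so 1 is added to make it
      positive.\<close>
    have "norm (dpart \<beta> (\<Psi> []) x) \<le> (C + 1) * exp (- a * norm x)" if x: "norm x \<ge> 1" for x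
    proof -
      have "x \<noteq> 0" using x by auto
      then have "dpart \<beta> (\<Psi> []) x = \<Psi> ks x" unfolding dpart_eq_pds ks_def[symmetric] by (rule pds_\<Psi>)
      moreover have "C * exp (- a * norm x) \<le> (C + 1) * exp (- a * norm x)" by (rule mult_right_mono) auto
      ultimately show ?thesis using C(2)[OF x] by (metis order_trans)
    qed
    then show ?thesis using C(1) by (intro exI[of _ "C + 1"]) auto
  qed
  ultimately show "\<exists>\<psi>. smooth_on (- {0}) \<psi> \<and> (AE x in lebesgue. \<phi> x = \<psi> x) \<and>
      (\<forall>a \<beta>. 0 < a \<and> a < sqrt (1 - lam\<^sup>2) \<longrightarrow> (\<exists>C>0. \<forall>x. norm x \<ge> 1 \<longrightarrow> norm (dpart \<beta> \<psi> x) \<le> C * exp (- a * norm x)))"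
    by blast
qed

end
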